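(* Let $G=\{G_1\rightrightarrows G_0\}$ be a Lie groupoid. The equivalence of 2-categories $\Phi$ from the 2-category $\mathsf{2term}$ of 2-term cochain complexes of vector bundles to the 2-category $\mathsf{VB}$ of linear Lie groupoid bundles (described in the context) induces an equivalence of categories $$\Phi(G):\mathsf{RutH}_2(G)\to \mathsf{WRep}(G)$$ from the category of 2-term representations up to homotopy of $G$ to the category of weak representations of $G$.
   Context: **Notation.** $s,t,u$ are the source, target and unit maps of $G$. $G_n$ is the manifold of composable $n$-tuples $(g_1,\dots,g_n)$, i.e. $s(g_i)=t(g_{i+1})$; $s_2(g,h)=s(h)$, $t_2(g,h)=t(g)$. In all groupoids a product $ab$ means "first $b$, then $a$". 2-categories and 2-functors are strict. An equivalence of 2-categories is an essentially surjective 2-functor inducing equivalences on all Hom categories. **2-term representations up to homotopy.** A quasi-action of $G$ on a vector bundle $E\to G_0$ is a smooth family of linear maps $\lambda_g:E_{s(g)}\to E_{t(g)}$, $g\in G_1$; it is unital if $\lambda_{u(x)}=\mathrm{id}$ for all $x\in G_0$. An object of $\mathsf{RutH}_2(G)$ is a tuple $(\delta:E^0\to E^1,\lambda^0,\lambda^1,\Omega)$ where $E^0,E^1\to G_0$ are vector bundles, $\delta$ is a vector bundle map covering $\mathrm{id}_{G_0}$, $\lambda^i$ is a unital quasi-action on $E^i$, and $\Omega$ is a smooth family of linear maps $\Omega_{g,h}:E^1_{s(h)}\to E^0_{t(g)}$, $(g,h)\in G_2$, vanishing when $g$ or $h$ is a unit, such that for all $(g_1,g_2,g_3)\in G_3$: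 (i) $\delta\lambda^0_{g_1}=\lambda^1_{g_1}\delta$; (ii) $\lambda^0_{g_1g_2}-\lambda^0_{g_1}\lambda^0_{g_2}=\Omega_{g_1,g_2}\delta$; (iii) $\lambda^1_{g_1g_2}-\lambda^1_{g_1}\lambda^1_{g_2}=\delta\Omega_{g_1,g_2}$; (iv) $\lambda^0_{g_1}\Omega_{g_2,g_3}-\Omega_{g_1g_2,g_3}+\Omega_{g_1,g_2g_3}-\Omega_{g_1,g_2}\lambda^1_{g_3}=0$. A morphism to $(\delta':E'^0\to E'^1,\lambda'^0,\lambda'^1,\Omega')$ is a triple $(\phi^0:E^0\to E'^0,\phi^1:E^1\to E'^1,\mu)$ of vector bundle maps $\phi^i$ covering $\mathrm{id}_{G_0}$ and a smooth family of linear maps $\mu_g:E^1_{s(g)}\to E'^0_{t(g)}$, $g\in G_1$, such that for all $(g,h)\in G_2$: $\phi^1\delta=\delta'\phi^0$; $\phi^0\lambda^0_g-\lambda'^0_g\phi^0=\mu_g\delta$; $\phi^1\lambda^1_g-\lambda'^1_g\phi^1=\delta'\mu_g$; $\phi^0\Omega_{g,h}+\mu_g\lambda^1_h+\lambda'^0_g\mu_h=\mu_{gh}+\Omega'_{g,h}\phi^1$. Composition is $(\phi',\mu')\circ(\phi,\mu)=(\phi'^0\phi^0,\phi'^1\phi^1,\ g\mapsto \phi'^0\mu_g+\mu'_g\phi^1)$; identities are $(\mathrm{id},\mathrm{id},0)$. **The 2-category $\mathsf{2term}$.** Objects are cochain complexes $C^\bullet=\{\delta^C:C^0\to C^1\}$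 of vector bundles over a manifold $M$, with $\delta^C$ a vector bundle map covering $\mathrm{id}_M$. 1-morphisms $f^\bullet:C^\bullet\to D^\bullet$ are chain maps $(f^0,f^1)$ of vector bundle maps covering one and the same smooth map of bases; they compose as chain maps. A 2-morphism $f^\bullet\Rightarrow g^\bullet$ is a chain homotopy: a vector bundle map $\Omega:C^1\to D^0$, covering the common base map, with $\delta^D\Omega=g^1-f^1$ and $\Omega\delta^C=g^0-f^0$. Vertical composition is the sum; the horizontal composite of $\Psi:f^\bullet\Rightarrow g^\bullet$ $(C^\bullet\to D^\bullet)$ with $\Omega:k^\bullet\Rightarrow\ell^\bullet$ $(D^\bullet\to E^\bullet)$ is $k^0\Psi+\Omega g^1$; identity 2-morphisms are zero maps. **The 2-category $\mathsf{VB}$.** A linear Lie groupoid bundle over a manifold $M$ is a map of Lie groupoids $\pi$ from $V=\{V_1\rightrightarrows V_0\}$ to the trivial groupoid $M$ (objects and morphisms $M$, all structure maps $\mathrm{id}_M$) such that $\pi_0:V_0\to M$, $\pi_1:V_1\to M$ are vector bundles and all structure maps of $V$ are vector bundle maps. A map of such is a map of Lie groupoids (smooth functor) whose object and arrow components are vector bundle maps covering one and the same smooth map $\bar f$ of bases. A natural transformation of linear Lie groupoid bundles between two maps $f,g:V\to W$ covering the same $\bar f$ is a natural transformation that is, as a map $V_0\to W_1$, a vector bundle map covering $\bar f$. Objects, 1-morphisms and 2-morphisms of $\mathsf{VB}$ are linear Lie groupoid bundles, their maps, and their natural transformations, with the usual compositions of functors and natural transformations. **The 2-functor $\Phi:\mathsf{2term}\to\mathsf{VB}$.**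 For $C^\bullet=\{\delta:C^0\to C^1\}$ over $M$, $\Phi(C^\bullet)$ is the linear Lie groupoid bundle over $M$ with objects $C^1$, arrows $C^0\oplus C^1$, source $(c_0,c_1)\mapsto c_1$, target $(c_0,c_1)\mapsto \delta(c_0)+c_1$, product $(c_0,c_1)(c_0',c_1')=(c_0+c_0',c_1')$, units $c\mapsto(0,c)$ and inverses $(c_0,c_1)\mapsto(-c_0,\delta(c_0)+c_1)$. A chain map $f^\bullet$ is sent to the functor with object map $f^1$ and arrow map $f^0\oplus f^1$. A chain homotopy $\Omega:f^\bullet\Rightarrow g^\bullet$ is sent to the natural transformation $c\mapsto(\Omega(c),f^1(c))$. This $\Phi$ is an equivalence of 2-categories. **Weak representations.** A weak representation of $G$ on a linear Lie groupoid bundle $\pi:V\to G_0$ is a pair $(A,\alpha)$ where: (1) $A:G_1\times_{s,G_0}V\to V$ is a map of linear Lie groupoid bundles covering $t:G_1\to G_0$; here $G_1\times_{s,G_0}V$ is the linear Lie groupoid bundle over $G_1$ with objects $\{(g,x)\in G_1\times V_0: s(g)=\pi_0(x)\}$, arrows $\{(g,v)\in G_1\times V_1: s(g)=\pi_1(v)\}$, and groupoid structure only in the $V$-factor. Write $g\cdot x=A(g,x)$, $g\cdot v=A(g,v)$. (2) $A$ is unital: $u(\pi(x))\cdot x=x$ and $u(\pi(v))\cdot v=v$ for all $x\in V_0$, $v\in V_1$. (3) $\alpha$ is a natural transformation of linear Lie groupoid bundles covering $t_2$ with components $\alpha(g,k,x):g\cdot(k\cdot x)\to(gk)\cdot x$,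 for $(g,k)\in G_2$, $x\in V_0$, $s(k)=\pi_0(x)$; naturality means $\alpha(g,k,y)\,(g\cdot(k\cdot v))=((gk)\cdot v)\,\alpha(g,k,x)$ for $v:x\to y$. (4) For all $(g,k,l)\in G_3$ and $x\in V_0$ with $s(l)=\pi_0(x)$: $\alpha(g,kl,x)\,(g\cdot\alpha(k,l,x))=\alpha(gk,l,x)\,\alpha(g,k,l\cdot x)$; and for all $(g,x)\in G_1\times V_0$ with $s(g)=\pi_0(x)$, $\alpha(g,u(\pi(x)),x)$ and $\alpha(u(t(g)),g,x)$ are identity arrows of $V$ at $g\cdot x$. A map of weak representations $(V,A,\alpha)\to(W,B,\beta)$ is a pair $(F,\Delta)$ where $F:V\to W$ is a map of linear Lie groupoid bundles covering $\mathrm{id}_{G_0}$ and $\Delta$ is a natural transformation of linear Lie groupoid bundles covering $t$, with components $\Delta(g,x):F(g\cdot x)\to g\cdot F(x)$, such that $\beta(g,k,F(x))\,(g\cdot\Delta(k,x))\,\Delta(g,k\cdot x)=\Delta(gk,x)\,F(\alpha(g,k,x))$ for all $(g,k)\in G_2$ and $x\in V_0$ with $s(k)=\pi_0(x)$, and $\Delta(u(\pi(x)),x)$ is the identity arrow at $F(x)$ for all $x\in V_0$. Composition: $(F',\Delta')\circ(F,\Delta)=(F'\circ F,\ (g,x)\mapsto \Delta'(g,F(x))\,F'(\Delta(g,x)))$. $\mathsf{WRep}(G)$ is the resulting category. *)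

theory Defs
  imports "HOL-Analysis.Analysis"
begin

section \<open>Smooth maps between open subsets of Euclidean spaces\<close>

text \<open>The space R^n is the library's \<^term>\<open>Euclidean_space n\<close>: the functions
  \<^typ>\<open>nat \<Rightarrow> real\<close> that vanish at all indices \<open>i \<ge> n\<close>. In particular R^k is literally a subset
  of R^n for \<open>k \<le> n\<close>. The predicates below are meant for \<open>U\<close> open in R^n.\<close>

definition partial_deriv :: "nat \<Rightarrow> ((nat \<Rightarrow> real) \<Rightarrow> real) \<Rightarrow> (nat \<Rightarrow> real) \<Rightarrow> real" where
  "partial_deriv i f x = deriv (\<lambda>r. f (x(i := r))) (x i)"

fun Ck :: "nat \<Rightarrow> nat \<Rightarrow> (nat \<Rightarrow> real) set \<Rightarrow> ((nat \<Rightarrow> real) \<Rightarrow> real) \<Rightarrow> bool" where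
  "Ck 0 n U f \<longleftrightarrow> continuous_on U f"
| "Ck (Suc k) n U f \<longleftrightarrow> continuous_on U f \<and>
     (\<forall>i<n. (\<forall>x\<in>U. (\<lambda>r. f (x(i := r))) field_differentiable at (x i)) \<and>
            Ck k n U (partial_deriv i f))"

definition smooth_euclid ::
  "nat \<Rightarrow> nat \<Rightarrow> (nat \<Rightarrow> real) set \<Rightarrow> ((nat \<Rightarrow> real) \<Rightarrow> (nat \<Rightarrow> real)) \<Rightarrow> bool" where
  "smooth_euclid n m U f \<longleftrightarrow> (\<forall>j<m. \<forall>k. Ck k n U (\<lambda>x. f x j))"


section \<open>Manifolds\<close>

text \<open>A chart \<open>(n, U, \<phi>)\<close> has domain \<open>U\<close> and values in R^n. The dimension is part of the chart,
  so different components of a manifold may have different dimensions (and the rank of a vector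
  bundle is only locally constant).\<close>

type_synonym 'a chart = "nat \<times> 'a set \<times> ('a \<Rightarrow> nat \<Rightarrow> real)"

record 'a mfd =
  mtop :: "'a topology"
  atlas :: "'a chart set"

abbreviation pts :: "'a mfd \<Rightarrow> 'a set" where
  "pts X \<equiv> topspace (mtop X)"

definition is_chart :: "'a topology \<Rightarrow> 'a chart \<Rightarrow> bool" where
  "is_chart T = (\<lambda>(n, U, \<phi>). openin T U \<and> openin (Euclidean_space n) (\<phi> ` U) \<and>
     homeomorphic_map (subtopology T U) (subtopology (Euclidean_space n) (\<phi> ` U)) \<phi>)"

definition compatible :: "'a chart \<Rightarrow> 'a chart \<Rightarrow> bool" where
  "compatible = (\<lambda>(n, U, \<phi>) (m, V, \<psi>).
     smooth_euclid n m (\<phi> ` (U \<inter> V)) (\<psi> \<circ> inv_into U \<phi>) \<and>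
     smooth_euclid m n (\<psi> ` (U \<inter> V)) (\<phi> \<circ> inv_into V \<psi>))"

definition covered :: "'a mfd \<Rightarrow> 'a set" where
  "covered X = (\<Union>(n, U, \<phi>)\<in>atlas X. U)"

definition manifold :: "'a mfd \<Rightarrow> bool" where
  "manifold X \<longleftrightarrow> Hausdorff_space (mtop X) \<and> second_countable (mtop X) \<and>
     (\<forall>c\<in>atlas X. is_chart (mtop X) c) \<and> covered X = pts X \<and>
     (\<forall>c\<in>atlas X. \<forall>d\<in>atlas X. compatible c d)"

definition maximal_atlas :: "'a mfd \<Rightarrow> 'a chart set" where
  "maximal_atlas X = {(n, U, \<phi>). is_chart (mtop X) (n, U, \<phi>) \<and> U \<subseteq> covered X \<and>
     (\<forall>d\<in>atlas X. compatible (n, U, \<phi>) d)}"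

definition smooth_map :: "'a mfd \<Rightarrow> 'b mfd \<Rightarrow> ('a \<Rightarrow> 'b) \<Rightarrow> bool" where
  "smooth_map X Y f \<longleftrightarrow> continuous_map (mtop X) (mtop Y) f \<and>
     (\<forall>(n, U, \<phi>)\<in>atlas X. \<forall>(m, V, \<psi>)\<in>atlas Y.
        smooth_euclid n m (\<phi> ` (U \<inter> f -` V)) (\<psi> \<circ> f \<circ> inv_into U \<phi>))"

definition diffeomorphism :: "'a mfd \<Rightarrow> 'b mfd \<Rightarrow> ('a \<Rightarrow> 'b) \<Rightarrow> bool" where
  "diffeomorphism X Y f \<longleftrightarrow> bij_betw f (pts X) (pts Y) \<and> smooth_map X Y f \<and>
     smooth_map Y X (inv_into (pts X) f)"

text \<open>Surjectivity of the differential, written out in charts with the Jacobian matrix.\<close>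

definition submersion :: "'a mfd \<Rightarrow> 'b mfd \<Rightarrow> ('a \<Rightarrow> 'b) \<Rightarrow> bool" where
  "submersion X Y f \<longleftrightarrow> smooth_map X Y f \<and>
     (\<forall>(n, U, \<phi>)\<in>atlas X. \<forall>(m, V, \<psi>)\<in>atlas Y. \<forall>p\<in>U. f p \<in> V \<longrightarrow>
        (\<forall>w. \<exists>v. \<forall>j<m.
           (\<Sum>i<n. partial_deriv i (\<lambda>x. \<psi> (f (inv_into U \<phi> x)) j) (\<phi> p) * v i) = w j))"

definition Rn :: "nat \<Rightarrow> (nat \<Rightarrow> real) mfd" where
  "Rn n = \<lparr>mtop = Euclidean_space n, atlas = {(n, topspace (Euclidean_space n), \<lambda>x. x)}\<rparr>"

definition prod_chart :: "'a chart \<Rightarrow> 'b chart \<Rightarrow> ('a \<times> 'b) chart" where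
  "prod_chart = (\<lambda>(n, U, \<phi>) (m, V, \<psi>).
     (n + m, U \<times> V, \<lambda>(x, y) i. if i < n then \<phi> x i else \<psi> y (i - n)))"

definition prod_mfd :: "'a mfd \<Rightarrow> 'b mfd \<Rightarrow> ('a \<times> 'b) mfd" where
  "prod_mfd X Y = \<lparr>mtop = prod_topology (mtop X) (mtop Y),
     atlas = {prod_chart c d | c d. c \<in> atlas X \<and> d \<in> atlas Y}\<rparr>"

text \<open>The subset \<open>S\<close> of \<open>X\<close> with the subspace topology and all slice charts, i.e. the restrictions
  of those charts of \<open>X\<close> in which \<open>S\<close> is the intersection of the image with R^k. This is the usual
  smooth structure when \<open>S\<close> is an embedded submanifold (for instance open, or a fibre product along
  submersions).\<close>

definition submfd :: "'a mfd \<Rightarrow> 'a set \<Rightarrow> 'a mfd" where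
  "submfd X S = \<lparr>mtop = subtopology (mtop X) S,
     atlas = {(k, U \<inter> S, \<phi>) | k U \<phi>. \<exists>n\<ge>k. (n, U, \<phi>) \<in> maximal_atlas X \<and>
                \<phi> ` (U \<inter> S) = \<phi> ` U \<inter> topspace (Euclidean_space k)}\<rparr>"

definition fibre_prod :: "'a mfd \<Rightarrow> ('a \<Rightarrow> 'c) \<Rightarrow> 'b mfd \<Rightarrow> ('b \<Rightarrow> 'c) \<Rightarrow> ('a \<times> 'b) mfd" where
  "fibre_prod X f Y g = submfd (prod_mfd X Y) {(x, y). x \<in> pts X \<and> y \<in> pts Y \<and> f x = g y}"


section \<open>Lie groupoids\<close>

text \<open>\<open>gmult G g h\<close> is defined when \<open>gsrc G g = gtgt G h\<close> and means: first \<open>h\<close>, then \<open>g\<close>.\<close>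

record ('o, 'a) groupoid =
  Obj :: "'o mfd"
  Arr :: "'a mfd"
  gsrc :: "'a \<Rightarrow> 'o"
  gtgt :: "'a \<Rightarrow> 'o"
  gunit :: "'o \<Rightarrow> 'a"
  ginv :: "'a \<Rightarrow> 'a"
  gmult :: "'a \<Rightarrow> 'a \<Rightarrow> 'a"

definition comp_pairs :: "('o, 'a) groupoid \<Rightarrow> ('a \<times> 'a) mfd" where
  "comp_pairs G = fibre_prod (Arr G) (gsrc G) (Arr G) (gtgt G)"

definition comp_triples :: "('o, 'a) groupoid \<Rightarrow> ('a \<times> 'a \<times> 'a) set" where
  "comp_triples G = {(g, h, k). g \<in> pts (Arr G) \<and> h \<in> pts (Arr G) \<and> k \<in> pts (Arr G) \<and>
     gsrc G g = gtgt G h \<and> gsrc G h = gtgt G k}"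

definition lie_groupoid :: "('o, 'a) groupoid \<Rightarrow> bool" where
  "lie_groupoid G \<longleftrightarrow>
     manifold (Obj G) \<and> manifold (Arr G) \<and>
     submersion (Arr G) (Obj G) (gsrc G) \<and> submersion (Arr G) (Obj G) (gtgt G) \<and>
     smooth_map (Obj G) (Arr G) (gunit G) \<and> smooth_map (Arr G) (Arr G) (ginv G) \<and>
     smooth_map (comp_pairs G) (Arr G) (\<lambda>(g, h). gmult G g h) \<and>
     (\<forall>(g, h)\<in>pts (comp_pairs G).
        gsrc G (gmult G g h) = gsrc G h \<and> gtgt G (gmult G g h) = gtgt G g) \<and>
     (\<forall>(g, h, k)\<in>comp_triples G. gmult G (gmult G g h) k = gmult G g (gmult G h k)) \<and>
     (\<forall>x\<in>pts (Obj G). gsrc G (gunit G x) = x \<and> gtgt G (gunit G x) = x) \<and>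
     (\<forall>g\<in>pts (Arr G). gmult G g (gunit G (gsrc G g)) = g \<and> gmult G (gunit G (gtgt G g)) g = g) \<and>
     (\<forall>g\<in>pts (Arr G). gsrc G (ginv G g) = gtgt G g \<and> gtgt G (ginv G g) = gsrc G g \<and>
        gmult G (ginv G g) g = gunit G (gsrc G g) \<and> gmult G g (ginv G g) = gunit G (gtgt G g))"

definition lie_groupoid_map ::
  "('o, 'a) groupoid \<Rightarrow> ('p, 'b) groupoid \<Rightarrow> ('o \<Rightarrow> 'p) \<Rightarrow> ('a \<Rightarrow> 'b) \<Rightarrow> bool" where
  "lie_groupoid_map G H f0 f1 \<longleftrightarrow>
     smooth_map (Obj G) (Obj H) f0 \<and> smooth_map (Arr G) (Arr H) f1 \<and>
     (\<forall>g\<in>pts (Arr G). gsrc H (f1 g) = f0 (gsrc G g) \<and> gtgt H (f1 g) = f0 (gtgt G g)) \<and>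
     (\<forall>x\<in>pts (Obj G). f1 (gunit G x) = gunit H (f0 x)) \<and>
     (\<forall>(g, h)\<in>pts (comp_pairs G). f1 (gmult G g h) = gmult H (f1 g) (f1 h))"

definition trivial_groupoid :: "'b mfd \<Rightarrow> ('b, 'b) groupoid" where
  "trivial_groupoid M = \<lparr>Obj = M, Arr = M, gsrc = (\<lambda>x. x), gtgt = (\<lambda>x. x), gunit = (\<lambda>x. x),
     ginv = (\<lambda>x. x), gmult = (\<lambda>x y. x)\<rparr>"


section \<open>Vector bundles\<close>

record ('b, 'e) vbundle =
  base :: "'b mfd"
  tot :: "'e mfd"
  proj :: "'e \<Rightarrow> 'b"
  vadd :: "'e \<Rightarrow> 'e \<Rightarrow> 'e"
  vscale :: "real \<Rightarrow> 'e \<Rightarrow> 'e"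
  vzero :: "'b \<Rightarrow> 'e"

definition fibre :: "('b, 'e) vbundle \<Rightarrow> 'b \<Rightarrow> 'e set" where
  "fibre E x = {e \<in> pts (tot E). proj E e = x}"

definition vneg :: "('b, 'e) vbundle \<Rightarrow> 'e \<Rightarrow> 'e" where
  "vneg E a = vscale E (-1) a"

definition vsub :: "('b, 'e) vbundle \<Rightarrow> 'e \<Rightarrow> 'e \<Rightarrow> 'e" where
  "vsub E a b = vadd E a (vneg E b)"

definition vector_space_fibre :: "('b, 'e) vbundle \<Rightarrow> 'b \<Rightarrow> bool" where
  "vector_space_fibre E x \<longleftrightarrow>
     vzero E x \<in> fibre E x \<and>
     (\<forall>a\<in>fibre E x. \<forall>b\<in>fibre E x. vadd E a b \<in> fibre E x \<and> vadd E a b = vadd E b a) \<and>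
     (\<forall>a\<in>fibre E x. \<forall>b\<in>fibre E x. \<forall>c\<in>fibre E x.
        vadd E (vadd E a b) c = vadd E a (vadd E b c)) \<and>
     (\<forall>a\<in>fibre E x. vadd E a (vzero E x) = a \<and> vadd E a (vneg E a) = vzero E x) \<and>
     (\<forall>a\<in>fibre E x. vscale E 1 a = a \<and>
        (\<forall>r. vscale E r a \<in> fibre E x \<and>
             (\<forall>q. vscale E r (vscale E q a) = vscale E (r * q) a \<and>
                  vscale E (r + q) a = vadd E (vscale E r a) (vscale E q a)) \<and>
             (\<forall>b\<in>fibre E x. vscale E r (vadd E a b) = vadd E (vscale E r a) (vscale E r b))))"

definition vector_bundle :: "('b, 'e) vbundle \<Rightarrow> bool" where
  "vector_bundle E \<longleftrightarrow>
     manifold (base E) \<and> manifold (tot E) \<and> smooth_map (tot E) (base E) (proj E) \<and>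
     (\<forall>x\<in>pts (base E). vector_space_fibre E x) \<and>
     (\<forall>x\<in>pts (base E). \<exists>U k \<tau>. openin (mtop (base E)) U \<and> x \<in> U \<and>
        diffeomorphism (submfd (tot E) {e \<in> pts (tot E). proj E e \<in> U})
          (prod_mfd (submfd (base E) U) (Rn k)) (\<lambda>e. (proj E e, \<tau> e)) \<and>
        (\<forall>y\<in>U. \<forall>a\<in>fibre E y.
           (\<forall>b\<in>fibre E y. \<tau> (vadd E a b) = (\<lambda>i. \<tau> a i + \<tau> b i)) \<and>
           (\<forall>r. \<tau> (vscale E r a) = (\<lambda>i. r * \<tau> a i))))"

definition vb_map ::
  "('b, 'e) vbundle \<Rightarrow> ('c, 'f) vbundle \<Rightarrow> ('b \<Rightarrow> 'c) \<Rightarrow> ('e \<Rightarrow> 'f) \<Rightarrow> bool" where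
  "vb_map E F fb f \<longleftrightarrow>
     smooth_map (base E) (base F) fb \<and> smooth_map (tot E) (tot F) f \<and>
     (\<forall>e\<in>pts (tot E). proj F (f e) = fb (proj E e)) \<and>
     (\<forall>x\<in>pts (base E). \<forall>a\<in>fibre E x.
        (\<forall>b\<in>fibre E x. f (vadd E a b) = vadd F (f a) (f b)) \<and>
        (\<forall>r. f (vscale E r a) = vscale F r (f a)))"

text \<open>The pullback of \<open>E\<close> along \<open>a\<close> from \<open>P\<close> to the base of \<open>E\<close>. A smooth family of linear maps from
  \<open>E\<^bsub>a(p)\<^esub>\<close> to \<open>F\<^bsub>b(p)\<^esub>\<close>, with \<open>p\<close> in \<open>P\<close>, is a vector bundle map from this pullback to \<open>F\<close>
  covering \<open>b\<close>.\<close>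

definition pullback_vb :: "'p mfd \<Rightarrow> ('p \<Rightarrow> 'b) \<Rightarrow> ('b, 'e) vbundle \<Rightarrow> ('p, 'p \<times> 'e) vbundle" where
  "pullback_vb P a E = \<lparr>base = P, tot = fibre_prod P a (tot E) (proj E), proj = fst,
     vadd = (\<lambda>(p, e) (q, f). (p, vadd E e f)), vscale = (\<lambda>r (p, e). (p, vscale E r e)),
     vzero = (\<lambda>p. (p, vzero E (a p)))\<rparr>"

definition whitney_sum :: "('b, 'e) vbundle \<Rightarrow> ('b, 'f) vbundle \<Rightarrow> ('b, 'e \<times> 'f) vbundle" where
  "whitney_sum E F = \<lparr>base = base E, tot = fibre_prod (tot E) (proj E) (tot F) (proj F),
     proj = (\<lambda>(e, f). proj E e),
     vadd = (\<lambda>(e, f) (e', f'). (vadd E e e', vadd F f f')),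
     vscale = (\<lambda>r (e, f). (vscale E r e, vscale F r f)),
     vzero = (\<lambda>x. (vzero E x, vzero F x))\<rparr>"


section \<open>Linear Lie groupoid bundles\<close>

record ('b, 'x, 'y) lgb =
  Vob :: "('b, 'x) vbundle"
  Varr :: "('b, 'y) vbundle"
  lsrc :: "'y \<Rightarrow> 'x"
  ltgt :: "'y \<Rightarrow> 'x"
  lunit :: "'x \<Rightarrow> 'y"
  linv :: "'y \<Rightarrow> 'y"
  lmult :: "'y \<Rightarrow> 'y \<Rightarrow> 'y"

definition grpd :: "('b, 'x, 'y) lgb \<Rightarrow> ('x, 'y) groupoid" where
  "grpd V = \<lparr>Obj = tot (Vob V), Arr = tot (Varr V), gsrc = lsrc V, gtgt = ltgt V,
     gunit = lunit V, ginv = linv V, gmult = lmult V\<rparr>"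

definition comp_vb :: "('b, 'x, 'y) lgb \<Rightarrow> ('b, 'y \<times> 'y) vbundle" where
  "comp_vb V = (whitney_sum (Varr V) (Varr V)) \<lparr>tot := comp_pairs (grpd V)\<rparr>"

definition linear_lie_groupoid_bundle :: "('b, 'x, 'y) lgb \<Rightarrow> bool" where
  "linear_lie_groupoid_bundle V \<longleftrightarrow>
     lie_groupoid (grpd V) \<and> base (Varr V) = base (Vob V) \<and>
     vector_bundle (Vob V) \<and> vector_bundle (Varr V) \<and>
     lie_groupoid_map (grpd V) (trivial_groupoid (base (Vob V))) (proj (Vob V)) (proj (Varr V)) \<and>
     vb_map (Varr V) (Vob V) (\<lambda>x. x) (lsrc V) \<and> vb_map (Varr V) (Vob V) (\<lambda>x. x) (ltgt V) \<and>
     vb_map (Vob V) (Varr V) (\<lambda>x. x) (lunit V) \<and> vb_map (Varr V) (Varr V) (\<lambda>x. x) (linv V) \<and>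
     vb_map (comp_vb V) (Varr V) (\<lambda>x. x) (\<lambda>(v, w). lmult V v w)"

definition lgb_map :: "('b, 'x, 'y) lgb \<Rightarrow> ('c, 'z, 'w) lgb \<Rightarrow> ('b \<Rightarrow> 'c) \<Rightarrow>
    ('x \<Rightarrow> 'z) \<Rightarrow> ('y \<Rightarrow> 'w) \<Rightarrow> bool" where
  "lgb_map V W fb f0 f1 \<longleftrightarrow> lie_groupoid_map (grpd V) (grpd W) f0 f1 \<and>
     vb_map (Vob V) (Vob W) fb f0 \<and> vb_map (Varr V) (Varr W) fb f1"

text \<open>\<open>\<eta>\<close> is a natural transformation from \<open>(f0, f1)\<close> to \<open>(g0, g1)\<close>, two maps of linear Lie
  groupoid bundles covering \<open>fb\<close>.\<close>

definition lgb_nat :: "('b, 'x, 'y) lgb \<Rightarrow> ('c, 'z, 'w) lgb \<Rightarrow> ('b \<Rightarrow> 'c) \<Rightarrow>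
    ('x \<Rightarrow> 'z) \<times> ('y \<Rightarrow> 'w) \<Rightarrow> ('x \<Rightarrow> 'z) \<times> ('y \<Rightarrow> 'w) \<Rightarrow> ('x \<Rightarrow> 'w) \<Rightarrow> bool" where
  "lgb_nat V W fb = (\<lambda>(f0, f1) (g0, g1) \<eta>. vb_map (Vob V) (Varr W) fb \<eta> \<and>
     (\<forall>x\<in>pts (tot (Vob V)). lsrc W (\<eta> x) = f0 x \<and> ltgt W (\<eta> x) = g0 x) \<and>
     (\<forall>v\<in>pts (tot (Varr V)).
        lmult W (\<eta> (ltgt V v)) (f1 v) = lmult W (g1 v) (\<eta> (lsrc V v))))"

definition pullback_lgb ::
  "'p mfd \<Rightarrow> ('p \<Rightarrow> 'b) \<Rightarrow> ('b, 'x, 'y) lgb \<Rightarrow> ('p, 'p \<times> 'x, 'p \<times> 'y) lgb" where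
  "pullback_lgb P a V = \<lparr>Vob = pullback_vb P a (Vob V), Varr = pullback_vb P a (Varr V),
     lsrc = (\<lambda>(p, v). (p, lsrc V v)), ltgt = (\<lambda>(p, v). (p, ltgt V v)),
     lunit = (\<lambda>(p, x). (p, lunit V x)), linv = (\<lambda>(p, v). (p, linv V v)),
     lmult = (\<lambda>(p, v) (q, w). (p, lmult V v w))\<rparr>"


section \<open>Complexes of vector bundles and the 2-functor \<open>\<Phi>\<close>\<close>

record ('b, 'e, 'f) complex2 =
  C0 :: "('b, 'e) vbundle"
  C1 :: "('b, 'f) vbundle"
  diff :: "'e \<Rightarrow> 'f"

definition cochain_complex :: "('b, 'e, 'f) complex2 \<Rightarrow> bool" where
  "cochain_complex C \<longleftrightarrow> vector_bundle (C0 C) \<and> vector_bundle (C1 C) \<and>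
     base (C1 C) = base (C0 C) \<and> vb_map (C0 C) (C1 C) (\<lambda>x. x) (diff C)"

definition Phi_obj :: "('b, 'e, 'f) complex2 \<Rightarrow> ('b, 'f, 'e \<times> 'f) lgb" where
  "Phi_obj C = \<lparr>Vob = C1 C, Varr = whitney_sum (C0 C) (C1 C),
     lsrc = snd, ltgt = (\<lambda>(c0, c1). vadd (C1 C) (diff C c0) c1),
     lunit = (\<lambda>c. (vzero (C0 C) (proj (C1 C) c), c)),
     linv = (\<lambda>(c0, c1). (vneg (C0 C) c0, vadd (C1 C) (diff C c0) c1)),
     lmult = (\<lambda>(c0, c1) (c0', c1'). (vadd (C0 C) c0 c0', c1'))\<rparr>"

definition Phi_map :: "('e \<Rightarrow> 'e') \<times> ('f \<Rightarrow> 'f') \<Rightarrow> ('f \<Rightarrow> 'f') \<times> ('e \<times> 'f \<Rightarrow> 'e' \<times> 'f')" where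
  "Phi_map = (\<lambda>(f0, f1). (f1, \<lambda>(c0, c1). (f0 c0, f1 c1)))"

text \<open>\<open>\<Phi>\<close> of a chain homotopy \<open>\<Omega>\<close> whose source is the chain map \<open>(f0, f1)\<close>.\<close>

definition Phi_htpy :: "('e \<Rightarrow> 'e') \<times> ('f \<Rightarrow> 'f') \<Rightarrow> ('f \<Rightarrow> 'e') \<Rightarrow> ('f \<Rightarrow> 'e' \<times> 'f')" where
  "Phi_htpy = (\<lambda>(f0, f1) \<Omega> c. (\<Omega> c, f1 c))"


section \<open>Categories and equivalences\<close>

text \<open>\<open>Comp C a b c g f\<close> is the composite of \<open>f\<close> from \<open>a\<close> to \<open>b\<close> with \<open>g\<close> from \<open>b\<close> to \<open>c\<close>.\<close>

record ('o, 'm) category =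
  Ob :: "'o set"
  Hom :: "'o \<Rightarrow> 'o \<Rightarrow> 'm set"
  Ident :: "'o \<Rightarrow> 'm"
  Comp :: "'o \<Rightarrow> 'o \<Rightarrow> 'o \<Rightarrow> 'm \<Rightarrow> 'm \<Rightarrow> 'm"

definition is_category :: "('o, 'm) category \<Rightarrow> bool" where
  "is_category C \<longleftrightarrow>
     (\<forall>a\<in>Ob C. Ident C a \<in> Hom C a a) \<and>
     (\<forall>a\<in>Ob C. \<forall>b\<in>Ob C. \<forall>c\<in>Ob C. \<forall>f\<in>Hom C a b. \<forall>g\<in>Hom C b c. Comp C a b c g f \<in> Hom C a c) \<and>
     (\<forall>a\<in>Ob C. \<forall>b\<in>Ob C. \<forall>f\<in>Hom C a b.
        Comp C a a b f (Ident C a) = f \<and> Comp C a b b (Ident C b) f = f) \<and>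
     (\<forall>a\<in>Ob C. \<forall>b\<in>Ob C. \<forall>c\<in>Ob C. \<forall>d\<in>Ob C.
        \<forall>f\<in>Hom C a b. \<forall>g\<in>Hom C b c. \<forall>h\<in>Hom C c d.
        Comp C a b d (Comp C b c d h g) f = Comp C a c d h (Comp C a b c g f))"

text \<open>\<open>Fo\<close> is the action on objects, and \<open>Fm a b\<close> the action on morphisms from \<open>a\<close> to \<open>b\<close>.\<close>

definition is_functor :: "('o, 'm) category \<Rightarrow> ('p, 'n) category \<Rightarrow>
    ('o \<Rightarrow> 'p) \<Rightarrow> ('o \<Rightarrow> 'o \<Rightarrow> 'm \<Rightarrow> 'n) \<Rightarrow> bool" where
  "is_functor C D Fo Fm \<longleftrightarrow>
     (\<forall>a\<in>Ob C. Fo a \<in> Ob D) \<and>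
     (\<forall>a\<in>Ob C. \<forall>b\<in>Ob C. \<forall>f\<in>Hom C a b. Fm a b f \<in> Hom D (Fo a) (Fo b)) \<and>
     (\<forall>a\<in>Ob C. Fm a a (Ident C a) = Ident D (Fo a)) \<and>
     (\<forall>a\<in>Ob C. \<forall>b\<in>Ob C. \<forall>c\<in>Ob C. \<forall>f\<in>Hom C a b. \<forall>g\<in>Hom C b c.
        Fm a c (Comp C a b c g f) = Comp D (Fo a) (Fo b) (Fo c) (Fm b c g) (Fm a b f))"

definition is_iso :: "('o, 'm) category \<Rightarrow> 'o \<Rightarrow> 'o \<Rightarrow> 'm \<Rightarrow> bool" where
  "is_iso C a b f \<longleftrightarrow> f \<in> Hom C a b \<and>
     (\<exists>g\<in>Hom C b a. Comp C a b a g f = Ident C a \<and> Comp C b a b f g = Ident C b)"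

definition natural_iso :: "('o, 'm) category \<Rightarrow> ('p, 'n) category \<Rightarrow>
    ('o \<Rightarrow> 'p) \<Rightarrow> ('o \<Rightarrow> 'o \<Rightarrow> 'm \<Rightarrow> 'n) \<Rightarrow> ('o \<Rightarrow> 'p) \<Rightarrow> ('o \<Rightarrow> 'o \<Rightarrow> 'm \<Rightarrow> 'n) \<Rightarrow> ('o \<Rightarrow> 'n) \<Rightarrow> bool"
  where
  "natural_iso C D Fo Fm Go Gm \<eta> \<longleftrightarrow>
     (\<forall>a\<in>Ob C. is_iso D (Fo a) (Go a) (\<eta> a)) \<and>
     (\<forall>a\<in>Ob C. \<forall>b\<in>Ob C. \<forall>f\<in>Hom C a b.
        Comp D (Fo a) (Fo b) (Go b) (\<eta> b) (Fm a b f) =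
        Comp D (Fo a) (Go a) (Go b) (Gm a b f) (\<eta> a))"

definition equivalence_of_categories :: "('o, 'm) category \<Rightarrow> ('p, 'n) category \<Rightarrow>
    ('o \<Rightarrow> 'p) \<Rightarrow> ('o \<Rightarrow> 'o \<Rightarrow> 'm \<Rightarrow> 'n) \<Rightarrow> bool" where
  "equivalence_of_categories C D Fo Fm \<longleftrightarrow>
     is_category C \<and> is_category D \<and> is_functor C D Fo Fm \<and>
     (\<exists>Go Gm \<eta> \<epsilon>. is_functor D C Go Gm \<and>
        natural_iso C C (\<lambda>a. a) (\<lambda>a b f. f)
          (\<lambda>a. Go (Fo a)) (\<lambda>a b f. Gm (Fo a) (Fo b) (Fm a b f)) \<eta> \<and>
        natural_iso D D (\<lambda>p. Fo (Go p)) (\<lambda>p q f. Fm (Go p) (Go q) (Gm p q f))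
          (\<lambda>p. p) (\<lambda>p q f. f) \<epsilon>)"


section \<open>2-term representations up to homotopy\<close>

abbreviation src2 :: "('o, 'a) groupoid \<Rightarrow> 'a \<times> 'a \<Rightarrow> 'o" where
  "src2 G \<equiv> (\<lambda>(g, h). gsrc G h)"

abbreviation tgt2 :: "('o, 'a) groupoid \<Rightarrow> 'a \<times> 'a \<Rightarrow> 'o" where
  "tgt2 G \<equiv> (\<lambda>(g, h). gtgt G g)"

text \<open>The pullbacks \<open>s\<^sup>*E\<close> to \<open>G\<^sub>1\<close> and \<open>s\<^sub>2\<^sup>*E\<close> to \<open>G\<^sub>2\<close>, for vector bundles and for linear Lie
  groupoid bundles.\<close>

abbreviation pull1 :: "('o, 'a) groupoid \<Rightarrow> ('o, 'e) vbundle \<Rightarrow> ('a, 'a \<times> 'e) vbundle" where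
  "pull1 G E \<equiv> pullback_vb (Arr G) (gsrc G) E"

abbreviation pull2 ::
  "('o, 'a) groupoid \<Rightarrow> ('o, 'e) vbundle \<Rightarrow> ('a \<times> 'a, ('a \<times> 'a) \<times> 'e) vbundle" where
  "pull2 G E \<equiv> pullback_vb (comp_pairs G) (src2 G) E"

abbreviation lpull1 ::
  "('o, 'a) groupoid \<Rightarrow> ('o, 'x, 'y) lgb \<Rightarrow> ('a, 'a \<times> 'x, 'a \<times> 'y) lgb" where
  "lpull1 G V \<equiv> pullback_lgb (Arr G) (gsrc G) V"

abbreviation lpull2 ::
  "('o, 'a) groupoid \<Rightarrow> ('o, 'x, 'y) lgb \<Rightarrow> ('a \<times> 'a, ('a \<times> 'a) \<times> 'x, ('a \<times> 'a) \<times> 'y) lgb" where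
  "lpull2 G V \<equiv> pullback_lgb (comp_pairs G) (src2 G) V"

definition unital_quasi_action ::
  "('o, 'a) groupoid \<Rightarrow> ('o, 'e) vbundle \<Rightarrow> ('a \<times> 'e \<Rightarrow> 'e) \<Rightarrow> bool" where
  "unital_quasi_action G E l \<longleftrightarrow> vb_map (pull1 G E) E (gtgt G) l \<and>
     (\<forall>e\<in>pts (tot E). l (gunit G (proj E e), e) = e)"

record ('o, 'a, 'e, 'f) ruth =
  cpx :: "('o, 'e, 'f) complex2"
  lam0 :: "'a \<times> 'e \<Rightarrow> 'e"
  lam1 :: "'a \<times> 'f \<Rightarrow> 'f"
  Omg :: "('a \<times> 'a) \<times> 'f \<Rightarrow> 'e"

abbreviation E0 :: "('o, 'a, 'e, 'f) ruth \<Rightarrow> ('o, 'e) vbundle" where "E0 R \<equiv> C0 (cpx R)"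
abbreviation E1 :: "('o, 'a, 'e, 'f) ruth \<Rightarrow> ('o, 'f) vbundle" where "E1 R \<equiv> C1 (cpx R)"
abbreviation dl :: "('o, 'a, 'e, 'f) ruth \<Rightarrow> 'e \<Rightarrow> 'f" where "dl R \<equiv> diff (cpx R)"

definition is_ruth2 :: "('o, 'a) groupoid \<Rightarrow> ('o, 'a, 'e, 'f) ruth \<Rightarrow> bool" where
  "is_ruth2 G R \<longleftrightarrow>
     cochain_complex (cpx R) \<and> base (E0 R) = Obj G \<and>
     unital_quasi_action G (E0 R) (lam0 R) \<and> unital_quasi_action G (E1 R) (lam1 R) \<and>
     vb_map (pull2 G (E1 R)) (E0 R) (tgt2 G) (Omg R) \<and>
     (\<forall>g\<in>pts (Arr G).
        (\<forall>e\<in>fibre (E1 R) (gsrc G g).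
           Omg R ((g, gunit G (gsrc G g)), e) = vzero (E0 R) (gtgt G g) \<and>
           Omg R ((gunit G (gtgt G g), g), e) = vzero (E0 R) (gtgt G g)) \<and>
        (\<forall>e\<in>fibre (E0 R) (gsrc G g). dl R (lam0 R (g, e)) = lam1 R (g, dl R e))) \<and>
     (\<forall>(g, h)\<in>pts (comp_pairs G).
        (\<forall>e\<in>fibre (E0 R) (gsrc G h).
           vsub (E0 R) (lam0 R (gmult G g h, e)) (lam0 R (g, lam0 R (h, e))) =
           Omg R ((g, h), dl R e)) \<and>
        (\<forall>e\<in>fibre (E1 R) (gsrc G h).
           vsub (E1 R) (lam1 R (gmult G g h, e)) (lam1 R (g, lam1 R (h, e))) =
           dl R (Omg R ((g, h), e)))) \<and>
     (\<forall>(g, h, k)\<in>comp_triples G. \<forall>e\<in>fibre (E1 R) (gsrc G k).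
        vsub (E0 R)
          (vadd (E0 R)
            (vsub (E0 R) (lam0 R (g, Omg R ((h, k), e))) (Omg R ((gmult G g h, k), e)))
            (Omg R ((g, gmult G h k), e)))
          (Omg R ((g, h), lam1 R (k, e))) = vzero (E0 R) (gtgt G g))"

text \<open>A morphism is determined by the values of its components on the total spaces concerned; in
  both categories below the components are made unique by requiring them to be \<open>undefined\<close>
  elsewhere (\<^const>\<open>extensional\<close>).\<close>

type_synonym ('a, 'e, 'f, 'e', 'f') ruth_mor = "('e \<Rightarrow> 'e') \<times> ('f \<Rightarrow> 'f') \<times> ('a \<times> 'f \<Rightarrow> 'e')"

definition ruth2_hom :: "('o, 'a) groupoid \<Rightarrow> ('o, 'a, 'e, 'f) ruth \<Rightarrow> ('o, 'a, 'e', 'f') ruth \<Rightarrow>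
    ('a, 'e, 'f, 'e', 'f') ruth_mor set" where
  "ruth2_hom G R R' = {(p0, p1, m).
     p0 \<in> extensional (pts (tot (E0 R))) \<and> p1 \<in> extensional (pts (tot (E1 R))) \<and>
     m \<in> extensional (pts (tot (pull1 G (E1 R)))) \<and>
     vb_map (E0 R) (E0 R') (\<lambda>x. x) p0 \<and> vb_map (E1 R) (E1 R') (\<lambda>x. x) p1 \<and>
     vb_map (pull1 G (E1 R)) (E0 R') (gtgt G) m \<and>
     (\<forall>e\<in>pts (tot (E0 R)). p1 (dl R e) = dl R' (p0 e)) \<and>
     (\<forall>g\<in>pts (Arr G).
        (\<forall>e\<in>fibre (E0 R) (gsrc G g).
           vsub (E0 R') (p0 (lam0 R (g, e))) (lam0 R' (g, p0 e)) = m (g, dl R e)) \<and>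
        (\<forall>e\<in>fibre (E1 R) (gsrc G g).
           vsub (E1 R') (p1 (lam1 R (g, e))) (lam1 R' (g, p1 e)) = dl R' (m (g, e)))) \<and>
     (\<forall>(g, h)\<in>pts (comp_pairs G). \<forall>e\<in>fibre (E1 R) (gsrc G h).
        vadd (E0 R') (vadd (E0 R') (p0 (Omg R ((g, h), e))) (m (g, lam1 R (h, e))))
          (lam0 R' (g, m (h, e))) =
        vadd (E0 R') (m (gmult G g h, e)) (Omg R' ((g, h), p1 e)))}"

definition RutH2 :: "('o, 'a) groupoid \<Rightarrow>
    (('o, 'a, 'e, 'f) ruth, ('a, 'e, 'f, 'e, 'f) ruth_mor) category" where
  "RutH2 G = \<lparr>Ob = {R. is_ruth2 G R}, Hom = ruth2_hom G,
     Ident = (\<lambda>R. (restrict (\<lambda>e. e) (pts (tot (E0 R))), restrict (\<lambda>e. e) (pts (tot (E1 R))),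
        restrict (\<lambda>(g, e). vzero (E0 R) (gtgt G g)) (pts (tot (pull1 G (E1 R)))))),
     Comp = (\<lambda>R R' R'' (q0, q1, n) (p0, p1, m).
       (compose (pts (tot (E0 R))) q0 p0, compose (pts (tot (E1 R))) q1 p1,
        restrict (\<lambda>(g, e). vadd (E0 R'') (q0 (m (g, e))) (n (g, p1 e)))
          (pts (tot (pull1 G (E1 R))))))\<rparr>"


section \<open>Weak representations\<close>

record ('o, 'a, 'x, 'y) wrep =
  wV :: "('o, 'x, 'y) lgb"
  act0 :: "'a \<times> 'x \<Rightarrow> 'x"
  act1 :: "'a \<times> 'y \<Rightarrow> 'y"
  alph :: "('a \<times> 'a) \<times> 'x \<Rightarrow> 'y"

definition is_weak_rep :: "('o, 'a) groupoid \<Rightarrow> ('o, 'a, 'x, 'y) wrep \<Rightarrow> bool" where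
  "is_weak_rep G A \<longleftrightarrow> (let V = wV A in
     linear_lie_groupoid_bundle V \<and> base (Vob V) = Obj G \<and>
     lgb_map (lpull1 G V) V (gtgt G) (act0 A) (act1 A) \<and>
     (\<forall>x\<in>pts (tot (Vob V)). act0 A (gunit G (proj (Vob V) x), x) = x) \<and>
     (\<forall>v\<in>pts (tot (Varr V)). act1 A (gunit G (proj (Varr V) v), v) = v) \<and>
     lgb_nat (lpull2 G V) V (tgt2 G)
       (\<lambda>((g, k), x). act0 A (g, act0 A (k, x)), \<lambda>((g, k), v). act1 A (g, act1 A (k, v)))
       (\<lambda>((g, k), x). act0 A (gmult G g k, x), \<lambda>((g, k), v). act1 A (gmult G g k, v))
       (alph A) \<and>
     (\<forall>(g, k, l)\<in>comp_triples G. \<forall>x\<in>fibre (Vob V) (gsrc G l).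
        lmult V (alph A ((g, gmult G k l), x)) (act1 A (g, alph A ((k, l), x))) =
        lmult V (alph A ((gmult G g k, l), x)) (alph A ((g, k), act0 A (l, x)))) \<and>
     (\<forall>g\<in>pts (Arr G). \<forall>x\<in>fibre (Vob V) (gsrc G g).
        alph A ((g, gunit G (gsrc G g)), x) = lunit V (act0 A (g, x)) \<and>
        alph A ((gunit G (gtgt G g), g), x) = lunit V (act0 A (g, x))))"

type_synonym ('a, 'x, 'y, 'z, 'w) wrep_mor = "('x \<Rightarrow> 'z) \<times> ('y \<Rightarrow> 'w) \<times> ('a \<times> 'x \<Rightarrow> 'w)"

definition wrep_hom :: "('o, 'a) groupoid \<Rightarrow> ('o, 'a, 'x, 'y) wrep \<Rightarrow> ('o, 'a, 'z, 'w) wrep \<Rightarrow>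
    ('a, 'x, 'y, 'z, 'w) wrep_mor set" where
  "wrep_hom G A B = (let V = wV A; W = wV B in {(f0, f1, D).
     f0 \<in> extensional (pts (tot (Vob V))) \<and> f1 \<in> extensional (pts (tot (Varr V))) \<and>
     D \<in> extensional (pts (tot (pull1 G (Vob V)))) \<and>
     lgb_map V W (\<lambda>x. x) f0 f1 \<and>
     lgb_nat (lpull1 G V) W (gtgt G)
       (\<lambda>(g, x). f0 (act0 A (g, x)), \<lambda>(g, v). f1 (act1 A (g, v)))
       (\<lambda>(g, x). act0 B (g, f0 x), \<lambda>(g, v). act1 B (g, f1 v)) D \<and>
     (\<forall>(g, k)\<in>pts (comp_pairs G). \<forall>x\<in>fibre (Vob V) (gsrc G k).
        lmult W (lmult W (alph B ((g, k), f0 x)) (act1 B (g, D (k, x)))) (D (g, act0 A (k, x))) =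
        lmult W (D (gmult G g k, x)) (f1 (alph A ((g, k), x)))) \<and>
     (\<forall>x\<in>pts (tot (Vob V)). D (gunit G (proj (Vob V) x), x) = lunit W (f0 x))})"

definition WRep :: "('o, 'a) groupoid \<Rightarrow>
    (('o, 'a, 'x, 'y) wrep, ('a, 'x, 'y, 'x, 'y) wrep_mor) category" where
  "WRep G = \<lparr>Ob = {A. is_weak_rep G A}, Hom = wrep_hom G,
     Ident = (\<lambda>A. (restrict (\<lambda>x. x) (pts (tot (Vob (wV A)))),
        restrict (\<lambda>v. v) (pts (tot (Varr (wV A)))),
        restrict (\<lambda>(g, x). lunit (wV A) (act0 A (g, x))) (pts (tot (pull1 G (Vob (wV A))))))),
     Comp = (\<lambda>A B C (f0', f1', D') (f0, f1, D).
       (compose (pts (tot (Vob (wV A)))) f0' f0, compose (pts (tot (Varr (wV A)))) f1' f1,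
        restrict (\<lambda>(g, x). lmult (wV C) (D' (g, f0 x)) (f1' (D (g, x))))
          (pts (tot (pull1 G (Vob (wV A)))))))\<rparr>"


section \<open>The induced functor\<close>

text \<open>The quasi-actions form a 1-morphism \<open>(\<lambda>\<^sup>0, \<lambda>\<^sup>1)\<close> of complexes from \<open>s\<^sup>*E\<close> to \<open>E\<close> covering \<open>t\<close>, and
  \<open>\<Omega>\<close> is a chain homotopy over \<open>G\<^sub>2\<close> from \<open>\<lambda>\<^sub>g\<lambda>\<^sub>h\<close> to the action of \<open>gh\<close>. The functor applies \<open>\<Phi>\<close> to
  these. The canonical identification of the pullback of \<open>\<Phi>(E)\<close> with \<open>\<Phi>\<close> of the pullback of \<open>E\<close> is,
  on arrows, \<open>pull_iso\<close>.\<close>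

definition pull_iso :: "'p \<times> ('e \<times> 'f) \<Rightarrow> ('p \<times> 'e) \<times> ('p \<times> 'f)" where
  "pull_iso = (\<lambda>(p, (e, f)). ((p, e), (p, f)))"

definition Phi_G_obj :: "('o, 'a, 'e, 'f) ruth \<Rightarrow> ('o, 'a, 'f, 'e \<times> 'f) wrep" where
  "Phi_G_obj R = \<lparr>wV = Phi_obj (cpx R),
     act0 = fst (Phi_map (lam0 R, lam1 R)),
     act1 = snd (Phi_map (lam0 R, lam1 R)) \<circ> pull_iso,
     alph = Phi_htpy
       (\<lambda>((g, h), e). lam0 R (g, lam0 R (h, e)), \<lambda>((g, h), e). lam1 R (g, lam1 R (h, e))) (Omg R)\<rparr>"

text \<open>The conditions on a morphism \<open>(\<phi>, \<mu>)\<close> say \<open>\<phi>\<lambda>\<^sub>g - \<lambda>'\<^sub>g\<phi> = \<delta>'\<mu>\<^sub>g\<close> in degree 1 (and likewise in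
  degree 0), so that \<open>-\<mu>\<close>, rather than \<open>\<mu>\<close>, is a chain homotopy from \<open>\<phi>\<lambda>\<^sub>g\<close> to \<open>\<lambda>'\<^sub>g\<phi>\<close>.\<close>

definition Phi_G_mor :: "('o, 'a) groupoid \<Rightarrow> ('o, 'a, 'e, 'f) ruth \<Rightarrow> ('o, 'a, 'e', 'f') ruth \<Rightarrow>
    ('a, 'e, 'f, 'e', 'f') ruth_mor \<Rightarrow> ('a, 'f, 'e \<times> 'f, 'f', 'e' \<times> 'f') wrep_mor" where
  "Phi_G_mor G R R' = (\<lambda>(p0, p1, m).
     (restrict (fst (Phi_map (p0, p1))) (pts (tot (E1 R))),
      restrict (snd (Phi_map (p0, p1))) (pts (tot (whitney_sum (E0 R) (E1 R)))),
      restrict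
        (Phi_htpy (\<lambda>(g, e). p0 (lam0 R (g, e)), \<lambda>(g, e). p1 (lam1 R (g, e)))
           (\<lambda>c. vneg (E0 R') (m c)))
        (pts (tot (pull1 G (E1 R))))))"

end

theory Submission
  imports Defs
begin

text \<open>A linear Lie groupoid bundle \<open>V\<close> carries little structure. Linearity forces
  \<open>v w = (v - 1\<^sub>x) + w\<close> where \<open>x\<close> is the source of \<open>v\<close>, and splitting off the kernel of the source map
  along the units identifies \<open>V\<close> with \<open>\<Phi>(C)\<close> for the complex \<open>C = (ker s \<rightarrow> V\<^sub>0)\<close> whose differential is the
  target map. Under such an identification the components \<open>\<alpha>\<close> of a weak representation and \<open>\<Delta>\<close> of a
  map have prescribed sources, so they are the same as their kernel components \<open>\<Omega>\<close> and \<open>-\<mu>\<close>, and the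
  axioms on either side turn into each other. Thus every weak representation is presented by a
  representation up to homotopy, and the maps between presented objects correspond bijectively and
  compatibly with composition. The kernel bundle lives on the type of arrows \<open>'u \<times> 'u\<close>; since \<open>'u\<close> is
  infinite, it can be transported to \<open>'u\<close>.\<close>

section \<open>Functions of class \<open>C^k\<close> on open subsets of Euclidean spaces\<close>

text \<open>The obstacle is smoothness on \<open>G\<^sub>2\<close> and on pullbacks. A
  \<open>submfd\<close> is tested only in its slice charts, and nothing in its construction says
  that these cover an arbitrary subset. The working notion is therefore \<open>psmooth\<close>
  between premanifolds: a smooth map that also respects the covered regions, so that such maps
  compose. The composable pairs occur only as a source of smooth maps and as a base of pullbacks,
  while maps into a fibre product always go along a vector bundle projection, where slice charts can
  be written down.

  On the categorical side, an object of \<open>WRep G\<close> need not be of the form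
  \<open>\<Phi>(C)\<close>, and it has many presentations. Morphisms are therefore compared for
  arbitrary presentations at both ends. One choice of a presentation for each object then yields the
  inverse functor, and even the category laws of \<open>WRep G\<close> are inherited from
  \<open>RutH2 G\<close>.\<close>

lemma openin_Euclidean_space:
  "openin (Euclidean_space n) U \<longleftrightarrow> (\<exists>T. open T \<and> U = T \<inter> topspace (Euclidean_space n))"
  by (simp add: Euclidean_space_def openin_subtopology euclidean_product_topology)

lemma continuous_on_fun_upd: "continuous_on UNIV (\<lambda>r::real. (x::nat \<Rightarrow> real)(i := r))"
proof (rule continuous_on_coordinatewise_then_product)
  fix j show "continuous_on UNIV (\<lambda>r. (x(i := r)) j)"
    by (cases "j = i") auto
qed

text \<open>\<open>partial_deriv\<close> differentiates a total function in one variable. Varying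
  one of the first \<open>n\<close> coordinates stays in R^n, so near \<open>x i\<close> the line
  stays in the relatively open \<open>U\<close> and only the values on \<open>U\<close>
  matter.\<close>

lemma eventually_line:
  assumes "openin (Euclidean_space n) U" "x \<in> U" "i < n"
  shows "eventually (\<lambda>r. x(i := r) \<in> U) (nhds (x i))"
proof -
  obtain T where T: "open T" "U = T \<inter> topspace (Euclidean_space n)"
    using assms(1) by (auto simp: openin_Euclidean_space)
  have "open ((\<lambda>r. x(i := r)) -` T)"
    using T(1) continuous_on_fun_upd by (metis continuous_on_open_vimage open_UNIV Int_UNIV_right)
  moreover have "x i \<in> (\<lambda>r. x(i := r)) -` T" using assms T by simp
  moreover have "x(i := r) \<in> topspace (Euclidean_space n)" for r
    using assms T by (auto simp: topspace_Euclidean_space)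
  ultimately show ?thesis
    using T by (auto simp: eventually_nhds intro!: exI[of _ "(\<lambda>r. x(i := r)) -` T"])
qed

lemma field_differentiable_cong_ev:
  fixes f g :: "real \<Rightarrow> real"
  assumes "eventually (\<lambda>r. f r = g r) (nhds x)"
  shows "f field_differentiable at x \<longleftrightarrow> g field_differentiable at x" "deriv f x = deriv g x"
proof -
  show "f field_differentiable at x \<longleftrightarrow> g field_differentiable at x"
    unfolding field_differentiable_def using DERIV_cong_ev[OF refl assms refl] by blast
  show "deriv f x = deriv g x"
    using assms by (rule deriv_cong_ev) simp
qed

lemma Ck_imp_continuous_on: "Ck k n U f \<Longrightarrow> continuous_on U f"
  by (cases k) auto

lemma Ck_subset: "Ck k n U f \<Longrightarrow> V \<subseteq> U \<Longrightarrow> Ck k n V f"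
  by (induction k arbitrary: f) (auto intro: continuous_on_subset)

lemma Ck_Suc_imp: "Ck (Suc k) n U f \<Longrightarrow> Ck k n U f"
  by (induction k arbitrary: f) auto

lemma partial_deriv_cong:
  assumes "openin (Euclidean_space n) U" "\<And>x. x \<in> U \<Longrightarrow> f x = g x" "x \<in> U" "i < n"
  shows "partial_deriv i f x = partial_deriv i g x"
    and "(\<lambda>r. f (x(i := r))) field_differentiable at (x i) \<longleftrightarrow>
         (\<lambda>r. g (x(i := r))) field_differentiable at (x i)"
proof -
  have ev: "eventually (\<lambda>r. f (x(i := r)) = g (x(i := r))) (nhds (x i))"
    using eventually_line[OF assms(1,3,4)] by eventually_elim (rule assms(2))
  show "partial_deriv i f x = partial_deriv i g x"
    unfolding partial_deriv_def by (rule field_differentiable_cong_ev(2)[OF ev])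
  show "(\<lambda>r. f (x(i := r))) field_differentiable at (x i) \<longleftrightarrow>
         (\<lambda>r. g (x(i := r))) field_differentiable at (x i)"
    by (rule field_differentiable_cong_ev(1)[OF ev])
qed

text \<open>On an open set equal functions have equal partial derivatives, so the induction passes
  to these; outside \<open>U\<close> the two functions may differ.\<close>

lemma Ck_cong:
  assumes "openin (Euclidean_space n) U" "\<And>x. x \<in> U \<Longrightarrow> f x = g x" "Ck k n U f"
  shows "Ck k n U g"
  using assms(2,3)
proof (induction k arbitrary: f g)
  case 0
  then show ?case by (simp cong: continuous_on_cong)
next
  case (Suc k)
  have "continuous_on U g"
    using Suc.prems by (simp cong: continuous_on_cong)
  moreover have "Ck k n U (partial_deriv i g)" if "i < n" for i
    by (rule Suc.IH[of "partial_deriv i f"])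
      (use Suc.prems that partial_deriv_cong(1)[OF assms(1) Suc.prems(1) _ that] in auto)
  moreover have "(\<lambda>r. g (x(i := r))) field_differentiable at (x i)" if "i < n" "x \<in> U" for i x
    using Suc.prems(2) that partial_deriv_cong(2)[where f = f and g = g, OF assms(1) Suc.prems(1) that(2,1)] by simp
  ultimately show ?case by simp
qed

lemma continuous_on_locally:
  assumes "\<And>x. x \<in> U \<Longrightarrow> \<exists>W. openin (Euclidean_space n) W \<and> x \<in> W \<and> continuous_on (W \<inter> U) f"
    and "U \<subseteq> topspace (Euclidean_space n)"
  shows "continuous_on U f"
  unfolding continuous_on_eq_continuous_within
proof
  fix x assume x: "x \<in> U"
  then obtain W T where W: "x \<in> W" "continuous_on (W \<inter> U) f" and T: "open T" 
    "W = T \<inter> topspace (Euclidean_space n)"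
    using assms(1) openin_Euclidean_space by metis
  have "W \<inter> U = U \<inter> T" using assms(2) T by auto
  then have "continuous (at x within (U \<inter> T)) f"
    using W x T by (auto simp: continuous_on_eq_continuous_within)
  then show "continuous (at x within U) f"
    using at_within_nhd[of x T U "U \<inter> T"] T W unfolding continuous_within by auto
qed

lemma Ck_locally:
  assumes "\<And>x. x \<in> U \<Longrightarrow> \<exists>W. openin (Euclidean_space n) W \<and> x \<in> W \<and> Ck k n (W \<inter> U) f"
    and U: "U \<subseteq> topspace (Euclidean_space n)"
  shows "Ck k n U f"
  using assms(1)
proof (induction k arbitrary: f)
  case 0
  then show ?case using continuous_on_locally[OF _ U, of f] by simp
next
  case (Suc k)
  have "continuous_on U f"
    using continuous_on_locally[OF _ U, of f] Suc.prems by (meson Ck_imp_continuous_on)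
  moreover have "(\<lambda>r. f (x(i := r))) field_differentiable at (x i)" if "i < n" "x \<in> U" for i x
    using Suc.prems[OF that(2)] that by auto
  moreover have "Ck k n U (partial_deriv i f)" if "i < n" for i
    by (rule Suc.IH) (use Suc.prems that in fastforce)
  ultimately show ?case by simp
qed

section \<open>Algebra of \<open>C^k\<close> functions\<close>

lemma partial_deriv_const [simp]: "partial_deriv i (\<lambda>x. c) = (\<lambda>x. 0)"
  by (rule ext) (simp add: partial_deriv_def)

lemma partial_deriv_coordinate: "partial_deriv i (\<lambda>x. x j) = (\<lambda>x. if i = j then 1 else 0)"
  by (rule ext) (simp add: partial_deriv_def)

lemma Ck_const [intro, simp]: "Ck k n U (\<lambda>x. c)"
  by (induction k arbitrary: c) auto

lemma Ck_coordinate [intro, simp]: "Ck k n U (\<lambda>x. x j)"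
proof (cases k)
  case 0
  have "continuous_on U (\<lambda>x::nat\<Rightarrow>real. x j)"
    by (rule continuous_on_subset[OF continuous_on_product_coordinates]) simp
  then show ?thesis using 0 by simp
next
  case (Suc k')
  have "continuous_on U (\<lambda>x::nat\<Rightarrow>real. x j)"
    by (rule continuous_on_subset[OF continuous_on_product_coordinates]) simp
  moreover have "(\<lambda>r::real. if j = i then r else x j) field_differentiable at t" for i x t
    by (cases "j = i") auto
  ultimately show ?thesis using Suc by (auto simp: partial_deriv_coordinate)
qed

lemma partial_deriv_add:
  assumes "(\<lambda>r. f (x(i := r))) field_differentiable at (x i)"
    "(\<lambda>r. g (x(i := r))) field_differentiable at (x i)"
  shows "partial_deriv i (\<lambda>x. f x + g x) x = partial_deriv i f x + partial_deriv i g x"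
  unfolding partial_deriv_def using assms by (simp add: deriv_add)

lemma Ck_add:
  assumes "openin (Euclidean_space n) U"
  shows "Ck k n U f \<Longrightarrow> Ck k n U g \<Longrightarrow> Ck k n U (\<lambda>x. f x + g x)"
proof (induction k arbitrary: f g)
  case 0
  then show ?case by (simp add: continuous_intros)
next
  case (Suc k)
  have "Ck k n U (partial_deriv i (\<lambda>x. f x + g x))" if "i < n" for i
    by (rule Ck_cong[OF assms _ Suc.IH[of "partial_deriv i f" "partial_deriv i g"]])
       (use Suc.prems that in \<open>auto simp: partial_deriv_add\<close>)
  then show ?case using Suc.prems
    by (auto intro!: continuous_intros field_differentiable_add)
qed

lemma Ck_sum:
  assumes "openin (Euclidean_space n) U"
  shows "(\<And>j. j \<in> J \<Longrightarrow> Ck k n U (f j)) \<Longrightarrow> Ck k n U (\<lambda>x. \<Sum>j\<in>J. f j x)"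
  by (induction J rule: infinite_finite_induct) (auto intro: Ck_add[OF assms])

lemma partial_deriv_mult:
  assumes "(\<lambda>r. f (x(i := r))) field_differentiable at (x i)"
    "(\<lambda>r. g (x(i := r))) field_differentiable at (x i)"
  shows "partial_deriv i (\<lambda>x. f x * g x) x = f x * partial_deriv i g x + partial_deriv i f x * g x"
  unfolding partial_deriv_def using deriv_mult[OF assms] by simp

lemma Ck_mult:
  assumes "openin (Euclidean_space n) U"
  shows "Ck k n U f \<Longrightarrow> Ck k n U g \<Longrightarrow> Ck k n U (\<lambda>x. f x * g x)"
proof (induction k arbitrary: f g)
  case 0
  then show ?case by (simp add: continuous_intros)
next
  case (Suc k)
  have fg: "Ck k n U f" "Ck k n U g" using Suc.prems Ck_Suc_imp by blast+
  have "Ck k n U (partial_deriv i (\<lambda>x. f x * g x))" if "i < n" for i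
    by (rule Ck_cong[OF assms _ Ck_add[OF assms Suc.IH[of f "partial_deriv i g"]
          Suc.IH[of "partial_deriv i f" g]]])
       (use Suc.prems fg that in \<open>auto simp: partial_deriv_mult\<close>)
  then show ?case using Suc.prems
    by (auto intro!: continuous_intros field_differentiable_mult)
qed

text \<open>The derivative is written as a product of -1, the partial derivative and two inverses,
  the shape to which \<open>Ck_mult\<close> applies in the induction for
  \<open>Ck_inverse\<close>.\<close>

lemma partial_deriv_inverse:
  assumes "(\<lambda>r. f (x(i := r))) field_differentiable at (x i)" "f x \<noteq> 0"
  shows "partial_deriv i (\<lambda>x. inverse (f x)) x =
    (- 1) * (partial_deriv i f x * (inverse (f x) * inverse (f x)))"
proof -
  have "((\<lambda>r. f (x(i := r))) has_field_derivative partial_deriv i f x) (at (x i))"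
    unfolding partial_deriv_def using assms field_differentiable_derivI by blast
  from DERIV_inverse_fun[OF this] show ?thesis
    using assms(2) by (simp add: partial_deriv_def DERIV_imp_deriv power2_eq_square)
qed

lemma Ck_inverse:
  assumes "openin (Euclidean_space n) U" "\<And>x. x \<in> U \<Longrightarrow> f x \<noteq> 0"
  shows "Ck k n U f \<Longrightarrow> Ck k n U (\<lambda>x. inverse (f x))"
proof (induction k)
  case 0
  then show ?case using assms by (auto intro!: continuous_intros)
next
  case (Suc k)
  have f: "Ck k n U (\<lambda>x. inverse (f x))" using Suc Ck_Suc_imp by blast
  have "Ck k n U (partial_deriv i (\<lambda>x. inverse (f x)))" if "i < n" for i
    by (rule Ck_cong[OF assms(1) _ Ck_mult[OF assms(1) Ck_const[where c = "-1"] Ck_mult[OF assms(1) _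
            Ck_mult[OF assms(1) f f]]], of "partial_deriv i f"])
       (use Suc.prems assms that in \<open>auto simp: partial_deriv_inverse\<close>)
  then show ?case using Suc.prems assms
    by (auto intro!: continuous_intros field_differentiable_inverse)
qed

text \<open>Walk from \<open>y0\<close> to \<open>y\<close> one coordinate at a time and apply the
  mean value theorem on each leg. The intermediate points lie in the box spanned by
  \<open>y0\<close> and \<open>y\<close>, so they are forced towards \<open>y0\<close> when
  \<open>y\<close> tends to it.\<close>

lemma Ck1_mean_value:
  assumes V: "openin (Euclidean_space m) V" and h: "Ck (Suc 0) m V h"
    and box: "\<And>z. z \<in> topspace (Euclidean_space m) \<Longrightarrow>
      (\<And>j. min (y0 j) (y j) \<le> z j \<and> z j \<le> max (y0 j) (y j)) \<Longrightarrow> z \<in> V"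
    and y: "y0 \<in> topspace (Euclidean_space m)" "y \<in> topspace (Euclidean_space m)"
  shows "\<exists>z. (\<forall>j<m. z j \<in> V \<and> (\<forall>l. \<bar>z j l - y0 l\<bar> \<le> \<bar>y l - y0 l\<bar>)) \<and>
    h y - h y0 = (\<Sum>j<m. partial_deriv j h (z j) * (y j - y0 j))"
proof -
  \<comment> \<open>The corner of the box whose first \<open>j\<close> coordinates have already
    moved from \<open>y0\<close> to \<open>y\<close>; the telescope runs from \<open>w j\<close> to
    \<open>w (Suc j)\<close>.\<close>
  define w where "w j = (\<lambda>l. if l < j then y l else y0 l)" for j :: nat
  have w0: "w 0 = y0" by (simp add: w_def)
  have wm: "w m = y" using y by (auto simp: w_def topspace_Euclidean_space)
  have step: "\<exists>z. z \<in> topspace (Euclidean_space m) \<and> (\<forall>l. \<bar>z l - y0 l\<bar> \<le> \<bar>y l - y0 l\<bar>) \<and> z \<in> V \<and>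
     h (w (Suc j)) - h (w j) = partial_deriv j h z * (y j - y0 j)" if j: "j < m" for j
  proof -
    define p where "p r = (w j)(j := r)" for r
    have pV: "p r \<in> V" if "min (y0 j) (y j) \<le> r" "r \<le> max (y0 j) (y j)" for r
      using that y j by (intro box) (auto simp: p_def w_def topspace_Euclidean_space)
    have p1: "p (y j) = w (Suc j)" by (rule ext) (auto simp: p_def w_def)
    have p0: "p (y0 j) = w j" by (rule ext) (auto simp: p_def w_def)
    have D: "((\<lambda>r. h (p r)) has_real_derivative partial_deriv j h (p r)) (at r)"
      if "min (y0 j) (y j) \<le> r" "r \<le> max (y0 j) (y j)" for r
    proof -
      have "(\<lambda>s. h ((p r)(j := s))) field_differentiable at (p r j)"
        using h pV[OF that] j by simp
      then have "((\<lambda>s. h ((p r)(j := s))) has_real_derivative partial_deriv j h (p r)) (at (p r j))"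
        unfolding partial_deriv_def by (rule field_differentiable_derivI)
      then show ?thesis by (simp add: p_def)
    qed
    have "\<exists>r. min (y0 j) (y j) \<le> r \<and> r \<le> max (y0 j) (y j) \<and>
      h (p (y j)) - h (p (y0 j)) = partial_deriv j h (p r) * (y j - y0 j)"
    \<comment> \<open>The mean value theorem is available on a nondegenerate interval in increasing
      order; if the two coordinates agree, both sides vanish.\<close>
    proof (cases "y0 j" "y j" rule: linorder_cases)
      case less
      obtain r where "y0 j < r" "r < y j" "h (p (y j)) - h (p (y0 j)) = (y j - y0 j) * partial_deriv j h (p r)"
        using MVT2[OF less, of "\<lambda>r. h (p r)" "\<lambda>r. partial_deriv j h (p r)"] D less by auto
      then show ?thesis using less by (auto intro!: exI[of _ r] simp: mult.commute)
    next
      case equal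
      then show ?thesis by (auto intro!: exI[of _ "y j"])
    next
      case greater
      obtain r where r: "y j < r" "r < y0 j" "h (p (y0 j)) - h (p (y j)) = (y0 j - y j) * partial_deriv j h (p r)"
        using MVT2[OF greater, of "\<lambda>r. h (p r)" "\<lambda>r. partial_deriv j h (p r)"] D greater by auto
      have "h (p (y j)) - h (p (y0 j)) = partial_deriv j h (p r) * (y j - y0 j)"
        using r(3) by (simp add: algebra_simps)
      then show ?thesis using r by (auto intro!: exI[of _ r])
    qed
    then obtain r where r: "min (y0 j) (y j) \<le> r" "r \<le> max (y0 j) (y j)"
      "h (p (y j)) - h (p (y0 j)) = partial_deriv j h (p r) * (y j - y0 j)" by blast
    have "\<bar>p r l - y0 l\<bar> \<le> \<bar>y l - y0 l\<bar>" for l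
      using r by (auto simp: p_def w_def)
    moreover have "p r \<in> topspace (Euclidean_space m)"
      using y j by (auto simp: p_def w_def topspace_Euclidean_space)
    ultimately show ?thesis using pV[OF r(1,2)] r(3) p0 p1 by auto
  qed
  then obtain z where z: "\<forall>j<m. z j \<in> topspace (Euclidean_space m) \<and>
     (\<forall>l. \<bar>z j l - y0 l\<bar> \<le> \<bar>y l - y0 l\<bar>) \<and> z j \<in> V \<and>
     h (w (Suc j)) - h (w j) = partial_deriv j h (z j) * (y j - y0 j)" by metis
  have "h y - h y0 = (\<Sum>j<m. h (w (Suc j)) - h (w j))"
    by (subst sum_lessThan_telescope) (simp add: w0 wm)
  also have "\<dots> = (\<Sum>j<m. partial_deriv j h (z j) * (y j - y0 j))"
    using z by (intro sum.cong) auto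
  finally show ?thesis using z by (intro exI[of _ z]) auto
qed

lemma tendsto_coordinatewise:
  fixes f :: "'b \<Rightarrow> nat \<Rightarrow> real"
  assumes "\<And>j. ((\<lambda>x. f x j) \<longlongrightarrow> l j) F"
  shows "(f \<longlongrightarrow> l) F"
proof -
  have "limitin (product_topology (\<lambda>i. euclidean) UNIV) f l F"
    using assms by (auto simp: limitin_componentwise)
  then show ?thesis by (simp add: euclidean_product_topology)
qed

text \<open>A basic open set of the product topology restricts only finitely many coordinates, so
  one radius serves for all of them.\<close>

lemma box_in_open:
  assumes V: "openin (Euclidean_space m) V" and y: "y0 \<in> V"
  obtains e where "e > 0"
    "\<And>z. z \<in> topspace (Euclidean_space m) \<Longrightarrow> (\<And>j. \<bar>z j - y0 j\<bar> < e) \<Longrightarrow> z \<in> V"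
proof -
  obtain T where T: "open T" "V = T \<inter> topspace (Euclidean_space m)"
    using V openin_Euclidean_space by metis
  then have "openin (product_topology (\<lambda>i. euclidean) UNIV) T" "y0 \<in> T"
    using y by (auto simp: euclidean_product_topology)
  then obtain X where X: "y0 \<in> Pi\<^sub>E UNIV X" "\<And>i. open (X i)" "finite {i. X i \<noteq> UNIV}" 
     "Pi\<^sub>E UNIV X \<subseteq> T"
    using product_topology_open_contains_basis[of "\<lambda>i. euclideanreal" UNIV T y0] by auto
  have "\<exists>e>0. \<forall>r. \<bar>r - y0 i\<bar> < e \<longrightarrow> r \<in> X i" for i
    using X(1,2) open_real[of "X i"] by (auto simp: PiE_iff)
  then obtain e where e: "\<And>i. e i > 0" "\<And>i r. \<bar>r - y0 i\<bar> < e i \<Longrightarrow> r \<in> X i" by metis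
  \<comment> \<open>The extra 1 keeps the minimum defined when no coordinate is restricted.\<close>
  define d where "d = Min (insert 1 (e ` {i. X i \<noteq> UNIV}))"
  have "d > 0" using X(3) e(1) by (auto simp: d_def)
  moreover have "z \<in> V" if z: "z \<in> topspace (Euclidean_space m)" "\<And>j. \<bar>z j - y0 j\<bar> < d" for z
  proof -
    have "z i \<in> X i" for i
    proof (cases "X i = UNIV")
      case False
      then have "d \<le> e i" using X(3) by (auto simp: d_def)
      then show ?thesis using e(2) z(2)[of i] by fastforce
    qed auto
    then show ?thesis using X(4) T z(1) by (auto simp: PiE_iff)
  qed
  ultimately show ?thesis using that by blast
qed

text \<open>The chain rule along a curve: by telescoping over the coordinates, the difference quotient of
  \<open>h \<circ> c\<close> is a combination of partial derivatives of \<open>h\<close> at intermediate points.\<close>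

lemma Ck1_chain_rule:
  assumes V: "openin (Euclidean_space m) V" and h: "Ck (Suc 0) m V h"
    and c: "\<And>j. j < m \<Longrightarrow> ((\<lambda>r. c r j) has_real_derivative c' j) (at t)"
    and cE: "\<And>r. r \<in> R \<Longrightarrow> c r \<in> topspace (Euclidean_space m)" and R: "open R" "t \<in> R" and t: "c t \<in> V"
  shows "((\<lambda>r. h (c r)) has_real_derivative (\<Sum>j<m. partial_deriv j h (c t) * c' j)) (at t)"
proof -
  obtain e where e: "e > 0"
    "\<And>z. z \<in> topspace (Euclidean_space m) \<Longrightarrow> (\<And>j. \<bar>z j - c t j\<bar> < e) \<Longrightarrow> z \<in> V"
    using box_in_open[OF V t] by blast
  \<comment> \<open>The derivative is given for the first \<open>m\<close> coordinates only. From
    index \<open>m\<close> on the curve is constantly 0 near \<open>t\<close>, because it runs in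
    R^m there.\<close>
  have lim: "((\<lambda>r. c r j) \<longlongrightarrow> c t j) (at t)" for j
  proof (cases "j < m")
    case True
    then show ?thesis using c DERIV_isCont isCont_def by blast
  next
    case False
    have "eventually (\<lambda>r. c r j = 0) (at t)"
      using R cE False unfolding eventually_at_topological topspace_Euclidean_space by auto
    moreover have "c t j = 0" using cE[OF R(2)] False by (auto simp: topspace_Euclidean_space)
    ultimately show ?thesis using tendsto_eventually by fastforce
  qed
  have "eventually (\<lambda>r. \<bar>c r j - c t j\<bar> < e) (at t)" for j
    using lim[of j] e(1) by (auto simp: tendsto_iff dist_real_def)
  then have "eventually (\<lambda>r. \<forall>j\<in>{..<m}. \<bar>c r j - c t j\<bar> < e) (at t)"
    by (simp add: eventually_ball_finite)
  moreover have evR: "eventually (\<lambda>r. r \<in> R) (at t)"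
    using R by (simp add: eventually_at_in_open')
  ultimately have "eventually (\<lambda>r. \<exists>z. (\<forall>j<m. z j \<in> V \<and> (\<forall>l. \<bar>z j l - c t l\<bar> \<le> \<bar>c r l - c t l\<bar>)) \<and>
      h (c r) - h (c t) = (\<Sum>j<m. partial_deriv j h (z j) * (c r j - c t j))) (at t)"
  proof eventually_elim
    case (elim r)
    have all: "\<bar>c r j - c t j\<bar> < e" for j
      using elim cE[of r] cE[OF R(2)] e(1) by (cases "j < m") (auto simp: topspace_Euclidean_space)
    have box: "z \<in> V" if "z \<in> topspace (Euclidean_space m)"
      "\<And>j. min (c t j) (c r j) \<le> z j \<and> z j \<le> max (c t j) (c r j)" for z
    proof (rule e(2)[OF that(1)])
      fix j show "\<bar>z j - c t j\<bar> < e"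
        using that(2)[of j] all[of j] by (auto simp: min_def max_def split: if_splits)
    qed
    show ?case by (rule Ck1_mean_value[OF V h box cE[OF R(2)] cE[OF elim(2)]])
  qed
  \<comment> \<open>The intermediate points become functions of \<open>r\<close>. In each coordinate
    they are at most as far from \<open>c t\<close> as \<open>c r\<close> is, so they tend to
    \<open>c t\<close>, where the partial derivatives of \<open>h\<close> are continuous.\<close>
  then obtain Z where Z: "eventually (\<lambda>r. (\<forall>j<m. Z r j \<in> V \<and> (\<forall>l. \<bar>Z r j l - c t l\<bar> \<le> \<bar>c r l - c t l\<bar>)) \<and>
      h (c r) - h (c t) = (\<Sum>j<m. partial_deriv j h (Z r j) * (c r j - c t j))) (at t)"
    using eventually_ex[where P = "\<lambda>r z. (\<forall>j<m. z j \<in> V \<and> (\<forall>l. \<bar>z j l - c t l\<bar> \<le> \<bar>c r l - c t l\<bar>)) \<and>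
      h (c r) - h (c t) = (\<Sum>j<m. partial_deriv j h (z j) * (c r j - c t j))"] by blast
  have Zlim: "((\<lambda>r. Z r j) \<longlongrightarrow> c t) (at t)" if "j < m" for j
  proof (rule tendsto_coordinatewise)
    fix l
    have 1: "((\<lambda>r. \<bar>c r l - c t l\<bar>) \<longlongrightarrow> 0) (at t)"
      using lim[of l] by (auto intro!: tendsto_eq_intros)
    have "((\<lambda>r. Z r j l - c t l) \<longlongrightarrow> 0) (at t)"
      by (rule Lim_null_comparison[OF _ 1]) (use Z that in \<open>auto elim!: eventually_mono\<close>)
    then show "((\<lambda>r. Z r j l) \<longlongrightarrow> c t l) (at t)"
      by (simp add: LIM_zero_iff)
  qed
  have plim: "((\<lambda>r. partial_deriv j h (Z r j)) \<longlongrightarrow> partial_deriv j h (c t)) (at t)" if "j < m" for j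
  proof -
    have "continuous_on V (partial_deriv j h)" using h that by auto
    then show ?thesis
      by (rule continuous_on_tendsto_compose[OF _ Zlim[OF that] t])
         (use Z that in \<open>auto elim!: eventually_mono\<close>)
  qed
  have "((\<lambda>r. \<Sum>j<m. partial_deriv j h (Z r j) * ((c r j - c t j) / (r - t))) \<longlongrightarrow>
      (\<Sum>j<m. partial_deriv j h (c t) * c' j)) (at t)"
    using c plim by (intro tendsto_sum tendsto_mult) (auto simp: has_field_derivative_iff)
  moreover have "eventually (\<lambda>r. (\<Sum>j<m. partial_deriv j h (Z r j) * ((c r j - c t j) / (r - t))) =
     (h (c r) - h (c t)) / (r - t)) (at t)"
    using Z by eventually_elim (auto simp: sum_divide_distrib)
  ultimately show ?thesis
    unfolding has_field_derivative_iff by (rule Lim_transform_eventually)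
qed

lemma partial_deriv_compose:
  assumes V: "openin (Euclidean_space m) V" and h: "Ck (Suc 0) m V h"
    and U: "openin (Euclidean_space n) U"
    and f: "\<And>j. j < m \<Longrightarrow> Ck (Suc 0) n U (\<lambda>x. f x j)" and fV: "f ` U \<subseteq> V"
    and x: "x \<in> U" and i: "i < n"
  shows "((\<lambda>r. h (f (x(i := r)))) has_real_derivative
      (\<Sum>j<m. partial_deriv j h (f x) * partial_deriv i (\<lambda>x. f x j) x)) (at (x i))"
proof -
  obtain R where R: "open R" "x i \<in> R" "\<And>r. r \<in> R \<Longrightarrow> x(i := r) \<in> U"
    using eventually_line[OF U x i] by (auto simp: eventually_nhds)
  have "((\<lambda>r. f (x(i := r)) j) has_real_derivative partial_deriv i (\<lambda>x. f x j) x) (at (x i))" 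
    if "j < m" for j
    unfolding partial_deriv_def using f[OF that] x i by (intro field_differentiable_derivI) auto
  from Ck1_chain_rule[OF V h, where c = "\<lambda>r. f (x(i := r))", OF this _ R(1,2)] show ?thesis
    using R fV x openin_subset[OF V] by fastforce
qed

text \<open>Induction on the order. By the chain rule a partial derivative of the composite is a sum
  of products of \<open>partial_deriv j h (f x)\<close>, to which the induction hypothesis applies,
  and a partial derivative of a component of \<open>f\<close>.\<close>

lemma Ck_compose:
  assumes V: "openin (Euclidean_space m) V" and U: "openin (Euclidean_space n) U" 
    and fV: "f ` U \<subseteq> V"
  shows "Ck k m V h \<Longrightarrow> (\<And>j. j < m \<Longrightarrow> Ck k n U (\<lambda>x. f x j)) \<Longrightarrow> Ck k n U (\<lambda>x. h (f x))"
proof (induction k arbitrary: h)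
  case 0
  \<comment> \<open>Continuity into the space of sequences concerns all coordinates; those from
    \<open>m\<close> on vanish because \<open>f\<close> maps into R^m.\<close>
  have "f x j = 0" if "x \<in> U" "\<not> j < m" for x j
    using openin_subset[OF V] fV that by (force simp: topspace_Euclidean_space image_subset_iff)
  then have "continuous_on U (\<lambda>x. f x j)" for j
    using 0(2)[of j] by (cases "j < m") (auto cong: continuous_on_cong)
  then have "continuous_on U f"
    by (simp add: continuous_on_coordinatewise_then_product)
  then show ?case using 0(1) fV by (auto intro: continuous_on_compose2[of V h U f])
next
  case (Suc k)
  have f: "Ck k n U (\<lambda>x. f x j)" if "j < m" for j using Suc.prems(2) Ck_Suc_imp that by blast
  have "Ck (Suc 0) m V h" "\<And>j. j < m \<Longrightarrow> Ck (Suc 0) n U (\<lambda>x. f x j)"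
    using Suc.prems by (auto intro: Ck_imp_continuous_on)
  note pd = partial_deriv_compose[OF V this(1) U this(2) fV]
  have "Ck k n U (\<lambda>x. h (f x))"
    using Suc.IH[OF Ck_Suc_imp[OF Suc.prems(1)] f] by simp
  then have "continuous_on U (\<lambda>x. h (f x))" by (rule Ck_imp_continuous_on)
  moreover have "(\<lambda>r. h (f (x(i := r)))) field_differentiable at (x i)" if "x \<in> U" "i < n" for x i
    using pd[OF _ that] field_differentiable_def by blast
  moreover have "Ck k n U (partial_deriv i (\<lambda>x. h (f x)))" if i: "i < n" for i
  proof -
    have "Ck k n U (\<lambda>x. partial_deriv j h (f x))" if "j < m" for j
      using Suc.IH[of "partial_deriv j h"] Suc.prems(1) f that by simp
    moreover have "Ck k n U (partial_deriv i (\<lambda>x. f x j))" if "j < m" for j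
      using Suc.prems(2)[OF that] i by simp
    ultimately have c: "Ck k n U (\<lambda>x. \<Sum>j<m. partial_deriv j h (f x) * partial_deriv i (\<lambda>x. f x j) x)"
      by (intro Ck_sum[OF U] Ck_mult[OF U]) auto
    have eq: "(\<Sum>j<m. partial_deriv j h (f x) * partial_deriv i (\<lambda>x. f x j) x) =
        partial_deriv i (\<lambda>x. h (f x)) x" if "x \<in> U" for x
      using pd[OF _ that i] by (simp add: partial_deriv_def[of i "\<lambda>x. h (f x)"] DERIV_imp_deriv)
    show ?thesis
      by (rule Ck_cong[OF U eq c])
  qed
  ultimately show ?case by simp
qed

section \<open>Charts and smooth maps\<close>

abbreviation EU :: "nat \<Rightarrow> (nat \<Rightarrow> real) set" where "EU n \<equiv> topspace (Euclidean_space n)"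

lemma smooth_euclidI: "(\<And>j k. j < m \<Longrightarrow> Ck k n U (\<lambda>x. f x j)) \<Longrightarrow> smooth_euclid n m U f"
  by (simp add: smooth_euclid_def)

lemma smooth_euclidD: "smooth_euclid n m U f \<Longrightarrow> j < m \<Longrightarrow> Ck k n U (\<lambda>x. f x j)"
  by (simp add: smooth_euclid_def)

lemma smooth_euclid_subset: "smooth_euclid n m U f \<Longrightarrow> V \<subseteq> U \<Longrightarrow> smooth_euclid n m V f"
  by (meson Ck_subset smooth_euclid_def)

lemma smooth_euclid_cong:
  assumes "openin (Euclidean_space n) U" "\<And>x. x \<in> U \<Longrightarrow> f x = g x" "smooth_euclid n m U f"
  shows "smooth_euclid n m U g"
proof (rule smooth_euclidI)
  fix j k assume "j < m"
  then show "Ck k n U (\<lambda>x. g x j)"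
    using assms by (intro Ck_cong[OF assms(1) _ smooth_euclidD[OF assms(3)]]) auto
qed

lemma smooth_euclid_compose:
  assumes "openin (Euclidean_space n) U" "openin (Euclidean_space m) V" "f ` U \<subseteq> V"
    "smooth_euclid n m U f" "smooth_euclid m l V g"
  shows "smooth_euclid n l U (\<lambda>x. g (f x))"
proof (rule smooth_euclidI)
  fix j k assume "j < l"
  then show "Ck k n U (\<lambda>x. g (f x) j)"
    using Ck_compose[OF assms(2,1,3), of k "\<lambda>y. g y j"] assms by (simp add: smooth_euclid_def)
qed

lemma smooth_euclid_locally:
  assumes "\<And>x. x \<in> U \<Longrightarrow> \<exists>W. openin (Euclidean_space n) W \<and> x \<in> W \<and> smooth_euclid n m (W \<inter> U) f"
    and "U \<subseteq> EU n"
  shows "smooth_euclid n m U f"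
proof (rule smooth_euclidI)
  fix j k assume j: "j < m"
  show "Ck k n U (\<lambda>x. f x j)"
  proof (rule Ck_locally[OF _ assms(2)])
    fix x assume "x \<in> U"
    then obtain W where "openin (Euclidean_space n) W" "x \<in> W" "smooth_euclid n m (W \<inter> U) f"
      using assms(1) by blast
    then show "\<exists>W. openin (Euclidean_space n) W \<and> x \<in> W \<and> Ck k n (W \<inter> U) (\<lambda>x. f x j)"
      using smooth_euclidD[OF _ j] by (intro exI[of _ W]) auto
  qed
qed

lemma is_chartD:
  assumes "is_chart T (n, U, \<phi>)"
  shows "openin T U" "openin (Euclidean_space n) (\<phi> ` U)" "inj_on \<phi> U" "\<phi> ` U \<subseteq> EU n" 
    "U \<subseteq> topspace T"
    and "continuous_map (subtopology T U) (Euclidean_space n) \<phi>"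
    and "continuous_map (subtopology (Euclidean_space n) (\<phi> ` U)) T (inv_into U \<phi>)"
proof -
  have h: "homeomorphic_map (subtopology T U) (subtopology (Euclidean_space n) (\<phi> ` U)) \<phi>"
    and o: "openin T U" "openin (Euclidean_space n) (\<phi> ` U)"
    using assms by (simp_all add: is_chart_def)
  show "openin T U" "openin (Euclidean_space n) (\<phi> ` U)" by fact+
  show sub: "\<phi> ` U \<subseteq> EU n" "U \<subseteq> topspace T" using o openin_subset by blast+
  have t: "topspace (subtopology T U) = U" using sub by auto
  show inj: "inj_on \<phi> U" using homeomorphic_imp_injective_map[OF h] t by simp
  show "continuous_map (subtopology T U) (Euclidean_space n) \<phi>"
    using homeomorphic_imp_continuous_map[OF h] continuous_map_in_subtopology by blast
  obtain g where g: "homeomorphic_maps (subtopology T U) (subtopology (Euclidean_space n) (\<phi> ` U)) \<phi> g"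
    using h homeomorphic_map_maps by blast
  then have "continuous_map (subtopology (Euclidean_space n) (\<phi> ` U)) T g"
    by (auto simp: homeomorphic_maps_def continuous_map_in_subtopology)
  moreover have "g y = inv_into U \<phi> y" if "y \<in> \<phi> ` U" for y
    using g that t inj by (auto simp: homeomorphic_maps_def)
  ultimately show "continuous_map (subtopology (Euclidean_space n) (\<phi> ` U)) T (inv_into U \<phi>)"
    by (rule continuous_map_eq) auto
qed

text \<open>Charts are produced together with an explicit inverse \<open>\<psi>\<close>; the third
  conclusion trades the \<open>inv_into\<close> of the definitions for it.\<close>

lemma is_chartI:
  assumes "openin T U" "openin (Euclidean_space n) O1"
    "continuous_map (subtopology T U) (Euclidean_space n) \<phi>"
    "continuous_map (subtopology (Euclidean_space n) O1) T \<psi>"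
    "\<And>p. p \<in> U \<Longrightarrow> \<phi> p \<in> O1 \<and> \<psi> (\<phi> p) = p" "\<And>x. x \<in> O1 \<Longrightarrow> \<psi> x \<in> U \<and> \<phi> (\<psi> x) = x"
  shows "is_chart T (n, U, \<phi>)" "\<phi> ` U = O1" "\<And>x. x \<in> O1 \<Longrightarrow> inv_into U \<phi> x = \<psi> x"
proof -
  show im: "\<phi> ` U = O1" using assms(5,6) by force
  have inj: "inj_on \<phi> U" using assms(5) by (metis inj_onI)
  show "\<And>x. x \<in> O1 \<Longrightarrow> inv_into U \<phi> x = \<psi> x"
    using assms(6) inj by (metis inv_into_f_eq)
  have sub: "U \<subseteq> topspace T" "O1 \<subseteq> EU n" using assms(1,2) openin_subset by blast+
  have "homeomorphic_maps (subtopology T U) (subtopology (Euclidean_space n) O1) \<phi> \<psi>"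
    unfolding homeomorphic_maps_def
    using assms(3-6) sub im by (auto simp: continuous_map_in_subtopology)
  then show "is_chart T (n, U, \<phi>)"
    unfolding is_chart_def using assms(1,2) im homeomorphic_map_maps by auto
qed

lemma chart_image_open:
  assumes "is_chart T (n, U, \<phi>)" "openin T W" "W \<subseteq> U"
  shows "openin (Euclidean_space n) (\<phi> ` W)"
proof -
  have "openin (subtopology (Euclidean_space n) (\<phi> ` U))
     {x \<in> topspace (subtopology (Euclidean_space n) (\<phi> ` U)). inv_into U \<phi> x \<in> W}"
    using is_chartD(7)[OF assms(1)] assms(2) openin_continuous_map_preimage by blast
  moreover have "{x \<in> topspace (subtopology (Euclidean_space n) (\<phi> ` U)). inv_into U \<phi> x \<in> W} = \<phi> ` W"
    using is_chartD[OF assms(1)] assms(3) by (force simp: inv_into_f_f)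
  ultimately show ?thesis
    using is_chartD(2)[OF assms(1)] openin_open_subtopology by metis
qed

lemma chart_restrict:
  assumes "is_chart T (n, U, \<phi>)" "openin T W" "W \<subseteq> U"
  shows "is_chart T (n, W, \<phi>)"
proof (rule is_chartI[where \<psi> = "inv_into U \<phi>" and ?O1.0 = "\<phi> ` W"])
  note D = is_chartD[OF assms(1)]
  show "openin T W" by fact
  show "openin (Euclidean_space n) (\<phi> ` W)" by (rule chart_image_open[OF assms])
  show "continuous_map (subtopology T W) (Euclidean_space n) \<phi>"
    using D(6) assms(3) continuous_map_from_subtopology_mono by blast
  show "continuous_map (subtopology (Euclidean_space n) (\<phi> ` W)) T (inv_into U \<phi>)"
    using D(7) assms(3) continuous_map_from_subtopology_mono by (metis image_mono)
qed (use is_chartD(3)[OF assms(1)] assms(3) in \<open>auto simp: inv_into_f_f subset_iff\<close>)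

lemma inv_into_restrict:
  assumes "inj_on \<phi> U" "W \<subseteq> U" "x \<in> \<phi> ` W"
  shows "inv_into W \<phi> x = inv_into U \<phi> x"
  using assms by (metis f_inv_into_f inj_on_subset inv_into_f_f inv_into_into subsetD)

lemma smooth_euclid_chart_comp:
  assumes c: "is_chart T (n, U, \<phi>)" "is_chart T' (m, V, \<psi>)"
    and O1: "openin T O1" "O1 \<subseteq> U" and O2: "openin T' O2" "O2 \<subseteq> V" and f: "f ` O1 \<subseteq> O2"
    and "smooth_euclid n m (\<phi> ` O1) (\<psi> \<circ> f \<circ> inv_into U \<phi>)"
      "smooth_euclid m l (\<psi> ` O2) (\<theta> \<circ> g \<circ> inv_into V \<psi>)"
  shows "smooth_euclid n l (\<phi> ` O1) (\<theta> \<circ> (\<lambda>x. g (f x)) \<circ> inv_into U \<phi>)"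
proof -
  have o1: "openin (Euclidean_space n) (\<phi> ` O1)" by (rule chart_image_open[OF c(1) O1])
  have o2: "openin (Euclidean_space m) (\<psi> ` O2)" by (rule chart_image_open[OF c(2) O2])
  have im: "(\<psi> \<circ> f \<circ> inv_into U \<phi>) ` \<phi> ` O1 \<subseteq> \<psi> ` O2"
    using f O1(2) is_chartD(3)[OF c(1)] by (auto simp: inv_into_f_f subset_iff)
  show ?thesis
  proof (rule smooth_euclid_cong[OF o1 _ smooth_euclid_compose[OF o1 o2 im assms(8,9)]])
    fix x assume "x \<in> \<phi> ` O1"
    then show "(\<theta> \<circ> g \<circ> inv_into V \<psi>) ((\<psi> \<circ> f \<circ> inv_into U \<phi>) x) = (\<theta> \<circ> (\<lambda>x. g (f x)) \<circ> inv_into U \<phi>) x"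
      using f O1(2) O2(2) is_chartD(3)[OF c(1)] is_chartD(3)[OF c(2)]
      by (auto simp: inv_into_f_f subset_iff image_subset_iff)
  qed
qed

lemma smooth_euclid_chart_locally:
  assumes c: "is_chart T (n, U, \<phi>)" and W: "openin T W" "W \<subseteq> U"
    and "\<And>p. p \<in> W \<Longrightarrow> \<exists>N. openin T N \<and> p \<in> N \<and> N \<subseteq> W \<and> smooth_euclid n m (\<phi> ` N) f"
  shows "smooth_euclid n m (\<phi> ` W) f"
proof (rule smooth_euclid_locally)
  show "\<phi> ` W \<subseteq> EU n" using is_chartD(4)[OF c] W by auto
  fix x assume "x \<in> \<phi> ` W"
  then obtain p N where p: "p \<in> W" "x = \<phi> p" "openin T N" "p \<in> N" "N \<subseteq> W" "smooth_euclid n m (\<phi> ` N) f"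
    using assms(4) by blast
  have "openin (Euclidean_space n) (\<phi> ` N)"
    using p W by (intro chart_image_open[OF c]) auto
  moreover have "\<phi> ` N \<inter> \<phi> ` W = \<phi> ` N" using p by auto
  ultimately show "\<exists>Wa. openin (Euclidean_space n) Wa \<and> x \<in> Wa \<and> smooth_euclid n m (Wa \<inter> \<phi> ` W) f"
    using p by (metis imageI)
qed

text \<open>A manifold without the separation axioms and without the requirement that the charts cover.
  Every \<^const>\<open>submfd\<close> is of this kind, whether or not the subset is an embedded submanifold.\<close>

definition premanifold :: "'a mfd \<Rightarrow> bool" where
  "premanifold X \<longleftrightarrow> (\<forall>c\<in>atlas X. is_chart (mtop X) c) \<and> (\<forall>c\<in>atlas X. \<forall>d\<in>atlas X. compatible c d)"

text \<open>Smooth maps into a premanifold compose only if they do not leave the region covered by charts.\<close>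

definition psmooth :: "'a mfd \<Rightarrow> 'b mfd \<Rightarrow> ('a \<Rightarrow> 'b) \<Rightarrow> bool" where
  "psmooth X Y f \<longleftrightarrow> premanifold X \<and> premanifold Y \<and> smooth_map X Y f \<and> f ` covered X \<subseteq> covered Y"

lemma coveredE:
  assumes "p \<in> covered X"
  obtains n U \<phi> where "(n, U, \<phi>) \<in> atlas X" "p \<in> U"
  using assms by (auto simp: covered_def)

lemma coveredI: "(n, U, \<phi>) \<in> atlas X \<Longrightarrow> p \<in> U \<Longrightarrow> p \<in> covered X"
  by (force simp: covered_def)

lemma premanifold_chart: "premanifold X \<Longrightarrow> c \<in> atlas X \<Longrightarrow> is_chart (mtop X) c"
  by (simp add: premanifold_def)

lemma covered_subset_pts: "premanifold X \<Longrightarrow> covered X \<subseteq> pts X"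
  by (meson coveredE is_chartD(5) premanifold_chart subset_iff)

lemma atlas_maximal: "premanifold X \<Longrightarrow> c \<in> atlas X \<Longrightarrow> c \<in> maximal_atlas X"
  by (cases c) (force simp: maximal_atlas_def premanifold_def covered_def)

lemma maximal_atlasD:
  assumes "(n, U, \<phi>) \<in> maximal_atlas X"
  shows "is_chart (mtop X) (n, U, \<phi>)" "U \<subseteq> covered X" "\<And>d. d \<in> atlas X \<Longrightarrow> compatible (n, U, \<phi>) d"
  using assms by (auto simp: maximal_atlas_def)

lemma compatibleD:
  assumes "compatible (n, U, \<phi>) (m, V, \<psi>)"
  shows "smooth_euclid n m (\<phi> ` (U \<inter> V)) (\<psi> \<circ> (\<lambda>x. x) \<circ> inv_into U \<phi>)"
    "smooth_euclid m n (\<psi> ` (U \<inter> V)) (\<phi> \<circ> (\<lambda>x. x) \<circ> inv_into V \<psi>)"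
  using assms by (auto simp: compatible_def comp_def)

lemma continuous_preimage_open:
  assumes "continuous_map T T' f" "openin T U" "openin T' V"
  shows "openin T (U \<inter> f -` V)"
proof -
  have "U \<inter> f -` V = U \<inter> {x \<in> topspace T. f x \<in> V}" using openin_subset[OF assms(2)] by auto
  then show ?thesis using openin_continuous_map_preimage[OF assms(1,3)] assms(2) by auto
qed

text \<open>Near each point insert an atlas chart on either side: the local expression becomes a
  transition map, the given expression of \<open>f\<close>, and another transition map. Charts
  constructed by hand thereby become usable at both ends.\<close>

lemma psmooth_maximal:
  assumes f: "psmooth X Y f" and c: "(n, U, \<phi>) \<in> maximal_atlas X" and d: "(m, V, \<psi>) \<in> maximal_atlas Y"
  shows "smooth_euclid n m (\<phi> ` (U \<inter> f -` V)) (\<psi> \<circ> f \<circ> inv_into U \<phi>)"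
proof (rule smooth_euclid_chart_locally)
  note C = maximal_atlasD[OF c] note D = maximal_atlasD[OF d]
  show "is_chart (mtop X) (n, U, \<phi>)" by fact
  have cont: "continuous_map (mtop X) (mtop Y) f" using f by (simp add: psmooth_def smooth_map_def)
  show op: "openin (mtop X) (U \<inter> f -` V)"
    using is_chartD(1)[OF C(1)] is_chartD(1)[OF D(1)] cont by (rule_tac continuous_preimage_open)
  show "U \<inter> f -` V \<subseteq> U" by simp
  fix p assume p: "p \<in> U \<inter> f -` V"
  then obtain n' U' \<phi>' where c': "(n', U', \<phi>') \<in> atlas X" "p \<in> U'" using C(2) by (blast elim: coveredE)
  obtain m' V' \<psi>' where d': "(m', V', \<psi>') \<in> atlas Y" "f p \<in> V'" using D(2) p by (blast elim: coveredE)
  have ch: "is_chart (mtop X) (n', U', \<phi>')" "is_chart (mtop Y) (m', V', \<psi>')"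
    using f c' d' premanifold_chart psmooth_def by blast+
  define N where "N = (U \<inter> f -` V) \<inter> (U' \<inter> f -` V')"
  have oN: "openin (mtop X) N"
    unfolding N_def using op is_chartD(1)[OF ch(1)] is_chartD(1)[OF ch(2)] cont
    by (intro openin_Int[OF op] continuous_preimage_open)
  have oV: "openin (mtop Y) (V \<inter> V')" using is_chartD(1)[OF D(1)] is_chartD(1)[OF ch(2)] by blast
  have f0: "smooth_euclid n' m' (\<phi>' ` (U' \<inter> f -` V')) (\<psi>' \<circ> f \<circ> inv_into U' \<phi>')"
    using f c' d' unfolding psmooth_def smooth_map_def by fastforce
  have f1: "smooth_euclid n' m (\<phi>' ` N) (\<psi> \<circ> (\<lambda>x. f x) \<circ> inv_into U' \<phi>')"
  proof (rule smooth_euclid_chart_comp[OF ch(1,2) oN _ oV, where g = "\<lambda>x. x"])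
    show "smooth_euclid n' m' (\<phi>' ` N) (\<psi>' \<circ> f \<circ> inv_into U' \<phi>')"
      using f0 by (rule smooth_euclid_subset) (auto simp: N_def)
    show "smooth_euclid m' m (\<psi>' ` (V \<inter> V')) (\<psi> \<circ> (\<lambda>x. x) \<circ> inv_into V' \<psi>')"
      using compatibleD(2)[OF D(3)[OF d'(1)]] .
  qed (auto simp: N_def)
  have "smooth_euclid n m (\<phi> ` N) (\<psi> \<circ> (\<lambda>x. f x) \<circ> inv_into U \<phi>)"
  proof (rule smooth_euclid_chart_comp[OF C(1) ch(1) oN _ oN, where f = "\<lambda>x. x"])
    show "smooth_euclid n n' (\<phi> ` N) (\<phi>' \<circ> (\<lambda>x. x) \<circ> inv_into U \<phi>)"
      using compatibleD(1)[OF C(3)[OF c'(1)]] by (rule smooth_euclid_subset) (auto simp: N_def)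
  qed (use f1 in \<open>auto simp: N_def\<close>)
  then show "\<exists>N. openin (mtop X) N \<and> p \<in> N \<and> N \<subseteq> U \<inter> f -` V \<and>
      smooth_euclid n m (\<phi> ` N) (\<psi> \<circ> f \<circ> inv_into U \<phi>)"
    using oN p c' d' by (intro exI[of _ N]) (auto simp: N_def)
qed

lemma psmoothI:
  assumes "premanifold X" "premanifold Y" "continuous_map (mtop X) (mtop Y) f" "f ` covered X \<subseteq> covered Y"
    "\<And>n U \<phi> m V \<psi>. (n, U, \<phi>) \<in> atlas X \<Longrightarrow> (m, V, \<psi>) \<in> atlas Y \<Longrightarrow>
       smooth_euclid n m (\<phi> ` (U \<inter> f -` V)) (\<psi> \<circ> f \<circ> inv_into U \<phi>)"
  shows "psmooth X Y f"
  using assms by (auto simp: psmooth_def smooth_map_def)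

lemma psmoothD:
  assumes "psmooth X Y f"
  shows "premanifold X" "premanifold Y" "continuous_map (mtop X) (mtop Y) f" "f ` covered X \<subseteq> covered Y"
    "smooth_map X Y f" "x \<in> pts X \<Longrightarrow> f x \<in> pts Y"
  using assms by (auto simp: psmooth_def smooth_map_def continuous_map_def)

lemma psmooth_id: "premanifold X \<Longrightarrow> psmooth X X (\<lambda>x. x)"
proof (rule psmoothI)
  fix n U \<phi> m V \<psi> assume X: "premanifold X" and c: "(n, U, \<phi>) \<in> atlas X" "(m, V, \<psi>) \<in> atlas X"
  have "compatible (n, U, \<phi>) (m, V, \<psi>)" using X c by (auto simp: premanifold_def)
  from compatibleD(1)[OF this] show "smooth_euclid n m (\<phi> ` (U \<inter> (\<lambda>x. x) -` V)) (\<psi> \<circ> (\<lambda>x. x) \<circ> inv_into U \<phi>)"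
    by simp
qed (auto simp: continuous_map_id[unfolded id_def])

lemma maximal_atlas_compatible:
  assumes "premanifold X" "c \<in> maximal_atlas X" "d \<in> maximal_atlas X"
  shows "compatible c d"
proof -
  obtain n U \<phi> m V \<psi> where cd: "c = (n, U, \<phi>)" "d = (m, V, \<psi>)" by (metis prod_cases3)
  show ?thesis
    using psmooth_maximal[OF psmooth_id[OF assms(1)] assms(2)[unfolded cd] assms(3)[unfolded cd]]
      psmooth_maximal[OF psmooth_id[OF assms(1)] assms(3)[unfolded cd] assms(2)[unfolded cd]]
    by (simp add: cd compatible_def Int_commute comp_def)
qed

text \<open>The local expression of the composite is factored through a chart of \<open>Y\<close> at
  \<open>f p\<close>; there is one because \<open>f\<close> respects the covered regions. This is
  the reason for that clause of \<open>psmooth\<close>.\<close>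

lemma psmooth_comp:
  assumes f: "psmooth X Y f" and g: "psmooth Y Z g"
  shows "psmooth X Z (\<lambda>x. g (f x))"
proof (rule psmoothI)
  show "continuous_map (mtop X) (mtop Z) (\<lambda>x. g (f x))"
    using continuous_map_compose[OF psmoothD(3)[OF f] psmoothD(3)[OF g]] by (simp add: comp_def)
  show "(\<lambda>x. g (f x)) ` covered X \<subseteq> covered Z" using psmoothD(4)[OF f] psmoothD(4)[OF g] by blast
  fix n U \<phi> l W \<theta> assume c: "(n, U, \<phi>) \<in> atlas X" and e: "(l, W, \<theta>) \<in> atlas Z"
  have ch: "is_chart (mtop X) (n, U, \<phi>)" "is_chart (mtop Z) (l, W, \<theta>)"
    using c e premanifold_chart psmoothD[OF f] psmoothD[OF g] by blast+
  note cf = psmoothD(3)[OF f] and cg = psmoothD(3)[OF g]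
  have cgf: "continuous_map (mtop X) (mtop Z) (\<lambda>x. g (f x))" by fact
  note U = is_chartD(1)[OF ch(1)] and W = is_chartD(1)[OF ch(2)]
  show "smooth_euclid n l (\<phi> ` (U \<inter> (\<lambda>x. g (f x)) -` W)) (\<theta> \<circ> (\<lambda>x. g (f x)) \<circ> inv_into U \<phi>)"
  proof (rule smooth_euclid_chart_locally[OF ch(1)])
    show op: "openin (mtop X) (U \<inter> (\<lambda>x. g (f x)) -` W)" by (rule continuous_preimage_open[OF cgf U W])
    fix p assume p: "p \<in> U \<inter> (\<lambda>x. g (f x)) -` W"
    then have "f p \<in> covered Y" using psmoothD(4)[OF f] coveredI[OF c] by blast
    then obtain m V \<psi> where d: "(m, V, \<psi>) \<in> atlas Y" "f p \<in> V" by (rule coveredE)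
    have cd: "is_chart (mtop Y) (m, V, \<psi>)" using d premanifold_chart psmoothD[OF f] by blast
    note V = is_chartD(1)[OF cd]
    define N where "N = (U \<inter> (\<lambda>x. g (f x)) -` W) \<inter> (U \<inter> f -` V)"
    have oN: "openin (mtop X) N" unfolding N_def using U V cf by (intro openin_Int[OF op] continuous_preimage_open)
    have oV: "openin (mtop Y) (V \<inter> g -` W)" by (rule continuous_preimage_open[OF cg V W])
    have "smooth_euclid n l (\<phi> ` N) (\<theta> \<circ> (\<lambda>x. g (f x)) \<circ> inv_into U \<phi>)"
    proof (rule smooth_euclid_chart_comp[OF ch(1) cd oN _ oV])
      have "smooth_euclid n m (\<phi> ` (U \<inter> f -` V)) (\<psi> \<circ> f \<circ> inv_into U \<phi>)"
        using psmoothD(5)[OF f] c d unfolding smooth_map_def by fastforce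
      then show "smooth_euclid n m (\<phi> ` N) (\<psi> \<circ> f \<circ> inv_into U \<phi>)"
        by (rule smooth_euclid_subset) (auto simp: N_def)
      show "smooth_euclid m l (\<psi> ` (V \<inter> g -` W)) (\<theta> \<circ> g \<circ> inv_into V \<psi>)"
        using psmoothD(5)[OF g] d e unfolding smooth_map_def by fastforce
    qed (auto simp: N_def)
    then show "\<exists>N. openin (mtop X) N \<and> p \<in> N \<and> N \<subseteq> U \<inter> (\<lambda>x. g (f x)) -` W \<and>
       smooth_euclid n l (\<phi> ` N) (\<theta> \<circ> (\<lambda>x. g (f x)) \<circ> inv_into U \<phi>)"
      using oN p d by (intro exI[of _ N]) (auto simp: N_def)
  qed simp
qed (use psmoothD[OF f] psmoothD[OF g] in auto)

lemma psmooth_cong: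
  assumes f: "psmooth X Y f" and eq: "\<And>x. x \<in> pts X \<Longrightarrow> f x = g x"
  shows "psmooth X Y g"
proof (rule psmoothI)
  show "continuous_map (mtop X) (mtop Y) g" using psmoothD(3)[OF f] eq by (rule continuous_map_eq)
  show "g ` covered X \<subseteq> covered Y"
    using psmoothD(4)[OF f] eq covered_subset_pts[OF psmoothD(1)[OF f]] by (force simp: image_subset_iff subset_iff)
  fix n U \<phi> m V \<psi> assume c: "(n, U, \<phi>) \<in> atlas X" and d: "(m, V, \<psi>) \<in> atlas Y"
  have ch: "is_chart (mtop X) (n, U, \<phi>)" "is_chart (mtop Y) (m, V, \<psi>)"
    using c d premanifold_chart psmoothD[OF f] by blast+
  note C = is_chartD[OF ch(1)]
  have e: "U \<inter> f -` V = U \<inter> g -` V" using eq C(5) by auto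
  have "openin (mtop X) (U \<inter> f -` V)"
    using continuous_preimage_open[OF psmoothD(3)[OF f] C(1) is_chartD(1)[OF ch(2)]] .
  then have o: "openin (Euclidean_space n) (\<phi> ` (U \<inter> f -` V))"
    by (rule chart_image_open[OF ch(1)]) auto
  have "smooth_euclid n m (\<phi> ` (U \<inter> f -` V)) (\<psi> \<circ> f \<circ> inv_into U \<phi>)"
    using psmoothD(5)[OF f] c d unfolding smooth_map_def by fastforce
  then have "smooth_euclid n m (\<phi> ` (U \<inter> f -` V)) (\<psi> \<circ> g \<circ> inv_into U \<phi>)"
    using C(3,5) eq by (elim smooth_euclid_cong[OF o, rotated]) (auto simp: inv_into_f_f subset_iff)
  then show "smooth_euclid n m (\<phi> ` (U \<inter> g -` V)) (\<psi> \<circ> g \<circ> inv_into U \<phi>)" by (simp add: e)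
qed (use psmoothD[OF f] in auto)

lemma manifoldD: "manifold X \<Longrightarrow> premanifold X" "manifold X \<Longrightarrow> covered X = pts X"
  by (auto simp: manifold_def premanifold_def)

text \<open>When the charts of the target cover it, the clause on covered regions is automatic. This
  is the bridge to the \<open>smooth_map\<close> that occurs in the definitions of bundles,
  groupoids and their maps.\<close>

lemma psmooth_full_iff:
  assumes "premanifold X" "premanifold Y" "covered Y = pts Y"
  shows "psmooth X Y f \<longleftrightarrow> smooth_map X Y f"
  using assms covered_subset_pts[OF assms(1)]
  by (auto simp: psmooth_def smooth_map_def continuous_map_def)

section \<open>Products, submanifolds and Euclidean targets\<close>

definition join :: "nat \<Rightarrow> (nat \<Rightarrow> real) \<Rightarrow> (nat \<Rightarrow> real) \<Rightarrow> (nat \<Rightarrow> real)" where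
  "join n x y = (\<lambda>i. if i < n then x i else y (i - n))"

definition vtake :: "nat \<Rightarrow> (nat \<Rightarrow> real) \<Rightarrow> (nat \<Rightarrow> real)" where
  "vtake n z = (\<lambda>i. if i < n then z i else 0)"

definition vdrop :: "nat \<Rightarrow> (nat \<Rightarrow> real) \<Rightarrow> (nat \<Rightarrow> real)" where
  "vdrop n z = (\<lambda>i. z (n + i))"

lemma EU_iff: "x \<in> EU n \<longleftrightarrow> (\<forall>i\<ge>n. x i = 0)"
  by (simp add: topspace_Euclidean_space)

lemma join_EU [simp]: "y \<in> EU m \<Longrightarrow> join n x y \<in> EU (n + m)"
  by (auto simp: join_def EU_iff)

lemma vtake_EU [simp]: "vtake n z \<in> EU n"
  by (auto simp: vtake_def EU_iff)

lemma vdrop_EU [simp]: "z \<in> EU (n + m) \<Longrightarrow> vdrop n z \<in> EU m"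
  by (auto simp: vdrop_def EU_iff)

lemma vtake_join [simp]: "x \<in> EU n \<Longrightarrow> vtake n (join n x y) = x"
  by (auto simp: vtake_def join_def EU_iff)

lemma vdrop_join [simp]: "vdrop n (join n x y) = y"
  by (auto simp: vdrop_def join_def)

lemma join_vtake_vdrop [simp]: "join n (vtake n z) (vdrop n z) = z"
  by (auto simp: vtake_def vdrop_def join_def)

lemma continuous_map_EU_iff:
  "continuous_map T (Euclidean_space n) f \<longleftrightarrow>
     (\<forall>j. continuous_map T euclideanreal (\<lambda>x. f x j)) \<and> (\<forall>x\<in>topspace T. f x \<in> EU n)"
  unfolding Euclidean_space_def continuous_map_in_subtopology continuous_map_componentwise_UNIV
  by auto

lemma continuous_map_EU_coordinate: "continuous_map (Euclidean_space n) euclideanreal (\<lambda>x. x j)"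
proof -
  have "continuous_map (Euclidean_space n) (Euclidean_space n) (\<lambda>x. x)" by (simp add: continuous_map_id[unfolded id_def])
  then show ?thesis using continuous_map_EU_iff by metis
qed

lemma continuous_map_vtake: "continuous_map (Euclidean_space n) (Euclidean_space m) (vtake m)"
  unfolding continuous_map_EU_iff
proof (intro conjI allI ballI vtake_EU)
  fix j show "continuous_map (Euclidean_space n) euclideanreal (\<lambda>x. vtake m x j)"
    by (cases "j < m") (auto simp: vtake_def continuous_map_EU_coordinate)
qed

lemma continuous_map_vdrop: "continuous_map (Euclidean_space (n + m)) (Euclidean_space m) (vdrop n)"
  unfolding continuous_map_EU_iff by (auto simp: vdrop_def continuous_map_EU_coordinate EU_iff)

lemma continuous_map_join:
  assumes "continuous_map T (Euclidean_space n) f" "continuous_map T (Euclidean_space m) g"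
  shows "continuous_map T (Euclidean_space (n + m)) (\<lambda>x. join n (f x) (g x))"
  unfolding continuous_map_EU_iff
proof (intro conjI allI ballI)
  fix j show "continuous_map T euclideanreal (\<lambda>x. join n (f x) (g x) j)"
    using assms by (cases "j < n") (auto simp: join_def continuous_map_EU_iff)
qed (use assms in \<open>auto simp: continuous_map_EU_iff\<close>)

lemma smooth_euclid_join:
  "smooth_euclid k n U f \<Longrightarrow> smooth_euclid k m U g \<Longrightarrow> smooth_euclid k (n + m) U (\<lambda>x. join n (f x) (g x))"
proof (rule smooth_euclidI)
  fix j l assume h: "smooth_euclid k n U f" "smooth_euclid k m U g" "j < n + m"
  show "Ck l k U (\<lambda>x. join n (f x) (g x) j)"
    by (cases "j < n") (use h smooth_euclidD[of k m U g "j - n" l] in \<open>auto simp: join_def smooth_euclid_def\<close>)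
qed

lemma smooth_euclid_vtake: "smooth_euclid n m U (vtake m)"
  by (rule smooth_euclidI) (simp add: vtake_def)

lemma smooth_euclid_vdrop: "smooth_euclid n m U (vdrop k)"
  by (rule smooth_euclidI) (simp add: vdrop_def)

lemma smooth_euclid_ident: "smooth_euclid n m U (\<lambda>x. x)"
  by (rule smooth_euclidI) simp

section \<open>Product manifolds\<close>

lemma prod_chart_eq:
  "prod_chart (n, U, \<phi>) (m, V, \<psi>) = (n + m, U \<times> V, \<lambda>(x, y). join n (\<phi> x) (\<psi> y))"
  by (auto simp: prod_chart_def join_def fun_eq_iff)

lemma
  assumes c: "is_chart T (n, U, \<phi>)" and d: "is_chart T' (m, V, \<psi>)"
  shows is_chart_prod: "is_chart (prod_topology T T') (n + m, U \<times> V, \<lambda>(x, y). join n (\<phi> x) (\<psi> y))"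
    and prod_chart_image: "(\<lambda>(x, y). join n (\<phi> x) (\<psi> y)) ` (U \<times> V) =
       {z \<in> EU (n + m). vtake n z \<in> \<phi> ` U \<and> vdrop n z \<in> \<psi> ` V}"
    and prod_chart_inv: "\<And>z. z \<in> (\<lambda>(x, y). join n (\<phi> x) (\<psi> y)) ` (U \<times> V) \<Longrightarrow>
       inv_into (U \<times> V) (\<lambda>(x, y). join n (\<phi> x) (\<psi> y)) z = (inv_into U \<phi> (vtake n z), inv_into V \<psi> (vdrop n z))"
proof -
  note C = is_chartD[OF c] and D = is_chartD[OF d]
  define O1 where "O1 = {z \<in> EU (n + m). vtake n z \<in> \<phi> ` U \<and> vdrop n z \<in> \<psi> ` V}"
  have "O1 = {z \<in> EU (n + m). vtake n z \<in> \<phi> ` U} \<inter> {z \<in> EU (n + m). vdrop n z \<in> \<psi> ` V}"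
    by (auto simp: O1_def)
  moreover have "openin (Euclidean_space (n + m)) \<dots>"
    using openin_continuous_map_preimage[OF continuous_map_vtake C(2)]
      openin_continuous_map_preimage[OF continuous_map_vdrop D(2)] by blast
  ultimately have o: "openin (Euclidean_space (n + m)) O1" by simp
  have sub: "subtopology (prod_topology T T') (U \<times> V) = prod_topology (subtopology T U) (subtopology T' V)"
    by (simp add: subtopology_Times)
  have 1: "continuous_map (subtopology (prod_topology T T') (U \<times> V)) (Euclidean_space (n + m))
     (\<lambda>(x, y). join n (\<phi> x) (\<psi> y))"
    unfolding sub case_prod_unfold
    by (intro continuous_map_join continuous_map_compose[OF continuous_map_fst C(6), unfolded comp_def]
       continuous_map_compose[OF continuous_map_snd D(6), unfolded comp_def])
  have "continuous_map (subtopology (Euclidean_space (n + m)) O1) (subtopology (Euclidean_space n) (\<phi> ` U)) (vtake n)"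
    using continuous_map_from_subtopology[OF continuous_map_vtake] by (auto simp: continuous_map_in_subtopology O1_def)
  then have 2: "continuous_map (subtopology (Euclidean_space (n + m)) O1) T (\<lambda>z. inv_into U \<phi> (vtake n z))"
    using continuous_map_compose[OF _ C(7)] by (fastforce simp: comp_def)
  have "continuous_map (subtopology (Euclidean_space (n + m)) O1) (subtopology (Euclidean_space m) (\<psi> ` V)) (vdrop n)"
    using continuous_map_from_subtopology[OF continuous_map_vdrop] by (auto simp: continuous_map_in_subtopology O1_def)
  then have 3: "continuous_map (subtopology (Euclidean_space (n + m)) O1) T' (\<lambda>z. inv_into V \<psi> (vdrop n z))"
    using continuous_map_compose[OF _ D(7)] by (fastforce simp: comp_def)
  have 4: "continuous_map (subtopology (Euclidean_space (n + m)) O1) (prod_topology T T')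
     (\<lambda>z. (inv_into U \<phi> (vtake n z), inv_into V \<psi> (vdrop n z)))"
    using 2 3 by (simp add: continuous_map_pairedI)
  have 5: "(case p of (x, y) \<Rightarrow> join n (\<phi> x) (\<psi> y)) \<in> O1 \<and>
     (inv_into U \<phi> (vtake n (case p of (x, y) \<Rightarrow> join n (\<phi> x) (\<psi> y))), inv_into V \<psi> (vdrop n (case p of (x, y) \<Rightarrow> join n (\<phi> x) (\<psi> y)))) = p"
    if p: "p \<in> U \<times> V" for p
  proof -
    obtain x y where xy: "p = (x, y)" "x \<in> U" "y \<in> V" using p by blast
    then have "\<phi> x \<in> EU n" "\<psi> y \<in> EU m" using C(4) D(4) by auto
    then show ?thesis using xy C(3) D(3) by (simp add: O1_def inv_into_f_f)
  qed
  have 6: "(inv_into U \<phi> (vtake n z), inv_into V \<psi> (vdrop n z)) \<in> U \<times> V \<and>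
    (case (inv_into U \<phi> (vtake n z), inv_into V \<psi> (vdrop n z)) of (x, y) \<Rightarrow> join n (\<phi> x) (\<psi> y)) = z" if "z \<in> O1" for z
    using that by (auto simp: O1_def f_inv_into_f inv_into_into)
  have UV: "openin (prod_topology T T') (U \<times> V)" using C(1) D(1) by (simp add: openin_prod_Times_iff)
  note I = is_chartI[OF UV o 1 4 5 6]
  show "is_chart (prod_topology T T') (n + m, U \<times> V, \<lambda>(x, y). join n (\<phi> x) (\<psi> y))"
    by (rule I(1)) assumption+
  show im: "(\<lambda>(x, y). join n (\<phi> x) (\<psi> y)) ` (U \<times> V) = {z \<in> EU (n + m). vtake n z \<in> \<phi> ` U \<and> vdrop n z \<in> \<psi> ` V}"
    using I(2) unfolding O1_def by simp
  show "\<And>z. z \<in> (\<lambda>(x, y). join n (\<phi> x) (\<psi> y)) ` (U \<times> V) \<Longrightarrow>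
       inv_into (U \<times> V) (\<lambda>(x, y). join n (\<phi> x) (\<psi> y)) z = (inv_into U \<phi> (vtake n z), inv_into V \<psi> (vdrop n z))"
    using I(2,3) by simp
qed

lemma prod_mfd_atlasE:
  assumes "(k, W, \<theta>) \<in> atlas (prod_mfd X Y)"
  obtains n U \<phi> m V \<psi> where "(n, U, \<phi>) \<in> atlas X" "(m, V, \<psi>) \<in> atlas Y" "k = n + m" "W = U \<times> V"
    "\<theta> = (\<lambda>(x, y). join n (\<phi> x) (\<psi> y))"
  using assms by (auto simp: prod_mfd_def prod_chart_eq)

lemma prod_mfd_atlasI:
  "(n, U, \<phi>) \<in> atlas X \<Longrightarrow> (m, V, \<psi>) \<in> atlas Y \<Longrightarrow>
   (n + m, U \<times> V, \<lambda>(x, y). join n (\<phi> x) (\<psi> y)) \<in> atlas (prod_mfd X Y)"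
  by (force simp: prod_mfd_def prod_chart_eq[symmetric])

lemma mtop_prod_mfd [simp]: "mtop (prod_mfd X Y) = prod_topology (mtop X) (mtop Y)"
  by (simp add: prod_mfd_def)

lemma covered_prod_mfd: "covered (prod_mfd X Y) = covered X \<times> covered Y"
proof
  show "covered (prod_mfd X Y) \<subseteq> covered X \<times> covered Y"
    by (auto elim!: coveredE prod_mfd_atlasE intro: coveredI)
  show "covered X \<times> covered Y \<subseteq> covered (prod_mfd X Y)"
    by (auto elim!: coveredE intro: coveredI[OF prod_mfd_atlasI])
qed

lemma chart_prod_open:
  assumes "is_chart T (n, U, \<phi>)" "is_chart T' (m, V, \<psi>)" "openin T A" "A \<subseteq> U" "openin T' B" "B \<subseteq> V"
  shows "openin (Euclidean_space (n + m)) ((\<lambda>(x, y). join n (\<phi> x) (\<psi> y)) ` (A \<times> B))"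
  by (rule chart_image_open[OF is_chart_prod[OF assms(1,2)]]) (use assms in \<open>auto simp: openin_prod_Times_iff\<close>)

lemma prod_mfd_compatible:
  assumes c: "is_chart T (n, U, \<phi>)" "is_chart T' (n', U', \<phi>')" and d: "is_chart T (m, V, \<psi>)" "is_chart T' (m', V', \<psi>')"
    and "smooth_euclid n m (\<phi> ` (U \<inter> V)) (\<psi> \<circ> inv_into U \<phi>)"
    "smooth_euclid n' m' (\<phi>' ` (U' \<inter> V')) (\<psi>' \<circ> inv_into U' \<phi>')"
  shows "smooth_euclid (n + n') (m + m') ((\<lambda>(x, y). join n (\<phi> x) (\<phi>' y)) ` (U \<times> U' \<inter> V \<times> V'))
    ((\<lambda>(x, y). join m (\<psi> x) (\<psi>' y)) \<circ> inv_into (U \<times> U') (\<lambda>(x, y). join n (\<phi> x) (\<phi>' y)))"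
proof -
  let ?S = "(\<lambda>(x, y). join n (\<phi> x) (\<phi>' y)) ` (U \<times> U' \<inter> V \<times> V')"
  note C = is_chartD[OF c(1)] and C' = is_chartD[OF c(2)]
  note D = is_chartD[OF d(1)] and D' = is_chartD[OF d(2)]
  have o: "openin (Euclidean_space n) (\<phi> ` (U \<inter> V))" "openin (Euclidean_space n') (\<phi>' ` (U' \<inter> V'))"
    using chart_image_open[OF c(1)] chart_image_open[OF c(2)] C(1) D(1) C'(1) D'(1) by auto
  have oS: "openin (Euclidean_space (n + n')) ?S"
    using chart_prod_open[OF c, of "U \<inter> V" "U' \<inter> V'"] C(1) D(1) C'(1) D'(1) by (simp add: Times_Int_Times openin_Int)
  have S: "z \<in> ?S \<Longrightarrow> vtake n z \<in> \<phi> ` (U \<inter> V) \<and> vdrop n z \<in> \<phi>' ` (U' \<inter> V')" for z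
    using C(4) C'(4) by (auto simp: image_subset_iff)
  have 1: "smooth_euclid (n + n') m ?S (\<lambda>z. (\<psi> \<circ> inv_into U \<phi>) (vtake n z))"
    by (rule smooth_euclid_compose[OF oS o(1) _ smooth_euclid_vtake assms(5)]) (use S in blast)
  have 2: "smooth_euclid (n + n') m' ?S (\<lambda>z. (\<psi>' \<circ> inv_into U' \<phi>') (vdrop n z))"
    by (rule smooth_euclid_compose[OF oS o(2) _ smooth_euclid_vdrop assms(6)]) (use S in blast)
  show ?thesis
  proof (rule smooth_euclid_cong[OF oS _ smooth_euclid_join[OF 1 2]])
    fix z assume "z \<in> ?S"
    then have "z \<in> (\<lambda>(x, y). join n (\<phi> x) (\<phi>' y)) ` (U \<times> U')" by auto
    from prod_chart_inv[OF c this] show "join m ((\<psi> \<circ> inv_into U \<phi>) (vtake n z)) ((\<psi>' \<circ> inv_into U' \<phi>') (vdrop n z)) =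
        ((\<lambda>(x, y). join m (\<psi> x) (\<psi>' y)) \<circ> inv_into (U \<times> U') (\<lambda>(x, y). join n (\<phi> x) (\<phi>' y))) z"
      by simp
  qed
qed

lemma premanifold_prod:
  assumes X: "premanifold X" and Y: "premanifold Y"
  shows "premanifold (prod_mfd X Y)"
  unfolding premanifold_def
proof (intro conjI ballI)
  fix c assume c: "c \<in> atlas (prod_mfd X Y)"
  then obtain k W \<theta> where cc: "c = (k, W, \<theta>)" by (cases c)
  from c[unfolded cc] obtain n U \<phi> m V \<psi> where 1: "(n, U, \<phi>) \<in> atlas X" "(m, V, \<psi>) \<in> atlas Y" "k = n + m" "W = U \<times> V"
    "\<theta> = (\<lambda>(x, y). join n (\<phi> x) (\<psi> y))" by (rule prod_mfd_atlasE)
  show "is_chart (mtop (prod_mfd X Y)) c"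
    unfolding cc 1(3-5) mtop_prod_mfd
    by (rule is_chart_prod[OF premanifold_chart[OF X 1(1)] premanifold_chart[OF Y 1(2)]])
  fix d assume d: "d \<in> atlas (prod_mfd X Y)"
  obtain k' W' \<theta>' where dd: "d = (k', W', \<theta>')" by (cases d)
  from d[unfolded dd] obtain n' U' \<phi>' m' V' \<psi>' where 2: "(n', U', \<phi>') \<in> atlas X" "(m', V', \<psi>') \<in> atlas Y" "k' = n' + m'" "W' = U' \<times> V'"
    "\<theta>' = (\<lambda>(x, y). join n' (\<phi>' x) (\<psi>' y))" by (rule prod_mfd_atlasE)
  note ch = premanifold_chart[OF X 1(1)] premanifold_chart[OF Y 1(2)] premanifold_chart[OF X 2(1)] premanifold_chart[OF Y 2(2)]
  have "compatible (n, U, \<phi>) (n', U', \<phi>')" "compatible (m, V, \<psi>) (m', V', \<psi>')"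
    using X Y 1 2 by (auto simp: premanifold_def)
  then have s: "smooth_euclid n n' (\<phi> ` (U \<inter> U')) (\<phi>' \<circ> inv_into U \<phi>)" "smooth_euclid m m' (\<psi> ` (V \<inter> V')) (\<psi>' \<circ> inv_into V \<psi>)"
     "smooth_euclid n' n (\<phi>' ` (U' \<inter> U)) (\<phi> \<circ> inv_into U' \<phi>')" "smooth_euclid m' m (\<psi>' ` (V' \<inter> V)) (\<psi> \<circ> inv_into V' \<psi>')"
    by (simp_all add: compatible_def Int_commute)
  show "compatible c d"
    unfolding cc dd 1(3-5) 2(3-5) compatible_def prod.case
    using prod_mfd_compatible[OF ch s(1,2)] prod_mfd_compatible[OF ch(3,4,1,2) s(3,4)] 
    by (simp only: Int_commute)
qed

lemma psmooth_fst:
  assumes X: "premanifold X" and Y: "premanifold Y"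
  shows "psmooth (prod_mfd X Y) X fst"
proof (rule psmoothI)
  show "fst ` covered (prod_mfd X Y) \<subseteq> covered X" by (auto simp: covered_prod_mfd)
  fix k W \<theta> l S \<xi> assume c: "(k, W, \<theta>) \<in> atlas (prod_mfd X Y)" and d: "(l, S, \<xi>) \<in> atlas X"
  from c obtain n U \<phi> m V \<psi> where 1: "(n, U, \<phi>) \<in> atlas X" "(m, V, \<psi>) \<in> atlas Y" "k = n + m" "W = U \<times> V"
    "\<theta> = (\<lambda>(x, y). join n (\<phi> x) (\<psi> y))" by (rule prod_mfd_atlasE)
  note ch = premanifold_chart[OF X 1(1)] premanifold_chart[OF Y 1(2)] premanifold_chart[OF X d]
  have "compatible (n, U, \<phi>) (l, S, \<xi>)" using X 1 d by (auto simp: premanifold_def)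
  then have s: "smooth_euclid n l (\<phi> ` (U \<inter> S)) (\<xi> \<circ> inv_into U \<phi>)" by (simp add: compatible_def)
  let ?A = "\<theta> ` (W \<inter> fst -` S)"
  have e: "W \<inter> fst -` S = (U \<inter> S) \<times> V" using 1 by auto
  have oS: "openin (mtop X) (U \<inter> S)" using is_chartD(1) ch by blast
  have o: "openin (Euclidean_space k) ?A"
    unfolding e 1(3,5) using oS is_chartD(1)[OF ch(2)] by (intro chart_prod_open[OF ch(1,2)]) auto
  have "smooth_euclid k l ?A (\<lambda>z. (\<xi> \<circ> inv_into U \<phi>) (vtake n z))"
    by (rule smooth_euclid_compose[OF o chart_image_open[OF ch(1) oS] _ smooth_euclid_vtake s])
       (use is_chartD(4)[OF ch(1)] in \<open>auto simp: e 1 image_subset_iff\<close>)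
  then show "smooth_euclid k l ?A (\<xi> \<circ> fst \<circ> inv_into W \<theta>)"
  proof (rule smooth_euclid_cong[OF o, rotated])
    fix z assume "z \<in> ?A"
    then have "z \<in> (\<lambda>(x, y). join n (\<phi> x) (\<psi> y)) ` (U \<times> V)" using e 1 by auto
    from prod_chart_inv[OF ch(1,2) this] show "(\<xi> \<circ> inv_into U \<phi>) (vtake n z) = (\<xi> \<circ> fst \<circ> inv_into W \<theta>) z"
      by (simp add: 1)
  qed
qed (use assms premanifold_prod continuous_map_fst in auto)

lemma psmooth_snd:
  assumes X: "premanifold X" and Y: "premanifold Y"
  shows "psmooth (prod_mfd X Y) Y snd"
proof (rule psmoothI)
  show "snd ` covered (prod_mfd X Y) \<subseteq> covered Y" by (auto simp: covered_prod_mfd)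
  fix k W \<theta> l S \<xi> assume c: "(k, W, \<theta>) \<in> atlas (prod_mfd X Y)" and d: "(l, S, \<xi>) \<in> atlas Y"
  from c obtain n U \<phi> m V \<psi> where 1: "(n, U, \<phi>) \<in> atlas X" "(m, V, \<psi>) \<in> atlas Y" "k = n + m" "W = U \<times> V"
    "\<theta> = (\<lambda>(x, y). join n (\<phi> x) (\<psi> y))" by (rule prod_mfd_atlasE)
  note ch = premanifold_chart[OF X 1(1)] premanifold_chart[OF Y 1(2)] premanifold_chart[OF Y d]
  have "compatible (m, V, \<psi>) (l, S, \<xi>)" using Y 1 d by (auto simp: premanifold_def)
  then have s: "smooth_euclid m l (\<psi> ` (V \<inter> S)) (\<xi> \<circ> inv_into V \<psi>)" by (simp add: compatible_def)
  let ?A = "\<theta> ` (W \<inter> snd -` S)"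
  have e: "W \<inter> snd -` S = U \<times> (V \<inter> S)" using 1 by auto
  have oS: "openin (mtop Y) (V \<inter> S)" using is_chartD(1) ch by blast
  have o: "openin (Euclidean_space k) ?A"
    unfolding e 1(3,5) using oS is_chartD(1)[OF ch(1)] by (intro chart_prod_open[OF ch(1,2)]) auto
  have "smooth_euclid k l ?A (\<lambda>z. (\<xi> \<circ> inv_into V \<psi>) (vdrop n z))"
    by (rule smooth_euclid_compose[OF o chart_image_open[OF ch(2) oS] _ smooth_euclid_vdrop s])
       (auto simp: e 1)
  then show "smooth_euclid k l ?A (\<xi> \<circ> snd \<circ> inv_into W \<theta>)"
  proof (rule smooth_euclid_cong[OF o, rotated])
    fix z assume "z \<in> ?A"
    then have "z \<in> (\<lambda>(x, y). join n (\<phi> x) (\<psi> y)) ` (U \<times> V)" using e 1 by auto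
    from prod_chart_inv[OF ch(1,2) this] show "(\<xi> \<circ> inv_into V \<psi>) (vdrop n z) = (\<xi> \<circ> snd \<circ> inv_into W \<theta>) z"
      by (simp add: 1)
  qed
qed (use assms premanifold_prod continuous_map_snd in auto)

lemma psmooth_pair:
  assumes f: "psmooth X Y f" and g: "psmooth X Z g"
  shows "psmooth X (prod_mfd Y Z) (\<lambda>x. (f x, g x))"
proof (rule psmoothI)
  show "continuous_map (mtop X) (mtop (prod_mfd Y Z)) (\<lambda>x. (f x, g x))"
    using psmoothD(3)[OF f] psmoothD(3)[OF g] by (simp add: continuous_map_pairedI)
  show "(\<lambda>x. (f x, g x)) ` covered X \<subseteq> covered (prod_mfd Y Z)"
    using psmoothD(4)[OF f] psmoothD(4)[OF g] by (auto simp: covered_prod_mfd)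
  fix n U \<phi> k W \<theta> assume c: "(n, U, \<phi>) \<in> atlas X" and "(k, W, \<theta>) \<in> atlas (prod_mfd Y Z)"
  then obtain m V \<psi> m' V' \<psi>' where 1: "(m, V, \<psi>) \<in> atlas Y" "(m', V', \<psi>') \<in> atlas Z" "k = m + m'" "W = V \<times> V'"
    "\<theta> = (\<lambda>(x, y). join m (\<psi> x) (\<psi>' y))" by (elim prod_mfd_atlasE) blast
  have "smooth_euclid n m (\<phi> ` (U \<inter> f -` V)) (\<psi> \<circ> f \<circ> inv_into U \<phi>)"
    using psmoothD(5)[OF f] c 1 unfolding smooth_map_def by fastforce
  then have "smooth_euclid n m (\<phi> ` (U \<inter> (\<lambda>x. (f x, g x)) -` W)) (\<psi> \<circ> f \<circ> inv_into U \<phi>)"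
    by (rule smooth_euclid_subset) (auto simp: 1)
  moreover have "smooth_euclid n m' (\<phi> ` (U \<inter> g -` V')) (\<psi>' \<circ> g \<circ> inv_into U \<phi>)"
    using psmoothD(5)[OF g] c 1 unfolding smooth_map_def by fastforce
  then have "smooth_euclid n m' (\<phi> ` (U \<inter> (\<lambda>x. (f x, g x)) -` W)) (\<psi>' \<circ> g \<circ> inv_into U \<phi>)"
    by (rule smooth_euclid_subset) (auto simp: 1)
  moreover have "\<theta> \<circ> (\<lambda>x. (f x, g x)) \<circ> inv_into U \<phi> =
      (\<lambda>x. join m ((\<psi> \<circ> f \<circ> inv_into U \<phi>) x) ((\<psi>' \<circ> g \<circ> inv_into U \<phi>) x))"
    by (simp add: 1 fun_eq_iff)
  ultimately show "smooth_euclid n k (\<phi> ` (U \<inter> (\<lambda>x. (f x, g x)) -` W)) (\<theta> \<circ> (\<lambda>x. (f x, g x)) \<circ> inv_into U \<phi>)"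
    unfolding 1(3) by (simp only: smooth_euclid_join)
qed (use psmoothD[OF f] psmoothD[OF g] premanifold_prod in auto)

section \<open>Maps into Euclidean spaces\<close>

lemma inv_into_ident: "x \<in> A \<Longrightarrow> inv_into A (\<lambda>x. x) x = x"
  using inv_into_f_f[of "\<lambda>x. x" A x] by simp

lemma Rn_simps [simp]: "mtop (Rn n) = Euclidean_space n" "atlas (Rn n) = {(n, EU n, \<lambda>x. x)}" "covered (Rn n) = EU n"
  by (auto simp: Rn_def covered_def)

lemma premanifold_Rn [simp]: "premanifold (Rn n)"
proof -
  have "is_chart (Euclidean_space n) (n, EU n, \<lambda>x. x)"
    unfolding is_chart_def by (simp add: homeomorphic_map_id[unfolded id_def])
  moreover have "smooth_euclid n n (EU n) ((\<lambda>x. x) \<circ> inv_into (EU n) (\<lambda>x. x))"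
    by (rule smooth_euclid_cong[OF _ _ smooth_euclid_ident]) (auto simp: inv_into_ident)
  ultimately show ?thesis by (auto simp: premanifold_def compatible_def)
qed

text \<open>The type of real numbers is not \<open>Rn 1\<close>, whose points are sequences, yet
  coordinates and coefficients are real-valued; hence a separate predicate, related to
  \<open>Rn 1\<close> below.\<close>

definition psmooth_real :: "'a mfd \<Rightarrow> ('a \<Rightarrow> real) \<Rightarrow> bool" where
  "psmooth_real X h \<longleftrightarrow> premanifold X \<and> continuous_map (mtop X) euclideanreal h \<and>
     (\<forall>(n, U, \<phi>)\<in>atlas X. \<forall>k. Ck k n (\<phi> ` U) (h \<circ> inv_into U \<phi>))"

lemma psmooth_realI:
  assumes "premanifold X" "continuous_map (mtop X) euclideanreal h"
    "\<And>n U \<phi> k. (n, U, \<phi>) \<in> atlas X \<Longrightarrow> is_chart (mtop X) (n, U, \<phi>) \<Longrightarrow> 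
       openin (Euclidean_space n) (\<phi> ` U) \<Longrightarrow> Ck k n (\<phi> ` U) (\<lambda>x. h (inv_into U \<phi> x))"
  shows "psmooth_real X h"
  unfolding psmooth_real_def 
proof (intro conjI)
  show "\<forall>(n, U, \<phi>)\<in>atlas X. \<forall>k. Ck k n (\<phi> ` U) (h \<circ> inv_into U \<phi>)"
  proof clarify
    fix n U \<phi> k assume "(n, U, \<phi>) \<in> atlas X"
    then show "Ck k n (\<phi> ` U) (h \<circ> inv_into U \<phi>)"
      using assms(3)[of n U \<phi> k] premanifold_chart[OF assms(1), of "(n, U, \<phi>)"] is_chartD(2)[of "mtop X" n U \<phi>]
      by (simp add: comp_def)
  qed
qed (use assms in auto)

lemma psmooth_realD:
  assumes "psmooth_real X h"
  shows "premanifold X" "continuous_map (mtop X) euclideanreal h"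
    "\<And>n U \<phi> k. (n, U, \<phi>) \<in> atlas X \<Longrightarrow> Ck k n (\<phi> ` U) (\<lambda>x. h (inv_into U \<phi> x))"
  using assms by (fastforce simp: psmooth_real_def comp_def)+

lemma psmooth_Rn_iff:
  "psmooth X (Rn N) f \<longleftrightarrow> premanifold X \<and> (\<forall>x\<in>pts X. f x \<in> EU N) \<and> (\<forall>j<N. psmooth_real X (\<lambda>x. f x j))"
  (is "?l \<longleftrightarrow> ?r")
proof
  assume f: ?l
  have cont: "continuous_map (mtop X) (Euclidean_space N) f" using psmoothD(3)[OF f] by simp
  have "psmooth_real X (\<lambda>x. f x j)" if j: "j < N" for j
  proof (rule psmooth_realI)
    fix n U \<phi> k assume c: "(n, U, \<phi>) \<in> atlas X" "is_chart (mtop X) (n, U, \<phi>)" "openin (Euclidean_space n) (\<phi> ` U)"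
    have "smooth_euclid n N (\<phi> ` (U \<inter> f -` EU N)) ((\<lambda>x. x) \<circ> f \<circ> inv_into U \<phi>)"
      using psmoothD(5)[OF f] c unfolding smooth_map_def by fastforce
    moreover have "U \<inter> f -` EU N = U"
      using cont is_chartD(5)[OF c(2)] by (auto simp: continuous_map_EU_iff)
    ultimately have "Ck k n (\<phi> ` U) (\<lambda>x. ((\<lambda>x. x) \<circ> f \<circ> inv_into U \<phi>) x j)"
      using smooth_euclidD[OF _ j] by metis
    then show "Ck k n (\<phi> ` U) (\<lambda>x. f (inv_into U \<phi> x) j)" by (simp add: comp_def)
  qed (use cont psmoothD[OF f] in \<open>auto simp: continuous_map_EU_iff\<close>)
  then show ?r using psmoothD(1,6)[OF f] by auto
next
  assume r: ?r
  show ?l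
  proof (rule psmoothI)
    show "continuous_map (mtop X) (mtop (Rn N)) f"
      unfolding Rn_simps continuous_map_EU_iff
    proof (intro conjI allI)
      fix j show "continuous_map (mtop X) euclideanreal (\<lambda>x. f x j)"
      proof (cases "j < N")
        case True
        then show ?thesis using r psmooth_realD(2) by blast
      next
        case False
        have "continuous_map (mtop X) euclideanreal (\<lambda>x. 0)" by simp
        then show ?thesis by (rule continuous_map_eq) (use r False in \<open>auto simp: EU_iff\<close>)
      qed
    qed (use r in auto)
    show "f ` covered X \<subseteq> covered (Rn N)" using r covered_subset_pts[of X] by auto
    fix n U \<phi> m V \<psi> assume c: "(n, U, \<phi>) \<in> atlas X" and "(m, V, \<psi>) \<in> atlas (Rn N)"
    then have d: "m = N" "V = EU N" "\<psi> = (\<lambda>x. x)" by auto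
    show "smooth_euclid n m (\<phi> ` (U \<inter> f -` V)) (\<psi> \<circ> f \<circ> inv_into U \<phi>)"
      unfolding d
    proof (rule smooth_euclidI)
      fix j k assume "j < N"
      then have "psmooth_real X (\<lambda>x. f x j)" using r by simp
      from psmooth_realD(3)[OF this c, of k]
      show "Ck k n (\<phi> ` (U \<inter> f -` EU N)) (\<lambda>x. ((\<lambda>x. x) \<circ> f \<circ> inv_into U \<phi>) x j)"
        unfolding comp_def by (rule Ck_subset) auto
    qed
  qed (use r in auto)
qed

lemma psmooth_real_Rn1:
  "psmooth_real X h \<longleftrightarrow> psmooth X (Rn 1) (\<lambda>x i. if i = 0 then h x else 0)"
  by (auto simp: psmooth_Rn_iff EU_iff psmooth_realD(1))

lemma psmooth_real_comp:
  assumes "psmooth X Y f" "psmooth_real Y h"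
  shows "psmooth_real X (\<lambda>x. h (f x))"
  using psmooth_comp[OF assms(1) assms(2)[unfolded psmooth_real_Rn1]] by (simp add: psmooth_real_Rn1)

lemma psmooth_real_coord: "psmooth X (Rn N) f \<Longrightarrow> psmooth_real X (\<lambda>x. f x j)"
proof (cases "j < N")
  case False
  assume f: "psmooth X (Rn N) f"
  have "psmooth_real X (\<lambda>x. 0)"
    using psmoothD(1)[OF f] by (intro psmooth_realI) auto
  then have "psmooth X (Rn 1) (\<lambda>x i. if i = 0 then 0 else 0)" by (simp add: psmooth_real_Rn1)
  then have "psmooth X (Rn 1) (\<lambda>x i. if i = 0 then f x j else 0)"
    by (rule psmooth_cong) (use psmoothD(6)[OF f] False in \<open>auto simp: EU_iff fun_eq_iff\<close>)
  then show ?thesis by (simp add: psmooth_real_Rn1)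
qed (auto simp: psmooth_Rn_iff)

lemma psmooth_RnI:
  "premanifold X \<Longrightarrow> (\<And>x. x \<in> pts X \<Longrightarrow> f x \<in> EU N) \<Longrightarrow> (\<And>j. j < N \<Longrightarrow> psmooth_real X (\<lambda>x. f x j)) \<Longrightarrow>
   psmooth X (Rn N) f"
  by (simp add: psmooth_Rn_iff)

lemma psmooth_real_const: "premanifold X \<Longrightarrow> psmooth_real X (\<lambda>x. c)"
  by (rule psmooth_realI) auto

lemma psmooth_real_add:
  assumes f: "psmooth_real X f" and g: "psmooth_real X g"
  shows "psmooth_real X (\<lambda>x. f x + g x)"
proof (rule psmooth_realI)
  show "continuous_map (mtop X) euclideanreal (\<lambda>x. f x + g x)"
    using psmooth_realD(2)[OF f] psmooth_realD(2)[OF g] by (rule continuous_map_add)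
qed (use Ck_add psmooth_realD[OF f] psmooth_realD[OF g] in auto)

lemma psmooth_real_mult:
  assumes f: "psmooth_real X f" and g: "psmooth_real X g"
  shows "psmooth_real X (\<lambda>x. f x * g x)"
proof (rule psmooth_realI)
  show "continuous_map (mtop X) euclideanreal (\<lambda>x. f x * g x)"
    using psmooth_realD(2)[OF f] psmooth_realD(2)[OF g] by (rule continuous_map_real_mult)
qed (use Ck_mult psmooth_realD[OF f] psmooth_realD[OF g] in auto)

lemma psmooth_real_diff:
  assumes f: "psmooth_real X f" and g: "psmooth_real X g"
  shows "psmooth_real X (\<lambda>x. f x - g x)"
  using psmooth_real_add[OF f psmooth_real_mult[OF psmooth_real_const[of X "-1"] g]] psmooth_realD(1)[OF f]
  by simp

lemma psmooth_real_sum: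
  assumes "premanifold X"
  shows "(\<And>j. j \<in> J \<Longrightarrow> psmooth_real X (f j)) \<Longrightarrow> psmooth_real X (\<lambda>x. \<Sum>j\<in>J. f j x)"
  by (induction J rule: infinite_finite_induct) (auto intro: psmooth_real_add psmooth_real_const[OF assms])

lemma psmooth_real_inverse:
  assumes f: "psmooth_real X f" and nz: "\<And>x. x \<in> pts X \<Longrightarrow> f x \<noteq> 0"
  shows "psmooth_real X (\<lambda>x. inverse (f x))"
proof (rule psmooth_realI)
  show "continuous_map (mtop X) euclideanreal (\<lambda>x. inverse (f x))"
    using psmooth_realD(2)[OF f] nz by (rule continuous_map_real_inverse) auto
  fix n U \<phi> k
  assume a: "(n, U, \<phi>) \<in> atlas X" "is_chart (mtop X) (n, U, \<phi>)" "openin (Euclidean_space n) (\<phi> ` U)"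
  show "Ck k n (\<phi> ` U) (\<lambda>x. inverse (f (inv_into U \<phi> x)))"
    using Ck_inverse[OF a(3) _ psmooth_realD(3)[OF f a(1)]] nz is_chartD(5)[OF a(2)]
    by (metis inv_into_into subsetD)
qed (use psmooth_realD[OF f] in auto)

section \<open>Submanifolds and slice charts\<close>

lemma mtop_submfd [simp]: "mtop (submfd X S) = subtopology (mtop X) S"
  by (simp add: submfd_def)

lemma submfd_atlasE:
  assumes "(k, W, \<phi>) \<in> atlas (submfd X S)"
  obtains n U where "W = U \<inter> S" "k \<le> n" "(n, U, \<phi>) \<in> maximal_atlas X" "\<phi> ` (U \<inter> S) = \<phi> ` U \<inter> EU k"
  using assms by (auto simp: submfd_def)

lemma submfd_atlasI:
  "k \<le> n \<Longrightarrow> (n, U, \<phi>) \<in> maximal_atlas X \<Longrightarrow> \<phi> ` (U \<inter> S) = \<phi> ` U \<inter> EU k \<Longrightarrow> (k, U \<inter> S, \<phi>) \<in> atlas (submfd X S)"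
  by (auto simp: submfd_def)

lemma EU_mono: "k \<le> n \<Longrightarrow> EU k \<subseteq> EU n"
  by simp

text \<open>R^k is literally a subset of R^n, and both carry the topology of the sequence space.
  Hence the open set of sequences that cuts the image of the chart out of R^n also shows its slice
  to be open in R^k.\<close>

lemma slice_is_chart:
  assumes kn: "k \<le> n" and c: "is_chart T (n, U, \<phi>)" and sl: "\<phi> ` (U \<inter> S) = \<phi> ` U \<inter> EU k"
  shows "is_chart (subtopology T S) (k, U \<inter> S, \<phi>)"
proof (rule is_chartI[where \<psi> = "inv_into U \<phi>" and ?O1.0 = "\<phi> ` (U \<inter> S)"])
  note C = is_chartD[OF c]
  show "openin (subtopology T S) (U \<inter> S)" using C(1) by (auto simp: openin_subtopology)
  obtain O1 where O1: "open O1" "\<phi> ` U = O1 \<inter> EU n" using C(2) openin_Euclidean_space by metis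
  then have "\<phi> ` U \<inter> EU k = O1 \<inter> EU k" using EU_mono[OF kn] by blast
  then show "openin (Euclidean_space k) (\<phi> ` (U \<inter> S))" using O1 sl openin_Euclidean_space by metis
  have "continuous_map (subtopology T (U \<inter> S)) (Euclidean_space n) \<phi>"
    using C(6) continuous_map_from_subtopology_mono by blast
  then have "continuous_map (subtopology T (U \<inter> S)) (Euclidean_space k) \<phi>"
    using sl by (auto simp: continuous_map_EU_iff)
  then show "continuous_map (subtopology (subtopology T S) (U \<inter> S)) (Euclidean_space k) \<phi>"
    by (simp add: subtopology_subtopology Int_absorb1)
  have e: "subtopology (Euclidean_space k) (\<phi> ` (U \<inter> S)) = subtopology (Euclidean_space n) (\<phi> ` (U \<inter> S))"
    unfolding Euclidean_space_def subtopology_subtopology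
    using sl EU_mono[OF kn] by (intro arg_cong[of _ _ "subtopology _"]) (auto simp: topspace_Euclidean_space)
  have "continuous_map (subtopology (Euclidean_space n) (\<phi> ` (U \<inter> S))) T (inv_into U \<phi>)"
    by (rule continuous_map_from_subtopology_mono[OF C(7)]) auto
  then show "continuous_map (subtopology (Euclidean_space k) (\<phi> ` (U \<inter> S))) (subtopology T S) (inv_into U \<phi>)"
    unfolding e continuous_map_in_subtopology using C(3) by (auto simp: inv_into_f_f)
qed (use is_chartD(3)[OF c] in \<open>auto simp: inv_into_f_f\<close>)

lemma slice_smooth:
  assumes kn: "k \<le> n" and c: "is_chart T (n, U, \<phi>)" and sl: "\<phi> ` (U \<inter> S) = \<phi> ` U \<inter> EU k"
    and V: "openin T V" and s: "smooth_euclid n m (\<phi> ` (U \<inter> V)) (\<psi> \<circ> inv_into U \<phi>)"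
  shows "smooth_euclid k m (\<phi> ` (U \<inter> S \<inter> V)) (\<psi> \<circ> inv_into (U \<inter> S) \<phi>)"
proof -
  note C = is_chartD[OF c]
  have "openin (subtopology T S) (U \<inter> S \<inter> V)"
    using C(1) V by (metis Int_assoc Int_commute openin_Int openin_subtopology_Int)
  then have o: "openin (Euclidean_space k) (\<phi> ` (U \<inter> S \<inter> V))"
    by (rule chart_image_open[OF slice_is_chart[OF kn c sl]]) auto
  have o2: "openin (Euclidean_space n) (\<phi> ` (U \<inter> V))" using C(1) V by (intro chart_image_open[OF c]) auto
  show ?thesis
  proof (rule smooth_euclid_cong[OF o _ smooth_euclid_compose[OF o o2 _ smooth_euclid_ident s]])
    fix x assume "x \<in> \<phi> ` (U \<inter> S \<inter> V)"
    then show "(\<psi> \<circ> inv_into U \<phi>) x = (\<psi> \<circ> inv_into (U \<inter> S) \<phi>) x"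
      using inv_into_restrict[OF C(3), of "U \<inter> S" x] by auto
  qed auto
qed

text \<open>Transition maps between slice charts are restrictions of ambient transition maps with
  the trailing coordinates dropped, whatever \<open>S\<close> is.\<close>

lemma premanifold_submfd:
  assumes X: "premanifold X"
  shows "premanifold (submfd X S)"
  unfolding premanifold_def
proof (intro conjI ballI)
  fix c assume c: "c \<in> atlas (submfd X S)"
  obtain k W \<phi> where cc: "c = (k, W, \<phi>)" by (cases c)
  from c[unfolded cc] obtain n U where 1: "W = U \<inter> S" "k \<le> n" "(n, U, \<phi>) \<in> maximal_atlas X" "\<phi> ` (U \<inter> S) = \<phi> ` U \<inter> EU k"
    by (rule submfd_atlasE)
  show "is_chart (mtop (submfd X S)) c"
    unfolding cc 1(1) mtop_submfd by (rule slice_is_chart[OF 1(2) maximal_atlasD(1)[OF 1(3)] 1(4)])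
  fix d assume d: "d \<in> atlas (submfd X S)"
  obtain k' W' \<phi>' where dd: "d = (k', W', \<phi>')" by (cases d)
  from d[unfolded dd] obtain n' U' where 2: "W' = U' \<inter> S" "k' \<le> n'" "(n', U', \<phi>') \<in> maximal_atlas X" "\<phi>' ` (U' \<inter> S) = \<phi>' ` U' \<inter> EU k'"
    by (rule submfd_atlasE)
  note ch = maximal_atlasD(1)[OF 1(3)] maximal_atlasD(1)[OF 2(3)]
  have "compatible (n, U, \<phi>) (n', U', \<phi>')" by (rule maximal_atlas_compatible[OF X 1(3) 2(3)])
  then have s: "smooth_euclid n n' (\<phi> ` (U \<inter> U')) (\<phi>' \<circ> inv_into U \<phi>)" "smooth_euclid n' n (\<phi>' ` (U' \<inter> U)) (\<phi> \<circ> inv_into U' \<phi>')"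
    by (auto simp: compatible_def Int_commute)
  have le: "smooth_euclid a b A f \<Longrightarrow> b' \<le> b \<Longrightarrow> smooth_euclid a b' A f" for a b b' A f
    by (auto simp: smooth_euclid_def)
  have "smooth_euclid k k' (\<phi> ` (U \<inter> S \<inter> U')) (\<phi>' \<circ> inv_into (U \<inter> S) \<phi>)"
    by (rule le[OF slice_smooth[OF 1(2) ch(1) 1(4) is_chartD(1)[OF ch(2)] s(1)] 2(2)])
  moreover have "smooth_euclid k' k (\<phi>' ` (U' \<inter> S \<inter> U)) (\<phi> \<circ> inv_into (U' \<inter> S) \<phi>')"
    by (rule le[OF slice_smooth[OF 2(2) ch(2) 2(4) is_chartD(1)[OF ch(1)] s(2)] 1(2)])
  moreover have "U \<inter> S \<inter> (U' \<inter> S) = U \<inter> S \<inter> U'" "U' \<inter> S \<inter> U = U \<inter> S \<inter> (U' \<inter> S)" by auto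
  ultimately show "compatible c d"
    unfolding cc dd 1(1) 2(1) compatible_def prod.case by simp
qed

lemma psmooth_incl:
  assumes X: "premanifold X"
  shows "psmooth (submfd X S) X (\<lambda>x. x)"
proof (rule psmoothI)
  show "(\<lambda>x. x) ` covered (submfd X S) \<subseteq> covered X"
    using maximal_atlasD(2) by (fastforce elim!: coveredE submfd_atlasE)
  fix k W \<phi> m V \<psi> assume c: "(k, W, \<phi>) \<in> atlas (submfd X S)" and d: "(m, V, \<psi>) \<in> atlas X"
  from c obtain n U where 1: "W = U \<inter> S" "k \<le> n" "(n, U, \<phi>) \<in> maximal_atlas X" "\<phi> ` (U \<inter> S) = \<phi> ` U \<inter> EU k"
    by (rule submfd_atlasE)
  have V: "openin (mtop X) V" using premanifold_chart[OF X d] is_chartD(1) by blast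
  have s: "smooth_euclid n m (\<phi> ` (U \<inter> V)) (\<psi> \<circ> inv_into U \<phi>)"
    using maximal_atlasD(3)[OF 1(3) d] by (simp add: compatible_def)
  show "smooth_euclid k m (\<phi> ` (W \<inter> (\<lambda>x. x) -` V)) (\<psi> \<circ> (\<lambda>x. x) \<circ> inv_into W \<phi>)"
    using slice_smooth[OF 1(2) maximal_atlasD(1)[OF 1(3)] 1(4) V s] by (simp add: 1(1) comp_def)
qed (use assms premanifold_submfd in \<open>auto simp: continuous_map_from_subtopology continuous_map_id[unfolded id_def]\<close>)

lemma psmooth_submfd:
  assumes "psmooth X Y f" shows "psmooth (submfd X S) Y f"
  using psmooth_comp[OF psmooth_incl[OF psmoothD(1)[OF assms]] assms] .

text \<open>In a slice chart the expression of \<open>f\<close> consists of the first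
  \<open>k\<close> coordinates of its ambient expression, so smoothness is inherited. What has to be
  supplied is the existence of slice charts at the image points.\<close>

lemma psmooth_into_submfd:
  assumes f: "psmooth Y X f" and S: "\<And>y. y \<in> pts Y \<Longrightarrow> f y \<in> S"
    and cov: "\<And>y. y \<in> covered Y \<Longrightarrow> f y \<in> covered (submfd X S)"
  shows "psmooth Y (submfd X S) f"
proof (rule psmoothI)
  show "continuous_map (mtop Y) (mtop (submfd X S)) f"
    using psmoothD(3)[OF f] S by (auto simp: continuous_map_in_subtopology)
  fix n0 U0 \<phi>0 k W \<phi> assume c: "(n0, U0, \<phi>0) \<in> atlas Y" and d: "(k, W, \<phi>) \<in> atlas (submfd X S)"
  from d obtain n U where 1: "W = U \<inter> S" "k \<le> n" "(n, U, \<phi>) \<in> maximal_atlas X" "\<phi> ` (U \<inter> S) = \<phi> ` U \<inter> EU k"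
    by (rule submfd_atlasE)
  have "U0 \<subseteq> pts Y" using premanifold_chart[OF psmoothD(1)[OF f] c] is_chartD(5) by blast
  then have e: "U0 \<inter> f -` W = U0 \<inter> f -` U" using S 1 by auto
  have "smooth_euclid n0 n (\<phi>0 ` (U0 \<inter> f -` U)) (\<phi> \<circ> f \<circ> inv_into U0 \<phi>0)"
    by (rule psmooth_maximal[OF f atlas_maximal[OF psmoothD(1)[OF f] c] 1(3)])
  then show "smooth_euclid n0 k (\<phi>0 ` (U0 \<inter> f -` W)) (\<phi> \<circ> f \<circ> inv_into U0 \<phi>0)"
    using 1(2) by (auto simp: e smooth_euclid_def)
qed (use psmoothD[OF f] premanifold_submfd cov in auto)

lemma maximal_atlas_restrict:
  assumes "(n, U, \<phi>) \<in> maximal_atlas X" "openin (mtop X) W" "W \<subseteq> U" and X: "premanifold X"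
  shows "(n, W, \<phi>) \<in> maximal_atlas X"
proof -
  note M = maximal_atlasD[OF assms(1)]
  have ch: "is_chart (mtop X) (n, W, \<phi>)" by (rule chart_restrict[OF M(1) assms(2,3)])
  have "compatible (n, W, \<phi>) d" if d: "d \<in> atlas X" for d
  proof -
    obtain m V \<psi> where dd: "d = (m, V, \<psi>)" by (cases d)
    have chd: "is_chart (mtop X) (m, V, \<psi>)" using premanifold_chart[OF X d] dd by simp
    have "compatible (n, U, \<phi>) (m, V, \<psi>)" using M(3)[OF d] dd by simp
    then have s: "smooth_euclid n m (\<phi> ` (U \<inter> V)) (\<psi> \<circ> inv_into U \<phi>)" "smooth_euclid m n (\<psi> ` (U \<inter> V)) (\<phi> \<circ> inv_into V \<psi>)"
      by (auto simp: compatible_def)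
    have "openin (mtop X) (W \<inter> V)" using assms(2) is_chartD(1)[OF chd] by blast
    then have o: "openin (Euclidean_space n) (\<phi> ` (W \<inter> V))" by (rule chart_image_open[OF ch]) auto
    have "smooth_euclid n m (\<phi> ` (W \<inter> V)) (\<psi> \<circ> inv_into W \<phi>)"
    proof (rule smooth_euclid_cong[OF o _ smooth_euclid_subset[OF s(1)]])
      fix x assume "x \<in> \<phi> ` (W \<inter> V)"
      then show "(\<psi> \<circ> inv_into U \<phi>) x = (\<psi> \<circ> inv_into W \<phi>) x"
        using inv_into_restrict[OF is_chartD(3)[OF M(1)] assms(3), of x] by auto
    qed (use assms(3) in auto)
    moreover have "smooth_euclid m n (\<psi> ` (W \<inter> V)) (\<phi> \<circ> inv_into V \<psi>)"
      by (rule smooth_euclid_subset[OF s(2)]) (use assms(3) in auto)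
    ultimately show ?thesis by (simp add: dd compatible_def)
  qed
  then show ?thesis using ch M(2) assms(3) unfolding maximal_atlas_def by auto
qed

text \<open>For an open subset take \<open>k = n\<close>: after restriction the slice condition
  holds because the image of a chart already lies in R^n.\<close>

lemma submfd_open_atlas:
  assumes "(n, U, \<phi>) \<in> maximal_atlas X" "openin (mtop X) S" and X: "premanifold X"
  shows "(n, U \<inter> S, \<phi>) \<in> atlas (submfd X S)"
proof -
  note M = maximal_atlasD[OF assms(1)]
  have "(n, U \<inter> S, \<phi>) \<in> maximal_atlas X"
    using assms is_chartD(1)[OF M(1)] by (intro maximal_atlas_restrict[OF assms(1)]) auto
  from submfd_atlasI[OF order_refl this, of S] show ?thesis
    using is_chartD(4)[OF M(1)] by (simp add: Int_assoc) blast
qed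

lemma covered_submfd_open:
  assumes X: "premanifold X" and S: "openin (mtop X) S"
  shows "covered (submfd X S) = covered X \<inter> S"
proof
  show "covered (submfd X S) \<subseteq> covered X \<inter> S"
    using psmoothD(4)[OF psmooth_incl[OF X, of S]] by (auto elim!: coveredE submfd_atlasE)
  show "covered X \<inter> S \<subseteq> covered (submfd X S)"
    using submfd_open_atlas[OF atlas_maximal[OF X] S X] by (fastforce elim!: coveredE intro: coveredI)
qed

text \<open>The atlas of the open subset draws on the whole maximal atlas of \<open>X\<close>. A
  test in the charts of \<open>X\<close> is enough, since smoothness of the inclusion expresses all
  other charts through them.\<close>

lemma psmooth_submfd_openI:
  assumes X: "premanifold X" and Y: "premanifold Y" and S: "openin (mtop X) S"
    and cont: "continuous_map (subtopology (mtop X) S) (mtop Y) f" and cov: "f ` (covered X \<inter> S) \<subseteq> covered Y"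
    and sm: "\<And>n U \<phi> m V \<psi>. (n, U, \<phi>) \<in> atlas X \<Longrightarrow> (m, V, \<psi>) \<in> atlas Y \<Longrightarrow>
       smooth_euclid n m (\<phi> ` (U \<inter> S \<inter> f -` V)) (\<psi> \<circ> f \<circ> inv_into U \<phi>)"
  shows "psmooth (submfd X S) Y f"
proof (rule psmoothI)
  fix k W \<phi>' m V \<psi> assume c: "(k, W, \<phi>') \<in> atlas (submfd X S)" and d: "(m, V, \<psi>) \<in> atlas Y"
  note ch = premanifold_chart[OF premanifold_submfd[OF X] c] premanifold_chart[OF Y d]
  have cont': "continuous_map (mtop (submfd X S)) (mtop Y) f" using cont by simp
  have WS: "W \<subseteq> S" using c by (auto elim: submfd_atlasE)
  have opS: "openin (mtop X) A" if "openin (mtop (submfd X S)) A" for A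
    using that S by (simp add: openin_open_subtopology)
  show "smooth_euclid k m (\<phi>' ` (W \<inter> f -` V)) (\<psi> \<circ> f \<circ> inv_into W \<phi>')"
  proof (rule smooth_euclid_chart_locally[OF ch(1)])
    show op: "openin (mtop (submfd X S)) (W \<inter> f -` V)"
      by (rule continuous_preimage_open[OF cont' is_chartD(1)[OF ch(1)] is_chartD(1)[OF ch(2)]])
    fix p assume p: "p \<in> W \<inter> f -` V"
    have "p \<in> covered X" using psmoothD(4)[OF psmooth_incl[OF X, of S]] coveredI[OF c] p by auto
    then obtain n U \<phi> where e: "(n, U, \<phi>) \<in> atlas X" "p \<in> U" by (rule coveredE)
    note che = premanifold_chart[OF X e(1)]
    define N where "N = U \<inter> S \<inter> (W \<inter> f -` V)"
    have oN: "openin (mtop X) N" unfolding N_def using is_chartD(1)[OF che] S opS[OF op] by blast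
    have oN': "openin (mtop (submfd X S)) N" using oN S by (auto simp: openin_open_subtopology N_def)
    have "smooth_euclid k m (\<phi>' ` N) (\<psi> \<circ> (\<lambda>x. f x) \<circ> inv_into W \<phi>')"
    proof (rule smooth_euclid_chart_comp[OF ch(1) che oN' _ oN, where f = "\<lambda>x. x"])
      have "smooth_euclid k n (\<phi>' ` (W \<inter> (\<lambda>x. x) -` U)) (\<phi> \<circ> (\<lambda>x. x) \<circ> inv_into W \<phi>')"
        using psmoothD(5)[OF psmooth_incl[OF X, of S]] c e(1) unfolding smooth_map_def by fastforce
      then show "smooth_euclid k n (\<phi>' ` N) (\<phi> \<circ> (\<lambda>x. x) \<circ> inv_into W \<phi>')"
        by (rule smooth_euclid_subset) (auto simp: N_def)
      show "smooth_euclid n m (\<phi> ` N) (\<psi> \<circ> f \<circ> inv_into U \<phi>)"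
        by (rule smooth_euclid_subset[OF sm[OF e(1) d]]) (auto simp: N_def)
    qed (auto simp: N_def)
    then show "\<exists>N. openin (mtop (submfd X S)) N \<and> p \<in> N \<and> N \<subseteq> W \<inter> f -` V \<and>
        smooth_euclid k m (\<phi>' ` N) (\<psi> \<circ> f \<circ> inv_into W \<phi>')"
      using oN' p e WS by (intro exI[of _ N]) (auto simp: N_def)
  qed auto
qed (use assms premanifold_submfd covered_submfd_open[OF X S] in auto)

text \<open>Formulas for bundle operations exist only over trivializing sets; smoothness is glued
  from there.\<close>

lemma psmooth_locally:
  assumes X: "premanifold X" and Y: "premanifold Y"
    and loc: "\<And>p. p \<in> pts X \<Longrightarrow> \<exists>W. openin (mtop X) W \<and> p \<in> W \<and> psmooth (submfd X W) Y f"
  shows "psmooth X Y f"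
proof (rule psmoothI)
  show cont: "continuous_map (mtop X) (mtop Y) f"
    unfolding continuous_map
  proof (intro conjI allI impI)
    show "f ` pts X \<subseteq> pts Y"
    proof clarify
      fix p assume p: "p \<in> pts X"
      with loc obtain W where "p \<in> W" "psmooth (submfd X W) Y f" by blast
      then show "f p \<in> pts Y" using psmoothD(6)[of "submfd X W" Y f p] p by auto
    qed
    fix V assume V: "openin (mtop Y) V"
    show "openin (mtop X) {x \<in> pts X. f x \<in> V}"
    proof (subst openin_subopen, clarify)
      fix p assume p: "p \<in> pts X" "f p \<in> V"
      with loc obtain W where W: "openin (mtop X) W" "p \<in> W" "psmooth (submfd X W) Y f" by blast
      have "openin (subtopology (mtop X) W) {x \<in> topspace (subtopology (mtop X) W). f x \<in> V}"
        using openin_continuous_map_preimage[OF psmoothD(3)[OF W(3)] V] by (simp only: mtop_submfd)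
      then have "openin (mtop X) {x \<in> topspace (subtopology (mtop X) W). f x \<in> V}"
        using W(1) openin_open_subtopology by blast
      then show "\<exists>T. openin (mtop X) T \<and> p \<in> T \<and> T \<subseteq> {x \<in> pts X. f x \<in> V}"
        using p W by (intro exI[of _ "{x \<in> topspace (subtopology (mtop X) W). f x \<in> V}"]) auto
    qed
  qed
  show "f ` covered X \<subseteq> covered Y"
  proof clarify
    fix p assume p: "p \<in> covered X"
    with loc covered_subset_pts[OF X] obtain W where W: "openin (mtop X) W" "p \<in> W" "psmooth (submfd X W) Y f" by blast
    then show "f p \<in> covered Y" using p psmoothD(4)[OF W(3)] covered_submfd_open[OF X W(1)] by auto
  qed
  fix n U \<phi> m V \<psi> assume c: "(n, U, \<phi>) \<in> atlas X" and d: "(m, V, \<psi>) \<in> atlas Y"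
  note ch = premanifold_chart[OF X c] premanifold_chart[OF Y d]
  show "smooth_euclid n m (\<phi> ` (U \<inter> f -` V)) (\<psi> \<circ> f \<circ> inv_into U \<phi>)"
  proof (rule smooth_euclid_chart_locally[OF ch(1)])
    show op: "openin (mtop X) (U \<inter> f -` V)"
      by (rule continuous_preimage_open[OF cont is_chartD(1)[OF ch(1)] is_chartD(1)[OF ch(2)]])
    fix p assume p: "p \<in> U \<inter> f -` V"
    then have "p \<in> pts X" using is_chartD(5)[OF ch(1)] by auto
    with loc obtain W where W: "openin (mtop X) W" "p \<in> W" "psmooth (submfd X W) Y f" by blast
    have cW: "(n, U \<inter> W, \<phi>) \<in> atlas (submfd X W)"
      by (rule submfd_open_atlas[OF atlas_maximal[OF X c] W(1) X])
    define N where "N = W \<inter> (U \<inter> f -` V)"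
    have oN: "openin (mtop X) N" unfolding N_def using W op by blast
    have "smooth_euclid n m (\<phi> ` (U \<inter> W \<inter> f -` V)) (\<psi> \<circ> f \<circ> inv_into (U \<inter> W) \<phi>)"
      using psmoothD(5)[OF W(3)] cW d unfolding smooth_map_def by fastforce
    then have s: "smooth_euclid n m (\<phi> ` N) (\<psi> \<circ> f \<circ> inv_into (U \<inter> W) \<phi>)"
      by (rule smooth_euclid_subset) (auto simp: N_def)
    have o: "openin (Euclidean_space n) (\<phi> ` N)" by (rule chart_image_open[OF ch(1) oN]) (auto simp: N_def)
    have "smooth_euclid n m (\<phi> ` N) (\<psi> \<circ> f \<circ> inv_into U \<phi>)"
    proof (rule smooth_euclid_cong[OF o _ s])
      fix x assume "x \<in> \<phi> ` N"
      then show "(\<psi> \<circ> f \<circ> inv_into (U \<inter> W) \<phi>) x = (\<psi> \<circ> f \<circ> inv_into U \<phi>) x"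
        using inv_into_restrict[OF is_chartD(3)[OF ch(1)], of "U \<inter> W" x] by (auto simp: N_def)
    qed
    then show "\<exists>N. openin (mtop X) N \<and> p \<in> N \<and> N \<subseteq> U \<inter> f -` V \<and>
        smooth_euclid n m (\<phi> ` N) (\<psi> \<circ> f \<circ> inv_into U \<phi>)"
      using oN p W by (intro exI[of _ N]) (auto simp: N_def)
  qed auto
qed (use X Y in auto)

section \<open>Charts as smooth maps\<close>

lemma psmooth_chart:
  assumes X: "premanifold X" and c: "(n, U, \<phi>) \<in> maximal_atlas X"
  shows "psmooth (submfd X U) (Rn n) \<phi>"
proof (rule psmooth_submfd_openI[OF X])
  note M = maximal_atlasD[OF c] note C = is_chartD[OF M(1)]
  show "continuous_map (subtopology (mtop X) U) (mtop (Rn n)) \<phi>" using C(6) by simp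
  show "\<phi> ` (covered X \<inter> U) \<subseteq> covered (Rn n)" using C(4) by auto
  fix k V \<psi> m W \<theta> assume d: "(k, V, \<psi>) \<in> atlas X" and "(m, W, \<theta>) \<in> atlas (Rn n)"
  then have e: "m = n" "W = EU n" "\<theta> = (\<lambda>x. x)" by auto
  have "smooth_euclid k n (\<psi> ` (U \<inter> V)) (\<phi> \<circ> inv_into V \<psi>)"
    using M(3)[OF d] by (simp add: compatible_def)
  then show "smooth_euclid k m (\<psi> ` (V \<inter> U \<inter> \<phi> -` W)) (\<theta> \<circ> \<phi> \<circ> inv_into V \<psi>)"
    unfolding e by (auto simp: comp_def elim!: smooth_euclid_subset)
qed (use is_chartD(1)[OF maximal_atlasD(1)[OF c]] in auto)

lemma psmooth_chart_inv:
  assumes X: "premanifold X" and c: "(n, U, \<phi>) \<in> maximal_atlas X"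
  shows "psmooth (submfd (Rn n) (\<phi> ` U)) X (inv_into U \<phi>)"
proof (rule psmooth_submfd_openI[OF _ X])
  note M = maximal_atlasD[OF c] note C = is_chartD[OF M(1)]
  show "continuous_map (subtopology (mtop (Rn n)) (\<phi> ` U)) (mtop X) (inv_into U \<phi>)" using C(7) by simp
  show "openin (mtop (Rn n)) (\<phi> ` U)" using C(2) by simp
  show "inv_into U \<phi> ` (covered (Rn n) \<inter> \<phi> ` U) \<subseteq> covered X" using M(2) C(3) by (auto simp: inv_into_f_f)
  fix k V \<psi> m W \<theta> assume "(k, V, \<psi>) \<in> atlas (Rn n)" and d: "(m, W, \<theta>) \<in> atlas X"
  then have e: "k = n" "V = EU n" "\<psi> = (\<lambda>x. x)" by auto
  have s: "smooth_euclid n m (\<phi> ` (U \<inter> W)) (\<theta> \<circ> inv_into U \<phi>)"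
    using M(3)[OF d] by (simp add: compatible_def)
  have i: "EU n \<inter> \<phi> ` U \<inter> inv_into U \<phi> -` W = \<phi> ` (U \<inter> W)"
    using C(3,4) by (auto simp: inv_into_f_f)
  have o: "openin (Euclidean_space n) (\<phi> ` (U \<inter> W))"
    using C(1) is_chartD(1)[OF premanifold_chart[OF X d]] by (intro chart_image_open[OF M(1)]) auto
  show "smooth_euclid k m (\<psi> ` (V \<inter> \<phi> ` U \<inter> inv_into U \<phi> -` W)) (\<theta> \<circ> inv_into U \<phi> \<circ> inv_into V \<psi>)"
    unfolding e i image_ident
    by (rule smooth_euclid_cong[OF o _ s]) (use C(4) in \<open>auto simp: inv_into_ident subset_iff\<close>)
qed simp

text \<open>A diffeomorphism between open sets of \<open>X\<close> and R^N is a chart: smoothness of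
  \<open>\<phi>\<close> and of \<open>\<psi>\<close> gives the two transition maps to any atlas
  chart. Charts adapted to a fibre product or a kernel are obtained this way.\<close>

lemma maximal_atlasI:
  assumes X: "premanifold X" and W: "openin (mtop X) W" "W \<subseteq> covered X" and O1: "openin (Euclidean_space N) O1"
    and s: "psmooth (submfd X W) (Rn N) \<phi>" "psmooth (submfd (Rn N) O1) X \<psi>"
    and inv: "\<And>p. p \<in> W \<Longrightarrow> \<phi> p \<in> O1 \<and> \<psi> (\<phi> p) = p" "\<And>x. x \<in> O1 \<Longrightarrow> \<psi> x \<in> W \<and> \<phi> (\<psi> x) = x"
  shows "(N, W, \<phi>) \<in> maximal_atlas X" "\<phi> ` W = O1"
proof -
  have cont: "continuous_map (subtopology (mtop X) W) (Euclidean_space N) \<phi>"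
    "continuous_map (subtopology (Euclidean_space N) O1) (mtop X) \<psi>"
    using psmoothD(3)[OF s(1)] psmoothD(3)[OF s(2)] by auto
  note I = is_chartI[OF W(1) O1 cont inv]
  have ch: "is_chart (mtop X) (N, W, \<phi>)" by (rule I(1)) assumption+
  show im: "\<phi> ` W = O1" using I(2) by simp
  have ii: "inv_into W \<phi> x = \<psi> x" if "x \<in> O1" for x using I(3) that by simp
  have OE: "O1 \<subseteq> EU N" using openin_subset[OF O1] .
  have "compatible (N, W, \<phi>) d" if d: "d \<in> atlas X" for d
  proof -
    obtain m V \<theta> where dd: "d = (m, V, \<theta>)" by (cases d)
    have chd: "is_chart (mtop X) (m, V, \<theta>)" using premanifold_chart[OF X d] dd by simp
    have oWV: "openin (mtop X) (W \<inter> V)" using W is_chartD(1)[OF chd] by blast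
    have o: "openin (Euclidean_space N) (\<phi> ` (W \<inter> V))" using oWV by (rule chart_image_open[OF ch]) auto
    have o': "openin (Euclidean_space m) (\<theta> ` (W \<inter> V))" using oWV by (rule chart_image_open[OF chd]) auto
    have c1: "(N, EU N \<inter> O1, \<lambda>x. x) \<in> atlas (submfd (Rn N) O1)"
      by (rule submfd_open_atlas[OF atlas_maximal]) (use O1 in auto)
    have "smooth_euclid N m ((\<lambda>x. x) ` (EU N \<inter> O1 \<inter> \<psi> -` V)) (\<theta> \<circ> \<psi> \<circ> inv_into (EU N \<inter> O1) (\<lambda>x. x))"
      using psmoothD(5)[OF s(2)] c1 d[unfolded dd] unfolding smooth_map_def by fastforce
    moreover have "(\<lambda>x. x) ` (EU N \<inter> O1 \<inter> \<psi> -` V) = \<phi> ` (W \<inter> V)"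
      using inv im OE by force
    ultimately have s1: "smooth_euclid N m (\<phi> ` (W \<inter> V)) (\<theta> \<circ> \<psi> \<circ> inv_into (EU N \<inter> O1) (\<lambda>x. x))" by simp
    have s2: "smooth_euclid N m (\<phi> ` (W \<inter> V)) (\<theta> \<circ> inv_into W \<phi>)"
    proof (rule smooth_euclid_cong[OF o _ s1])
      fix x assume "x \<in> \<phi> ` (W \<inter> V)"
      then have "x \<in> O1" "x \<in> EU N \<inter> O1" using im OE by auto
      then show "(\<theta> \<circ> \<psi> \<circ> inv_into (EU N \<inter> O1) (\<lambda>x. x)) x = (\<theta> \<circ> inv_into W \<phi>) x"
        by (simp add: inv_into_ident ii)
    qed
    have c2: "(m, V \<inter> W, \<theta>) \<in> atlas (submfd X W)"
      by (rule submfd_open_atlas[OF atlas_maximal[OF X] W(1) X]) (use d dd in simp)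
    have "smooth_euclid m N (\<theta> ` (V \<inter> W \<inter> \<phi> -` EU N)) ((\<lambda>x. x) \<circ> \<phi> \<circ> inv_into (V \<inter> W) \<theta>)"
      using psmoothD(5)[OF s(1)] c2 unfolding smooth_map_def by fastforce
    moreover have "V \<inter> W \<inter> \<phi> -` EU N = W \<inter> V" using inv(1) OE by auto
    ultimately have s3: "smooth_euclid m N (\<theta> ` (W \<inter> V)) ((\<lambda>x. x) \<circ> \<phi> \<circ> inv_into (V \<inter> W) \<theta>)" by simp
    have s4: "smooth_euclid m N (\<theta> ` (W \<inter> V)) (\<phi> \<circ> inv_into V \<theta>)"
    proof (rule smooth_euclid_cong[OF o' _ s3])
      fix x assume "x \<in> \<theta> ` (W \<inter> V)"
      then show "((\<lambda>x. x) \<circ> \<phi> \<circ> inv_into (V \<inter> W) \<theta>) x = (\<phi> \<circ> inv_into V \<theta>) x"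
        using inv_into_restrict[OF is_chartD(3)[OF chd], of "V \<inter> W" x] by (auto simp: Int_commute)
    qed
    show ?thesis using s2 s4 by (simp add: dd compatible_def)
  qed
  then show "(N, W, \<phi>) \<in> maximal_atlas X" using ch W(2) unfolding maximal_atlas_def by auto
qed

lemma second_countable_prod_topology:
  assumes "second_countable X" "second_countable Y"
  shows "second_countable (prod_topology X Y)"
proof -
  obtain A B where A: "countable A" "\<And>V. V \<in> A \<Longrightarrow> openin X V" "\<And>U x. openin X U \<Longrightarrow> x \<in> U \<Longrightarrow> \<exists>V\<in>A. x \<in> V \<and> V \<subseteq> U"
    and B: "countable B" "\<And>V. V \<in> B \<Longrightarrow> openin Y V" "\<And>U x. openin Y U \<Longrightarrow> x \<in> U \<Longrightarrow> \<exists>V\<in>B. x \<in> V \<and> V \<subseteq> U"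
    using assms unfolding second_countable_def by metis
  show ?thesis
    unfolding second_countable_def
  proof (intro exI[of _ "(\<lambda>(a, b). a \<times> b) ` (A \<times> B)"] conjI ballI allI impI)
    fix V assume "V \<in> (\<lambda>(a, b). a \<times> b) ` (A \<times> B)"
    then show "openin (prod_topology X Y) V" using A(2) B(2) by (auto simp: openin_prod_Times_iff)
  next
    fix U p assume U: "openin (prod_topology X Y) U \<and> p \<in> U"
    obtain x y where p: "p = (x, y)" by (cases p)
    then obtain S T where ST: "openin X S" "openin Y T" "x \<in> S" "y \<in> T" "S \<times> T \<subseteq> U"
      using U openin_prod_topology_alt by metis
    obtain a b where "a \<in> A" "x \<in> a" "a \<subseteq> S" "b \<in> B" "y \<in> b" "b \<subseteq> T"
      using A(3)[OF ST(1,3)] B(3)[OF ST(2,4)] by blast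
    then show "\<exists>V\<in>(\<lambda>(a, b). a \<times> b) ` (A \<times> B). p \<in> V \<and> V \<subseteq> U"
      using ST(5) p by (intro bexI[of _ "a \<times> b"]) auto
  qed (use A B in auto)
qed

lemma manifold_prod:
  assumes "manifold X" "manifold Y" shows "manifold (prod_mfd X Y)"
  using assms premanifold_prod[of X Y] 
  by (simp add: manifold_def premanifold_def Hausdorff_space_prod_topology second_countable_prod_topology covered_prod_mfd)

lemma manifold_submfd:
  assumes "manifold X" "covered (submfd X S) = pts (submfd X S)"
  shows "manifold (submfd X S)"
  using assms premanifold_submfd[of X S]
  by (simp add: manifold_def premanifold_def Hausdorff_space_subtopology second_countable_subtopology)

lemma psmooth_into_open:
  assumes f: "psmooth X Y f" and W: "openin (mtop Y) W" and fW: "\<And>x. x \<in> pts X \<Longrightarrow> f x \<in> W"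
  shows "psmooth X (submfd Y W) f"
proof (rule psmooth_into_submfd[OF f fW])
  fix x assume x: "x \<in> covered X"
  then have "x \<in> pts X" using covered_subset_pts[OF psmoothD(1)[OF f]] by blast
  then show "f x \<in> covered (submfd Y W)"
    using psmoothD(4)[OF f] x fW covered_submfd_open[OF psmoothD(2)[OF f] W] by auto
qed

lemma psmooth_chart_comp:
  assumes f: "psmooth X Y f" and c: "(n, U, \<phi>) \<in> maximal_atlas Y" and fU: "\<And>x. x \<in> pts X \<Longrightarrow> f x \<in> U"
  shows "psmooth X (Rn n) (\<lambda>x. \<phi> (f x))"
  using psmooth_comp[OF psmooth_into_open[OF f is_chartD(1)[OF maximal_atlasD(1)[OF c]] fU]
    psmooth_chart[OF psmoothD(2)[OF f] c]] by simp

lemma psmooth_chart_inv_comp: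
  assumes v: "psmooth X (Rn n) v" and Y: "premanifold Y" and c: "(n, U, \<phi>) \<in> maximal_atlas Y"
    and vU: "\<And>x. x \<in> pts X \<Longrightarrow> v x \<in> \<phi> ` U"
  shows "psmooth X Y (\<lambda>x. inv_into U \<phi> (v x))"
proof -
  have "openin (mtop (Rn n)) (\<phi> ` U)" using is_chartD(2)[OF maximal_atlasD(1)[OF c]] by simp
  from psmooth_comp[OF psmooth_into_open[OF v this vU] psmooth_chart_inv[OF Y c]] show ?thesis by simp
qed

lemma psmooth_join:
  assumes "psmooth X (Rn n) f" "psmooth X (Rn m) g"
  shows "psmooth X (Rn (n + m)) (\<lambda>x. join n (f x) (g x))"
proof (rule psmooth_RnI)
  fix j show "psmooth_real X (\<lambda>x. join n (f x) (g x) j)"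
    using assms[THEN psmooth_real_coord] by (cases "j < n") (auto simp: join_def)
qed (use psmoothD(1)[OF assms(1)] psmoothD(6)[OF assms(2)] in auto)

lemma psmooth_vtake:
  assumes "psmooth X (Rn m) f" shows "psmooth X (Rn n) (\<lambda>x. vtake n (f x))"
  by (rule psmooth_RnI) (use psmoothD(1)[OF assms] psmooth_real_coord[OF assms] in \<open>auto simp: vtake_def[abs_def] EU_iff\<close>)

lemma psmooth_vdrop:
  assumes "psmooth X (Rn (n + m)) f" shows "psmooth X (Rn m) (\<lambda>x. vdrop n (f x))"
  by (rule psmooth_RnI) (use psmoothD(1)[OF assms] psmooth_real_coord[OF assms] psmoothD(6)[OF assms] in \<open>auto simp: vdrop_def[abs_def] EU_iff\<close>)

lemma psmooth_Rn_add:
  assumes "psmooth X (Rn n) f" "psmooth X (Rn n) g"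
  shows "psmooth X (Rn n) (\<lambda>x i. f x i + g x i)"
  by (rule psmooth_RnI) (use psmoothD(1)[OF assms(1)] assms[THEN psmooth_real_coord] assms[THEN psmoothD(6)] 
    in \<open>auto simp: EU_iff intro: psmooth_real_add\<close>)

lemma psmooth_Rn_diff:
  assumes "psmooth X (Rn n) f" "psmooth X (Rn n) g"
  shows "psmooth X (Rn n) (\<lambda>x i. f x i - g x i)"
  by (rule psmooth_RnI) (use psmoothD(1)[OF assms(1)] assms[THEN psmooth_real_coord] assms[THEN psmoothD(6)] 
    in \<open>auto simp: EU_iff intro: psmooth_real_diff\<close>)

lemma psmooth_Rn_scale:
  assumes "psmooth X (Rn n) f"
  shows "psmooth X (Rn n) (\<lambda>x i. r * f x i)"
  by (rule psmooth_RnI) (use psmoothD(1)[OF assms(1)] assms[THEN psmooth_real_coord] assms[THEN psmoothD(6)] 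
    in \<open>auto simp: EU_iff intro: psmooth_real_mult psmooth_real_const\<close>)

lemma psmooth_Rn_zero: "premanifold X \<Longrightarrow> psmooth X (Rn n) (\<lambda>x i. 0)"
  by (rule psmooth_RnI) (auto simp: EU_iff intro: psmooth_real_const)

lemma preimage_open: "continuous_map T T' f \<Longrightarrow> openin T' V \<Longrightarrow> openin T {x \<in> topspace T. f x \<in> V}"
  by (rule openin_continuous_map_preimage)

section \<open>Vector bundles\<close>

text \<open>The diffeomorphism demanded by \<open>vector_bundle\<close>, split into its fibre part
  \<open>\<tau>\<close> and an explicit inverse \<open>\<sigma>\<close>, so that smooth maps into
  the total space can be written down with \<open>\<sigma>\<close>.\<close>

definition local_triv :: "('b, 'e) vbundle \<Rightarrow> 'b set \<Rightarrow> nat \<Rightarrow> ('e \<Rightarrow> nat \<Rightarrow> real) \<Rightarrow>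
    ('b \<Rightarrow> (nat \<Rightarrow> real) \<Rightarrow> 'e) \<Rightarrow> bool" where
  "local_triv E U k \<tau> \<sigma> \<longleftrightarrow> openin (mtop (base E)) U \<and>
     psmooth (submfd (tot E) {e \<in> pts (tot E). proj E e \<in> U}) (Rn k) \<tau> \<and>
     psmooth (prod_mfd (submfd (base E) U) (Rn k)) (tot E) (\<lambda>(y, v). \<sigma> y v) \<and>
     (\<forall>y\<in>U. \<forall>v\<in>EU k. \<sigma> y v \<in> fibre E y \<and> \<tau> (\<sigma> y v) = v) \<and>
     (\<forall>e\<in>pts (tot E). proj E e \<in> U \<longrightarrow> \<tau> e \<in> EU k \<and> \<sigma> (proj E e) (\<tau> e) = e) \<and>
     (\<forall>y\<in>U. \<forall>a\<in>fibre E y.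
        (\<forall>b\<in>fibre E y. \<tau> (vadd E a b) = (\<lambda>i. \<tau> a i + \<tau> b i)) \<and>
        (\<forall>r. \<tau> (vscale E r a) = (\<lambda>i. r * \<tau> a i)))"

lemma fibre_iff: "e \<in> fibre E x \<longleftrightarrow> e \<in> pts (tot E) \<and> proj E e = x"
  by (simp add: fibre_def)

lemma local_trivD:
  assumes "local_triv E U k \<tau> \<sigma>"
  shows "openin (mtop (base E)) U"
    "psmooth (submfd (tot E) {e \<in> pts (tot E). proj E e \<in> U}) (Rn k) \<tau>"
    "psmooth (prod_mfd (submfd (base E) U) (Rn k)) (tot E) (\<lambda>(y, v). \<sigma> y v)"
    "\<And>y v. y \<in> U \<Longrightarrow> v \<in> EU k \<Longrightarrow> \<sigma> y v \<in> pts (tot E)"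
    "\<And>y v. y \<in> U \<Longrightarrow> v \<in> EU k \<Longrightarrow> proj E (\<sigma> y v) = y"
    "\<And>y v. y \<in> U \<Longrightarrow> v \<in> EU k \<Longrightarrow> \<tau> (\<sigma> y v) = v"
    "\<And>e. e \<in> pts (tot E) \<Longrightarrow> proj E e \<in> U \<Longrightarrow> \<tau> e \<in> EU k"
    "\<And>e. e \<in> pts (tot E) \<Longrightarrow> proj E e \<in> U \<Longrightarrow> \<sigma> (proj E e) (\<tau> e) = e"
    "\<And>a b. a \<in> pts (tot E) \<Longrightarrow> b \<in> pts (tot E) \<Longrightarrow> proj E a = proj E b \<Longrightarrow> proj E a \<in> U \<Longrightarrow> 
       \<tau> (vadd E a b) = (\<lambda>i. \<tau> a i + \<tau> b i)"
    "\<And>a r. a \<in> pts (tot E) \<Longrightarrow> proj E a \<in> U \<Longrightarrow> \<tau> (vscale E r a) = (\<lambda>i. r * \<tau> a i)"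
  using assms by (auto simp: local_triv_def fibre_iff)

lemma proj_preimage_open:
  assumes "psmooth (tot E) (base E) (proj E)" "openin (mtop (base E)) U"
  shows "openin (mtop (tot E)) {e \<in> pts (tot E). proj E e \<in> U}"
  by (rule preimage_open[OF psmoothD(3)[OF assms(1)] assms(2)])

text \<open>Over a trivializing set all the spaces involved are covered by their charts, so the
  diffeomorphism of the definition is \<open>psmooth\<close> in both directions, and its inverse
  provides \<open>\<sigma>\<close>.\<close>

lemma vector_bundle_iff:
  "vector_bundle E \<longleftrightarrow> manifold (base E) \<and> manifold (tot E) \<and> psmooth (tot E) (base E) (proj E) \<and>
     (\<forall>x\<in>pts (base E). vector_space_fibre E x) \<and>
     (\<forall>x\<in>pts (base E). \<exists>U k \<tau> \<sigma>. x \<in> U \<and> local_triv E U k \<tau> \<sigma>)"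
proof -
  have *: "(openin (mtop (base E)) U \<and>
        diffeomorphism (submfd (tot E) {e \<in> pts (tot E). proj E e \<in> U})
          (prod_mfd (submfd (base E) U) (Rn k)) (\<lambda>e. (proj E e, \<tau> e)) \<and>
        (\<forall>y\<in>U. \<forall>a\<in>fibre E y.
           (\<forall>b\<in>fibre E y. \<tau> (vadd E a b) = (\<lambda>i. \<tau> a i + \<tau> b i)) \<and>
           (\<forall>r. \<tau> (vscale E r a) = (\<lambda>i. r * \<tau> a i)))) \<longleftrightarrow> (\<exists>\<sigma>. local_triv E U k \<tau> \<sigma>)"
    (is "?O \<and> ?D \<and> ?L \<longleftrightarrow> ?R")
    if m: "manifold (base E)" "manifold (tot E)" and p: "psmooth (tot E) (base E) (proj E)" for U k \<tau>
  proof (cases ?O)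
    case U: True
    let ?W = "{e \<in> pts (tot E). proj E e \<in> U}"
    let ?S = "submfd (tot E) ?W" and ?P = "prod_mfd (submfd (base E) U) (Rn k)"
    have W: "openin (mtop (tot E)) ?W" by (rule proj_preimage_open[OF p U])
    have pre: "premanifold ?S" "premanifold ?P" "premanifold (submfd (base E) U)"
      using m manifoldD by (auto intro!: premanifold_submfd premanifold_prod)
    have U': "U \<subseteq> pts (base E)" using openin_subset[OF U] .
    have cS: "covered ?S = pts ?S" "covered ?P = pts ?P"
      using covered_submfd_open[OF manifoldD(1)[OF m(1)] U] covered_submfd_open[OF manifoldD(1)[OF m(2)] W] m U
      by (auto simp: covered_prod_mfd manifoldD)
    have pS: "pts ?S = ?W" "pts ?P = U \<times> EU k" using U' by auto
    have projS: "psmooth ?S (submfd (base E) U) (proj E)"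
      by (rule psmooth_into_open[OF psmooth_submfd[OF p] U]) auto
    show ?thesis
    proof
      assume a: "?O \<and> ?D \<and> ?L"
      then have D: ?D and L: ?L by auto
      let ?f = "\<lambda>e. (proj E e, \<tau> e)"
      let ?g = "inv_into (pts ?S) ?f"
      have bij: "bij_betw ?f ?W (U \<times> EU k)" using D unfolding diffeomorphism_def pS by auto
      have f: "psmooth ?S ?P ?f" using D pre cS by (simp add: psmooth_full_iff diffeomorphism_def)
      have g: "psmooth ?P ?S ?g" using D pre cS by (simp add: psmooth_full_iff diffeomorphism_def)
      have g': "psmooth ?P (tot E) ?g"
        by (rule psmooth_comp[OF g psmooth_incl[OF manifoldD(1)[OF m(2)]]])
      have t: "psmooth ?S (Rn k) \<tau>" using psmooth_comp[OF f psmooth_snd] pre by simp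
      have gg: "?g (y, v) \<in> ?W \<and> ?f (?g (y, v)) = (y, v)" if "y \<in> U" "v \<in> EU k" for y v
        using bij that unfolding pS by (metis (no_types, lifting) SigmaI bij_betw_def f_inv_into_f inv_into_into)
      have gf: "?g (?f e) = e" if "e \<in> ?W" for e
        using bij that unfolding pS by (meson bij_betw_def inv_into_f_f)
      have "local_triv E U k \<tau> (\<lambda>y v. ?g (y, v))"
        unfolding local_triv_def
      proof (intro conjI ballI impI)
        show "psmooth ?P (tot E) (\<lambda>(y, v). ?g (y, v))" using g' by simp
        fix e assume "e \<in> pts (tot E)" "proj E e \<in> U"
        then show "\<tau> e \<in> EU k" "?g (proj E e, \<tau> e) = e" using gf bij bij_betwE by fastforce+
      next
        fix y v assume "y \<in> U" "v \<in> EU k"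
        from gg[OF this] show "?g (y, v) \<in> fibre E y" "\<tau> (?g (y, v)) = v" by (auto simp: fibre_iff)
      qed (use U t L in auto)
      then show ?R by blast
    next
      assume ?R
      then obtain \<sigma> where lt: "local_triv E U k \<tau> \<sigma>" by blast
      note T = local_trivD[OF lt]
      let ?f = "\<lambda>e. (proj E e, \<tau> e)"
      have f: "psmooth ?S ?P ?f" by (rule psmooth_pair[OF projS T(2)])
      have g: "psmooth ?P ?S (\<lambda>(y, v). \<sigma> y v)"
        by (rule psmooth_into_open[OF T(3) W]) (use T in auto)
      have bij: "bij_betw ?f (pts ?S) (pts ?P)"
        unfolding pS by (rule bij_betw_byWitness[where f' = "\<lambda>(y, v). \<sigma> y v"]) (use T in auto)
      have "inv_into (pts ?S) ?f z = (\<lambda>(y, v). \<sigma> y v) z" if "z \<in> pts ?P" for z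
      proof -
        have "(\<lambda>(y, v). \<sigma> y v) z \<in> pts ?S" "?f ((\<lambda>(y, v). \<sigma> y v) z) = z"
          using that T unfolding pS by auto
        then show ?thesis using bij by (metis (no_types, lifting) bij_betw_def inv_into_f_f)
      qed
      then have "psmooth ?P ?S (inv_into (pts ?S) ?f)" by (intro psmooth_cong[OF g]) simp
      then have ?D unfolding diffeomorphism_def using bij f by (simp add: psmooth_def)
      then show "?O \<and> ?D \<and> ?L" using U lt by (simp add: local_triv_def)
    qed
  qed (auto simp: local_triv_def)
  have pr: "psmooth (tot E) (base E) (proj E) \<longleftrightarrow> smooth_map (tot E) (base E) (proj E)"
    if "manifold (base E)" "manifold (tot E)"
    using that by (intro psmooth_full_iff manifoldD)
  show ?thesis
  proof (cases "manifold (base E) \<and> manifold (tot E) \<and> psmooth (tot E) (base E) (proj E)")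
    case True
    then have t: "manifold (base E)" "manifold (tot E)" "psmooth (tot E) (base E) (proj E)" by simp_all
    have "(\<exists>U k \<tau>. openin (mtop (base E)) U \<and> x \<in> U \<and>
        diffeomorphism (submfd (tot E) {e \<in> pts (tot E). proj E e \<in> U})
          (prod_mfd (submfd (base E) U) (Rn k)) (\<lambda>e. (proj E e, \<tau> e)) \<and>
        (\<forall>y\<in>U. \<forall>a\<in>fibre E y.
           (\<forall>b\<in>fibre E y. \<tau> (vadd E a b) = (\<lambda>i. \<tau> a i + \<tau> b i)) \<and>
           (\<forall>r. \<tau> (vscale E r a) = (\<lambda>i. r * \<tau> a i)))) \<longleftrightarrow>
        (\<exists>U k \<tau>. x \<in> U \<and> (\<exists>\<sigma>. local_triv E U k \<tau> \<sigma>))" for x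
      unfolding *[OF t, symmetric] by (intro iff_exI) (simp only: conj_left_commute)
    then show ?thesis
      unfolding vector_bundle_def using t pr by simp
  next
    case False
    then show ?thesis unfolding vector_bundle_def using pr by auto
  qed
qed

lemma vector_bundleD:
  assumes "vector_bundle E"
  shows "manifold (base E)" "manifold (tot E)" "psmooth (tot E) (base E) (proj E)"
    "premanifold (base E)" "premanifold (tot E)" "covered (base E) = pts (base E)" "covered (tot E) = pts (tot E)"
    "\<And>x. x \<in> pts (base E) \<Longrightarrow> vector_space_fibre E x"
    "\<And>e. e \<in> pts (tot E) \<Longrightarrow> proj E e \<in> pts (base E)"
proof -
  have *: "manifold (base E)" "manifold (tot E)" "psmooth (tot E) (base E) (proj E)"
    and v: "\<forall>x\<in>pts (base E). vector_space_fibre E x"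
    using assms unfolding vector_bundle_iff by simp_all
  then show "manifold (base E)" "manifold (tot E)" "psmooth (tot E) (base E) (proj E)" by simp_all
  show "premanifold (base E)" "premanifold (tot E)" "covered (base E) = pts (base E)" "covered (tot E) = pts (tot E)"
    using manifoldD[OF *(1)] manifoldD[OF *(2)] by simp_all
  show "\<And>x. x \<in> pts (base E) \<Longrightarrow> vector_space_fibre E x" using v by simp
  show "\<And>e. e \<in> pts (tot E) \<Longrightarrow> proj E e \<in> pts (base E)" by (rule psmoothD(6)[OF *(3)])
qed

lemma vector_bundle_triv:
  assumes "vector_bundle E" "x \<in> pts (base E)"
  obtains U k \<tau> \<sigma> where "x \<in> U" "local_triv E U k \<tau> \<sigma>"
  using assms unfolding vector_bundle_iff by blast

lemma psmooth_triv:
  assumes E: "vector_bundle E" and t: "local_triv E U k \<tau> \<sigma>" and f: "psmooth X (tot E) f"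
    and fU: "\<And>x. x \<in> pts X \<Longrightarrow> proj E (f x) \<in> U"
  shows "psmooth X (Rn k) (\<lambda>x. \<tau> (f x))"
  by (rule psmooth_comp[OF psmooth_into_open[OF f proj_preimage_open[OF vector_bundleD(3)[OF E] local_trivD(1)[OF t]]]
        local_trivD(2)[OF t]])
     (use fU psmoothD(6)[OF f] in auto)

lemma psmooth_triv_inv:
  assumes E: "vector_bundle E" and t: "local_triv E U k \<tau> \<sigma>" and a: "psmooth X (base E) a"
    and aU: "\<And>x. x \<in> pts X \<Longrightarrow> a x \<in> U" and v: "psmooth X (Rn k) v"
  shows "psmooth X (tot E) (\<lambda>x. \<sigma> (a x) (v x))"
  using psmooth_comp[OF psmooth_pair[OF psmooth_into_open[OF a local_trivD(1)[OF t] aU] v] local_trivD(3)[OF t]]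
  by simp

lemma vector_space_fibreD:
  assumes "vector_space_fibre E x"
  shows "vzero E x \<in> pts (tot E)" "proj E (vzero E x) = x"
    "\<And>a b. a \<in> pts (tot E) \<Longrightarrow> proj E a = x \<Longrightarrow> b \<in> pts (tot E) \<Longrightarrow> proj E b = x \<Longrightarrow>
       vadd E a b \<in> pts (tot E) \<and> proj E (vadd E a b) = x"
    "\<And>a. a \<in> pts (tot E) \<Longrightarrow> proj E a = x \<Longrightarrow> vadd E a (vneg E a) = vzero E x"
    "\<And>a r. a \<in> pts (tot E) \<Longrightarrow> proj E a = x \<Longrightarrow> vscale E r a \<in> pts (tot E) \<and> proj E (vscale E r a) = x"
    "\<And>a. a \<in> pts (tot E) \<Longrightarrow> proj E a = x \<Longrightarrow> vscale E 1 a = a"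
    "\<And>a r q. a \<in> pts (tot E) \<Longrightarrow> proj E a = x \<Longrightarrow> vscale E (r + q) a = vadd E (vscale E r a) (vscale E q a)"
  using assms unfolding vector_space_fibre_def fibre_def by auto

lemma vector_bundle_fibre_ops:
  assumes E: "vector_bundle E"
  shows "x \<in> pts (base E) \<Longrightarrow> vzero E x \<in> pts (tot E)" "x \<in> pts (base E) \<Longrightarrow> proj E (vzero E x) = x"
    "a \<in> pts (tot E) \<Longrightarrow> b \<in> pts (tot E) \<Longrightarrow> proj E a = proj E b \<Longrightarrow> vadd E a b \<in> pts (tot E)"
    "a \<in> pts (tot E) \<Longrightarrow> b \<in> pts (tot E) \<Longrightarrow> proj E a = proj E b \<Longrightarrow> proj E (vadd E a b) = proj E b"
    "a \<in> pts (tot E) \<Longrightarrow> vscale E r a \<in> pts (tot E)" "a \<in> pts (tot E) \<Longrightarrow> proj E (vscale E r a) = proj E a"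
    "a \<in> pts (tot E) \<Longrightarrow> vneg E a \<in> pts (tot E)" "a \<in> pts (tot E) \<Longrightarrow> proj E (vneg E a) = proj E a"
    "a \<in> pts (tot E) \<Longrightarrow> b \<in> pts (tot E) \<Longrightarrow> proj E a = proj E b \<Longrightarrow> vsub E a b \<in> pts (tot E)"
    "a \<in> pts (tot E) \<Longrightarrow> b \<in> pts (tot E) \<Longrightarrow> proj E a = proj E b \<Longrightarrow> proj E (vsub E a b) = proj E b"
proof -
  have v: "vector_space_fibre E (proj E a)" if "a \<in> pts (tot E)" for a
    using vector_bundleD(8,9)[OF E] that by blast
  show "x \<in> pts (base E) \<Longrightarrow> vzero E x \<in> pts (tot E)" "x \<in> pts (base E) \<Longrightarrow> proj E (vzero E x) = x"
    using vector_space_fibreD(1,2)[OF vector_bundleD(8)[OF E]] by auto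
  have add: "vadd E a b \<in> pts (tot E) \<and> proj E (vadd E a b) = proj E b"
    if "a \<in> pts (tot E)" "b \<in> pts (tot E)" "proj E a = proj E b" for a b
    using vector_space_fibreD(3)[OF v[OF that(2)] that(1,3,2) refl] .
  have sc: "vscale E r a \<in> pts (tot E) \<and> proj E (vscale E r a) = proj E a" if "a \<in> pts (tot E)" for a r
    using vector_space_fibreD(5)[OF v[OF that] that refl] .
  show "a \<in> pts (tot E) \<Longrightarrow> b \<in> pts (tot E) \<Longrightarrow> proj E a = proj E b \<Longrightarrow> vadd E a b \<in> pts (tot E)"
    "a \<in> pts (tot E) \<Longrightarrow> b \<in> pts (tot E) \<Longrightarrow> proj E a = proj E b \<Longrightarrow> proj E (vadd E a b) = proj E b"
    "a \<in> pts (tot E) \<Longrightarrow> vscale E r a \<in> pts (tot E)" "a \<in> pts (tot E) \<Longrightarrow> proj E (vscale E r a) = proj E a"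
    "a \<in> pts (tot E) \<Longrightarrow> vneg E a \<in> pts (tot E)" "a \<in> pts (tot E) \<Longrightarrow> proj E (vneg E a) = proj E a"
    "a \<in> pts (tot E) \<Longrightarrow> b \<in> pts (tot E) \<Longrightarrow> proj E a = proj E b \<Longrightarrow> vsub E a b \<in> pts (tot E)"
    "a \<in> pts (tot E) \<Longrightarrow> b \<in> pts (tot E) \<Longrightarrow> proj E a = proj E b \<Longrightarrow> proj E (vsub E a b) = proj E b"
    using add sc by (auto simp: vneg_def vsub_def)
qed

text \<open>Zero is \<open>a\<close> minus \<open>a\<close>, that is \<open>(1 - 1) a\<close>.
  Bundle maps are defined by compatibility with addition and scaling; this is how they come to
  respect zero vectors.\<close>

lemma vzero_eq_scale:
  assumes E: "vector_bundle E" and a: "a \<in> pts (tot E)"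
  shows "vzero E (proj E a) = vscale E 0 a"
proof -
  have v: "vector_space_fibre E (proj E a)" using vector_bundleD(8,9)[OF E] a by blast
  note d = vector_space_fibreD[OF v]
  have "vzero E (proj E a) = vadd E (vscale E 1 a) (vscale E (-1) a)"
    using d(4,6) a by (simp add: vneg_def)
  also have "\<dots> = vscale E (1 + -1) a"
    using d(7)[OF a refl, of 1 "-1"] by simp
  finally show ?thesis by simp
qed

lemma local_triv_zero:
  assumes E: "vector_bundle E" and t: "local_triv E U k \<tau> \<sigma>" and y: "y \<in> U"
  shows "\<tau> (vzero E y) = (\<lambda>i. 0)" "\<sigma> y (\<lambda>i. 0) = vzero E y"
proof -
  have "y \<in> pts (base E)" using openin_subset[OF local_trivD(1)[OF t]] y by blast
  note z = vector_bundle_fibre_ops(1,2)[OF E this]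
  show 1: "\<tau> (vzero E y) = (\<lambda>i. 0)"
    using local_trivD(10)[OF t z(1), of 0] z y vzero_eq_scale[OF E z(1)] by simp
  show "\<sigma> y (\<lambda>i. 0) = vzero E y"
    using local_trivD(8)[OF t z(1)] z y 1 by simp
qed

text \<open>The definition of a vector bundle states no smoothness of the fibre operations. It is
  recovered from the trivializations, in which addition is that of R^k.\<close>

lemma psmooth_vadd:
  assumes E: "vector_bundle E" and f: "psmooth X (tot E) f" and g: "psmooth X (tot E) g"
    and fg: "\<And>x. x \<in> pts X \<Longrightarrow> proj E (f x) = proj E (g x)"
  shows "psmooth X (tot E) (\<lambda>x. vadd E (f x) (g x))"
proof (rule psmooth_locally)
  note X = psmoothD(1)[OF f]
  show "premanifold X" by fact
  show "premanifold (tot E)" by (rule vector_bundleD(5)[OF E])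
  have pf: "psmooth X (base E) (\<lambda>x. proj E (f x))" by (rule psmooth_comp[OF f vector_bundleD(3)[OF E]])
  fix p assume p: "p \<in> pts X"
  obtain U k \<tau> \<sigma> where t: "proj E (f p) \<in> U" "local_triv E U k \<tau> \<sigma>"
    using vector_bundle_triv[OF E psmoothD(6)[OF pf p]] .
  let ?W = "{x \<in> pts X. proj E (f x) \<in> U}"
  have W: "openin (mtop X) ?W" by (rule preimage_open[OF psmoothD(3)[OF pf] local_trivD(1)[OF t(2)]])
  have "psmooth (submfd X ?W) (tot E) (\<lambda>x. \<sigma> (proj E (f x)) (\<lambda>i. \<tau> (f x) i + \<tau> (g x) i))"
    by (intro psmooth_triv_inv[OF E t(2)] psmooth_Rn_add psmooth_triv[OF E t(2)] psmooth_submfd f g pf)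
       (use fg in auto)
  then have "psmooth (submfd X ?W) (tot E) (\<lambda>x. vadd E (f x) (g x))"
  proof (rule psmooth_cong)
    fix x assume "x \<in> pts (submfd X ?W)"
    then have x: "x \<in> pts X" "proj E (f x) \<in> U" by auto
    note m = psmoothD(6)[OF f x(1)] psmoothD(6)[OF g x(1)]
    note o = vector_bundle_fibre_ops(3,4)[OF E m fg[OF x(1)]]
    show "\<sigma> (proj E (f x)) (\<lambda>i. \<tau> (f x) i + \<tau> (g x) i) = vadd E (f x) (g x)"
      using local_trivD(8)[OF t(2) o(1)] local_trivD(9)[OF t(2) m fg[OF x(1)] x(2)] o(2) x fg[OF x(1)] by simp
  qed
  then show "\<exists>W. openin (mtop X) W \<and> p \<in> W \<and> psmooth (submfd X W) (tot E) (\<lambda>x. vadd E (f x) (g x))"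
    using W p t(1) by blast
qed

lemma psmooth_vscale:
  assumes E: "vector_bundle E" and f: "psmooth X (tot E) f"
  shows "psmooth X (tot E) (\<lambda>x. vscale E r (f x))"
proof (rule psmooth_locally)
  note X = psmoothD(1)[OF f]
  show "premanifold X" by fact
  show "premanifold (tot E)" by (rule vector_bundleD(5)[OF E])
  have pf: "psmooth X (base E) (\<lambda>x. proj E (f x))" by (rule psmooth_comp[OF f vector_bundleD(3)[OF E]])
  fix p assume p: "p \<in> pts X"
  obtain U k \<tau> \<sigma> where t: "proj E (f p) \<in> U" "local_triv E U k \<tau> \<sigma>"
    using vector_bundle_triv[OF E psmoothD(6)[OF pf p]] .
  let ?W = "{x \<in> pts X. proj E (f x) \<in> U}"
  have W: "openin (mtop X) ?W" by (rule preimage_open[OF psmoothD(3)[OF pf] local_trivD(1)[OF t(2)]])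
  have "psmooth (submfd X ?W) (tot E) (\<lambda>x. \<sigma> (proj E (f x)) (\<lambda>i. r * \<tau> (f x) i))"
    by (intro psmooth_triv_inv[OF E t(2)] psmooth_Rn_scale psmooth_triv[OF E t(2)] psmooth_submfd f pf) auto
  then have "psmooth (submfd X ?W) (tot E) (\<lambda>x. vscale E r (f x))"
  proof (rule psmooth_cong)
    fix x assume "x \<in> pts (submfd X ?W)"
    then have x: "x \<in> pts X" "proj E (f x) \<in> U" by auto
    note m = psmoothD(6)[OF f x(1)]
    note o = vector_bundle_fibre_ops(5,6)[OF E m]
    show "\<sigma> (proj E (f x)) (\<lambda>i. r * \<tau> (f x) i) = vscale E r (f x)"
      using local_trivD(8)[OF t(2) o(1)] local_trivD(10)[OF t(2) m x(2)] o(2) x by simp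
  qed
  then show "\<exists>W. openin (mtop X) W \<and> p \<in> W \<and> psmooth (submfd X W) (tot E) (\<lambda>x. vscale E r (f x))"
    using W p t(1) by blast
qed

lemma psmooth_vzero:
  assumes E: "vector_bundle E" and a: "psmooth X (base E) a"
  shows "psmooth X (tot E) (\<lambda>x. vzero E (a x))"
proof (rule psmooth_locally)
  note X = psmoothD(1)[OF a]
  show "premanifold X" by fact
  show "premanifold (tot E)" by (rule vector_bundleD(5)[OF E])
  fix p assume p: "p \<in> pts X"
  obtain U k \<tau> \<sigma> where t: "a p \<in> U" "local_triv E U k \<tau> \<sigma>"
    using vector_bundle_triv[OF E psmoothD(6)[OF a p]] .
  let ?W = "{x \<in> pts X. a x \<in> U}"
  have W: "openin (mtop X) ?W" by (rule preimage_open[OF psmoothD(3)[OF a] local_trivD(1)[OF t(2)]])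
  have "psmooth (submfd X ?W) (tot E) (\<lambda>x. \<sigma> (a x) (\<lambda>i. 0))"
    by (intro psmooth_triv_inv[OF E t(2)] psmooth_Rn_zero psmooth_submfd a premanifold_submfd X) auto
  then have "psmooth (submfd X ?W) (tot E) (\<lambda>x. vzero E (a x))"
    by (rule psmooth_cong) (use local_triv_zero(2)[OF E t(2)] in auto)
  then show "\<exists>W. openin (mtop X) W \<and> p \<in> W \<and> psmooth (submfd X W) (tot E) (\<lambda>x. vzero E (a x))"
    using W p t(1) by blast
qed

subsection \<open>Fibre products along a vector bundle\<close>

lemma pts_fibre_prod [simp]: "pts (fibre_prod X f Y g) = {(x, y). x \<in> pts X \<and> y \<in> pts Y \<and> f x = g y}"
  by (auto simp: fibre_prod_def)

lemma premanifold_fibre_prod: "premanifold X \<Longrightarrow> premanifold Y \<Longrightarrow> premanifold (fibre_prod X f Y g)"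
  by (simp add: fibre_prod_def premanifold_submfd premanifold_prod)

lemma psmooth_fibre_prod_fst: "premanifold X \<Longrightarrow> premanifold Y \<Longrightarrow> psmooth (fibre_prod X f Y g) X fst"
  by (simp add: fibre_prod_def psmooth_submfd psmooth_fst)

lemma psmooth_fibre_prod_snd: "premanifold X \<Longrightarrow> premanifold Y \<Longrightarrow> psmooth (fibre_prod X f Y g) Y snd"
  by (simp add: fibre_prod_def psmooth_submfd psmooth_snd)

text \<open>The fibre product is a graph over \<open>X\<close> in a trivialization, so straightening the graph gives
  slice charts.\<close>

lemma covered_fibre_prod:
  assumes X: "premanifold X" and E: "vector_bundle E" and a: "psmooth X (base E) a"
  shows "covered (fibre_prod X a (tot E) (proj E)) = {(x, e). x \<in> covered X \<and> e \<in> pts (tot E) \<and> a x = proj E e}"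
proof -
  let ?P = "prod_mfd X (tot E)" and ?S = "{(x, e). x \<in> pts X \<and> e \<in> pts (tot E) \<and> a x = proj E e}"
  note EB = vector_bundleD[OF E]
  have P: "premanifold ?P" by (rule premanifold_prod[OF X EB(5)])
  have "covered (submfd ?P ?S) \<subseteq> covered ?P" "covered (submfd ?P ?S) \<subseteq> pts (submfd ?P ?S)"
    using psmoothD(4)[OF psmooth_incl[OF P]] covered_subset_pts[OF premanifold_submfd[OF P]] by auto
  then have sub: "covered (submfd ?P ?S) \<subseteq> {(x, e). x \<in> covered X \<and> e \<in> pts (tot E) \<and> a x = proj E e}"
    by (auto simp: covered_prod_mfd)
  have "(x0, e0) \<in> covered (submfd ?P ?S)" if p: "x0 \<in> covered X" "e0 \<in> pts (tot E)" "a x0 = proj E e0" for x0 e0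
  proof -
    obtain n U \<phi> where c: "(n, U, \<phi>) \<in> atlas X" "x0 \<in> U" using p(1) by (rule coveredE)
    have "proj E e0 \<in> covered (base E)" using EB(6,9) p by simp
    then obtain m V \<psi> where d: "(m, V, \<psi>) \<in> atlas (base E)" "proj E e0 \<in> V" by (rule coveredE)
    obtain U' k \<tau> \<sigma> where t: "proj E e0 \<in> U'" "local_triv E U' k \<tau> \<sigma>"
      using vector_bundle_triv[OF E EB(9)[OF p(2)]] .
    note T = local_trivD[OF t(2)]
    note cm = atlas_maximal[OF X c(1)] and dm = atlas_maximal[OF EB(4) d(1)]
    note C = is_chartD[OF maximal_atlasD(1)[OF cm]] and D = is_chartD[OF maximal_atlasD(1)[OF dm]]
    define B where "B = V \<inter> U'"
    have oB: "openin (mtop (base E)) B" unfolding B_def using D(1) T(1) by blast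
    define A where "A = U \<inter> a -` B"
    have oA: "openin (mtop X) A" unfolding A_def by (rule continuous_preimage_open[OF psmoothD(3)[OF a] C(1) oB])
    have Am: "(n, A, \<phi>) \<in> maximal_atlas X" by (rule maximal_atlas_restrict[OF cm oA _ X]) (auto simp: A_def)
    have Bm: "(m, B, \<psi>) \<in> maximal_atlas (base E)" by (rule maximal_atlas_restrict[OF dm oB _ EB(4)]) (auto simp: B_def)
    note CA = is_chartD[OF maximal_atlasD(1)[OF Am]] and CB = is_chartD[OF maximal_atlasD(1)[OF Bm]]
    define W where "W = A \<times> {e \<in> pts (tot E). proj E e \<in> B}"
    have oW: "openin (mtop ?P) W"
      using oA proj_preimage_open[OF EB(3) oB] by (simp add: W_def openin_prod_Times_iff)
    have WP: "W \<subseteq> covered ?P"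
      using maximal_atlasD(2)[OF Am] EB(7) by (auto simp: W_def covered_prod_mfd)
    \<comment> \<open>The last block compares the two base points in the chart
      \<open>\<psi>\<close>. It vanishes exactly on the fibre product, which therefore becomes the
      slice R^(n+k).\<close>
    define \<Phi> where "\<Phi> = (\<lambda>p. join n (\<phi> (fst p)) (join k (\<tau> (snd p)) (\<lambda>i. \<psi> (proj E (snd p)) i - \<psi> (a (fst p)) i)))"
    \<comment> \<open>Adding \<open>\<psi> (a x)\<close> back to the last block recovers the base
      coordinates of the bundle point.\<close>
    define h where "h = (\<lambda>w i. vdrop k (vdrop n w) i + \<psi> (a (inv_into A \<phi> (vtake n w))) i)"
    define \<Psi> where "\<Psi> = (\<lambda>w. (inv_into A \<phi> (vtake n w), \<sigma> (inv_into B \<psi> (h w)) (vtake k (vdrop n w))))"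
    define N where "N = n + (k + m)"
    \<comment> \<open>The image is described in two stages: \<open>h\<close> makes sense where the
      first block lies in the image of the chart of \<open>X\<close>, and its continuity there shows
      that \<open>O1\<close> is open.\<close>
    define Oa where "Oa = {w \<in> EU N. vtake n w \<in> \<phi> ` A}"
    have oOa: "openin (mtop (Rn N)) Oa"
      unfolding Oa_def Rn_simps by (rule preimage_open[OF continuous_map_vtake CA(2)])
    have idR: "psmooth (submfd (Rn N) S) (Rn N) (\<lambda>w. w)" for S by (rule psmooth_incl) simp
    have x1: "psmooth (submfd (Rn N) S) X (\<lambda>w. inv_into A \<phi> (vtake n w))" if "S \<subseteq> Oa" for S
      by (rule psmooth_chart_inv_comp[OF psmooth_vtake[OF idR] X Am]) (use that in \<open>auto simp: Oa_def\<close>)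
    have hs: "psmooth (submfd (Rn N) S) (Rn m) h" if "S \<subseteq> Oa" for S
      unfolding h_def
    proof (intro psmooth_Rn_add)
      show "psmooth (submfd (Rn N) S) (Rn m) (\<lambda>w. vdrop k (vdrop n w))"
        by (intro psmooth_vdrop) (use idR[of S] in \<open>simp add: N_def\<close>)
      show "psmooth (submfd (Rn N) S) (Rn m) (\<lambda>w. \<psi> (a (inv_into A \<phi> (vtake n w))))"
        by (rule psmooth_chart_comp[OF psmooth_comp[OF x1[OF that] a] Bm])
           (use that CA(3) in \<open>auto simp: Oa_def inv_into_f_f A_def\<close>)
    qed
    define O1 where "O1 = {w \<in> Oa. h w \<in> \<psi> ` B}"
    have "openin (subtopology (Euclidean_space N) Oa) {w \<in> topspace (subtopology (Euclidean_space N) Oa). h w \<in> \<psi> ` B}"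
      using preimage_open[OF psmoothD(3)[OF hs[OF order_refl]]] CB(2) by simp
    moreover have "{w \<in> topspace (subtopology (Euclidean_space N) Oa). h w \<in> \<psi> ` B} = O1"
      by (auto simp: O1_def Oa_def)
    ultimately have oO: "openin (Euclidean_space N) O1"
      using oOa openin_open_subtopology by (metis Rn_simps(1))
    have O1a: "O1 \<subseteq> Oa" by (auto simp: O1_def)
    have incW: "psmooth (submfd ?P W) X fst" "psmooth (submfd ?P W) (tot E) snd"
      using psmooth_fst[OF X EB(5)] psmooth_snd[OF X EB(5)] by (auto intro: psmooth_submfd)
    have s1: "psmooth (submfd ?P W) (Rn N) \<Phi>"
      unfolding \<Phi>_def N_def
      by (intro psmooth_join psmooth_Rn_diff psmooth_chart_comp[OF incW(1) Am] psmooth_triv[OF E t(2) incW(2)]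
          psmooth_chart_comp[OF psmooth_comp[OF incW(2) EB(3)] Bm] psmooth_chart_comp[OF psmooth_comp[OF incW(1) a] Bm])
         (auto simp: W_def A_def B_def)
    have s2: "psmooth (submfd (Rn N) O1) ?P \<Psi>"
      unfolding \<Psi>_def
    proof (intro psmooth_pair x1[OF O1a] psmooth_triv_inv[OF E t(2)] psmooth_chart_inv_comp[OF hs[OF O1a] EB(4) Bm] psmooth_vtake)
      show "psmooth (submfd (Rn N) O1) (Rn (k + m)) (vdrop n)"
        using psmooth_vdrop[of _ n "k + m" "\<lambda>w. w"] idR[of O1] by (simp add: N_def)
    qed (auto simp: O1_def inv_into_f_f CB(3), auto simp: B_def)
    have i1: "\<Phi> p \<in> O1 \<and> \<Psi> (\<Phi> p) = p" if pW: "p \<in> W" for p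
    proof -
      obtain x e where p: "p = (x, e)" "x \<in> A" "e \<in> pts (tot E)" "proj E e \<in> B" using pW by (auto simp: W_def)
      have EUs: "\<phi> x \<in> EU n" "\<tau> e \<in> EU k" "\<psi> (proj E e) \<in> EU m" "\<psi> (a x) \<in> EU m"
        using p CA(4) CB(4) T(7) by (auto simp: A_def B_def)
      have df: "(\<lambda>i. \<psi> (proj E e) i - \<psi> (a x) i) \<in> EU m" using EUs by (auto simp: EU_iff)
      have hp: "h (\<Phi> p) = \<psi> (proj E e)"
        using p EUs CA(3) by (auto simp: h_def \<Phi>_def inv_into_f_f)
      show ?thesis
        using p EUs df hp CA(3) CB(3) T(8)
        by (auto simp: O1_def Oa_def \<Psi>_def N_def inv_into_f_f) (auto simp: \<Phi>_def B_def inv_into_f_f)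
    qed
    have i2: "\<Psi> w \<in> W \<and> \<Phi> (\<Psi> w) = w" if "w \<in> O1" for w
    proof -
      have w: "w \<in> EU N" "vtake n w \<in> \<phi> ` A" "h w \<in> \<psi> ` B" using that by (auto simp: O1_def Oa_def)
      let ?x = "inv_into A \<phi> (vtake n w)" and ?b = "inv_into B \<psi> (h w)"
      have x: "?x \<in> A" "\<phi> ?x = vtake n w" and b: "?b \<in> B" "\<psi> ?b = h w"
        using w by (auto simp: f_inv_into_f inv_into_into)
      have e: "\<sigma> ?b (vtake k (vdrop n w)) \<in> pts (tot E)" "proj E (\<sigma> ?b (vtake k (vdrop n w))) = ?b"
        "\<tau> (\<sigma> ?b (vtake k (vdrop n w))) = vtake k (vdrop n w)"
        using T(4-6)[of ?b "vtake k (vdrop n w)"] b by (auto simp: B_def)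
      have "(\<lambda>i. h w i - \<psi> (a ?x) i) = vdrop k (vdrop n w)" by (simp add: h_def)
      then show ?thesis using x b e by (simp add: W_def \<Psi>_def \<Phi>_def)
    qed
    have max: "(N, W, \<Phi>) \<in> maximal_atlas ?P" "\<Phi> ` W = O1"
      using maximal_atlasI[OF P oW WP oO s1 s2 i1 i2] by auto
    have sl: "\<Phi> p \<in> EU (n + k) \<longleftrightarrow> p \<in> ?S" if pW: "p \<in> W" for p
    proof -
      obtain x e where p: "p = (x, e)" "x \<in> A" "e \<in> pts (tot E)" "proj E e \<in> B" using pW by (auto simp: W_def)
      have EUs: "\<psi> (proj E e) \<in> EU m" "\<psi> (a x) \<in> EU m"
        using p CB(4) by (auto simp: A_def)
      have "\<Phi> p \<in> EU (n + k) \<longleftrightarrow> (\<forall>i. \<psi> (proj E e) i - \<psi> (a x) i = 0)"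
      proof
        assume l: "\<Phi> p \<in> EU (n + k)"
        show "\<forall>i. \<psi> (proj E e) i - \<psi> (a x) i = 0"
        proof
          fix i have "\<Phi> p (n + (k + i)) = 0" using l by (auto simp: EU_iff)
          then show "\<psi> (proj E e) i - \<psi> (a x) i = 0" by (simp add: \<Phi>_def join_def p)
        qed
      next
        assume "\<forall>i. \<psi> (proj E e) i - \<psi> (a x) i = 0"
        then show "\<Phi> p \<in> EU (n + k)" by (auto simp: \<Phi>_def join_def p EU_iff)
      qed
      also have "\<dots> \<longleftrightarrow> \<psi> (proj E e) = \<psi> (a x)" by (auto simp: fun_eq_iff)
      also have "\<dots> \<longleftrightarrow> proj E e = a x" using CB(3) p by (auto simp: inj_on_eq_iff A_def)
      also have "\<dots> \<longleftrightarrow> p \<in> ?S" using p CA(5) by auto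
      finally show ?thesis .
    qed
    have "(n + k, W \<inter> ?S, \<Phi>) \<in> atlas (submfd ?P ?S)"
      by (rule submfd_atlasI[OF _ max(1)]) (use sl in \<open>auto simp: N_def\<close>)
    moreover have "(x0, e0) \<in> W \<inter> ?S"
      using p c d t C(5) by (auto simp: W_def A_def B_def)
    ultimately show ?thesis by (rule coveredI)
  qed
  then show ?thesis using sub unfolding fibre_prod_def by auto
qed

text \<open>The universal property of the fibre product along a bundle projection; the covered
  region computed above provides the slice charts at the image points.\<close>

lemma psmooth_fibre_prod_pair:
  assumes E: "vector_bundle E" and a: "psmooth X (base E) a" and f: "psmooth Z X f" and h: "psmooth Z (tot E) h"
    and fh: "\<And>z. z \<in> pts Z \<Longrightarrow> a (f z) = proj E (h z)"
  shows "psmooth Z (fibre_prod X a (tot E) (proj E)) (\<lambda>z. (f z, h z))"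
proof -
  have "(f z, h z) \<in> covered (fibre_prod X a (tot E) (proj E))" if "z \<in> covered Z" for z
  proof -
    have z: "z \<in> pts Z" using that covered_subset_pts[OF psmoothD(1)[OF f]] by blast
    show ?thesis using that psmoothD(4)[OF f] psmoothD(6)[OF h z] fh[OF z]
      by (auto simp: covered_fibre_prod[OF psmoothD(1)[OF a] E a])
  qed
  then show ?thesis
    using psmoothD(6)[OF f] psmoothD(6)[OF h] fh unfolding fibre_prod_def
    by (intro psmooth_into_submfd[OF psmooth_pair[OF f h]]) auto
qed

subsection \<open>Fibre coordinates\<close>

text \<open>A fibrewise linear and injective map to sequences. It reduces identities in the fibres to
  identities between real numbers.\<close>

definition coord :: "('b, 'e) vbundle \<Rightarrow> 'e \<Rightarrow> nat \<Rightarrow> real" where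
  "coord E = (SOME c. \<forall>x\<in>pts (base E). inj_on c (fibre E x) \<and>
     (\<forall>a\<in>fibre E x. (\<forall>b\<in>fibre E x. c (vadd E a b) = (\<lambda>i. c a i + c b i)) \<and>
        (\<forall>r. c (vscale E r a) = (\<lambda>i. r * c a i))))"

lemma coord_spec:
  assumes E: "vector_bundle E" and x: "x \<in> pts (base E)"
  shows "inj_on (coord E) (fibre E x)"
    "a \<in> fibre E x \<Longrightarrow> b \<in> fibre E x \<Longrightarrow> coord E (vadd E a b) = (\<lambda>i. coord E a i + coord E b i)"
    "a \<in> fibre E x \<Longrightarrow> coord E (vscale E r a) = (\<lambda>i. r * coord E a i)"
proof -
  have "\<exists>c :: _ \<Rightarrow> nat \<Rightarrow> real. inj_on c (fibre E x) \<and>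
     (\<forall>a\<in>fibre E x. (\<forall>b\<in>fibre E x. c (vadd E a b) = (\<lambda>i. c a i + c b i)) \<and>
        (\<forall>r. c (vscale E r a) = (\<lambda>i. r * c a i)))" if xb: "x \<in> pts (base E)" for x
  proof -
    obtain U k \<tau> \<sigma> where t: "x \<in> U" "local_triv E U k \<tau> \<sigma>" using vector_bundle_triv[OF E xb] .
    note T = local_trivD[OF t(2)]
    have "inj_on \<tau> (fibre E x)"
    proof (rule inj_onI)
      fix a b assume ab: "a \<in> fibre E x" "b \<in> fibre E x" and eq: "\<tau> a = \<tau> b"
      have "\<sigma> x (\<tau> e) = e" if "e \<in> fibre E x" for e using T(8)[of e] t(1) that by (simp add: fibre_def)
      from this[OF ab(1)] this[OF ab(2)] show "a = b" unfolding eq by (rule trans[OF sym])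
    qed
    moreover have "\<tau> (vadd E a b) = (\<lambda>i. \<tau> a i + \<tau> b i)" if "a \<in> fibre E x" "b \<in> fibre E x" for a b
      using T(9)[of a b] t(1) that by (simp add: fibre_def)
    moreover have "\<tau> (vscale E r a) = (\<lambda>i. r * \<tau> a i)" if "a \<in> fibre E x" for a r
      using T(10)[of a r] t(1) that by (simp add: fibre_def)
    ultimately show ?thesis by (intro exI[of _ \<tau>]) simp
  qed
  then have "\<forall>x\<in>pts (base E). \<exists>c :: _ \<Rightarrow> nat \<Rightarrow> real. inj_on c (fibre E x) \<and>
     (\<forall>a\<in>fibre E x. (\<forall>b\<in>fibre E x. c (vadd E a b) = (\<lambda>i. c a i + c b i)) \<and>
        (\<forall>r. c (vscale E r a) = (\<lambda>i. r * c a i)))" ..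
  from bchoice[OF this] obtain C :: "_ \<Rightarrow> _ \<Rightarrow> nat \<Rightarrow> real" where "\<forall>x\<in>pts (base E). inj_on (C x) (fibre E x) \<and>
     (\<forall>a\<in>fibre E x. (\<forall>b\<in>fibre E x. C x (vadd E a b) = (\<lambda>i. C x a i + C x b i)) \<and>
        (\<forall>r. C x (vscale E r a) = (\<lambda>i. r * C x a i)))" ..
  then have C: "\<And>x. x \<in> pts (base E) \<Longrightarrow> inj_on (C x) (fibre E x) \<and>
     (\<forall>a\<in>fibre E x. (\<forall>b\<in>fibre E x. C x (vadd E a b) = (\<lambda>i. C x a i + C x b i)) \<and>
        (\<forall>r. C x (vscale E r a) = (\<lambda>i. r * C x a i)))" ..
  \<comment> \<open>A fibrewise coordinate map has been chosen at each base point. The base point of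
    a vector selects the one to apply to it, which gives a single function on the total
    space.\<close>
  have "\<exists>c :: _ \<Rightarrow> nat \<Rightarrow> real. \<forall>x\<in>pts (base E). inj_on c (fibre E x) \<and>
     (\<forall>a\<in>fibre E x. (\<forall>b\<in>fibre E x. c (vadd E a b) = (\<lambda>i. c a i + c b i)) \<and>
        (\<forall>r. c (vscale E r a) = (\<lambda>i. r * c a i)))"
  proof (intro exI[of _ "\<lambda>e. C (proj E e) e"] ballI)
    fix x assume x: "x \<in> pts (base E)"
    have ops: "vadd E a b \<in> fibre E x" "vscale E r a \<in> fibre E x" if "a \<in> fibre E x" "b \<in> fibre E x" for a b r
      using vector_bundle_fibre_ops[OF E] that unfolding fibre_def by auto
    have p: "proj E a = x" if "a \<in> fibre E x" for a using that by (simp add: fibre_def)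
    have "inj_on (\<lambda>e. C (proj E e) e) (fibre E x)" using C[OF x] by (simp add: inj_on_def p)
    then show "inj_on (\<lambda>e. C (proj E e) e) (fibre E x) \<and>
       (\<forall>a\<in>fibre E x. (\<forall>b\<in>fibre E x. C (proj E (vadd E a b)) (vadd E a b) = (\<lambda>i. C (proj E a) a i + C (proj E b) b i)) \<and>
        (\<forall>r. C (proj E (vscale E r a)) (vscale E r a) = (\<lambda>i. r * C (proj E a) a i)))"
      using C[OF x] by (simp add: p ops)
  qed
  from someI_ex[OF this, folded coord_def] x
  show "inj_on (coord E) (fibre E x)"
    "a \<in> fibre E x \<Longrightarrow> b \<in> fibre E x \<Longrightarrow> coord E (vadd E a b) = (\<lambda>i. coord E a i + coord E b i)"
    "a \<in> fibre E x \<Longrightarrow> coord E (vscale E r a) = (\<lambda>i. r * coord E a i)"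
    by auto
qed

lemma coord_eqI:
  assumes E: "vector_bundle E" and "a \<in> pts (tot E)" "b \<in> pts (tot E)" "proj E a = proj E b"
    "\<And>i. coord E a i = coord E b i"
  shows "a = b"
  using coord_spec(1)[OF E vector_bundleD(9)[OF E assms(2)]] assms by (auto simp: inj_on_def fibre_def fun_eq_iff)

lemma coord_ops:
  assumes E: "vector_bundle E"
  shows "a \<in> pts (tot E) \<Longrightarrow> b \<in> pts (tot E) \<Longrightarrow> proj E a = proj E b \<Longrightarrow> coord E (vadd E a b) i = coord E a i + coord E b i"
    "a \<in> pts (tot E) \<Longrightarrow> coord E (vscale E r a) i = r * coord E a i"
    "a \<in> pts (tot E) \<Longrightarrow> coord E (vneg E a) i = - coord E a i"
    "a \<in> pts (tot E) \<Longrightarrow> b \<in> pts (tot E) \<Longrightarrow> proj E a = proj E b \<Longrightarrow> coord E (vsub E a b) i = coord E a i - coord E b i"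
    "x \<in> pts (base E) \<Longrightarrow> coord E (vzero E x) i = 0"
proof -
  note B = vector_bundleD(9)[OF E]
  note O = vector_bundle_fibre_ops[OF E]
  have add: "coord E (vadd E a b) i = coord E a i + coord E b i" if "a \<in> pts (tot E)" "b \<in> pts (tot E)" "proj E a = proj E b" for a b
    using coord_spec(2)[OF E B[OF that(1)], of a b] that by (simp add: fibre_def)
  have sc: "coord E (vscale E r a) i = r * coord E a i" if "a \<in> pts (tot E)" for a r
    using coord_spec(3)[OF E B[OF that], of a r] that by (simp add: fibre_def)
  show "a \<in> pts (tot E) \<Longrightarrow> b \<in> pts (tot E) \<Longrightarrow> proj E a = proj E b \<Longrightarrow> coord E (vadd E a b) i = coord E a i + coord E b i"
    "a \<in> pts (tot E) \<Longrightarrow> coord E (vscale E r a) i = r * coord E a i"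
    "a \<in> pts (tot E) \<Longrightarrow> coord E (vneg E a) i = - coord E a i"
    using add sc by (auto simp: vneg_def)
  show "a \<in> pts (tot E) \<Longrightarrow> b \<in> pts (tot E) \<Longrightarrow> proj E a = proj E b \<Longrightarrow> coord E (vsub E a b) i = coord E a i - coord E b i"
    using add sc O(5,6) by (simp add: vsub_def vneg_def)
  show "coord E (vzero E x) i = 0" if x: "x \<in> pts (base E)"
    using sc[OF O(1)[OF x], of 0] vzero_eq_scale[OF E O(1)[OF x]] O(2)[OF x] by simp
qed

subsection \<open>Vector bundle maps\<close>

text \<open>The part of the structure of a vector bundle that its pullbacks share in general.\<close>

definition prebundle :: "('b, 'e) vbundle \<Rightarrow> bool" where
  "prebundle E \<longleftrightarrow> premanifold (base E) \<and> psmooth (tot E) (base E) (proj E) \<and>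
     (\<forall>a\<in>pts (tot E). (\<forall>b\<in>pts (tot E). proj E a = proj E b \<longrightarrow> vadd E a b \<in> pts (tot E) \<and> proj E (vadd E a b) = proj E b) \<and>
        (\<forall>r. vscale E r a \<in> pts (tot E) \<and> proj E (vscale E r a) = proj E a))"

lemma prebundleD:
  assumes "prebundle E"
  shows "premanifold (base E)" "premanifold (tot E)" "psmooth (tot E) (base E) (proj E)"
    "a \<in> pts (tot E) \<Longrightarrow> b \<in> pts (tot E) \<Longrightarrow> proj E a = proj E b \<Longrightarrow> vadd E a b \<in> pts (tot E)"
    "a \<in> pts (tot E) \<Longrightarrow> b \<in> pts (tot E) \<Longrightarrow> proj E a = proj E b \<Longrightarrow> proj E (vadd E a b) = proj E b"
    "a \<in> pts (tot E) \<Longrightarrow> vscale E r a \<in> pts (tot E)" "a \<in> pts (tot E) \<Longrightarrow> proj E (vscale E r a) = proj E a"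
    "a \<in> pts (tot E) \<Longrightarrow> proj E a \<in> pts (base E)"
proof -
  show p: "psmooth (tot E) (base E) (proj E)" using assms by (simp add: prebundle_def)
  show "premanifold (base E)" "premanifold (tot E)" using assms psmoothD(1)[OF p] by (auto simp: prebundle_def)
  show "a \<in> pts (tot E) \<Longrightarrow> proj E a \<in> pts (base E)" by (rule psmoothD(6)[OF p])
qed (use assms in \<open>auto simp: prebundle_def\<close>)

lemma prebundle_vector_bundle: "vector_bundle E \<Longrightarrow> prebundle E"
  unfolding prebundle_def using vector_bundleD(3,4) vector_bundle_fibre_ops(3-6) by auto

lemma pullback_vb_simps [simp]:
  "base (pullback_vb P a E) = P" "tot (pullback_vb P a E) = fibre_prod P a (tot E) (proj E)"
  "proj (pullback_vb P a E) = fst" "vadd (pullback_vb P a E) (p, e) (q, f) = (p, vadd E e f)"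
  "vscale (pullback_vb P a E) r (p, e) = (p, vscale E r e)" "vzero (pullback_vb P a E) p = (p, vzero E (a p))"
  by (simp_all add: pullback_vb_def)

lemma prebundle_pullback:
  assumes "vector_bundle E" "premanifold P"
  shows "prebundle (pullback_vb P a E)"
  unfolding prebundle_def using assms vector_bundle_fibre_ops(3-6)[OF assms(1)] vector_bundleD(5)[OF assms(1)]
  by (auto intro: psmooth_fibre_prod_fst)

lemma vb_mapD:
  assumes f: "vb_map E F b f" and E: "prebundle E" and F: "vector_bundle F"
  shows "psmooth (base E) (base F) b" "psmooth (tot E) (tot F) f"
    "e \<in> pts (tot E) \<Longrightarrow> f e \<in> pts (tot F)" "e \<in> pts (tot E) \<Longrightarrow> proj F (f e) = b (proj E e)"
    "e \<in> pts (tot E) \<Longrightarrow> e' \<in> pts (tot E) \<Longrightarrow> proj E e = proj E e' \<Longrightarrow> f (vadd E e e') = vadd F (f e) (f e')"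
    "e \<in> pts (tot E) \<Longrightarrow> f (vscale E r e) = vscale F r (f e)"
    "e \<in> pts (tot E) \<Longrightarrow> f (vneg E e) = vneg F (f e)"
    "e \<in> pts (tot E) \<Longrightarrow> e' \<in> pts (tot E) \<Longrightarrow> proj E e = proj E e' \<Longrightarrow> f (vsub E e e') = vsub F (f e) (f e')"
proof -
  note e = prebundleD[OF E] and B = vector_bundleD[OF F]
  have s: "smooth_map (base E) (base F) b" "smooth_map (tot E) (tot F) f" using f by (auto simp: vb_map_def)
  show "psmooth (base E) (base F) b" using s(1) psmooth_full_iff[OF e(1) B(4,6)] by simp
  show ps: "psmooth (tot E) (tot F) f" using s(2) psmooth_full_iff[OF e(2) B(5,7)] by simp
  show "e \<in> pts (tot E) \<Longrightarrow> f e \<in> pts (tot F)" by (rule psmoothD(6)[OF ps])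
  show "e \<in> pts (tot E) \<Longrightarrow> proj F (f e) = b (proj E e)" using f by (auto simp: vb_map_def)
  have add: "f (vadd E e e') = vadd F (f e) (f e')" if "e \<in> pts (tot E)" "e' \<in> pts (tot E)" "proj E e = proj E e'" for e e'
    using f that e(8)[of e] unfolding vb_map_def fibre_def by auto
  have sc: "f (vscale E r e) = vscale F r (f e)" if "e \<in> pts (tot E)" for e r
    using f that e(8)[of e] unfolding vb_map_def fibre_def by auto
  show "e \<in> pts (tot E) \<Longrightarrow> e' \<in> pts (tot E) \<Longrightarrow> proj E e = proj E e' \<Longrightarrow> f (vadd E e e') = vadd F (f e) (f e')"
    "e \<in> pts (tot E) \<Longrightarrow> f (vscale E r e) = vscale F r (f e)"
    "e \<in> pts (tot E) \<Longrightarrow> f (vneg E e) = vneg F (f e)"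
    "e \<in> pts (tot E) \<Longrightarrow> e' \<in> pts (tot E) \<Longrightarrow> proj E e = proj E e' \<Longrightarrow> f (vsub E e e') = vsub F (f e) (f e')"
    using add sc e(6,7) by (auto simp: vneg_def vsub_def)
qed

lemma vb_mapI:
  assumes E: "prebundle E" and "psmooth (base E) (base F) b" "psmooth (tot E) (tot F) f"
    "\<And>e. e \<in> pts (tot E) \<Longrightarrow> proj F (f e) = b (proj E e)"
    "\<And>e e'. e \<in> pts (tot E) \<Longrightarrow> e' \<in> pts (tot E) \<Longrightarrow> proj E e = proj E e' \<Longrightarrow> f (vadd E e e') = vadd F (f e) (f e')"
    "\<And>e r. e \<in> pts (tot E) \<Longrightarrow> f (vscale E r e) = vscale F r (f e)"
  shows "vb_map E F b f"
  using assms(4-6) psmoothD(5)[OF assms(2)] psmoothD(5)[OF assms(3)] unfolding vb_map_def fibre_def by auto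

lemma vb_map_zero:
  assumes f: "vb_map E F b f" and E: "vector_bundle E" and F: "vector_bundle F" and x: "x \<in> pts (base E)"
  shows "f (vzero E x) = vzero F (b x)"
proof -
  note O = vector_bundle_fibre_ops[OF E] and D = vb_mapD[OF f prebundle_vector_bundle[OF E] F]
  have "f (vzero E x) = f (vscale E 0 (vzero E x))"
    using vzero_eq_scale[OF E O(1)[OF x]] O(2)[OF x] by simp
  also have "\<dots> = vscale F 0 (f (vzero E x))" using D(6) O(1)[OF x] by simp
  also have "\<dots> = vzero F (b x)" using vzero_eq_scale[OF F D(3)[OF O(1)[OF x]]] D(4) O(1,2)[OF x] by simp
  finally show ?thesis .
qed

lemma vb_map_cong:
  assumes f: "vb_map E F b f" and E: "prebundle E" and F: "vector_bundle F"
    and eq: "\<And>e. e \<in> pts (tot E) \<Longrightarrow> f e = g e" and beq: "\<And>x. x \<in> pts (base E) \<Longrightarrow> b x = c x"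
  shows "vb_map E F c g"
proof (rule vb_mapI[OF E])
  note e = prebundleD[OF E] and D = vb_mapD[OF f E F]
  show "psmooth (base E) (base F) c" by (rule psmooth_cong[OF D(1) beq])
  show "psmooth (tot E) (tot F) g" by (rule psmooth_cong[OF D(2) eq])
qed (use prebundleD[OF E] vb_mapD[OF f E F] in \<open>auto simp: eq[symmetric] beq[symmetric]\<close>)

lemma vb_map_comp:
  assumes f: "vb_map E F b f" and g: "vb_map F H c g" and E: "prebundle E" and F: "vector_bundle F" and H: "vector_bundle H"
  shows "vb_map E H (\<lambda>x. c (b x)) (\<lambda>e. g (f e))"
proof (rule vb_mapI[OF E])
  note D = vb_mapD[OF f E F] and D' = vb_mapD[OF g prebundle_vector_bundle[OF F] H]
  show "psmooth (base E) (base H) (\<lambda>x. c (b x))" by (rule psmooth_comp[OF D(1) D'(1)])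
  show "psmooth (tot E) (tot H) (\<lambda>e. g (f e))" by (rule psmooth_comp[OF D(2) D'(2)])
qed (use vb_mapD[OF f E F] vb_mapD[OF g prebundle_vector_bundle[OF F] H] in auto)

lemma vb_map_vadd:
  assumes f: "vb_map E F b f" and g: "vb_map E F b g" and E: "prebundle E" and F: "vector_bundle F"
  shows "vb_map E F b (\<lambda>e. vadd F (f e) (g e))"
proof (rule vb_mapI[OF E])
  note D = vb_mapD[OF f E F] and D' = vb_mapD[OF g E F] and O = vector_bundle_fibre_ops[OF F] and e = prebundleD[OF E]
  show "psmooth (base E) (base F) b" by fact
  show "psmooth (tot E) (tot F) (\<lambda>e. vadd F (f e) (g e))" by (rule psmooth_vadd[OF F D(2) D'(2)]) (simp add: D D')
  show "proj F (vadd F (f e) (g e)) = b (proj E e)" if "e \<in> pts (tot E)" for e using that by (simp add: D D' O)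
  show "vadd F (f (vadd E e e')) (g (vadd E e e')) = vadd F (vadd F (f e) (g e)) (vadd F (f e') (g e'))"
    if "e \<in> pts (tot E)" "e' \<in> pts (tot E)" "proj E e = proj E e'" for e e'
    using that by (intro coord_eqI[OF F]) (simp_all add: e D D' O coord_ops[OF F])
  show "vadd F (f (vscale E r e)) (g (vscale E r e)) = vscale F r (vadd F (f e) (g e))" if "e \<in> pts (tot E)" for e r
    using that by (intro coord_eqI[OF F]) (simp_all add: e D D' O coord_ops[OF F] algebra_simps)
qed

lemma vb_map_vscale:
  assumes f: "vb_map E F b f" and E: "prebundle E" and F: "vector_bundle F"
  shows "vb_map E F b (\<lambda>e. vscale F r (f e))"
proof (rule vb_mapI[OF E])
  note D = vb_mapD[OF f E F] and O = vector_bundle_fibre_ops[OF F] and e = prebundleD[OF E]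
  show "psmooth (base E) (base F) b" by fact
  show "psmooth (tot E) (tot F) (\<lambda>e. vscale F r (f e))" by (rule psmooth_vscale[OF F D(2)])
  show "proj F (vscale F r (f e)) = b (proj E e)" if "e \<in> pts (tot E)" for e using that by (simp add: D O)
  show "vscale F r (f (vadd E e e')) = vadd F (vscale F r (f e)) (vscale F r (f e'))"
    if "e \<in> pts (tot E)" "e' \<in> pts (tot E)" "proj E e = proj E e'" for e e'
    using that by (intro coord_eqI[OF F]) (simp_all add: e D O coord_ops[OF F] algebra_simps)
  show "vscale F r (f (vscale E q e)) = vscale F q (vscale F r (f e))" if "e \<in> pts (tot E)" for e q
    using that by (intro coord_eqI[OF F]) (simp_all add: e D O coord_ops[OF F] algebra_simps)
qed

lemma vb_map_vneg:
  assumes "vb_map E F b f" "prebundle E" "vector_bundle F"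
  shows "vb_map E F b (\<lambda>e. vneg F (f e))"
  unfolding vneg_def by (rule vb_map_vscale[OF assms])

lemma vb_map_vsub:
  assumes "vb_map E F b f" "vb_map E F b g" "prebundle E" "vector_bundle F"
  shows "vb_map E F b (\<lambda>e. vsub F (f e) (g e))"
  unfolding vsub_def by (intro vb_map_vadd vb_map_vneg assms)

lemma vb_map_const_zero:
  assumes b: "psmooth (base E) (base F) b" and E: "prebundle E" and F: "vector_bundle F"
  shows "vb_map E F b (\<lambda>e. vzero F (b (proj E e)))"
proof (rule vb_mapI[OF E b])
  note O = vector_bundle_fibre_ops[OF F] and e = prebundleD[OF E]
  have pb: "b (proj E e) \<in> pts (base F)" if "e \<in> pts (tot E)" for e using psmoothD(6)[OF b e(8)[OF that]] .
  show "psmooth (tot E) (tot F) (\<lambda>e. vzero F (b (proj E e)))"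
    by (rule psmooth_vzero[OF F psmooth_comp[OF e(3) b]])
  show "proj F (vzero F (b (proj E e))) = b (proj E e)" if "e \<in> pts (tot E)" for e using O(2) pb that by simp
  show "vzero F (b (proj E (vadd E e e'))) = vadd F (vzero F (b (proj E e))) (vzero F (b (proj E e')))"
    if "e \<in> pts (tot E)" "e' \<in> pts (tot E)" "proj E e = proj E e'" for e e'
    using that pb[OF that(2)] by (intro coord_eqI[OF F]) (simp_all add: e O coord_ops[OF F])
  show "vzero F (b (proj E (vscale E r e))) = vscale F r (vzero F (b (proj E e)))" if "e \<in> pts (tot E)" for e r
    using that pb[OF that] by (intro coord_eqI[OF F]) (simp_all add: e O coord_ops[OF F])
qed

lemma vb_map_ident: "prebundle E \<Longrightarrow> vb_map E E (\<lambda>x. x) (\<lambda>e. e)"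
  by (rule vb_mapI) (auto intro: psmooth_id prebundleD)

lemma vb_map_pullback_snd:
  assumes "vector_bundle E" "psmooth P (base E) a"
  shows "vb_map (pullback_vb P a E) E a snd"
  by (rule vb_mapI[OF prebundle_pullback[OF assms(1) psmoothD(1)[OF assms(2)]]])
     (use assms vector_bundleD(5)[OF assms(1)] psmoothD(1)[OF assms(2)] in \<open>auto intro: psmooth_fibre_prod_snd\<close>)

text \<open>Unlike \<open>vb_map_comp\<close>, this goes through a pullback, which need not be a vector bundle.\<close>

lemma vb_map_comp_pullback:
  assumes f: "vb_map E F c f" and E: "prebundle E" and F: "vector_bundle F" and b: "psmooth (base E) P b"
    and a: "psmooth P (base F) a" and ab: "\<And>x. x \<in> pts (base E) \<Longrightarrow> a (b x) = c x"
    and g: "vb_map (pullback_vb P a F) H d g" and H: "vector_bundle H"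
  shows "vb_map E H (\<lambda>x. d (b x)) (\<lambda>e. g (b (proj E e), f e))"
proof (rule vb_mapI[OF E])
  note D = vb_mapD[OF f E F] and e = prebundleD[OF E]
  note G = vb_mapD[OF g prebundle_pullback[OF F psmoothD(1)[OF a]] H]
  have pp: "psmooth (tot E) (tot (pullback_vb P a F)) (\<lambda>e. (b (proj E e), f e))"
    unfolding pullback_vb_simps
    by (rule psmooth_fibre_prod_pair[OF F a psmooth_comp[OF e(3) b] D(2)]) (simp add: D e ab)
  have bP: "b x \<in> pts P" if "x \<in> pts (base E)" for x using psmoothD(6)[OF b that] .
  show "psmooth (base E) (base H) (\<lambda>x. d (b x))" using psmooth_comp[OF b] G(1) by simp
  show "psmooth (tot E) (tot H) (\<lambda>e. g (b (proj E e), f e))" by (rule psmooth_comp[OF pp G(2)])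
  show "proj H (g (b (proj E x), f x)) = d (b (proj E x))" if "x \<in> pts (tot E)" for x
    using that G(4)[of "(b (proj E x), f x)"] D e ab bP by simp
  show "g (b (proj E (vadd E x y)), f (vadd E x y)) = vadd H (g (b (proj E x), f x)) (g (b (proj E y), f y))"
    if "x \<in> pts (tot E)" "y \<in> pts (tot E)" "proj E x = proj E y" for x y
    using that G(5)[of "(b (proj E x), f x)" "(b (proj E y), f y)"] D e ab bP by simp
  show "g (b (proj E (vscale E r x)), f (vscale E r x)) = vscale H r (g (b (proj E x), f x))" if "x \<in> pts (tot E)" for x r
    using that G(6)[of "(b (proj E x), f x)"] D e ab bP by simp
qed

subsection \<open>Whitney sums\<close>

lemma whitney_sum_simps [simp]:
  "base (whitney_sum E F) = base E" "tot (whitney_sum E F) = fibre_prod (tot E) (proj E) (tot F) (proj F)"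
  "proj (whitney_sum E F) (e, f) = proj E e" "vadd (whitney_sum E F) (e, f) (e', f') = (vadd E e e', vadd F f f')"
  "vscale (whitney_sum E F) r (e, f) = (vscale E r e, vscale F r f)" "vzero (whitney_sum E F) x = (vzero E x, vzero F x)"
  "vneg (whitney_sum E F) (e, f) = (vneg E e, vneg F f)"
  "vsub (whitney_sum E F) (e, f) (e', f') = (vsub E e e', vsub F f f')"
  by (simp_all add: whitney_sum_def vneg_def vsub_def)

text \<open>The axioms are pulled back from the real numbers along an injective family of linear
  coordinates. The index type is left free so that a Whitney sum can use tagged indices.\<close>

lemma vector_space_fibreI:
  assumes "vzero E x \<in> pts (tot E)" "proj E (vzero E x) = x"
    "\<And>a b. a \<in> pts (tot E) \<Longrightarrow> proj E a = x \<Longrightarrow> b \<in> pts (tot E) \<Longrightarrow> proj E b = x \<Longrightarrow>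
       vadd E a b \<in> pts (tot E) \<and> proj E (vadd E a b) = x"
    "\<And>a r. a \<in> pts (tot E) \<Longrightarrow> proj E a = x \<Longrightarrow> vscale E r a \<in> pts (tot E) \<and> proj E (vscale E r a) = x"
    and inj: "\<And>a b. a \<in> pts (tot E) \<Longrightarrow> proj E a = x \<Longrightarrow> b \<in> pts (tot E) \<Longrightarrow> proj E b = x \<Longrightarrow> (\<And>i::'i. c a i = c b i) \<Longrightarrow> a = b"
    and c0: "\<And>i. c (vzero E x) i = (0::real)"
    and ca: "\<And>a b i. a \<in> pts (tot E) \<Longrightarrow> proj E a = x \<Longrightarrow> b \<in> pts (tot E) \<Longrightarrow> proj E b = x \<Longrightarrow> c (vadd E a b) i = c a i + c b i"
    and cs: "\<And>a r i. a \<in> pts (tot E) \<Longrightarrow> proj E a = x \<Longrightarrow> c (vscale E r a) i = r * c a i"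
  shows "vector_space_fibre E x"
  unfolding vector_space_fibre_def fibre_def mem_Collect_eq vneg_def
  by (intro conjI ballI allI assms(1,2) inj; simp add: assms(1-4) c0 ca cs algebra_simps)

text \<open>The total space is a manifold because a fibre product along a bundle projection is
  covered by slice charts; trivializations are joined over the intersection of their
  domains.\<close>

lemma vector_bundle_whitney_sum:
  assumes E: "vector_bundle E" and F: "vector_bundle F" and b: "base F = base E"
  shows "vector_bundle (whitney_sum E F)"
  unfolding vector_bundle_iff
proof (intro conjI ballI)
  let ?W = "whitney_sum E F"
  note EB = vector_bundleD[OF E] and FB = vector_bundleD[OF F]
  have pE: "psmooth (tot E) (base F) (proj E)" using EB(3) b by simp
  show "manifold (base ?W)" using EB by simp
  have cov: "covered (tot ?W) = pts (tot ?W)"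
    using covered_fibre_prod[OF EB(5) F pE] EB(7) by auto
  then show "manifold (tot ?W)"
    using manifold_submfd[OF manifold_prod[OF EB(2) FB(2)]] by (auto simp: fibre_prod_def)
  have "psmooth (tot ?W) (tot E) fst" using psmooth_fibre_prod_fst[OF EB(5) FB(5)] by simp
  from psmooth_comp[OF this EB(3)] have "psmooth (tot ?W) (base E) (\<lambda>z. proj E (fst z))" .
  then show pW: "psmooth (tot ?W) (base ?W) (proj ?W)"
    by (simp add: whitney_sum_def case_prod_unfold)
  fix x assume "x \<in> pts (base ?W)"
  then have x: "x \<in> pts (base E)" "x \<in> pts (base F)" using b by auto
  note O = vector_bundle_fibre_ops[OF E] vector_bundle_fibre_ops[OF F] coord_ops[OF E] coord_ops[OF F]
  show "vector_space_fibre ?W x"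
  proof (rule vector_space_fibreI[where c = "\<lambda>(e, f) s. case s of (True, i) \<Rightarrow> coord E e i | (False, i) \<Rightarrow> coord F f (i::nat)"])
    fix p q assume p: "p \<in> pts (tot ?W)" "proj ?W p = x" "q \<in> pts (tot ?W)" "proj ?W q = x"
      and eq: "\<And>i. (case p of (e, f) \<Rightarrow> \<lambda>s. case s of (True, i) \<Rightarrow> coord E e i | (False, i) \<Rightarrow> coord F f (i::nat)) i =
         (case q of (e, f) \<Rightarrow> \<lambda>s. case s of (True, i) \<Rightarrow> coord E e i | (False, i) \<Rightarrow> coord F f (i::nat)) i"
    obtain e f e' f' where pq: "p = (e, f)" "q = (e', f')" by (cases p, cases q) auto
    have "coord E e i = coord E e' i" "coord F f i = coord F f' i" for i
      using eq[of "(True, i)"] eq[of "(False, i)"] pq by auto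
    then show "p = q" using p pq coord_eqI[OF E, of e e'] coord_eqI[OF F, of f f'] by auto
  qed (use x O in \<open>auto split: bool.splits\<close>)
  obtain U k \<tau> \<sigma> where t: "x \<in> U" "local_triv E U k \<tau> \<sigma>" using vector_bundle_triv[OF E x(1)] .
  obtain U' l \<tau>' \<sigma>' where t': "x \<in> U'" "local_triv F U' l \<tau>' \<sigma>'" using vector_bundle_triv[OF F x(2)] .
  note T = local_trivD[OF t(2)] and T' = local_trivD[OF t'(2)]
  let ?\<tau> = "\<lambda>(e, f). join k (\<tau> e) (\<tau>' f)" and ?\<sigma> = "\<lambda>y v. (\<sigma> y (vtake k v), \<sigma>' y (vdrop k v))"
  let ?S = "{e \<in> pts (tot ?W). proj ?W e \<in> U \<inter> U'}"
  have "local_triv ?W (U \<inter> U') (k + l) ?\<tau> ?\<sigma>"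
    unfolding local_triv_def
  proof (intro conjI ballI)
    show op: "openin (mtop (base ?W)) (U \<inter> U')" using T(1) T'(1) b by auto
    have f1: "psmooth (submfd (tot ?W) ?S) (tot E) fst" "psmooth (submfd (tot ?W) ?S) (tot F) snd"
      unfolding whitney_sum_simps(2)
      by (rule psmooth_submfd[OF psmooth_fibre_prod_fst[OF EB(5) FB(5)]], 
          rule psmooth_submfd[OF psmooth_fibre_prod_snd[OF EB(5) FB(5)]])
    have "psmooth (submfd (tot ?W) ?S) (Rn (k + l)) (\<lambda>z. join k (\<tau> (fst z)) (\<tau>' (snd z)))"
      by (intro psmooth_join psmooth_triv[OF E t(2) f1(1)] psmooth_triv[OF F t'(2) f1(2)]) auto
    then show "psmooth (submfd (tot ?W) ?S) (Rn (k + l)) ?\<tau>" by (simp add: case_prod_unfold)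
    let ?B = "prod_mfd (submfd (base ?W) (U \<inter> U')) (Rn (k + l))"
    have pB: "premanifold (submfd (base ?W) (U \<inter> U'))" using EB(4) by (simp add: premanifold_submfd)
    have g0: "psmooth ?B (base E) fst"
      using psmooth_comp[OF psmooth_fst[OF pB premanifold_Rn] psmooth_incl] EB(4) by simp
    have g1: "psmooth ?B (Rn (k + l)) snd" by (rule psmooth_snd[OF pB premanifold_Rn])
    have "psmooth ?B (tot ?W) (\<lambda>z. (\<sigma> (fst z) (vtake k (snd z)), \<sigma>' (fst z) (vdrop k (snd z))))"
      unfolding whitney_sum_simps(2)
      by (rule psmooth_fibre_prod_pair[OF F pE psmooth_triv_inv[OF E t(2) g0 _ psmooth_vtake[OF g1]]
            psmooth_triv_inv[OF F t'(2) g0[folded b] _ psmooth_vdrop[OF g1]]])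
         (use g0 b T T' in auto)
    then show "psmooth ?B (tot ?W) (\<lambda>(y, v). ?\<sigma> y v)" by (simp add: case_prod_unfold)
    fix y assume y: "y \<in> U \<inter> U'"
    show "?\<sigma> y v \<in> fibre ?W y" "?\<tau> (?\<sigma> y v) = v" if "v \<in> EU (k + l)" for v
      using T T' y that by (auto simp: fibre_def)
    show "?\<tau> (vadd ?W p q) = (\<lambda>i. ?\<tau> p i + ?\<tau> q i)" if "p \<in> fibre ?W y" "q \<in> fibre ?W y" for p q
      using that y T(9) T'(9) by (auto simp: fibre_def join_def fun_eq_iff)
    show "\<forall>r. ?\<tau> (vscale ?W r p) = (\<lambda>i. r * ?\<tau> p i)" if "p \<in> fibre ?W y" for p
      using that y T(10) T'(10) by (auto simp: fibre_def join_def fun_eq_iff)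
  next
    fix p assume p: "p \<in> pts (tot ?W)"
    show "proj ?W p \<in> U \<inter> U' \<longrightarrow> ?\<tau> p \<in> EU (k + l) \<and> ?\<sigma> (proj ?W p) (?\<tau> p) = p"
    proof
      assume pU: "proj ?W p \<in> U \<inter> U'"
      obtain e f where pe: "p = (e, f)" by (cases p)
      then have "e \<in> pts (tot E)" "f \<in> pts (tot F)" "proj E e = proj F f" "proj E e \<in> U" "proj F f \<in> U'"
        using p pU by auto
      then show "?\<tau> p \<in> EU (k + l) \<and> ?\<sigma> (proj ?W p) (?\<tau> p) = p"
        using T(7,8)[of e] T'(7,8)[of f] by (simp add: pe)
    qed
  qed
  then show "\<exists>U k \<tau> \<sigma>. x \<in> U \<and> local_triv ?W U k \<tau> \<sigma>" using t t' by blast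
qed

lemma vb_map_whitney_pair:
  assumes f: "vb_map E F b f" and g: "vb_map E H b g" and E: "prebundle E" and F: "vector_bundle F" 
    and H: "vector_bundle H" and FH: "base H = base F"
  shows "vb_map E (whitney_sum F H) b (\<lambda>e. (f e, g e))"
proof (rule vb_mapI[OF E])
  note D = vb_mapD[OF f E F] and D' = vb_mapD[OF g E H]
  have "psmooth (tot F) (base H) (proj F)" using vector_bundleD(3)[OF F] FH by simp
  from psmooth_fibre_prod_pair[OF H this D(2) D'(2)] D(4) D'(4)
  show "psmooth (tot E) (tot (whitney_sum F H)) (\<lambda>e. (f e, g e))" by simp
qed (use vb_mapD[OF f E F] vb_mapD[OF g E H] in auto)

lemma vb_map_whitney_fst:
  assumes F: "vector_bundle F" and H: "vector_bundle H" and FH: "base H = base F"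
  shows "vb_map (whitney_sum F H) F (\<lambda>x. x) fst"
  by (rule vb_mapI[OF prebundle_vector_bundle[OF vector_bundle_whitney_sum[OF assms]]])
     (use vector_bundleD[OF F] vector_bundleD[OF H] in \<open>auto intro: psmooth_id psmooth_fibre_prod_fst\<close>)

lemma vb_map_whitney_snd:
  assumes F: "vector_bundle F" and H: "vector_bundle H" and FH: "base H = base F"
  shows "vb_map (whitney_sum F H) H (\<lambda>x. x) snd"
  by (rule vb_mapI[OF prebundle_vector_bundle[OF vector_bundle_whitney_sum[OF assms]]])
     (use vector_bundleD[OF F] vector_bundleD[OF H] FH in \<open>auto intro: psmooth_id psmooth_fibre_prod_snd\<close>)

subsection \<open>Kernels of fibrewise surjective maps\<close>

text \<open>Base coordinates are followed by fibre coordinates. With the fibre coordinates last, the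
  vanishing of the final ones is a slice condition.\<close>

lemma local_triv_chart:
  assumes E: "vector_bundle E" and t: "local_triv E U k \<tau> \<sigma>" and c: "(n, V, \<psi>) \<in> atlas (base E)"
  shows "(n + k, {e \<in> pts (tot E). proj E e \<in> V \<inter> U}, \<lambda>e. join n (\<psi> (proj E e)) (\<tau> e)) \<in> maximal_atlas (tot E)"
proof -
  note EB = vector_bundleD[OF E] and T = local_trivD[OF t]
  define B where "B = V \<inter> U"
  note cm = atlas_maximal[OF EB(4) c]
  have oB: "openin (mtop (base E)) B" unfolding B_def using is_chartD(1)[OF maximal_atlasD(1)[OF cm]] T(1) by blast
  have Bm: "(n, B, \<psi>) \<in> maximal_atlas (base E)"
    by (rule maximal_atlas_restrict[OF cm oB _ EB(4)]) (auto simp: B_def)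
  note C = is_chartD[OF maximal_atlasD(1)[OF Bm]]
  let ?W = "{e \<in> pts (tot E). proj E e \<in> B}" and ?\<Phi> = "\<lambda>e. join n (\<psi> (proj E e)) (\<tau> e)"
  let ?\<Psi> = "\<lambda>w. \<sigma> (inv_into B \<psi> (vtake n w)) (vdrop n w)"
  define O1 where "O1 = {w \<in> EU (n + k). vtake n w \<in> \<psi> ` B}"
  have O1: "openin (Euclidean_space (n + k)) O1"
    unfolding O1_def by (rule preimage_open[OF continuous_map_vtake C(2)])
  have inc: "psmooth (submfd (tot E) ?W) (tot E) (\<lambda>e. e)" by (rule psmooth_incl[OF EB(5)])
  have s1: "psmooth (submfd (tot E) ?W) (Rn (n + k)) ?\<Phi>"
    by (intro psmooth_join psmooth_chart_comp[OF psmooth_comp[OF inc EB(3)] Bm] psmooth_triv[OF E t inc]) (auto simp: B_def)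
  have idR: "psmooth (submfd (Rn (n + k)) O1) (Rn (n + k)) (\<lambda>w. w)" by (rule psmooth_incl) simp
  have s2: "psmooth (submfd (Rn (n + k)) O1) (tot E) ?\<Psi>"
    by (intro psmooth_triv_inv[OF E t psmooth_chart_inv_comp[OF psmooth_vtake[OF idR] EB(4) Bm] _ psmooth_vdrop[OF idR]])
       (auto simp: O1_def inv_into_f_f C(3), auto simp: B_def)
  have i1: "?\<Phi> e \<in> O1 \<and> ?\<Psi> (?\<Phi> e) = e" if e: "e \<in> ?W" for e
  proof -
    have "\<psi> (proj E e) \<in> EU n" "\<tau> e \<in> EU k" "\<sigma> (proj E e) (\<tau> e) = e"
      using e C(4) T(7,8)[of e] by (auto simp: B_def)
    then show ?thesis using e C(3) by (simp add: O1_def inv_into_f_f)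
  qed
  have i2: "?\<Psi> w \<in> ?W \<and> ?\<Phi> (?\<Psi> w) = w" if "w \<in> O1" for w
  proof -
    have w: "w \<in> EU (n + k)" "vtake n w \<in> \<psi> ` B" using that by (auto simp: O1_def)
    let ?b = "inv_into B \<psi> (vtake n w)"
    have b: "?b \<in> B" "\<psi> ?b = vtake n w" using w by (auto simp: f_inv_into_f inv_into_into)
    then show ?thesis using T(4-6)[of ?b "vdrop n w"] w by (simp add: B_def)
  qed
  show ?thesis
    using maximal_atlasI(1)[OF EB(5) proj_preimage_open[OF EB(3) oB] _ O1 s1 s2 i1 i2] EB(7) by (auto simp: B_def)
qed

lemma local_triv_restrict:
  assumes E: "vector_bundle E" and t: "local_triv E U k \<tau> \<sigma>" and V: "openin (mtop (base E)) V" "V \<subseteq> U"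
  shows "local_triv E V k \<tau> \<sigma>"
proof -
  note EB = vector_bundleD[OF E] and T = local_trivD[OF t]
  have pV: "premanifold (submfd (base E) V)" by (rule premanifold_submfd[OF EB(4)])
  have s1: "psmooth (submfd (tot E) {e \<in> pts (tot E). proj E e \<in> V}) (Rn k) \<tau>"
    by (rule psmooth_triv[OF E t psmooth_incl[OF EB(5)]]) (use V in auto)
  have "psmooth (prod_mfd (submfd (base E) V) (Rn k)) (tot E) (\<lambda>z. \<sigma> (fst z) (snd z))"
    by (rule psmooth_triv_inv[OF E t psmooth_comp[OF psmooth_fst[OF pV premanifold_Rn] psmooth_incl[OF EB(4)]] _
         psmooth_snd[OF pV premanifold_Rn]]) (use V in auto)
  then show ?thesis
    using s1 V t unfolding local_triv_def case_prod_unfold by blast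
qed

text \<open>\<open>Q\<close> is a family of linear isomorphisms of R^k over \<open>U\<close> with
  inverse \<open>R\<close>, both smooth jointly in the base point and the vector.\<close>

lemma local_triv_change:
  assumes E: "vector_bundle E" and t: "local_triv E U k \<tau> \<sigma>"
    and Q: "psmooth (prod_mfd (submfd (base E) U) (Rn k)) (Rn k) (\<lambda>z. Q (fst z) (snd z))"
    and R: "psmooth (prod_mfd (submfd (base E) U) (Rn k)) (Rn k) (\<lambda>z. R (fst z) (snd z))"
    and inv: "\<And>y v. y \<in> U \<Longrightarrow> v \<in> EU k \<Longrightarrow> Q y (R y v) = v" "\<And>y v. y \<in> U \<Longrightarrow> v \<in> EU k \<Longrightarrow> R y (Q y v) = v"
    and lin: "\<And>y v w. y \<in> U \<Longrightarrow> Q y (\<lambda>i. v i + w i) = (\<lambda>i. Q y v i + Q y w i)"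
      "\<And>y v r. y \<in> U \<Longrightarrow> Q y (\<lambda>i. r * v i) = (\<lambda>i. r * Q y v i)"
  shows "local_triv E U k (\<lambda>e. Q (proj E e) (\<tau> e)) (\<lambda>y v. \<sigma> y (R y v))"
proof -
  note EB = vector_bundleD[OF E] and T = local_trivD[OF t]
  let ?P = "prod_mfd (submfd (base E) U) (Rn k)" and ?S = "submfd (tot E) {e \<in> pts (tot E). proj E e \<in> U}"
  have U: "U \<subseteq> pts (base E)" using openin_subset[OF T(1)] .
  have pV: "premanifold (submfd (base E) U)" by (rule premanifold_submfd[OF EB(4)])
  have "psmooth ?S (submfd (base E) U) (proj E)"
    by (rule psmooth_into_open[OF psmooth_submfd[OF EB(3)] T(1)]) auto
  from psmooth_comp[OF psmooth_pair[OF this T(2)] Q]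
  have s1: "psmooth ?S (Rn k) (\<lambda>e. Q (proj E e) (\<tau> e))" by simp
  have "psmooth ?P (tot E) (\<lambda>z. \<sigma> (fst z) (R (fst z) (snd z)))"
    by (rule psmooth_triv_inv[OF E t psmooth_comp[OF psmooth_fst[OF pV premanifold_Rn] psmooth_incl[OF EB(4)]] _ R]) auto
  then have s2: "psmooth ?P (tot E) (\<lambda>(y, v). \<sigma> y (R y v))" by (simp add: case_prod_unfold)
  have QE: "Q y v \<in> EU k" "R y v \<in> EU k" if "y \<in> U" "v \<in> EU k" for y v
    using psmoothD(6)[OF Q, of "(y, v)"] psmoothD(6)[OF R, of "(y, v)"] that U by auto
  show ?thesis
    unfolding local_triv_def
  proof (intro conjI ballI allI impI)
    fix y v assume y: "y \<in> U" "v \<in> EU k"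
    show "\<sigma> y (R y v) \<in> fibre E y" "Q (proj E (\<sigma> y (R y v))) (\<tau> (\<sigma> y (R y v))) = v"
      using T(4-6)[OF y(1) QE(2)[OF y]] inv(1)[OF y] by (auto simp: fibre_def)
  next
    fix e assume e: "e \<in> pts (tot E)" "proj E e \<in> U"
    show "Q (proj E e) (\<tau> e) \<in> EU k" "\<sigma> (proj E e) (R (proj E e) (Q (proj E e) (\<tau> e))) = e"
      using T(7,8)[OF e] QE(1)[OF e(2)] inv(2)[OF e(2)] by auto
  next
    fix y a b assume y: "y \<in> U" "a \<in> fibre E y" "b \<in> fibre E y"
    then show "Q (proj E (vadd E a b)) (\<tau> (vadd E a b)) = (\<lambda>i. Q (proj E a) (\<tau> a) i + Q (proj E b) (\<tau> b) i)"
      using T(9)[of a b] vector_bundle_fibre_ops(4)[OF E, of a b] lin(1)[OF y(1), of "\<tau> a" "\<tau> b"] by (auto simp: fibre_def)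
  next
    fix y a r assume y: "y \<in> U" "a \<in> fibre E y"
    then show "Q (proj E (vscale E r a)) (\<tau> (vscale E r a)) = (\<lambda>i. r * Q (proj E a) (\<tau> a) i)"
      using T(10)[of a r] vector_bundle_fibre_ops(6)[OF E, of a] lin(2)[OF y(1), of r "\<tau> a"] by (auto simp: fibre_def)
  qed (use T(1) s1 s2 in auto)
qed

section \<open>Linear functionals and elimination\<close>

definition unit_vec :: "nat \<Rightarrow> nat \<Rightarrow> real" where "unit_vec j = (\<lambda>i. if i = j then 1 else 0)"

lemma unit_vec_EU [simp]: "j < k \<Longrightarrow> unit_vec j \<in> EU k"
  by (auto simp: unit_vec_def EU_iff)

lemma linear_expansion:
  assumes add: "\<And>v w. v \<in> EU k \<Longrightarrow> w \<in> EU k \<Longrightarrow> h (\<lambda>i. v i + w i) = h v + (h w :: real)"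
    and sc: "\<And>v r. v \<in> EU k \<Longrightarrow> h (\<lambda>i. r * v i) = r * h v" and v: "v \<in> EU k"
  shows "h v = (\<Sum>l<k. h (unit_vec l) * v l)"
proof -
  \<comment> \<open>Induction on the number \<open>m\<close> of coordinates that are kept, the
    others being set to zero.\<close>
  have "h (\<lambda>i. if i < m then v i else 0) = (\<Sum>l<m. h (unit_vec l) * v l)" if "m \<le> k" for m
    using that
  proof (induction m)
    case 0
    then show ?case using sc[OF v, of 0] by simp
  next
    case (Suc m)
    have "(\<lambda>i. if i < Suc m then v i else 0) = (\<lambda>i. (if i < m then v i else 0) + v m * unit_vec m i)"
      by (auto simp: unit_vec_def less_Suc_eq fun_eq_iff)
    moreover have "(\<lambda>i. if i < m then v i else 0) \<in> EU k" "(\<lambda>i. v m * unit_vec m i) \<in> EU k"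
      using Suc.prems v by (auto simp: EU_iff unit_vec_def)
    ultimately show ?case using add sc[of "unit_vec m" "v m"] Suc by simp
  qed
  moreover have "(\<lambda>i. if i < k then v i else 0) = v" using v by (auto simp: EU_iff)
  ultimately show ?thesis by (metis order_refl)
qed

text \<open>A smooth section of the dual bundle over \<open>U\<close>, given by its values on
  vectors.\<close>

definition smooth_functional :: "('b, 'e) vbundle \<Rightarrow> 'b set \<Rightarrow> ('e \<Rightarrow> real) \<Rightarrow> bool" where
  "smooth_functional E U h \<longleftrightarrow> openin (mtop (base E)) U \<and>
     psmooth_real (submfd (tot E) {e \<in> pts (tot E). proj E e \<in> U}) h \<and>
     (\<forall>a\<in>pts (tot E). proj E a \<in> U \<longrightarrow>
        (\<forall>b\<in>pts (tot E). proj E a = proj E b \<longrightarrow> h (vadd E a b) = h a + h b) \<and> (\<forall>r. h (vscale E r a) = r * h a))"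

text \<open>The coefficients are taken with respect to the frame
  \<open>\<sigma> y (unit_vec l)\<close>. Linearity of \<open>\<sigma> y\<close> is derived from
  that of its inverse \<open>\<tau>\<close>.\<close>

lemma smooth_functional_coeffs:
  assumes E: "vector_bundle E" and t: "local_triv E U k \<tau> \<sigma>" and h: "smooth_functional E U0 h" and U: "U \<subseteq> U0"
  shows "l < k \<Longrightarrow> psmooth_real (submfd (base E) U) (\<lambda>y. h (\<sigma> y (unit_vec l)))"
    and "y \<in> U \<Longrightarrow> v \<in> EU k \<Longrightarrow> h (\<sigma> y v) = (\<Sum>l<k. h (\<sigma> y (unit_vec l)) * v l)"
proof -
  note EB = vector_bundleD[OF E] and T = local_trivD[OF t]
  have U0: "openin (mtop (base E)) U0" and sm: "psmooth_real (submfd (tot E) {e \<in> pts (tot E). proj E e \<in> U0}) h"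
    using h by (auto simp: smooth_functional_def)
  show "psmooth_real (submfd (base E) U) (\<lambda>y. h (\<sigma> y (unit_vec l)))" if l: "l < k"
  proof (rule psmooth_real_comp[OF psmooth_into_open[OF psmooth_triv_inv[OF E t psmooth_incl[OF EB(4)]] 
          proj_preimage_open[OF EB(3) U0]] sm])
    show "psmooth (submfd (base E) U) (Rn k) (\<lambda>y. unit_vec l)"
      using l EB(4) by (intro psmooth_RnI) (auto intro: premanifold_submfd psmooth_real_const)
  qed (use T(4,5) U l in auto)
  show "h (\<sigma> y v) = (\<Sum>l<k. h (\<sigma> y (unit_vec l)) * v l)" if y: "y \<in> U" and v: "v \<in> EU k"
  proof (rule linear_expansion[where h = "\<lambda>v. h (\<sigma> y v)", OF _ _ v])
    have inj: "a = b" if "a \<in> pts (tot E)" "b \<in> pts (tot E)" "proj E a = y" "proj E b = y" "\<tau> a = \<tau> b" for a b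
      using T(8)[OF that(1)] T(8)[OF that(2)] that y by metis
    fix u w r assume u: "u \<in> EU k" 
    have "\<sigma> y (\<lambda>i. r * u i) = vscale E r (\<sigma> y u)"
    proof (rule inj)
      have ru: "(\<lambda>i. r * u i) \<in> EU k" using u by (auto simp: EU_iff)
      show "\<sigma> y (\<lambda>i. r * u i) \<in> pts (tot E)" "proj E (\<sigma> y (\<lambda>i. r * u i)) = y" using T(4,5)[OF y ru] .
      show "vscale E r (\<sigma> y u) \<in> pts (tot E)" "proj E (vscale E r (\<sigma> y u)) = y"
        using vector_bundle_fibre_ops(5,6)[OF E T(4)[OF y u]] T(5)[OF y u] by auto
      show "\<tau> (\<sigma> y (\<lambda>i. r * u i)) = \<tau> (vscale E r (\<sigma> y u))"
        using T(6)[OF y ru] T(10)[OF T(4)[OF y u]] T(5,6)[OF y u] y by simp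
    qed
    then show "h (\<sigma> y (\<lambda>i. r * u i)) = r * h (\<sigma> y u)"
      using h T(4,5)[OF y u] y U unfolding smooth_functional_def by auto
    assume w: "w \<in> EU k"
    have "\<sigma> y (\<lambda>i. u i + w i) = vadd E (\<sigma> y u) (\<sigma> y w)"
    proof (rule inj)
      have uw: "(\<lambda>i. u i + w i) \<in> EU k" using u w by (auto simp: EU_iff)
      show "\<sigma> y (\<lambda>i. u i + w i) \<in> pts (tot E)" "proj E (\<sigma> y (\<lambda>i. u i + w i)) = y" using T(4,5)[OF y uw] .
      show "vadd E (\<sigma> y u) (\<sigma> y w) \<in> pts (tot E)" "proj E (vadd E (\<sigma> y u) (\<sigma> y w)) = y"
        using vector_bundle_fibre_ops(3,4)[OF E T(4)[OF y u] T(4)[OF y w]] T(5)[OF y u] T(5)[OF y w] by auto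
      show "\<tau> (\<sigma> y (\<lambda>i. u i + w i)) = \<tau> (vadd E (\<sigma> y u) (\<sigma> y w))"
        using T(6)[OF y uw] T(9)[OF T(4)[OF y u] T(4)[OF y w]] T(5,6)[OF y u] T(5,6)[OF y w] y by simp
    qed
    then show "h (\<sigma> y (\<lambda>i. u i + w i)) = h (\<sigma> y u) + h (\<sigma> y w)"
      using h T(4,5)[OF y u] T(4,5)[OF y w] y U unfolding smooth_functional_def by auto
  qed
qed

definition swap_index :: "nat \<Rightarrow> nat \<Rightarrow> nat \<Rightarrow> nat" where
  "swap_index j p i = (if i = j then p else if i = p then j else i)"

text \<open>One elimination step: a functional that does not vanish on the common kernel of the last \<open>m\<close>
  coordinates becomes the next coordinate from the end.\<close>

lemma local_triv_pivot:
  assumes E: "vector_bundle E" and t: "local_triv E U k \<tau> \<sigma>" and h: "smooth_functional E U0 h" and U: "U \<subseteq> U0"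
    and x: "x \<in> U" and c: "c \<in> pts (tot E)" "proj E c = x" "\<And>i. i < m \<Longrightarrow> \<tau> c (k - 1 - i) = 0" "h c \<noteq> 0"
    and m: "m \<le> k"
  obtains U' \<tau>' \<sigma>' where "m < k" "x \<in> U'" "U' \<subseteq> U" "local_triv E U' k \<tau>' \<sigma>'"
    "\<And>e. e \<in> pts (tot E) \<Longrightarrow> proj E e \<in> U' \<Longrightarrow> \<tau>' e (k - 1 - m) = h e"
    "\<And>e i. i < m \<Longrightarrow> \<tau>' e (k - 1 - i) = \<tau> e (k - 1 - i)"
proof -
  note EB = vector_bundleD[OF E] and T = local_trivD[OF t]
  have UB: "U \<subseteq> pts (base E)" using openin_subset[OF T(1)] .
  have cU: "proj E c \<in> U" using c x by simp
  have "h c = (\<Sum>l<k. h (\<sigma> x (unit_vec l)) * \<tau> c l)"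
    using smooth_functional_coeffs(2)[OF E t h U x T(7)[OF c(1) cU]] T(8)[OF c(1) cU] c(2) by simp
  \<comment> \<open>As \<open>h c\<close> is nonzero, there is an index at which \<open>c\<close>
    and the coefficient of \<open>h\<close> are both nonzero. It is not among the last
    \<open>m\<close>, where \<open>c\<close> vanishes, so it can be swapped into the position
    \<open>p\<close> just before them.\<close>
  then obtain j where j: "j < k" "h (\<sigma> x (unit_vec j)) \<noteq> 0" "\<tau> c j \<noteq> 0"
    using c(4) by (metis (no_types, lifting) lessThan_iff mult_not_zero sum.neutral)
  have jm: "j < k - m"
  proof (rule ccontr)
    assume "\<not> j < k - m"
    then have "k - 1 - j < m" "k - 1 - (k - 1 - j) = j" using j(1) m by auto
    then show False using c(3) j(3) by metis
  qed
  then have mk: "m < k" by auto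
  define p where "p = k - 1 - m"
  have p: "p < k" "j \<le> p" using jm mk by (auto simp: p_def)
  let ?P = "\<lambda>V. prod_mfd (submfd (base E) V) (Rn k)"
  have pV: "premanifold (submfd (base E) V)" for V by (rule premanifold_submfd[OF EB(4)])
  have pP: "premanifold (?P V)" for V by (rule premanifold_prod[OF pV premanifold_Rn])
  have co: "psmooth_real (?P V) (\<lambda>z. snd z l)" for V l
    by (rule psmooth_real_coord[OF psmooth_snd[OF pV premanifold_Rn]])
  let ?sw = "\<lambda>(y::'a) v i. v (swap_index j p i) :: real"
  have sw: "psmooth (?P U) (Rn k) (\<lambda>z. ?sw (fst z) (snd z))"
    by (rule psmooth_RnI[OF pP _ co]) (use p j in \<open>auto simp: swap_index_def EU_iff\<close>)
  have t1: "local_triv E U k (\<lambda>e. ?sw (proj E e) (\<tau> e)) (\<lambda>y v. \<sigma> y (?sw y v))"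
    by (rule local_triv_change[OF E t sw sw]) (auto simp: swap_index_def fun_eq_iff)
  define \<tau>1 where "\<tau>1 = (\<lambda>e i. \<tau> e (swap_index j p i))"
  define \<sigma>1 where "\<sigma>1 = (\<lambda>y v. \<sigma> y (\<lambda>i. v (swap_index j p i)))"
  have t1: "local_triv E U k \<tau>1 \<sigma>1" using t1 by (simp add: \<tau>1_def \<sigma>1_def)
  define a where "a l y = h (\<sigma>1 y (unit_vec l))" for l y
  have "(\<lambda>i. unit_vec p (swap_index j p i)) = unit_vec j" by (auto simp: unit_vec_def swap_index_def)
  then have ax: "a p x \<noteq> 0" using j(2) by (simp add: a_def \<sigma>1_def)
  have as: "psmooth_real (submfd (base E) U) (a l)" if "l < k" for l
    unfolding a_def[abs_def] by (rule smooth_functional_coeffs(1)[OF E t1 h U that])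
  \<comment> \<open>The pivot coefficient is nonzero at \<open>x\<close>, hence on an open
    neighbourhood, and there the functional can replace the old coordinate.\<close>
  define U' where "U' = {y \<in> U. a p y \<noteq> 0}"
  have "openin (subtopology (mtop (base E)) U) {y \<in> topspace (subtopology (mtop (base E)) U). a p y \<in> - {0}}"
    using preimage_open[OF psmooth_realD(2)[OF as[OF p(1)]], of "- {0}"] by (simp add: open_Compl)
  moreover have "{y \<in> topspace (subtopology (mtop (base E)) U). a p y \<in> - {0}} = U'" using UB by (auto simp: U'_def)
  ultimately have oU': "openin (mtop (base E)) U'" using T(1) openin_open_subtopology by metis
  have U'U: "U' \<subseteq> U" by (auto simp: U'_def)
  have t2: "local_triv E U' k \<tau>1 \<sigma>1" by (rule local_triv_restrict[OF E t1 oU' U'U])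
  have as': "psmooth_real (?P U') (\<lambda>z. a l (fst z))" if "l < k" for l
  proof (rule psmooth_real_comp[OF psmooth_fst[OF pV premanifold_Rn]])
    have "psmooth (submfd (base E) U') (submfd (base E) U) (\<lambda>y. y)"
      by (rule psmooth_into_open[OF psmooth_incl[OF EB(4)] T(1)]) (use U'U in auto)
    from psmooth_real_comp[OF this as[OF that]] show "psmooth_real (submfd (base E) U') (a l)" .
  qed
  \<comment> \<open>\<open>Q\<close> puts the value of the functional into position
    \<open>p\<close>; \<open>R\<close> solves for the old coordinate, dividing by the pivot.\<close>
  define Q where "Q y v = v(p := \<Sum>l<k. a l y * v l)" for y v
  define R where "R y v = v(p := (v p - (\<Sum>l\<in>{..<k} - {p}. a l y * v l)) * inverse (a p y))" for y v
  have split: "(\<Sum>l<k. a l y * v l) = a p y * v p + (\<Sum>l\<in>{..<k} - {p}. a l y * v l)" for y v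
    using p by (subst sum.remove[of _ p]) auto
  have 1: "psmooth (?P U') (Rn k) (\<lambda>z. Q (fst z) (snd z))"
  proof (rule psmooth_RnI[OF pP])
    fix i assume "i < k"
    show "psmooth_real (?P U') (\<lambda>z. Q (fst z) (snd z) i)"
      using co as' by (cases "i = p") (auto simp: Q_def intro!: psmooth_real_sum[OF pP] psmooth_real_mult)
  qed (use p in \<open>auto simp: Q_def EU_iff\<close>)
  have 2: "psmooth (?P U') (Rn k) (\<lambda>z. R (fst z) (snd z))"
  proof (rule psmooth_RnI[OF pP])
    fix i assume "i < k"
    show "psmooth_real (?P U') (\<lambda>z. R (fst z) (snd z) i)"
      using co as' p U'_def by (cases "i = p")
        (auto simp: R_def intro!: psmooth_real_sum[OF pP] psmooth_real_mult psmooth_real_inverse psmooth_real_diff)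
  qed (use p in \<open>auto simp: R_def EU_iff\<close>)
  have "local_triv E U' k (\<lambda>e. Q (proj E e) (\<tau>1 e)) (\<lambda>y v. \<sigma>1 y (R y v))"
  proof (rule local_triv_change[OF E t2 1 2])
    fix y v assume y: "y \<in> U'" 
    have nz: "a p y \<noteq> 0" using y by (simp add: U'_def)
    show "Q y (R y v) = v"
      using nz by (auto simp: Q_def split R_def fun_eq_iff field_simps)
    show "R y (Q y v) = v"
      using nz by (auto simp: Q_def split R_def fun_eq_iff divide_inverse[symmetric])
  next
    fix y v w show "Q y (\<lambda>i. v i + w i) = (\<lambda>i. Q y v i + Q y w i)"
      by (auto simp: Q_def fun_eq_iff sum.distrib algebra_simps)
  next
    fix y v r show "Q y (\<lambda>i. r * v i) = (\<lambda>i. r * Q y v i)"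
      by (auto simp: Q_def fun_eq_iff sum_distrib_left algebra_simps)
  qed
  moreover have "Q (proj E e) (\<tau>1 e) (k - 1 - m) = h e" if e: "e \<in> pts (tot E)" "proj E e \<in> U'" for e
  proof -
    have "Q (proj E e) (\<tau>1 e) (k - 1 - m) = (\<Sum>l<k. a l (proj E e) * \<tau>1 e l)" by (simp add: Q_def p_def)
    also have "\<dots> = h (\<sigma>1 (proj E e) (\<tau>1 e))"
      unfolding a_def using smooth_functional_coeffs(2)[OF E t1 h U] e U'U local_trivD(7)[OF t1] by auto
    also have "\<dots> = h e" using local_trivD(8)[OF t1] e U'U by auto
    finally show ?thesis .
  qed
  moreover have "Q (proj E e) (\<tau>1 e) (k - 1 - i) = \<tau> e (k - 1 - i)" if "i < m" for e i
    using that mk p(2) by (auto simp: Q_def \<tau>1_def p_def swap_index_def)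
  ultimately show thesis
    using that[of U' "\<lambda>e. Q (proj E e) (\<tau>1 e)"] mk x ax U'U by (auto simp: U'_def)
qed

text \<open>Gaussian elimination with parameters: each functional in turn becomes a fibre
  coordinate, counted from the end. Joint surjectivity at \<open>x\<close> provides a vector that
  the earlier functionals kill and the next one does not.\<close>

lemma local_triv_adapted:
  assumes E: "vector_bundle E" and x: "x \<in> U0" and U0: "openin (mtop (base E)) U0"
  shows "(\<And>i. i < m \<Longrightarrow> smooth_functional E U0 (h i)) \<Longrightarrow>
    (\<And>c. \<exists>v\<in>pts (tot E). proj E v = x \<and> (\<forall>i<m. h i v = c i)) \<Longrightarrow>
    \<exists>U k \<tau> \<sigma>. x \<in> U \<and> U \<subseteq> U0 \<and> m \<le> k \<and> local_triv E U k \<tau> \<sigma> \<and>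
      (\<forall>e\<in>pts (tot E). proj E e \<in> U \<longrightarrow> (\<forall>i<m. \<tau> e (k - 1 - i) = h i e))"
proof (induction m)
  case 0
  obtain U k \<tau> \<sigma> where t: "x \<in> U" "local_triv E U k \<tau> \<sigma>"
    using vector_bundle_triv[OF E] x openin_subset[OF U0] by blast
  have "local_triv E (U \<inter> U0) k \<tau> \<sigma>"
    by (rule local_triv_restrict[OF E t(2)]) (use local_trivD(1)[OF t(2)] U0 in auto)
  then show ?case using t(1) x by blast
next
  case (Suc m)
  have "\<exists>v\<in>pts (tot E). proj E v = x \<and> (\<forall>i<m. h i v = c i)" for c
    using Suc.prems(2)[of c] by auto
  from Suc.IH[OF Suc.prems(1) this] obtain U k \<tau> \<sigma> where t: "x \<in> U" "U \<subseteq> U0" "m \<le> k" "local_triv E U k \<tau> \<sigma>"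
    and co: "\<And>e i. e \<in> pts (tot E) \<Longrightarrow> proj E e \<in> U \<Longrightarrow> i < m \<Longrightarrow> \<tau> e (k - 1 - i) = h i e" by auto
  obtain v where v: "v \<in> pts (tot E)" "proj E v = x" "\<forall>i<Suc m. h i v = (if i = m then 1 else 0)"
    using Suc.prems(2)[of "\<lambda>i. if i = m then 1 else 0"] by blast
  have h: "smooth_functional E U0 (h m)" using Suc.prems(1) by simp
  have v0: "\<tau> v (k - 1 - i) = 0" if "i < m" for i using co[of v i] v t(1) that by simp
  have vm: "h m v \<noteq> 0" using v(3) by simp
  obtain U' \<tau>' \<sigma>' where n: "m < k" "x \<in> U'" "U' \<subseteq> U" "local_triv E U' k \<tau>' \<sigma>'"
    "\<And>e. e \<in> pts (tot E) \<Longrightarrow> proj E e \<in> U' \<Longrightarrow> \<tau>' e (k - 1 - m) = h m e"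
    "\<And>e i. i < m \<Longrightarrow> \<tau>' e (k - 1 - i) = \<tau> e (k - 1 - i)"
    using local_triv_pivot[OF E t(4) h t(2,1) v(1,2) v0 vm t(3)] by blast
  have "\<tau>' e (k - 1 - i) = h i e" if "e \<in> pts (tot E)" "proj E e \<in> U'" "i < Suc m" for e i
    using that n(3,5,6) co[of e i] by (cases "i = m") auto
  then show ?case using n t(2) by (intro exI[of _ U'] exI[of _ k] exI[of _ \<tau>'] exI[of _ \<sigma>']) auto
qed

section \<open>The kernel bundle\<close>

definition ker_set :: "('b, 'e) vbundle \<Rightarrow> ('b, 'f) vbundle \<Rightarrow> ('e \<Rightarrow> 'f) \<Rightarrow> 'e set" where
  "ker_set E F s = {v \<in> pts (tot E). s v = vzero F (proj E v)}"

definition ker_bundle :: "('b, 'e) vbundle \<Rightarrow> ('b, 'f) vbundle \<Rightarrow> ('e \<Rightarrow> 'f) \<Rightarrow> ('b, 'e) vbundle" where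
  "ker_bundle E F s = \<lparr>base = base E, tot = submfd (tot E) (ker_set E F s), proj = proj E,
     vadd = vadd E, vscale = vscale E, vzero = vzero E\<rparr>"

lemma ker_bundle_simps [simp]:
  "base (ker_bundle E F s) = base E" "tot (ker_bundle E F s) = submfd (tot E) (ker_set E F s)"
  "proj (ker_bundle E F s) = proj E" "vadd (ker_bundle E F s) = vadd E" "vscale (ker_bundle E F s) = vscale E"
  "vzero (ker_bundle E F s) = vzero E"
  by (simp_all add: ker_bundle_def)

lemma pts_ker: "pts (submfd (tot E) (ker_set E F s)) = ker_set E F s"
  by (auto simp: ker_set_def)

context
  fixes E :: "('b, 'e) vbundle" and F :: "('b, 'f) vbundle" and s :: "'e \<Rightarrow> 'f"
  assumes E: "vector_bundle E" and F: "vector_bundle F" and b: "base F = base E"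
    and s: "vb_map E F (\<lambda>x. x) s"
    and surj: "\<And>w. w \<in> pts (tot F) \<Longrightarrow> \<exists>v\<in>pts (tot E). proj E v = proj F w \<and> s v = w"
begin

text \<open>The components of \<open>s\<close> in a trivialization of \<open>F\<close> are
  functionals on \<open>E\<close>, jointly onto because \<open>s\<close> is. In a trivialization
  adapted to them they are the last fibre coordinates, so the kernel is the coordinate subspace
  R^r.\<close>

lemma ker_local_triv:
  assumes x: "x \<in> pts (base E)"
  obtains U k r \<tau> \<sigma> where "x \<in> U" "local_triv E U k \<tau> \<sigma>" "r \<le> k"
    "\<And>e. e \<in> pts (tot E) \<Longrightarrow> proj E e \<in> U \<Longrightarrow> e \<in> ker_set E F s \<longleftrightarrow> \<tau> e \<in> EU r"
proof -
  note D = vb_mapD[OF s prebundle_vector_bundle[OF E] F]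
  obtain U' m \<tau>' \<sigma>' where t': "x \<in> U'" "local_triv F U' m \<tau>' \<sigma>'"
    using vector_bundle_triv[OF F] x b by metis
  note T' = local_trivD[OF t'(2)]
  have fn: "smooth_functional E U' (\<lambda>v. \<tau>' (s v) i)" for i
    unfolding smooth_functional_def
  proof (intro conjI ballI impI allI)
    show "openin (mtop (base E)) U'" using T'(1) b by simp
    show "psmooth_real (submfd (tot E) {e \<in> pts (tot E). proj E e \<in> U'}) (\<lambda>v. \<tau>' (s v) i)"
      by (rule psmooth_real_coord[OF psmooth_triv[OF F t'(2) psmooth_submfd[OF D(2)]]]) (auto simp: D(4))
  next
    fix a b assume "a \<in> pts (tot E)" "proj E a \<in> U'" "b \<in> pts (tot E)" "proj E a = proj E b"
    then show "\<tau>' (s (vadd E a b)) i = \<tau>' (s a) i + \<tau>' (s b) i" using T'(9)[of "s a" "s b"] D by simp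
  next
    fix a r assume "a \<in> pts (tot E)" "proj E a \<in> U'"
    then show "\<tau>' (s (vscale E r a)) i = r * \<tau>' (s a) i" using T'(10)[of "s a" r] D by simp
  qed
  have sj: "\<exists>v\<in>pts (tot E). proj E v = x \<and> (\<forall>i<m. \<tau>' (s v) i = c i)" for c
  proof -
    have c: "vtake m c \<in> EU m" by simp
    obtain v where "v \<in> pts (tot E)" "proj E v = proj F (\<sigma>' x (vtake m c))" "s v = \<sigma>' x (vtake m c)"
      using surj[OF T'(4)[OF t'(1) c]] by blast
    then show ?thesis using T'(5,6)[OF t'(1) c] by (intro bexI[of _ v]) (auto simp: vtake_def)
  qed
  have "openin (mtop (base E)) U'" using T'(1) b by simp
  from local_triv_adapted[OF E t'(1) this fn sj]
  obtain U k \<tau> \<sigma> where t: "x \<in> U" "U \<subseteq> U'" "m \<le> k" "local_triv E U k \<tau> \<sigma>"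
    and co: "\<And>e i. e \<in> pts (tot E) \<Longrightarrow> proj E e \<in> U \<Longrightarrow> i < m \<Longrightarrow> \<tau> e (k - 1 - i) = \<tau>' (s e) i" by blast
  have "e \<in> ker_set E F s \<longleftrightarrow> \<tau> e \<in> EU (k - m)" if e: "e \<in> pts (tot E)" "proj E e \<in> U" for e
  proof -
    have se: "s e \<in> pts (tot F)" "proj F (s e) = proj E e" "proj E e \<in> U'" using D e t(2) by auto
    have "e \<in> ker_set E F s \<longleftrightarrow> s e = vzero F (proj E e)" using e by (simp add: ker_set_def)
    also have "\<dots> \<longleftrightarrow> \<tau>' (s e) = (\<lambda>i. 0)"
      using local_triv_zero[OF F t'(2) se(3)] T'(8)[OF se(1)] se by metis
    also have "\<dots> \<longleftrightarrow> (\<forall>i<m. \<tau>' (s e) i = 0)"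
      using T'(7)[OF se(1)] se by (auto simp: EU_iff fun_eq_iff) (metis not_le)
    also have "\<dots> \<longleftrightarrow> (\<forall>i<m. \<tau> e (k - 1 - i) = 0)" using co[OF e] by simp
    also have "\<dots> \<longleftrightarrow> \<tau> e \<in> EU (k - m)"
    proof
      assume z: "\<forall>i<m. \<tau> e (k - 1 - i) = 0"
      show "\<tau> e \<in> EU (k - m)"
        unfolding EU_iff
      proof (intro allI impI)
        fix i assume i: "k - m \<le> i"
        show "\<tau> e i = 0"
        proof (cases "i < k")
          case True
          then have "k - 1 - i < m" "k - 1 - (k - 1 - i) = i" using i t(3) by auto
          then show ?thesis using z by metis
        next
          case False
          then show ?thesis using local_trivD(7)[OF t(4) e] by (auto simp: EU_iff)
        qed
      qed
    next
      assume "\<tau> e \<in> EU (k - m)"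
      then show "\<forall>i<m. \<tau> e (k - 1 - i) = 0" using t(3) by (auto simp: EU_iff)
    qed
    finally show ?thesis .
  qed
  then show thesis using that[of U k \<tau> \<sigma> "k - m"] t by auto
qed

lemma ker_covered: "covered (tot (ker_bundle E F s)) = ker_set E F s"
proof
  show "covered (tot (ker_bundle E F s)) \<subseteq> ker_set E F s"
    using covered_subset_pts[OF premanifold_submfd[OF vector_bundleD(5)[OF E]]] pts_ker by auto
  show "ker_set E F s \<subseteq> covered (tot (ker_bundle E F s))"
  proof
    fix v assume v: "v \<in> ker_set E F s"
    then have vE: "v \<in> pts (tot E)" by (simp add: ker_set_def)
    note EB = vector_bundleD[OF E]
    obtain U k r \<tau> \<sigma> where t: "proj E v \<in> U" "local_triv E U k \<tau> \<sigma>" "r \<le> k"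
      "\<And>e. e \<in> pts (tot E) \<Longrightarrow> proj E e \<in> U \<Longrightarrow> e \<in> ker_set E F s \<longleftrightarrow> \<tau> e \<in> EU r"
      using ker_local_triv[OF EB(9)[OF vE]] by metis
    have "proj E v \<in> covered (base E)" using EB(6,9) vE by simp
    then obtain n V \<psi> where c: "(n, V, \<psi>) \<in> atlas (base E)" "proj E v \<in> V" by (rule coveredE)
    let ?W = "{e \<in> pts (tot E). proj E e \<in> V \<inter> U}" and ?\<Phi> = "\<lambda>e. join n (\<psi> (proj E e)) (\<tau> e)"
    have mx: "(n + k, ?W, ?\<Phi>) \<in> maximal_atlas (tot E)" by (rule local_triv_chart[OF E t(2) c(1)])
    have "?\<Phi> e \<in> EU (n + r) \<longleftrightarrow> e \<in> ker_set E F s" if "e \<in> ?W" for e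
    proof -
      have "?\<Phi> e \<in> EU (n + r) \<longleftrightarrow> \<tau> e \<in> EU r"
        using vdrop_EU[of "?\<Phi> e" n r] by (auto simp del: vdrop_EU)
      then show ?thesis using t(4)[of e] that by auto
    qed
    then have "(n + r, ?W \<inter> ker_set E F s, ?\<Phi>) \<in> atlas (submfd (tot E) (ker_set E F s))"
      using t(3) by (intro submfd_atlasI[OF _ mx]) auto
    then show "v \<in> covered (tot (ker_bundle E F s))"
      using v vE t(1) c(2) by (auto intro: coveredI)
  qed
qed

lemma vector_bundle_ker: "vector_bundle (ker_bundle E F s)"
  unfolding vector_bundle_iff
proof (intro conjI ballI)
  note EB = vector_bundleD[OF E] and D = vb_mapD[OF s prebundle_vector_bundle[OF E] F]
  let ?K = "ker_bundle E F s"
  show "manifold (base ?K)" using EB by simp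
  show "manifold (tot ?K)" using manifold_submfd[OF EB(2)] ker_covered pts_ker by (metis ker_bundle_simps(2))
  show "psmooth (tot ?K) (base ?K) (proj ?K)" using psmooth_submfd[OF EB(3)] by simp
  fix x assume "x \<in> pts (base ?K)"
  then have x: "x \<in> pts (base E)" by simp
  note O = vector_bundle_fibre_ops[OF E]
  have z: "vzero F y = vadd F (vzero F y) (vzero F y)" "vzero F y = vscale F r (vzero F y)" if "y \<in> pts (base E)" for y r
    using that b vector_bundle_fibre_ops[OF F] by (auto intro!: coord_eqI[OF F] simp: coord_ops[OF F])
  show "vector_space_fibre ?K x"
  proof (rule vector_space_fibreI[where c = "coord E"])
    show "vzero ?K x \<in> pts (tot ?K)" 
      using O(1,2)[OF x] vb_map_zero[OF s E F x] unfolding ker_bundle_simps pts_ker by (simp add: ker_set_def)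
    show "vadd ?K p q \<in> pts (tot ?K) \<and> proj ?K (vadd ?K p q) = x"
      if "p \<in> pts (tot ?K)" "proj ?K p = x" "q \<in> pts (tot ?K)" "proj ?K q = x" for p q
      using that O z(1)[OF x] D unfolding ker_bundle_simps pts_ker by (simp add: ker_set_def)
    show "vscale ?K r p \<in> pts (tot ?K) \<and> proj ?K (vscale ?K r p) = x"
      if "p \<in> pts (tot ?K)" "proj ?K p = x" for p r
      using that O z(2)[OF x, of r] D unfolding ker_bundle_simps pts_ker by (simp add: ker_set_def)
    show "p = q" if "p \<in> pts (tot ?K)" "proj ?K p = x" "q \<in> pts (tot ?K)" "proj ?K q = x" "\<And>i. coord E p i = coord E q i" for p q
      using that coord_eqI[OF E, of p q] by simp
  qed (use O x coord_ops[OF E] in auto)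
  obtain U k r \<tau> \<sigma> where t: "x \<in> U" "local_triv E U k \<tau> \<sigma>" "r \<le> k"
    "\<And>e. e \<in> pts (tot E) \<Longrightarrow> proj E e \<in> U \<Longrightarrow> e \<in> ker_set E F s \<longleftrightarrow> \<tau> e \<in> EU r"
    using ker_local_triv[OF x] by metis
  note T = local_trivD[OF t(2)]
  have rk: "EU r \<subseteq> EU k" by (rule EU_mono[OF t(3)])
  have pK: "premanifold (tot ?K)" using premanifold_submfd[OF EB(5)] by simp
  have sK: "\<sigma> y v \<in> ker_set E F s" if "y \<in> U" "v \<in> EU r" for y v
  proof -
    have "v \<in> EU k" using that(2) rk by blast
    then show ?thesis using t(4)[OF T(4)[OF that(1)]] T(5,6)[OF that(1)] that by simp
  qed
  \<comment> \<open>The adapted trivialization itself serves, with vectors cut down from R^k to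
    R^r.\<close>
  have "local_triv ?K U r \<tau> \<sigma>"
    unfolding local_triv_def
  proof (intro conjI ballI impI allI)
    let ?S = "submfd (tot ?K) {e \<in> pts (tot ?K). proj ?K e \<in> U}"
    have S: "psmooth ?S (tot E) (\<lambda>e. e)"
      using psmooth_comp[OF psmooth_incl[OF pK] psmooth_incl[OF EB(5), of "ker_set E F s", folded ker_bundle_simps(2)[of E F s]]] .
    show "psmooth ?S (Rn r) \<tau>"
    proof (rule psmooth_RnI)
      show "premanifold ?S" by (rule psmoothD(1)[OF S])
      show "\<tau> e \<in> EU r" if "e \<in> pts ?S" for e
        using that t(4)[of e] by auto
      show "psmooth_real ?S (\<lambda>x. \<tau> x j)" for j
        by (rule psmooth_real_coord[OF psmooth_triv[OF E t(2) S]]) auto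
    qed
    let ?P = "prod_mfd (submfd (base ?K) U) (Rn r)"
    have pU: "premanifold (submfd (base E) U)" by (rule premanifold_submfd[OF EB(4)])
    have P: "psmooth ?P (base E) fst" "psmooth ?P (Rn r) snd"
      using psmooth_comp[OF psmooth_fst[OF pU premanifold_Rn] psmooth_incl[OF EB(4)]] psmooth_snd[OF pU premanifold_Rn] by auto
    have P2: "psmooth ?P (Rn k) snd"
      by (rule psmooth_RnI[OF psmoothD(1)[OF P(2)] _ psmooth_real_coord[OF P(2)]]) (use rk in \<open>auto simp del: subset_Euclidean_space\<close>)
    have g: "psmooth ?P (tot E) (\<lambda>z. \<sigma> (fst z) (snd z))"
      by (rule psmooth_triv_inv[OF E t(2) P(1) _ P2]) auto
    have zU: "fst z \<in> U \<and> snd z \<in> EU r" if "z \<in> pts ?P" for z using that by auto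
    have "psmooth ?P (tot ?K) (\<lambda>z. \<sigma> (fst z) (snd z))"
      unfolding ker_bundle_simps(2)
    proof (rule psmooth_into_submfd[OF g])
      show "\<sigma> (fst z) (snd z) \<in> ker_set E F s" if "z \<in> pts ?P" for z using sK zU[OF that] by blast
      then show "\<sigma> (fst z) (snd z) \<in> covered (submfd (tot E) (ker_set E F s))" if "z \<in> covered ?P" for z
        using ker_covered that covered_subset_pts[OF psmoothD(1)[OF g]] by auto
    qed
    then show "psmooth ?P (tot ?K) (\<lambda>(y, v). \<sigma> y v)" by (simp add: case_prod_unfold)
  next
    fix y v assume y: "y \<in> U" "v \<in> EU r"
    then have vk: "v \<in> EU k" using rk by blast
    show "\<sigma> y v \<in> fibre ?K y" using sK[OF y] T(5)[OF y(1) vk] unfolding fibre_def ker_bundle_simps pts_ker by simp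
    show "\<tau> (\<sigma> y v) = v" by (rule T(6)[OF y(1) vk])
  next
    fix e assume "e \<in> pts (tot ?K)" "proj ?K e \<in> U"
    then have e: "e \<in> ker_set E F s" "e \<in> pts (tot E)" "proj E e \<in> U" unfolding ker_bundle_simps pts_ker by (auto simp: ker_set_def)
    show "\<tau> e \<in> EU r" "\<sigma> (proj ?K e) (\<tau> e) = e" using t(4) T(8) e by auto
  qed (use T(1,9,10) in \<open>auto simp: fibre_def\<close>)
  then show "\<exists>U k \<tau> \<sigma>. x \<in> U \<and> local_triv ?K U k \<tau> \<sigma>" using t(1) by blast
qed

end

subsection \<open>Transport along a bijection of types\<close>

text \<open>The manifold structure that turns \<open>j\<close> into a diffeomorphism, when
  \<open>j\<close> is a bijection.\<close>

definition transport_mfd :: "('u \<Rightarrow> 'y) \<Rightarrow> 'y mfd \<Rightarrow> 'u mfd" where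
  "transport_mfd j X = \<lparr>mtop = pullback_topology UNIV j (mtop X),
     atlas = {(n, j -` U, \<phi> \<circ> j) | n U \<phi>. (n, U, \<phi>) \<in> atlas X}\<rparr>"

definition transport_vb :: "('u \<Rightarrow> 'y) \<Rightarrow> ('b, 'y) vbundle \<Rightarrow> ('b, 'u) vbundle" where
  "transport_vb j E = \<lparr>base = base E, tot = transport_mfd j (tot E), proj = (\<lambda>u. proj E (j u)),
     vadd = (\<lambda>a b. inv j (vadd E (j a) (j b))), vscale = (\<lambda>r a. inv j (vscale E r (j a))),
     vzero = (\<lambda>x. inv j (vzero E x))\<rparr>"

lemma transport_vb_simps [simp]:
  "base (transport_vb j E) = base E" "tot (transport_vb j E) = transport_mfd j (tot E)"
  "proj (transport_vb j E) u = proj E (j u)" "vadd (transport_vb j E) a b = inv j (vadd E (j a) (j b))"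
  "vscale (transport_vb j E) r a = inv j (vscale E r (j a))" "vzero (transport_vb j E) x = inv j (vzero E x)"
  by (simp_all add: transport_vb_def)

context
  fixes j :: "'u \<Rightarrow> 'y"
  assumes j: "bij j"
begin

lemma j_inv [simp]: "j (inv j y) = y" "inv j (j u) = u"
  using j by (simp_all add: bij_is_surj surj_f_inv_f bij_is_inj)

lemma mtop_transport: "mtop (transport_mfd j X) = pullback_topology UNIV j (mtop X)"
  by (simp add: transport_mfd_def)

lemma pts_transport [simp]: "pts (transport_mfd j X) = j -` pts X"
  by (simp add: mtop_transport topspace_pullback_topology)

lemma continuous_map_j: "continuous_map (mtop (transport_mfd j X)) (mtop X) j"
  using continuous_map_pullback[OF continuous_map_id, of UNIV j "mtop X"] by (simp add: mtop_transport)

lemma continuous_map_inv_j: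
  "continuous_map T (mtop X) f \<Longrightarrow> continuous_map T (mtop (transport_mfd j X)) (\<lambda>x. inv j (f x))"
  unfolding mtop_transport by (rule continuous_map_pullback') (auto simp: comp_def)

lemma vimage_image_j: "(\<phi> \<circ> j) ` (j -` A) = \<phi> ` A"
proof -
  have "j ` (j -` A) = A" using j by (simp add: bij_is_surj surj_image_vimage_eq)
  then show ?thesis by (metis image_comp)
qed

lemma transport_chart:
  assumes "is_chart (mtop X) (n, U, \<phi>)"
  shows "is_chart (mtop (transport_mfd j X)) (n, j -` U, \<phi> \<circ> j)"
    "x \<in> \<phi> ` U \<Longrightarrow> inv_into (j -` U) (\<phi> \<circ> j) x = inv j (inv_into U \<phi> x)"
proof -
  note C = is_chartD[OF assms]
  have op: "openin (mtop (transport_mfd j X)) (j -` U)"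
    using C(1) by (auto simp: mtop_transport openin_pullback_topology)
  have "continuous_map (subtopology (mtop (transport_mfd j X)) (j -` U)) (subtopology (mtop X) U) j"
    using continuous_map_from_subtopology[OF continuous_map_j] by (auto simp: continuous_map_in_subtopology)
  then have 1: "continuous_map (subtopology (mtop (transport_mfd j X)) (j -` U)) (Euclidean_space n) (\<phi> \<circ> j)"
    by (rule continuous_map_compose[OF _ C(6)])
  have i1: "(\<phi> \<circ> j) p \<in> \<phi> ` U \<and> inv j (inv_into U \<phi> ((\<phi> \<circ> j) p)) = p" if "p \<in> j -` U" for p
    using that C(3) by (auto simp: inv_into_f_f)
  have i2: "inv j (inv_into U \<phi> x) \<in> j -` U \<and> (\<phi> \<circ> j) (inv j (inv_into U \<phi> x)) = x" if "x \<in> \<phi> ` U" for x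
    using that by (auto simp: f_inv_into_f inv_into_into)
  note I = is_chartI[OF op C(2) 1 continuous_map_inv_j[OF C(7)] i1 i2]
  show "is_chart (mtop (transport_mfd j X)) (n, j -` U, \<phi> \<circ> j)" by (rule I(1)) assumption+
  show "x \<in> \<phi> ` U \<Longrightarrow> inv_into (j -` U) (\<phi> \<circ> j) x = inv j (inv_into U \<phi> x)" using I(3)[of x] by (simp add: comp_def)
qed

lemma transport_atlasE:
  assumes "(n, W, \<theta>) \<in> atlas (transport_mfd j X)"
  obtains U \<phi> where "(n, U, \<phi>) \<in> atlas X" "W = j -` U" "\<theta> = \<phi> \<circ> j"
  using assms by (auto simp: transport_mfd_def)

lemma covered_transport: "covered (transport_mfd j X) = j -` covered X"
  by (auto simp: covered_def transport_mfd_def)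

lemma transport_smooth_euclid:
  assumes X: "premanifold X" and c: "(n, U, \<phi>) \<in> atlas X" and d: "(m, V, \<psi>) \<in> atlas X"
  shows "smooth_euclid n m ((\<phi> \<circ> j) ` (j -` U \<inter> j -` V)) (\<psi> \<circ> j \<circ> inv_into (j -` U) (\<phi> \<circ> j))"
proof -
  note ch = premanifold_chart[OF X c] premanifold_chart[OF X d]
  have o: "openin (Euclidean_space n) (\<phi> ` (U \<inter> V))"
    using is_chartD(1)[OF ch(1)] is_chartD(1)[OF ch(2)] by (intro chart_image_open[OF ch(1)]) auto
  have "compatible (n, U, \<phi>) (m, V, \<psi>)" using X c d by (auto simp: premanifold_def)
  then have "smooth_euclid n m (\<phi> ` (U \<inter> V)) (\<psi> \<circ> inv_into U \<phi>)" by (simp add: compatible_def)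
  then have "smooth_euclid n m (\<phi> ` (U \<inter> V)) (\<psi> \<circ> j \<circ> inv_into (j -` U) (\<phi> \<circ> j))"
  proof (rule smooth_euclid_cong[OF o, rotated])
    fix x assume "x \<in> \<phi> ` (U \<inter> V)"
    then have "x \<in> \<phi> ` U" by auto
    from transport_chart(2)[OF ch(1) this]
    show "(\<psi> \<circ> inv_into U \<phi>) x = (\<psi> \<circ> j \<circ> inv_into (j -` U) (\<phi> \<circ> j)) x" by simp
  qed
  then show ?thesis using vimage_image_j[of \<phi> "U \<inter> V"] by (simp add: vimage_Int)
qed

lemma premanifold_transport:
  assumes X: "premanifold X" shows "premanifold (transport_mfd j X)"
  unfolding premanifold_def
proof (intro conjI ballI)
  fix c assume c: "c \<in> atlas (transport_mfd j X)"
  obtain n W \<theta> where cc: "c = (n, W, \<theta>)" by (cases c)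
  from c[unfolded cc] obtain U \<phi> where 1: "(n, U, \<phi>) \<in> atlas X" "W = j -` U" "\<theta> = \<phi> \<circ> j" by (rule transport_atlasE)
  show "is_chart (mtop (transport_mfd j X)) c"
    unfolding cc 1 by (rule transport_chart(1)[OF premanifold_chart[OF X 1(1)]])
  fix d assume d: "d \<in> atlas (transport_mfd j X)"
  obtain m W' \<theta>' where dd: "d = (m, W', \<theta>')" by (cases d)
  from d[unfolded dd] obtain V \<psi> where 2: "(m, V, \<psi>) \<in> atlas X" "W' = j -` V" "\<theta>' = \<psi> \<circ> j" by (rule transport_atlasE)
  show "compatible c d"
    unfolding cc dd 1(2,3) 2(2,3) compatible_def
    using transport_smooth_euclid[OF X 1(1) 2(1)] transport_smooth_euclid[OF X 2(1) 1(1)] by (simp add: Int_commute)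
qed

lemma psmooth_j: 
  assumes X: "premanifold X" shows "psmooth (transport_mfd j X) X j"
proof (rule psmoothI[OF premanifold_transport[OF X] X continuous_map_j])
  show "j ` covered (transport_mfd j X) \<subseteq> covered X" by (auto simp: covered_transport)
  fix n W \<theta> m V \<psi> assume "(n, W, \<theta>) \<in> atlas (transport_mfd j X)" and d: "(m, V, \<psi>) \<in> atlas X"
  then obtain U \<phi> where 1: "(n, U, \<phi>) \<in> atlas X" "W = j -` U" "\<theta> = \<phi> \<circ> j" by (elim transport_atlasE)
  show "smooth_euclid n m (\<theta> ` (W \<inter> j -` V)) (\<psi> \<circ> j \<circ> inv_into W \<theta>)"
    unfolding 1(2,3) by (rule transport_smooth_euclid[OF X 1(1) d])
qed

lemma psmooth_inv_j:
  assumes f: "psmooth Y X f" shows "psmooth Y (transport_mfd j X) (\<lambda>x. inv j (f x))"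
proof (rule psmoothI[OF psmoothD(1)[OF f] premanifold_transport[OF psmoothD(2)[OF f]] continuous_map_inv_j[OF psmoothD(3)[OF f]]])
  show "(\<lambda>x. inv j (f x)) ` covered Y \<subseteq> covered (transport_mfd j X)" using psmoothD(4)[OF f] by (auto simp: covered_transport)
  fix n U \<phi> m W \<theta> assume c: "(n, U, \<phi>) \<in> atlas Y" and "(m, W, \<theta>) \<in> atlas (transport_mfd j X)"
  then obtain V \<psi> where 1: "(m, V, \<psi>) \<in> atlas X" "W = j -` V" "\<theta> = \<psi> \<circ> j" by (elim transport_atlasE)
  have "smooth_euclid n m (\<phi> ` (U \<inter> f -` V)) (\<psi> \<circ> f \<circ> inv_into U \<phi>)"
    using psmoothD(5)[OF f] c 1 unfolding smooth_map_def by fastforce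
  moreover have "U \<inter> (\<lambda>x. inv j (f x)) -` W = U \<inter> f -` V" using 1 by auto
  moreover have "\<theta> \<circ> (\<lambda>x. inv j (f x)) \<circ> inv_into U \<phi> = \<psi> \<circ> f \<circ> inv_into U \<phi>" by (simp add: 1 fun_eq_iff)
  ultimately show "smooth_euclid n m (\<phi> ` (U \<inter> (\<lambda>x. inv j (f x)) -` W)) (\<theta> \<circ> (\<lambda>x. inv j (f x)) \<circ> inv_into U \<phi>)"
    by simp
qed

lemma manifold_transport:
  assumes X: "manifold X" shows "manifold (transport_mfd j X)"
proof -
  have "homeomorphic_maps (mtop (transport_mfd j X)) (mtop X) j (\<lambda>x. inv j x)"
    unfolding homeomorphic_maps_def
    using continuous_map_j[of X] continuous_map_inv_j[OF continuous_map_id[unfolded id_def], of X] by auto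
  then have h: "mtop (transport_mfd j X) homeomorphic_space mtop X" unfolding homeomorphic_space_def by blast
  show ?thesis
    using X premanifold_transport[OF manifoldD(1)[OF X]] homeomorphic_Hausdorff_space[OF h]
      homeomorphic_space_second_countability[OF h]
    by (simp add: manifold_def premanifold_def covered_transport)
qed

lemma vector_bundle_transport:
  assumes E: "vector_bundle E" shows "vector_bundle (transport_vb j E)"
  unfolding vector_bundle_iff
proof (intro conjI ballI)
  note EB = vector_bundleD[OF E] and O = vector_bundle_fibre_ops[OF E]
  let ?T = "transport_vb j E"
  show "manifold (base ?T)" "manifold (tot ?T)" using EB by (simp_all add: manifold_transport)
  have "psmooth (tot ?T) (base E) (\<lambda>u. proj E (j u))" using psmooth_comp[OF psmooth_j[OF EB(5)] EB(3)] by simp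
  moreover have "proj ?T = (\<lambda>u. proj E (j u))" by (simp add: transport_vb_def)
  ultimately show "psmooth (tot ?T) (base ?T) (proj ?T)" by simp
  fix x assume "x \<in> pts (base ?T)"
  then have x: "x \<in> pts (base E)" by simp
  show "vector_space_fibre ?T x"
  proof (rule vector_space_fibreI[where c = "\<lambda>u. coord E (j u)"])
    fix a b assume "a \<in> pts (tot ?T)" "proj ?T a = x" "b \<in> pts (tot ?T)" "proj ?T b = x" "\<And>i. coord E (j a) i = coord E (j b) i"
    then have "j a = j b" using coord_eqI[OF E, of "j a" "j b"] by auto
    then show "a = b" by (metis j_inv(2))
  qed (use O x coord_ops[OF E] in auto)
  obtain U k \<tau> \<sigma> where t: "x \<in> U" "local_triv E U k \<tau> \<sigma>" using vector_bundle_triv[OF E x] .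
  note T = local_trivD[OF t(2)]
  have "local_triv ?T U k (\<lambda>u. \<tau> (j u)) (\<lambda>y v. inv j (\<sigma> y v))"
    unfolding local_triv_def
  proof (intro conjI ballI impI allI)
    show "psmooth (submfd (tot ?T) {e \<in> pts (tot ?T). proj ?T e \<in> U}) (Rn k) (\<lambda>u. \<tau> (j u))"
      by (rule psmooth_triv[OF E t(2)]) (use psmooth_submfd[OF psmooth_j[OF EB(5)]] in auto)
    show "psmooth (prod_mfd (submfd (base ?T) U) (Rn k)) (tot ?T) (\<lambda>(y, v). inv j (\<sigma> y v))"
      using psmooth_inv_j[OF T(3)] by (simp add: case_prod_unfold)
  qed (use T in \<open>auto simp: fibre_def\<close>)
  then show "\<exists>U k \<tau> \<sigma>. x \<in> U \<and> local_triv ?T U k \<tau> \<sigma>" using t(1) by blast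
qed

end

section \<open>Lie groupoids and linear Lie groupoid bundles\<close>

lemma pts_comp_pairs [simp]:
  "pts (comp_pairs G) = {(g, h). g \<in> pts (Arr G) \<and> h \<in> pts (Arr G) \<and> gsrc G g = gtgt G h}"
  by (simp add: comp_pairs_def)

lemma lie_groupoidD:
  assumes "lie_groupoid G"
  shows "manifold (Obj G)" "manifold (Arr G)" "premanifold (Arr G)" "premanifold (comp_pairs G)"
    "psmooth (Arr G) (Obj G) (gsrc G)" "psmooth (Arr G) (Obj G) (gtgt G)" "psmooth (Obj G) (Arr G) (gunit G)"
    "psmooth (comp_pairs G) (Arr G) (\<lambda>(g, h). gmult G g h)"
    "psmooth (comp_pairs G) (Arr G) fst" "psmooth (comp_pairs G) (Arr G) snd"
    "psmooth (comp_pairs G) (Obj G) (src2 G)" "psmooth (comp_pairs G) (Obj G) (tgt2 G)"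
proof -
  have m: "manifold (Obj G)" "manifold (Arr G)" and 
    s: "smooth_map (Arr G) (Obj G) (gsrc G)" "smooth_map (Arr G) (Obj G) (gtgt G)" "smooth_map (Obj G) (Arr G) (gunit G)"
      "smooth_map (comp_pairs G) (Arr G) (\<lambda>(g, h). gmult G g h)"
    using assms by (simp_all add: lie_groupoid_def submersion_def)
  note M = manifoldD[OF m(1)] manifoldD[OF m(2)]
  show p: "premanifold (comp_pairs G)" unfolding comp_pairs_def by (rule premanifold_fibre_prod[OF M(3,3)])
  show "manifold (Obj G)" "manifold (Arr G)" "premanifold (Arr G)" using m M by auto
  show src: "psmooth (Arr G) (Obj G) (gsrc G)" and tgt: "psmooth (Arr G) (Obj G) (gtgt G)" and "psmooth (Obj G) (Arr G) (gunit G)"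
    "psmooth (comp_pairs G) (Arr G) (\<lambda>(g, h). gmult G g h)"
    using s M p psmooth_full_iff by blast+
  show f: "psmooth (comp_pairs G) (Arr G) fst" and s: "psmooth (comp_pairs G) (Arr G) snd"
    unfolding comp_pairs_def by (rule psmooth_fibre_prod_fst[OF M(3,3)], rule psmooth_fibre_prod_snd[OF M(3,3)])
  show "psmooth (comp_pairs G) (Obj G) (src2 G)" "psmooth (comp_pairs G) (Obj G) (tgt2 G)"
    using psmooth_comp[OF s src] psmooth_comp[OF f tgt] by (simp_all add: case_prod_unfold)
qed

lemma groupoid_laws:
  assumes G: "lie_groupoid G"
  shows "g \<in> pts (Arr G) \<Longrightarrow> gsrc G g \<in> pts (Obj G)" "g \<in> pts (Arr G) \<Longrightarrow> gtgt G g \<in> pts (Obj G)"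
    "x \<in> pts (Obj G) \<Longrightarrow> gunit G x \<in> pts (Arr G)" "x \<in> pts (Obj G) \<Longrightarrow> gsrc G (gunit G x) = x"
    "x \<in> pts (Obj G) \<Longrightarrow> gtgt G (gunit G x) = x"
    "g \<in> pts (Arr G) \<Longrightarrow> h \<in> pts (Arr G) \<Longrightarrow> gsrc G g = gtgt G h \<Longrightarrow> gmult G g h \<in> pts (Arr G)"
    "g \<in> pts (Arr G) \<Longrightarrow> h \<in> pts (Arr G) \<Longrightarrow> gsrc G g = gtgt G h \<Longrightarrow> gsrc G (gmult G g h) = gsrc G h"
    "g \<in> pts (Arr G) \<Longrightarrow> h \<in> pts (Arr G) \<Longrightarrow> gsrc G g = gtgt G h \<Longrightarrow> gtgt G (gmult G g h) = gtgt G g"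
    "g \<in> pts (Arr G) \<Longrightarrow> gmult G g (gunit G (gsrc G g)) = g" "g \<in> pts (Arr G) \<Longrightarrow> gmult G (gunit G (gtgt G g)) g = g"
proof -
  note D = lie_groupoidD[OF G]
  show "g \<in> pts (Arr G) \<Longrightarrow> gsrc G g \<in> pts (Obj G)" "g \<in> pts (Arr G) \<Longrightarrow> gtgt G g \<in> pts (Obj G)"
    "x \<in> pts (Obj G) \<Longrightarrow> gunit G x \<in> pts (Arr G)"
    using psmoothD(6)[OF D(5)] psmoothD(6)[OF D(6)] psmoothD(6)[OF D(7)] by auto
  show "g \<in> pts (Arr G) \<Longrightarrow> h \<in> pts (Arr G) \<Longrightarrow> gsrc G g = gtgt G h \<Longrightarrow> gmult G g h \<in> pts (Arr G)"
    using psmoothD(6)[OF D(8), of "(g, h)"] by simp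
qed (use G in \<open>auto simp: lie_groupoid_def\<close>)

lemma grpd_simps [simp]:
  "Obj (grpd V) = tot (Vob V)" "Arr (grpd V) = tot (Varr V)" "gsrc (grpd V) = lsrc V" "gtgt (grpd V) = ltgt V"
  "gunit (grpd V) = lunit V" "ginv (grpd V) = linv V" "gmult (grpd V) = lmult V"
  by (simp_all add: grpd_def)

lemma lgb_basicD:
  assumes V: "linear_lie_groupoid_bundle V"
  shows "lie_groupoid (grpd V)" "vector_bundle (Vob V)" "vector_bundle (Varr V)" "base (Varr V) = base (Vob V)"
    "vb_map (Varr V) (Vob V) (\<lambda>x. x) (lsrc V)" "vb_map (Varr V) (Vob V) (\<lambda>x. x) (ltgt V)"
    "vb_map (Vob V) (Varr V) (\<lambda>x. x) (lunit V)"
    "vb_map (comp_vb V) (Varr V) (\<lambda>x. x) (\<lambda>(v, w). lmult V v w)"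
  using V by (auto simp: linear_lie_groupoid_bundle_def)

lemma lgb_maps:
  assumes V: "linear_lie_groupoid_bundle V"
  shows "v \<in> pts (tot (Varr V)) \<Longrightarrow> lsrc V v \<in> pts (tot (Vob V))" "v \<in> pts (tot (Varr V)) \<Longrightarrow> proj (Vob V) (lsrc V v) = proj (Varr V) v"
    "v \<in> pts (tot (Varr V)) \<Longrightarrow> ltgt V v \<in> pts (tot (Vob V))" "v \<in> pts (tot (Varr V)) \<Longrightarrow> proj (Vob V) (ltgt V v) = proj (Varr V) v"
    "x \<in> pts (tot (Vob V)) \<Longrightarrow> lunit V x \<in> pts (tot (Varr V))" "x \<in> pts (tot (Vob V)) \<Longrightarrow> proj (Varr V) (lunit V x) = proj (Vob V) x"
    "x \<in> pts (tot (Vob V)) \<Longrightarrow> lsrc V (lunit V x) = x" "x \<in> pts (tot (Vob V)) \<Longrightarrow> ltgt V (lunit V x) = x"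
proof -
  note D = lgb_basicD[OF V]
  note p = prebundle_vector_bundle[OF D(2)] prebundle_vector_bundle[OF D(3)]
  note s = vb_mapD[OF D(5) p(2) D(2)] and t = vb_mapD[OF D(6) p(2) D(2)] and u = vb_mapD[OF D(7) p(1) D(3)]
  show "v \<in> pts (tot (Varr V)) \<Longrightarrow> lsrc V v \<in> pts (tot (Vob V))" "v \<in> pts (tot (Varr V)) \<Longrightarrow> proj (Vob V) (lsrc V v) = proj (Varr V) v"
    "v \<in> pts (tot (Varr V)) \<Longrightarrow> ltgt V v \<in> pts (tot (Vob V))" "v \<in> pts (tot (Varr V)) \<Longrightarrow> proj (Vob V) (ltgt V v) = proj (Varr V) v"
    "x \<in> pts (tot (Vob V)) \<Longrightarrow> lunit V x \<in> pts (tot (Varr V))" "x \<in> pts (tot (Vob V)) \<Longrightarrow> proj (Varr V) (lunit V x) = proj (Vob V) x"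
    using s(3,4) t(3,4) u(3,4) by auto
  show "x \<in> pts (tot (Vob V)) \<Longrightarrow> lsrc V (lunit V x) = x" "x \<in> pts (tot (Vob V)) \<Longrightarrow> ltgt V (lunit V x) = x"
    using groupoid_laws(4,5)[OF D(1)] by simp_all
qed

text \<open>Linearity determines the multiplication: \<open>(v, w) = (v - 1, 0) + (1, w)\<close> where \<open>1\<close> is the unit at the
  source of \<open>v\<close>, and \<open>0\<close> is itself a unit.\<close>

lemma lmult_eq:
  assumes V: "linear_lie_groupoid_bundle V" and v: "v \<in> pts (tot (Varr V))" and w: "w \<in> pts (tot (Varr V))"
    and vw: "lsrc V v = ltgt V w"
  shows "lmult V v w = vadd (Varr V) (vsub (Varr V) v (lunit V (lsrc V v))) w"
proof -
  note D = lgb_basicD[OF V] and M = lgb_maps[OF V]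
  note p = prebundle_vector_bundle[OF D(2)] prebundle_vector_bundle[OF D(3)]
  note s = vb_mapD[OF D(5) p(2) D(2)] and t = vb_mapD[OF D(6) p(2) D(2)] and u = vb_mapD[OF D(7) p(1) D(3)]
  note O = vector_bundle_fibre_ops[OF D(3)] vector_bundle_fibre_ops[OF D(2)] and C = coord_ops[OF D(3)]
  let ?E = "Varr V"
  let ?u = "lunit V (lsrc V v)" and ?x = "proj ?E v"
  have xw: "proj ?E w = ?x" using M(2)[OF v] M(4)[OF w] vw by simp
  have x: "?x \<in> pts (base (Vob V))" "?x \<in> pts (base ?E)" using vector_bundleD(9)[OF D(3) v] D(4) by auto
  have u': "?u \<in> pts (tot ?E)" "proj ?E ?u = ?x" using M v by auto
  have d: "vsub ?E v ?u \<in> pts (tot ?E)" "proj ?E (vsub ?E v ?u) = ?x" using O(9,10) v u' by auto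
  have z: "vzero ?E ?x = lunit V (vzero (Vob V) ?x)" using vb_map_zero[OF D(7,2,3) x(1)] by simp
  have "lsrc V (vsub ?E v ?u) = vsub (Vob V) (lsrc V v) (lsrc V v)" using s(8)[OF v u'(1)] u' M(1,7) v by simp
  also have "\<dots> = vzero (Vob V) ?x"
    using M(1,2)[OF v] O(19,20) O(11,12)[OF x(1)] x(1) by (intro coord_eqI[OF D(2)]) (auto simp: coord_ops[OF D(2)])
  finally have sd: "lsrc V (vsub ?E v ?u) = vzero (Vob V) ?x" .
  have tz: "ltgt V (vzero ?E ?x) = vzero (Vob V) ?x" using vb_map_zero[OF D(6,3,2) x(2)] by simp
  \<comment> \<open>Both summands are composable pairs over the same base point: the difference
    \<open>v - 1\<close> and 0 meet in the zero vector, the unit and \<open>w\<close> meet in the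
    source of \<open>v\<close>.\<close>
  have a: "(vsub ?E v ?u, vzero ?E ?x) \<in> fibre (comp_vb V) ?x" "(?u, w) \<in> fibre (comp_vb V) ?x"
    using d u' O(1)[OF x(2)] sd tz w M(7)[OF M(1)[OF v]] vw by (auto simp: fibre_def comp_vb_def)
  have e: "vadd (comp_vb V) (vsub ?E v ?u, vzero ?E ?x) (?u, w) = (v, w)"
  proof -
    have "vadd ?E (vsub ?E v ?u) ?u = v"
      using v u' d O(3,4) by (intro coord_eqI[OF D(3)]) (auto simp: C)
    moreover have "vadd ?E (vzero ?E ?x) w = w"
      using w xw O(1,2)[OF x(2)] O(3,4) x(2) by (intro coord_eqI[OF D(3)]) (auto simp: C)
    ultimately show ?thesis by (simp add: comp_vb_def)
  qed
  have "lmult V v w = vadd ?E (lmult V (vsub ?E v ?u) (vzero ?E ?x)) (lmult V ?u w)"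
  proof -
    have "?x \<in> pts (base (comp_vb V))" using x by (simp add: comp_vb_def)
    moreover have "\<forall>x\<in>pts (base (comp_vb V)). \<forall>p\<in>fibre (comp_vb V) x. \<forall>q\<in>fibre (comp_vb V) x.
        (\<lambda>(v, w). lmult V v w) (vadd (comp_vb V) p q) = vadd ?E ((\<lambda>(v, w). lmult V v w) p) ((\<lambda>(v, w). lmult V v w) q)"
      using D(8) unfolding vb_map_def by blast
    ultimately have "(\<lambda>(v, w). lmult V v w) (vadd (comp_vb V) (vsub ?E v ?u, vzero ?E ?x) (?u, w)) =
        vadd ?E ((\<lambda>(v, w). lmult V v w) (vsub ?E v ?u, vzero ?E ?x)) ((\<lambda>(v, w). lmult V v w) (?u, w))"
      using a by blast
    then show ?thesis unfolding e by simp
  qed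
  moreover have "lmult V (vsub ?E v ?u) (vzero ?E ?x) = vsub ?E v ?u"
    using groupoid_laws(9)[OF D(1), of "vsub ?E v ?u"] d(1) by (simp add: sd z)
  moreover have "lmult V ?u w = w"
    using groupoid_laws(10)[OF D(1), of w] w by (simp add: vw)
  ultimately show ?thesis by simp
qed

subsection \<open>Split linear Lie groupoid bundles\<close>

text \<open>An identification of \<open>V\<close> with \<open>\<Phi>(C)\<close>: the arrow \<open>(a, x)\<close> of \<open>\<Phi>(C)\<close> corresponds to
  \<open>\<kappa> a + 1\<^sub>x\<close>, and \<open>\<rho>\<close> extracts \<open>a\<close>.\<close>

locale split_lgb =
  fixes V :: "('b, 'f, 'y) lgb" and C :: "('b, 'e, 'f) complex2" and \<kappa> :: "'e \<Rightarrow> 'y" and \<rho> :: "'y \<Rightarrow> 'e"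
  assumes V: "linear_lie_groupoid_bundle V" and C: "cochain_complex C" and Vob: "Vob V = C1 C"
    and \<kappa>: "vb_map (C0 C) (Varr V) (\<lambda>x. x) \<kappa>" and \<rho>: "vb_map (Varr V) (C0 C) (\<lambda>x. x) \<rho>"
    and \<rho>\<kappa>: "a \<in> pts (tot (C0 C)) \<Longrightarrow> \<rho> (\<kappa> a) = a"
    and src_\<kappa>: "a \<in> pts (tot (C0 C)) \<Longrightarrow> lsrc V (\<kappa> a) = vzero (C1 C) (proj (C0 C) a)"
    and tgt_\<kappa>: "a \<in> pts (tot (C0 C)) \<Longrightarrow> ltgt V (\<kappa> a) = diff C a"
    and \<kappa>\<rho>: "v \<in> pts (tot (Varr V)) \<Longrightarrow> \<kappa> (\<rho> v) = vsub (Varr V) v (lunit V (lsrc V v))"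
begin

definition arr :: "'e \<Rightarrow> 'f \<Rightarrow> 'y" where "arr a x = vadd (Varr V) (\<kappa> a) (lunit V x)"

lemma vbs: "vector_bundle (C0 C)" "vector_bundle (C1 C)" "vector_bundle (Varr V)"
  "base (C1 C) = base (C0 C)" "base (Varr V) = base (C0 C)" "vb_map (C0 C) (C1 C) (\<lambda>x. x) (diff C)"
  using C V Vob by (auto simp: cochain_complex_def linear_lie_groupoid_bundle_def)

lemma lunit_vb: "vb_map (C1 C) (Varr V) (\<lambda>x. x) (lunit V)"
  and lsrc_vb: "vb_map (Varr V) (C1 C) (\<lambda>x. x) (lsrc V)"
  and ltgt_vb: "vb_map (Varr V) (C1 C) (\<lambda>x. x) (ltgt V)"
  using lgb_basicD[OF V] by (simp_all add: Vob)

lemmas pre = vbs(1-3)[THEN prebundle_vector_bundle]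

lemmas maps = lgb_maps[OF V, unfolded Vob]
lemmas \<kappa>D = vb_mapD[OF \<kappa> pre(1) vbs(3)] and \<rho>D = vb_mapD[OF \<rho> pre(3) vbs(1)]
  and diffD = vb_mapD[OF vbs(6) pre(1) vbs(2)]
  and unitD = vb_mapD[OF lunit_vb pre(2) vbs(3)] and srcD = vb_mapD[OF lsrc_vb pre(3) vbs(2)]
  and tgtD = vb_mapD[OF ltgt_vb pre(3) vbs(2)]
lemmas ops = vector_bundle_fibre_ops[OF vbs(1)] vector_bundle_fibre_ops[OF vbs(2)] vector_bundle_fibre_ops[OF vbs(3)]
lemmas coords = coord_ops[OF vbs(1)] coord_ops[OF vbs(2)] coord_ops[OF vbs(3)]

lemma in_base:
  "a \<in> pts (tot (C0 C)) \<Longrightarrow> proj (C0 C) a \<in> pts (base (C0 C))"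
  "x \<in> pts (tot (C1 C)) \<Longrightarrow> proj (C1 C) x \<in> pts (base (C0 C))"
  "v \<in> pts (tot (Varr V)) \<Longrightarrow> proj (Varr V) v \<in> pts (base (C0 C))"
  using vector_bundleD(9)[OF vbs(1)] vector_bundleD(9)[OF vbs(2)] vector_bundleD(9)[OF vbs(3)] vbs(4,5) by auto

text \<open>\<open>\<kappa>\<close> after \<open>\<rho>\<close> subtracts the unit at the source, so
  it kills units; applying \<open>\<rho>\<close> once more removes \<open>\<kappa>\<close>.\<close>

lemma \<rho>_lunit: "x \<in> pts (tot (C1 C)) \<Longrightarrow> \<rho> (lunit V x) = vzero (C0 C) (proj (C1 C) x)"
proof -
  assume x: "x \<in> pts (tot (C1 C))"
  let ?y = "proj (C1 C) x"
  have b: "?y \<in> pts (base (C0 C))" "?y \<in> pts (base (Varr V))" using in_base x vbs by auto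
  have "\<kappa> (\<rho> (lunit V x)) = vsub (Varr V) (lunit V x) (lunit V x)" using \<kappa>\<rho> maps x by simp
  also have "\<dots> = vzero (Varr V) ?y"
    using x maps ops b by (intro coord_eqI[OF vbs(3)]) (auto simp: coords)
  finally have "\<rho> (\<kappa> (\<rho> (lunit V x))) = \<rho> (vzero (Varr V) ?y)" by simp
  then show ?thesis using \<rho>\<kappa> \<rho>D(3) maps x vb_map_zero[OF \<rho> vbs(3,1) b(2)] by simp
qed

lemma arr_pts:
  assumes "a \<in> pts (tot (C0 C))" "x \<in> pts (tot (C1 C))" "proj (C0 C) a = proj (C1 C) x"
  shows "arr a x \<in> pts (tot (Varr V))" "proj (Varr V) (arr a x) = proj (C1 C) x"
    "lsrc V (arr a x) = x" "ltgt V (arr a x) = vadd (C1 C) (diff C a) x" "\<rho> (arr a x) = a"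
proof -
  have b: "proj (C1 C) x \<in> pts (base (C0 C))" "proj (C1 C) x \<in> pts (base (C1 C))" using in_base assms vbs(4) by auto
  show "arr a x \<in> pts (tot (Varr V))" "proj (Varr V) (arr a x) = proj (C1 C) x"
    using assms ops \<kappa>D maps by (auto simp: arr_def)
  have "lsrc V (arr a x) = vadd (C1 C) (vzero (C1 C) (proj (C1 C) x)) x"
    using assms srcD(5)[of "\<kappa> a" "lunit V x"] \<kappa>D maps src_\<kappa> by (simp add: arr_def)
  also have "\<dots> = x" using assms ops b by (intro coord_eqI[OF vbs(2)]) (auto simp: coords)
  finally show "lsrc V (arr a x) = x" .
  show "ltgt V (arr a x) = vadd (C1 C) (diff C a) x"
    using assms tgtD(5)[of "\<kappa> a" "lunit V x"] \<kappa>D maps tgt_\<kappa> by (simp add: arr_def)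
  have "\<rho> (arr a x) = vadd (C0 C) a (vzero (C0 C) (proj (C1 C) x))"
    using assms \<rho>D(5)[of "\<kappa> a" "lunit V x"] \<kappa>D maps \<rho>\<kappa> \<rho>_lunit by (simp add: arr_def)
  also have "\<dots> = a" using assms ops b by (intro coord_eqI[OF vbs(1)]) (auto simp: coords)
  finally show "\<rho> (arr a x) = a" .
qed

lemma arr_surj: 
  assumes v: "v \<in> pts (tot (Varr V))"
  shows "arr (\<rho> v) (lsrc V v) = v"
  unfolding arr_def \<kappa>\<rho>[OF v] using v maps ops by (intro coord_eqI[OF vbs(3)]) (auto simp: coords)

lemma arr_exhaust:
  assumes v: "v \<in> pts (tot (Varr V))"
  obtains a x where "a \<in> pts (tot (C0 C))" "x \<in> pts (tot (C1 C))" "proj (C0 C) a = proj (C1 C) x" 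
    "proj (Varr V) v = proj (C1 C) x" "v = arr a x"
  by (rule that[of "\<rho> v" "lsrc V v"]) (simp_all add: v \<rho>D(3,4) maps arr_surj)

lemma lunit_arr: "x \<in> pts (tot (C1 C)) \<Longrightarrow> lunit V x = arr (vzero (C0 C) (proj (C1 C) x)) x"
  using arr_surj[of "lunit V x"] maps \<rho>_lunit by simp

lemma \<kappa>_arr: "a \<in> pts (tot (C0 C)) \<Longrightarrow> \<kappa> a = arr a (vzero (C1 C) (proj (C0 C) a))"
  using arr_surj[of "\<kappa> a"] \<kappa>D \<rho>\<kappa> src_\<kappa> by simp

text \<open>By the forced form of the multiplication, composing adds kernel components and keeps the
  source of the arrow applied first. Groupoid identities are thereby reduced to identities in the
  fibres of \<open>C0 C\<close>.\<close>

lemma lmult_arr: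
  assumes "a \<in> pts (tot (C0 C))" "x \<in> pts (tot (C1 C))" "proj (C0 C) a = proj (C1 C) x"
    "b \<in> pts (tot (C0 C))" "y \<in> pts (tot (C1 C))" "proj (C0 C) b = proj (C1 C) y" "x = vadd (C1 C) (diff C b) y"
  shows "lmult V (arr a x) (arr b y) = arr (vadd (C0 C) a b) y"
proof -
  have xy: "proj (C1 C) x = proj (C1 C) y" using assms ops diffD by simp
  have "lmult V (arr a x) (arr b y) = vadd (Varr V) (vsub (Varr V) (arr a x) (lunit V x)) (arr b y)"
    using lmult_eq[OF V, of "arr a x" "arr b y"] arr_pts assms by simp
  also have "\<dots> = arr (vadd (C0 C) a b) y"
    using assms(1-6) xy arr_pts[of a x] arr_pts[of b y] ops \<kappa>D unitD unfolding arr_def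
    by (intro coord_eqI[OF vbs(3)]) (simp_all add: coords maps)
  finally show ?thesis .
qed

lemma arr_vb_map:
  assumes "vb_map E (C0 C) b f" "vb_map E (C1 C) b h" "prebundle E"
  shows "vb_map E (Varr V) b (\<lambda>e. arr (f e) (h e))"
  unfolding arr_def
  using vb_map_comp[OF assms(1) \<kappa> assms(3) vbs(1,3)] vb_map_comp[OF assms(2) lunit_vb assms(3) vbs(2,3)]
  by (intro vb_map_vadd assms(3) vbs(3)) auto

end

section \<open>Representations up to homotopy and weak representations\<close>

lemma pull_prebundle:
  assumes "lie_groupoid G" "vector_bundle E"
  shows "prebundle (pull1 G E)" "prebundle (pull2 G E)"
  using assms lie_groupoidD(3,4)[OF assms(1)] by (auto intro: prebundle_pullback)

lemma pull1_mapD: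
  assumes G: "lie_groupoid G" and E: "vector_bundle E" and F: "vector_bundle F" and f: "vb_map (pull1 G E) F c f"
  shows "g \<in> pts (Arr G) \<Longrightarrow> e \<in> pts (tot E) \<Longrightarrow> proj E e = gsrc G g \<Longrightarrow> f (g, e) \<in> pts (tot F)"
    "g \<in> pts (Arr G) \<Longrightarrow> e \<in> pts (tot E) \<Longrightarrow> proj E e = gsrc G g \<Longrightarrow> proj F (f (g, e)) = c g"
    "g \<in> pts (Arr G) \<Longrightarrow> e \<in> pts (tot E) \<Longrightarrow> proj E e = gsrc G g \<Longrightarrow> e' \<in> pts (tot E) \<Longrightarrow> proj E e' = gsrc G g \<Longrightarrow>
       f (g, vadd E e e') = vadd F (f (g, e)) (f (g, e'))"
    "g \<in> pts (Arr G) \<Longrightarrow> e \<in> pts (tot E) \<Longrightarrow> proj E e = gsrc G g \<Longrightarrow> f (g, vneg E e) = vneg F (f (g, e))"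
    "g \<in> pts (Arr G) \<Longrightarrow> gsrc G g \<in> pts (base E) \<Longrightarrow> f (g, vzero E (gsrc G g)) = vzero F (c g)"
proof -
  note D = vb_mapD[OF f pull_prebundle(1)[OF G E] F]
  show "g \<in> pts (Arr G) \<Longrightarrow> e \<in> pts (tot E) \<Longrightarrow> proj E e = gsrc G g \<Longrightarrow> f (g, e) \<in> pts (tot F)"
    "g \<in> pts (Arr G) \<Longrightarrow> e \<in> pts (tot E) \<Longrightarrow> proj E e = gsrc G g \<Longrightarrow> proj F (f (g, e)) = c g"
    "g \<in> pts (Arr G) \<Longrightarrow> e \<in> pts (tot E) \<Longrightarrow> proj E e = gsrc G g \<Longrightarrow> e' \<in> pts (tot E) \<Longrightarrow> proj E e' = gsrc G g \<Longrightarrow>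
       f (g, vadd E e e') = vadd F (f (g, e)) (f (g, e'))"
    "g \<in> pts (Arr G) \<Longrightarrow> e \<in> pts (tot E) \<Longrightarrow> proj E e = gsrc G g \<Longrightarrow> f (g, vneg E e) = vneg F (f (g, e))"
    using D(3,4)[of "(g, e)"] D(5)[of "(g, e)" "(g, e')"] D(6)[of "(g, e)" "-1"] by (simp_all add: vneg_def)
  assume g: "g \<in> pts (Arr G)" "gsrc G g \<in> pts (base E)"
  note z = vector_bundle_fibre_ops(1,2)[OF E g(2)]
  have e: "(g, vzero E (gsrc G g)) \<in> pts (tot (pull1 G E))" using z g by simp
  have "f (g, vzero E (gsrc G g)) = f (vscale (pull1 G E) 0 (g, vzero E (gsrc G g)))"
    using vzero_eq_scale[OF E z(1)] z by simp
  also have "\<dots> = vscale F 0 (f (g, vzero E (gsrc G g)))" by (rule D(6)[OF e])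
  also have "\<dots> = vzero F (c g)" using vzero_eq_scale[OF F D(3)[OF e]] D(4)[OF e] by simp
  finally show "f (g, vzero E (gsrc G g)) = vzero F (c g)" .
qed

lemma pull2_mapD:
  assumes G: "lie_groupoid G" and E: "vector_bundle E" and F: "vector_bundle F" and f: "vb_map (pull2 G E) F (tgt2 G) f"
    and gh: "g \<in> pts (Arr G)" "h \<in> pts (Arr G)" "gsrc G g = gtgt G h"
  shows "e \<in> pts (tot E) \<Longrightarrow> proj E e = gsrc G h \<Longrightarrow> f ((g, h), e) \<in> pts (tot F)"
    "e \<in> pts (tot E) \<Longrightarrow> proj E e = gsrc G h \<Longrightarrow> proj F (f ((g, h), e)) = gtgt G g"
    "e \<in> pts (tot E) \<Longrightarrow> proj E e = gsrc G h \<Longrightarrow> e' \<in> pts (tot E) \<Longrightarrow> proj E e' = gsrc G h \<Longrightarrow>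
       f ((g, h), vadd E e e') = vadd F (f ((g, h), e)) (f ((g, h), e'))"
  using vb_mapD(3,4)[OF f pull_prebundle(2)[OF G E] F, of "((g, h), e)"] 
    vb_mapD(5)[OF f pull_prebundle(2)[OF G E] F, of "((g, h), e)" "((g, h), e')"] gh by simp_all

section \<open>The axioms of a representation up to homotopy\<close>

context
  fixes G :: "('o, 'a) groupoid" and R :: "('o, 'a, 'e, 'f) ruth"
  assumes G: "lie_groupoid G" and R: "is_ruth2 G R"
begin

lemma ruth_bundles: "vector_bundle (E0 R)" "vector_bundle (E1 R)" "base (E0 R) = Obj G" "base (E1 R) = Obj G"
  "vb_map (E0 R) (E1 R) (\<lambda>x. x) (dl R)" "cochain_complex (cpx R)"
  using R by (auto simp: is_ruth2_def cochain_complex_def)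

lemma ruth_vb_maps: "vb_map (pull1 G (E0 R)) (E0 R) (gtgt G) (lam0 R)" "vb_map (pull1 G (E1 R)) (E1 R) (gtgt G) (lam1 R)"
  "vb_map (pull2 G (E1 R)) (E0 R) (tgt2 G) (Omg R)"
  using R by (auto simp: is_ruth2_def unital_quasi_action_def)

lemmas lam0D = pull1_mapD[OF G ruth_bundles(1,1) ruth_vb_maps(1)]
  and lam1D = pull1_mapD[OF G ruth_bundles(2,2) ruth_vb_maps(2)]
  and OmgD = pull2_mapD[OF G ruth_bundles(2,1) ruth_vb_maps(3)]
  and dlD = vb_mapD[OF ruth_bundles(5) prebundle_vector_bundle[OF ruth_bundles(1)] ruth_bundles(2)]

lemma dl_zero: "x \<in> pts (Obj G) \<Longrightarrow> dl R (vzero (E0 R) x) = vzero (E1 R) x"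
  using vb_map_zero[OF ruth_bundles(5,1,2)] ruth_bundles(3) by simp

lemma ruth_unit:
  "e \<in> pts (tot (E0 R)) \<Longrightarrow> lam0 R (gunit G (proj (E0 R) e), e) = e"
  "e' \<in> pts (tot (E1 R)) \<Longrightarrow> lam1 R (gunit G (proj (E1 R) e'), e') = e'"
  "g \<in> pts (Arr G) \<Longrightarrow> e' \<in> pts (tot (E1 R)) \<Longrightarrow> proj (E1 R) e' = gsrc G g \<Longrightarrow>
     Omg R ((g, gunit G (gsrc G g)), e') = vzero (E0 R) (gtgt G g)"
  "g \<in> pts (Arr G) \<Longrightarrow> e' \<in> pts (tot (E1 R)) \<Longrightarrow> proj (E1 R) e' = gsrc G g \<Longrightarrow>
     Omg R ((gunit G (gtgt G g), g), e') = vzero (E0 R) (gtgt G g)"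
  using R by (auto simp: is_ruth2_def unital_quasi_action_def fibre_def)

lemma dl_lam: "g \<in> pts (Arr G) \<Longrightarrow> e \<in> pts (tot (E0 R)) \<Longrightarrow> proj (E0 R) e = gsrc G g \<Longrightarrow>
    dl R (lam0 R (g, e)) = lam1 R (g, dl R e)"
  using R by (auto simp: is_ruth2_def fibre_def)

text \<open>Differences of vectors are turned into sums of fibre coordinates: in this form the
  axioms can be combined by linear arithmetic over the reals.\<close>

lemma lam_comp:
  assumes gh: "g \<in> pts (Arr G)" "h \<in> pts (Arr G)" "gsrc G g = gtgt G h"
  shows "e \<in> pts (tot (E0 R)) \<Longrightarrow> proj (E0 R) e = gsrc G h \<Longrightarrow> coord (E0 R) (lam0 R (gmult G g h, e)) i =
     coord (E0 R) (lam0 R (g, lam0 R (h, e))) i + coord (E0 R) (Omg R ((g, h), dl R e)) i"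
    "e' \<in> pts (tot (E1 R)) \<Longrightarrow> proj (E1 R) e' = gsrc G h \<Longrightarrow> coord (E1 R) (lam1 R (gmult G g h, e')) i =
     coord (E1 R) (lam1 R (g, lam1 R (h, e'))) i + coord (E1 R) (dl R (Omg R ((g, h), e'))) i"
proof -
  have 0: "\<forall>e\<in>fibre (E0 R) (gsrc G h). vsub (E0 R) (lam0 R (gmult G g h, e)) (lam0 R (g, lam0 R (h, e))) = Omg R ((g, h), dl R e)"
    and 1: "\<forall>e\<in>fibre (E1 R) (gsrc G h). vsub (E1 R) (lam1 R (gmult G g h, e)) (lam1 R (g, lam1 R (h, e))) = dl R (Omg R ((g, h), e))"
    using R gh by (auto simp: is_ruth2_def)
  show "coord (E0 R) (lam0 R (gmult G g h, e)) i = coord (E0 R) (lam0 R (g, lam0 R (h, e))) i + coord (E0 R) (Omg R ((g, h), dl R e)) i"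
    if e: "e \<in> pts (tot (E0 R))" "proj (E0 R) e = gsrc G h"
  proof -
    have "vsub (E0 R) (lam0 R (gmult G g h, e)) (lam0 R (g, lam0 R (h, e))) = Omg R ((g, h), dl R e)" using 0 e by (simp add: fibre_def)
    from arg_cong[OF this, of "\<lambda>e. coord (E0 R) e i"] show ?thesis
      using e gh by (simp add: coord_ops[OF ruth_bundles(1)] lam0D groupoid_laws[OF G])
  qed
  show "coord (E1 R) (lam1 R (gmult G g h, e')) i = coord (E1 R) (lam1 R (g, lam1 R (h, e'))) i + coord (E1 R) (dl R (Omg R ((g, h), e'))) i"
    if e: "e' \<in> pts (tot (E1 R))" "proj (E1 R) e' = gsrc G h"
  proof -
    have "vsub (E1 R) (lam1 R (gmult G g h, e')) (lam1 R (g, lam1 R (h, e'))) = dl R (Omg R ((g, h), e'))" using 1 e by (simp add: fibre_def)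
    from arg_cong[OF this, of "\<lambda>e. coord (E1 R) e i"] show ?thesis
      using e gh by (simp add: coord_ops[OF ruth_bundles(2)] lam1D groupoid_laws[OF G])
  qed
qed

lemma Omg_cocycle:
  assumes gh: "g \<in> pts (Arr G)" "h \<in> pts (Arr G)" "k \<in> pts (Arr G)" "gsrc G g = gtgt G h" "gsrc G h = gtgt G k"
    and e: "e \<in> pts (tot (E1 R))" "proj (E1 R) e = gsrc G k"
  shows "coord (E0 R) (lam0 R (g, Omg R ((h, k), e))) i + coord (E0 R) (Omg R ((g, gmult G h k), e)) i =
    coord (E0 R) (Omg R ((gmult G g h, k), e)) i + coord (E0 R) (Omg R ((g, h), lam1 R (k, e))) i"
proof -
  have "\<forall>(g, h, k)\<in>comp_triples G. \<forall>e\<in>fibre (E1 R) (gsrc G k).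
        vsub (E0 R) (vadd (E0 R) (vsub (E0 R) (lam0 R (g, Omg R ((h, k), e))) (Omg R ((gmult G g h, k), e)))
            (Omg R ((g, gmult G h k), e))) (Omg R ((g, h), lam1 R (k, e))) = vzero (E0 R) (gtgt G g)"
    using R by (simp add: is_ruth2_def)
  then have "vsub (E0 R) (vadd (E0 R) (vsub (E0 R) (lam0 R (g, Omg R ((h, k), e))) (Omg R ((gmult G g h, k), e)))
            (Omg R ((g, gmult G h k), e))) (Omg R ((g, h), lam1 R (k, e))) = vzero (E0 R) (gtgt G g)"
    using gh e by (auto simp: comp_triples_def fibre_def)
  from arg_cong[OF this, of "\<lambda>e. coord (E0 R) e i"] show ?thesis
    using e gh ruth_bundles(3) by (simp add: coord_ops[OF ruth_bundles(1)] vector_bundle_fibre_ops[OF ruth_bundles(1)] lam0D lam1D OmgD groupoid_laws[OF G])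
qed

end

section \<open>Morphisms of representations up to homotopy\<close>

lemma ruth2_hom_iff:
  "(p0, p1, m) \<in> ruth2_hom G R R' \<longleftrightarrow>
     p0 \<in> extensional (pts (tot (E0 R))) \<and> p1 \<in> extensional (pts (tot (E1 R))) \<and>
     m \<in> extensional (pts (tot (pull1 G (E1 R)))) \<and>
     vb_map (E0 R) (E0 R') (\<lambda>x. x) p0 \<and> vb_map (E1 R) (E1 R') (\<lambda>x. x) p1 \<and>
     vb_map (pull1 G (E1 R)) (E0 R') (gtgt G) m \<and>
     (\<forall>e. e \<in> pts (tot (E0 R)) \<longrightarrow> p1 (dl R e) = dl R' (p0 e)) \<and>
     (\<forall>g e. g \<in> pts (Arr G) \<longrightarrow> e \<in> pts (tot (E0 R)) \<longrightarrow> proj (E0 R) e = gsrc G g \<longrightarrow>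
        vsub (E0 R') (p0 (lam0 R (g, e))) (lam0 R' (g, p0 e)) = m (g, dl R e)) \<and>
     (\<forall>g e. g \<in> pts (Arr G) \<longrightarrow> e \<in> pts (tot (E1 R)) \<longrightarrow> proj (E1 R) e = gsrc G g \<longrightarrow>
        vsub (E1 R') (p1 (lam1 R (g, e))) (lam1 R' (g, p1 e)) = dl R' (m (g, e))) \<and>
     (\<forall>g h e. g \<in> pts (Arr G) \<longrightarrow> h \<in> pts (Arr G) \<longrightarrow> gsrc G g = gtgt G h \<longrightarrow> e \<in> pts (tot (E1 R)) \<longrightarrow> proj (E1 R) e = gsrc G h \<longrightarrow>
        vadd (E0 R') (vadd (E0 R') (p0 (Omg R ((g, h), e))) (m (g, lam1 R (h, e)))) (lam0 R' (g, m (h, e))) =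
        vadd (E0 R') (m (gmult G g h, e)) (Omg R' ((g, h), p1 e)))"
  unfolding ruth2_hom_def fibre_def by auto

context
  fixes G :: "('o, 'a) groupoid" and R :: "('o, 'a, 'e, 'f) ruth" and R' :: "('o, 'a, 'e', 'f') ruth" and p0 p1 m
  assumes G: "lie_groupoid G" and R: "is_ruth2 G R" and R': "is_ruth2 G R'" and p: "(p0, p1, m) \<in> ruth2_hom G R R'"
begin

lemma ruth_hom_vb: "vb_map (E0 R) (E0 R') (\<lambda>x. x) p0" "vb_map (E1 R) (E1 R') (\<lambda>x. x) p1"
  "vb_map (pull1 G (E1 R)) (E0 R') (gtgt G) m"
  using p by (auto simp: ruth2_hom_iff)

lemmas hp0D = vb_mapD[OF ruth_hom_vb(1) prebundle_vector_bundle[OF ruth_bundles(1)[OF G R]] ruth_bundles(1)[OF G R']]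
  and hp1D = vb_mapD[OF ruth_hom_vb(2) prebundle_vector_bundle[OF ruth_bundles(2)[OF G R]] ruth_bundles(2)[OF G R']]
  and hmD = pull1_mapD[OF G ruth_bundles(2)[OF G R] ruth_bundles(1)[OF G R'] ruth_hom_vb(3)]

lemmas rules = hp0D(3-7) hp1D(3-7) hmD lam0D[OF G R] lam1D[OF G R] OmgD[OF G R] lam0D[OF G R'] lam1D[OF G R'] OmgD[OF G R']
  dlD(3-7)[OF G R] dlD(3-7)[OF G R'] groupoid_laws[OF G]

lemma ruth_hom_dl: "e \<in> pts (tot (E0 R)) \<Longrightarrow> p1 (dl R e) = dl R' (p0 e)"
  using p by (simp add: ruth2_hom_iff)

lemma ruth_hom_lam:
  "g \<in> pts (Arr G) \<Longrightarrow> e \<in> pts (tot (E0 R)) \<Longrightarrow> proj (E0 R) e = gsrc G g \<Longrightarrow>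
     coord (E0 R') (p0 (lam0 R (g, e))) i = coord (E0 R') (lam0 R' (g, p0 e)) i + coord (E0 R') (m (g, dl R e)) i"
  "g \<in> pts (Arr G) \<Longrightarrow> e' \<in> pts (tot (E1 R)) \<Longrightarrow> proj (E1 R) e' = gsrc G g \<Longrightarrow>
     coord (E1 R') (p1 (lam1 R (g, e'))) i = coord (E1 R') (lam1 R' (g, p1 e')) i + coord (E1 R') (dl R' (m (g, e'))) i"
proof -
  show "coord (E0 R') (p0 (lam0 R (g, e))) i = coord (E0 R') (lam0 R' (g, p0 e)) i + coord (E0 R') (m (g, dl R e)) i"
    if e: "g \<in> pts (Arr G)" "e \<in> pts (tot (E0 R))" "proj (E0 R) e = gsrc G g"
  proof -
    have "vsub (E0 R') (p0 (lam0 R (g, e))) (lam0 R' (g, p0 e)) = m (g, dl R e)" using p e by (simp add: ruth2_hom_iff)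
    from arg_cong[OF this, of "\<lambda>e. coord (E0 R') e i"] show ?thesis
      using e by (simp add: coord_ops[OF ruth_bundles(1)[OF G R']] rules)
  qed
  show "coord (E1 R') (p1 (lam1 R (g, e'))) i = coord (E1 R') (lam1 R' (g, p1 e')) i + coord (E1 R') (dl R' (m (g, e'))) i"
    if e: "g \<in> pts (Arr G)" "e' \<in> pts (tot (E1 R))" "proj (E1 R) e' = gsrc G g"
  proof -
    have "vsub (E1 R') (p1 (lam1 R (g, e'))) (lam1 R' (g, p1 e')) = dl R' (m (g, e'))" using p e by (simp add: ruth2_hom_iff)
    from arg_cong[OF this, of "\<lambda>e. coord (E1 R') e i"] show ?thesis
      using e by (simp add: coord_ops[OF ruth_bundles(2)[OF G R']] rules)
  qed
qed

lemma ruth_hom_cocycle: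
  assumes gh: "g \<in> pts (Arr G)" "h \<in> pts (Arr G)" "gsrc G g = gtgt G h" and e: "e \<in> pts (tot (E1 R))" "proj (E1 R) e = gsrc G h"
  shows "coord (E0 R') (p0 (Omg R ((g, h), e))) i + coord (E0 R') (m (g, lam1 R (h, e))) i + coord (E0 R') (lam0 R' (g, m (h, e))) i =
    coord (E0 R') (m (gmult G g h, e)) i + coord (E0 R') (Omg R' ((g, h), p1 e)) i"
proof -
  have "vadd (E0 R') (vadd (E0 R') (p0 (Omg R ((g, h), e))) (m (g, lam1 R (h, e)))) (lam0 R' (g, m (h, e))) =
        vadd (E0 R') (m (gmult G g h, e)) (Omg R' ((g, h), p1 e))" using p gh e by (simp add: ruth2_hom_iff)
  from arg_cong[OF this, of "\<lambda>e. coord (E0 R') e i"] show ?thesis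
    using gh e by (simp add: coord_ops[OF ruth_bundles(1)[OF G R']] vector_bundle_fibre_ops[OF ruth_bundles(1)[OF G R']] rules)
qed

text \<open>The cocycle condition at a pair of units forces \<open>\<mu>\<close> to vanish on units.\<close>

lemma ruth_hom_unit:
  assumes e: "e \<in> pts (tot (E1 R))"
  shows "m (gunit G (proj (E1 R) e), e) = vzero (E0 R') (proj (E1 R) e)"
proof -
  let ?x = "proj (E1 R) e" and ?u = "gunit G (proj (E1 R) e)"
  have x: "?x \<in> pts (Obj G)" using vector_bundleD(9)[OF ruth_bundles(2)[OF G R] e] ruth_bundles(4)[OF G R] by simp
  have u: "?u \<in> pts (Arr G)" "gsrc G ?u = ?x" "gtgt G ?u = ?x" using groupoid_laws[OF G] x by auto
  have uu: "gmult G ?u ?u = ?u" using groupoid_laws(9)[OF G u(1)] u by simp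
  have me: "m (?u, e) \<in> pts (tot (E0 R'))" "proj (E0 R') (m (?u, e)) = ?x" using u e hmD by auto
  have O0: "Omg R ((?u, ?u), e) = vzero (E0 R) ?x" "Omg R' ((?u, ?u), p1 e) = vzero (E0 R') ?x"
    using ruth_unit(3)[OF G R u(1) e] ruth_unit(3)[OF G R' u(1), of "p1 e"] u e hp1D by auto
  have p00: "p0 (vzero (E0 R) ?x) = vzero (E0 R') ?x"
    using vb_map_zero[OF ruth_hom_vb(1) ruth_bundles(1)[OF G R] ruth_bundles(1)[OF G R']] x ruth_bundles(3)[OF G R] by simp
  \<comment> \<open>With both arrows equal to the unit the terms in \<open>\<Omega>\<close> and
    \<open>\<Omega>'\<close> vanish and the actions are trivial; what remains is
    \<open>m + m = m\<close> at that unit.\<close>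
  have "coord (E0 R') (m (?u, e)) i = 0" for i
    using ruth_hom_cocycle[OF u(1,1) _ e, of i] u uu O0 p00 ruth_unit(2)[OF G R e] ruth_unit(1)[OF G R' me(1)] me
       coord_ops(5)[OF ruth_bundles(1)[OF G R'], of ?x i] x ruth_bundles(3)[OF G R'] by simp
  then show ?thesis
    using me x ruth_bundles(3)[OF G R'] vector_bundle_fibre_ops(1,2)[OF ruth_bundles(1)[OF G R'], of ?x]
    by (intro coord_eqI[OF ruth_bundles(1)[OF G R']]) (auto simp: coord_ops[OF ruth_bundles(1)[OF G R']])
qed

end

section \<open>Weak representations and their maps, unfolded to elements\<close>

lemma wrep_hom_iff:
  "(f0, f1, D) \<in> wrep_hom G A B \<longleftrightarrow>
     f0 \<in> extensional (pts (tot (Vob (wV A)))) \<and> f1 \<in> extensional (pts (tot (Varr (wV A)))) \<and>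
     D \<in> extensional (pts (tot (pull1 G (Vob (wV A))))) \<and>
     lgb_map (wV A) (wV B) (\<lambda>x. x) f0 f1 \<and>
     vb_map (pull1 G (Vob (wV A))) (Varr (wV B)) (gtgt G) D \<and>
     (\<forall>g x. g \<in> pts (Arr G) \<longrightarrow> x \<in> pts (tot (Vob (wV A))) \<longrightarrow> proj (Vob (wV A)) x = gsrc G g \<longrightarrow>
        lsrc (wV B) (D (g, x)) = f0 (act0 A (g, x)) \<and> ltgt (wV B) (D (g, x)) = act0 B (g, f0 x)) \<and>
     (\<forall>g v. g \<in> pts (Arr G) \<longrightarrow> v \<in> pts (tot (Varr (wV A))) \<longrightarrow> proj (Varr (wV A)) v = gsrc G g \<longrightarrow>
        lmult (wV B) (D (g, ltgt (wV A) v)) (f1 (act1 A (g, v))) = lmult (wV B) (act1 B (g, f1 v)) (D (g, lsrc (wV A) v))) \<and>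
     (\<forall>g k x. g \<in> pts (Arr G) \<longrightarrow> k \<in> pts (Arr G) \<longrightarrow> gsrc G g = gtgt G k \<longrightarrow> x \<in> pts (tot (Vob (wV A))) \<longrightarrow> proj (Vob (wV A)) x = gsrc G k \<longrightarrow>
        lmult (wV B) (lmult (wV B) (alph B ((g, k), f0 x)) (act1 B (g, D (k, x)))) (D (g, act0 A (k, x))) =
        lmult (wV B) (D (gmult G g k, x)) (f1 (alph A ((g, k), x)))) \<and>
     (\<forall>x. x \<in> pts (tot (Vob (wV A))) \<longrightarrow> D (gunit G (proj (Vob (wV A)) x), x) = lunit (wV B) (f0 x))"
  unfolding wrep_hom_def Let_def lgb_nat_def pullback_lgb_def fibre_def by (auto simp: eq_commute)

lemma lgb_map_iff:
  "lgb_map V W fb f0 f1 \<longleftrightarrow>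
     vb_map (Vob V) (Vob W) fb f0 \<and> vb_map (Varr V) (Varr W) fb f1 \<and>
     (\<forall>v. v \<in> pts (tot (Varr V)) \<longrightarrow> lsrc W (f1 v) = f0 (lsrc V v) \<and> ltgt W (f1 v) = f0 (ltgt V v)) \<and>
     (\<forall>x. x \<in> pts (tot (Vob V)) \<longrightarrow> f1 (lunit V x) = lunit W (f0 x)) \<and>
     (\<forall>v w. v \<in> pts (tot (Varr V)) \<longrightarrow> w \<in> pts (tot (Varr V)) \<longrightarrow> lsrc V v = ltgt V w \<longrightarrow>
        f1 (lmult V v w) = lmult W (f1 v) (f1 w))"
  unfolding lgb_map_def lie_groupoid_map_def vb_map_def by auto

lemma pullback_lgb_simps [simp]:
  "Vob (pullback_lgb P a V) = pullback_vb P a (Vob V)" "Varr (pullback_lgb P a V) = pullback_vb P a (Varr V)"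
  "lsrc (pullback_lgb P a V) (p, v) = (p, lsrc V v)" "ltgt (pullback_lgb P a V) (p, v) = (p, ltgt V v)"
  "lunit (pullback_lgb P a V) (p, x) = (p, lunit V x)" "lmult (pullback_lgb P a V) (p, v) (q, w) = (p, lmult V v w)"
  by (simp_all add: pullback_lgb_def)

lemma weak_rep_iff:
  "is_weak_rep G A \<longleftrightarrow>
     linear_lie_groupoid_bundle (wV A) \<and> base (Vob (wV A)) = Obj G \<and>
     lgb_map (lpull1 G (wV A)) (wV A) (gtgt G) (act0 A) (act1 A) \<and>
     (\<forall>x. x \<in> pts (tot (Vob (wV A))) \<longrightarrow> act0 A (gunit G (proj (Vob (wV A)) x), x) = x) \<and>
     (\<forall>v. v \<in> pts (tot (Varr (wV A))) \<longrightarrow> act1 A (gunit G (proj (Varr (wV A)) v), v) = v) \<and>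
     vb_map (pull2 G (Vob (wV A))) (Varr (wV A)) (tgt2 G) (alph A) \<and>
     (\<forall>g k x. g \<in> pts (Arr G) \<longrightarrow> k \<in> pts (Arr G) \<longrightarrow> gsrc G g = gtgt G k \<longrightarrow> x \<in> pts (tot (Vob (wV A))) \<longrightarrow>
        proj (Vob (wV A)) x = gsrc G k \<longrightarrow>
        lsrc (wV A) (alph A ((g, k), x)) = act0 A (g, act0 A (k, x)) \<and>
        ltgt (wV A) (alph A ((g, k), x)) = act0 A (gmult G g k, x)) \<and>
     (\<forall>g k v. g \<in> pts (Arr G) \<longrightarrow> k \<in> pts (Arr G) \<longrightarrow> gsrc G g = gtgt G k \<longrightarrow> v \<in> pts (tot (Varr (wV A))) \<longrightarrow>
        proj (Varr (wV A)) v = gsrc G k \<longrightarrow>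
        lmult (wV A) (alph A ((g, k), ltgt (wV A) v)) (act1 A (g, act1 A (k, v))) =
        lmult (wV A) (act1 A (gmult G g k, v)) (alph A ((g, k), lsrc (wV A) v))) \<and>
     (\<forall>g k l x. g \<in> pts (Arr G) \<longrightarrow> k \<in> pts (Arr G) \<longrightarrow> l \<in> pts (Arr G) \<longrightarrow> gsrc G g = gtgt G k \<longrightarrow> gsrc G k = gtgt G l \<longrightarrow>
        x \<in> pts (tot (Vob (wV A))) \<longrightarrow> proj (Vob (wV A)) x = gsrc G l \<longrightarrow>
        lmult (wV A) (alph A ((g, gmult G k l), x)) (act1 A (g, alph A ((k, l), x))) =
        lmult (wV A) (alph A ((gmult G g k, l), x)) (alph A ((g, k), act0 A (l, x)))) \<and>
     (\<forall>g x. g \<in> pts (Arr G) \<longrightarrow> x \<in> pts (tot (Vob (wV A))) \<longrightarrow> proj (Vob (wV A)) x = gsrc G g \<longrightarrow>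
        alph A ((g, gunit G (gsrc G g)), x) = lunit (wV A) (act0 A (g, x)) \<and>
        alph A ((gunit G (gtgt G g), g), x) = lunit (wV A) (act0 A (g, x)))"
  unfolding is_weak_rep_def Let_def lgb_nat_def pullback_lgb_def fibre_def comp_triples_def by (auto simp: eq_commute)

text \<open>The weak representation \<open>A\<close> is the image of \<open>R\<close> under the functor, up to the identification
  \<open>(\<kappa>, \<rho>)\<close>.\<close>

locale presented = split_lgb "wV A" "cpx R" \<kappa> \<rho>
  for G :: "('o, 'a) groupoid" and R :: "('o, 'a, 'e, 'f) ruth" and A :: "('o, 'a, 'f, 'y) wrep" and \<kappa> \<rho> +
  assumes G: "lie_groupoid G" and R: "is_ruth2 G R" and A: "is_weak_rep G A"
    and act0: "g \<in> pts (Arr G) \<Longrightarrow> x \<in> pts (tot (E1 R)) \<Longrightarrow> proj (E1 R) x = gsrc G g \<Longrightarrow> act0 A (g, x) = lam1 R (g, x)"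
    and act1: "g \<in> pts (Arr G) \<Longrightarrow> a \<in> pts (tot (E0 R)) \<Longrightarrow> proj (E0 R) a = gsrc G g \<Longrightarrow> act1 A (g, \<kappa> a) = \<kappa> (lam0 R (g, a))"
    and alph: "g \<in> pts (Arr G) \<Longrightarrow> h \<in> pts (Arr G) \<Longrightarrow> gsrc G g = gtgt G h \<Longrightarrow> x \<in> pts (tot (E1 R)) \<Longrightarrow> proj (E1 R) x = gsrc G h \<Longrightarrow>
       alph A ((g, h), x) = split_lgb.arr (wV A) \<kappa> (Omg R ((g, h), x)) (lam1 R (g, lam1 R (h, x)))"
begin

lemmas lam0s = lam0D[OF G R] and lam1s = lam1D[OF G R] and Omgs = OmgD[OF G R]
lemmas bases = ruth_bundles(3,4)[OF G R]
lemmas laws = groupoid_laws[OF G]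

lemma act1_vb: "vb_map (pull1 G (Varr (wV A))) (Varr (wV A)) (gtgt G) (act1 A)"
  using A by (simp add: weak_rep_iff lgb_map_iff)

text \<open>The action on arrows is fibrewise linear, so it is determined by its values on
  \<open>\<kappa> a\<close>, given by \<open>lam0\<close>, and on units, given by functoriality and
  the action on objects.\<close>

lemma act1_arr:
  assumes g: "g \<in> pts (Arr G)" and a: "a \<in> pts (tot (E0 R))" "proj (E0 R) a = gsrc G g"
    and x: "x \<in> pts (tot (E1 R))" "proj (E1 R) x = gsrc G g"
  shows "act1 A (g, arr a x) = arr (lam0 R (g, a)) (lam1 R (g, x))"
proof -
  note D = pull1_mapD[OF G vbs(3,3) act1_vb]
  have "\<forall>z. z \<in> pts (tot (pull1 G (Vob (wV A)))) \<longrightarrow> act1 A (lunit (lpull1 G (wV A)) z) = lunit (wV A) (act0 A z)"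
    using A unfolding weak_rep_iff lgb_map_iff by simp
  then have "act1 A (g, lunit (wV A) x) = lunit (wV A) (lam1 R (g, x))"
    using g x by (auto simp: Vob act0)
  then show ?thesis
    unfolding arr_def using D(3)[OF g, of "\<kappa> a" "lunit (wV A) x"] g a x \<kappa>D maps act1 by simp
qed

end

text \<open>Components of morphisms are restricted functions; on the carrier they simplify to the
  underlying formula.\<close>

lemmas [simp] = restrict_apply'

text \<open>The functor on morphisms, for arbitrary presentations of source and target.\<close>

definition induced_mor :: "('o, 'a) groupoid \<Rightarrow> ('o, 'a, 'e, 'f) ruth \<Rightarrow> ('o, 'a, 'f, 'y) wrep \<Rightarrow> ('y \<Rightarrow> 'e) \<Rightarrow>
    ('o, 'a, 'e', 'f') ruth \<Rightarrow> ('o, 'a, 'f', 'z) wrep \<Rightarrow> ('e' \<Rightarrow> 'z) \<Rightarrow>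
    ('a, 'e, 'f, 'e', 'f') ruth_mor \<Rightarrow> ('a, 'f, 'y, 'f', 'z) wrep_mor" where
  "induced_mor G R A \<rho> R' A' \<kappa>' = (\<lambda>(p0, p1, m).
     (restrict p1 (pts (tot (E1 R))),
      restrict (\<lambda>v. split_lgb.arr (wV A') \<kappa>' (p0 (\<rho> v)) (p1 (lsrc (wV A) v))) (pts (tot (Varr (wV A)))),
      restrict (\<lambda>(g, x). split_lgb.arr (wV A') \<kappa>' (vneg (E0 R') (m (g, x))) (p1 (lam1 R (g, x)))) (pts (tot (pull1 G (E1 R))))))"

locale presented_pair = P: presented G R A \<kappa> \<rho> + P': presented G R' A' \<kappa>' \<rho>'
  for G :: "('o, 'a) groupoid" and R :: "('o, 'a, 'e, 'f) ruth" and A :: "('o, 'a, 'f, 'y) wrep" and \<kappa> \<rho>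
    and R' :: "('o, 'a, 'e', 'f') ruth" and A' :: "('o, 'a, 'f', 'z) wrep" and \<kappa>' \<rho>'
begin

abbreviation "V \<equiv> wV A"
abbreviation "W \<equiv> wV A'"

lemma induced_mor_apply:
  "induced_mor G R A \<rho> R' A' \<kappa>' (p0, p1, m) = (f0, f1, D) \<Longrightarrow> x \<in> pts (tot (E1 R)) \<Longrightarrow> f0 x = p1 x"
  "induced_mor G R A \<rho> R' A' \<kappa>' (p0, p1, m) = (f0, f1, D) \<Longrightarrow> a \<in> pts (tot (E0 R)) \<Longrightarrow> x \<in> pts (tot (E1 R)) \<Longrightarrow>
     proj (E0 R) a = proj (E1 R) x \<Longrightarrow> f1 (P.arr a x) = P'.arr (p0 a) (p1 x)"
  "induced_mor G R A \<rho> R' A' \<kappa>' (p0, p1, m) = (f0, f1, D) \<Longrightarrow> g \<in> pts (Arr G) \<Longrightarrow> x \<in> pts (tot (E1 R)) \<Longrightarrow>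
     proj (E1 R) x = gsrc G g \<Longrightarrow> D (g, x) = P'.arr (vneg (E0 R') (m (g, x))) (p1 (lam1 R (g, x)))"
  using P.arr_pts by (auto simp: induced_mor_def)

end

text \<open>Common ground for both directions of the correspondence: \<open>(f0, f1, D)\<close>
  belongs to \<open>(p0, p1, m)\<close>, and only those equations are assumed that make the arrows
  below composable. The two sides of naturality and of coherence are computed once and then read
  forwards or backwards.\<close>

locale presented_mor = presented_pair G R A \<kappa> \<rho> R' A' \<kappa>' \<rho>'
  for G :: "('o, 'a) groupoid" and R :: "('o, 'a, 'e, 'f) ruth" and A :: "('o, 'a, 'f, 'y) wrep" and \<kappa> \<rho>
    and R' :: "('o, 'a, 'e', 'f') ruth" and A' :: "('o, 'a, 'f', 'z) wrep" and \<kappa>' \<rho>' +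
  fixes p0 p1 m f0 f1 D
  assumes vb: "vb_map (E0 R) (E0 R') (\<lambda>x. x) p0" "vb_map (E1 R) (E1 R') (\<lambda>x. x) p1"
      "vb_map (pull1 G (E1 R)) (E0 R') (gtgt G) m"
    and dl: "a \<in> pts (tot (E0 R)) \<Longrightarrow> p1 (dl R a) = dl R' (p0 a)"
    and lam: "g \<in> pts (Arr G) \<Longrightarrow> x \<in> pts (tot (E1 R)) \<Longrightarrow> proj (E1 R) x = gsrc G g \<Longrightarrow>
      lam1 R' (g, p1 x) = vadd (E1 R') (dl R' (vneg (E0 R') (m (g, x)))) (p1 (lam1 R (g, x)))"
    and ap: "x \<in> pts (tot (E1 R)) \<Longrightarrow> f0 x = p1 x"
      "a \<in> pts (tot (E0 R)) \<Longrightarrow> x \<in> pts (tot (E1 R)) \<Longrightarrow> proj (E0 R) a = proj (E1 R) x \<Longrightarrow>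
        f1 (P.arr a x) = P'.arr (p0 a) (p1 x)"
      "g \<in> pts (Arr G) \<Longrightarrow> x \<in> pts (tot (E1 R)) \<Longrightarrow> proj (E1 R) x = gsrc G g \<Longrightarrow>
        D (g, x) = P'.arr (vneg (E0 R') (m (g, x))) (p1 (lam1 R (g, x)))"
begin

lemmas h0 = vb_mapD(3-8)[OF vb(1) P.pre(1) P'.vbs(1)] and h1 = vb_mapD(3-8)[OF vb(2) P.pre(2) P'.vbs(2)]
  and hm = pull1_mapD[OF P.G P.vbs(2) P'.vbs(1) vb(3)]

text \<open>Both composites start at the same object, so naturality amounts to equality of kernel
  components. After expanding \<open>m\<close> by additivity this is the degree 0 condition
  \<open>\<phi>\<lambda>\<^sub>g - \<lambda>'\<^sub>g\<phi> = \<mu>\<^sub>g\<delta>\<close>.\<close>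

lemma naturality_sides:
  assumes g: "g \<in> pts (Arr G)" and a: "a \<in> pts (tot (E0 R))" "proj (E0 R) a = gsrc G g"
    and x: "x \<in> pts (tot (E1 R))" "proj (E1 R) x = gsrc G g"
  shows "lmult W (D (g, ltgt V (P.arr a x))) (f1 (act1 A (g, P.arr a x))) =
      P'.arr (vadd (E0 R') (vneg (E0 R') (m (g, vadd (E1 R) (dl R a) x))) (p0 (lam0 R (g, a)))) (p1 (lam1 R (g, x)))"
    and "lmult W (act1 A' (g, f1 (P.arr a x))) (D (g, lsrc V (P.arr a x))) =
      P'.arr (vadd (E0 R') (lam0 R' (g, p0 a)) (vneg (E0 R') (m (g, x)))) (p1 (lam1 R (g, x)))"
proof -
  have l1: "p1 (lam1 R (g, vadd (E1 R) (dl R a) x)) = vadd (E1 R') (dl R' (p0 (lam0 R (g, a)))) (p1 (lam1 R (g, x)))"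
    using a g x by (simp add: P.lam1s P.lam0s P.diffD h1 dl dl_lam[OF P.G P.R, symmetric] P.ops)
  have dx: "vadd (E1 R) (dl R a) x \<in> pts (tot (E1 R))" "proj (E1 R) (vadd (E1 R) (dl R a) x) = gsrc G g"
    using a x P.ops P.diffD by auto
  show "lmult W (D (g, ltgt V (P.arr a x))) (f1 (act1 A (g, P.arr a x))) =
      P'.arr (vadd (E0 R') (vneg (E0 R') (m (g, vadd (E1 R) (dl R a) x))) (p0 (lam0 R (g, a)))) (p1 (lam1 R (g, x)))"
    using a g x dx l1 hm h0 h1 P'.ops P'.diffD P.lam0s P.lam1s
    by (simp add: P.arr_pts P.act1_arr ap P'.lmult_arr)
  show "lmult W (act1 A' (g, f1 (P.arr a x))) (D (g, lsrc V (P.arr a x))) =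
      P'.arr (vadd (E0 R') (lam0 R' (g, p0 a)) (vneg (E0 R') (m (g, x)))) (p1 (lam1 R (g, x)))"
    using a g x lam[OF g x] hm h0 h1 P'.ops P'.diffD P.lam1s P'.lam0s P'.lam1s
    by (simp add: P.arr_pts P'.act1_arr ap P'.lmult_arr)
qed

text \<open>Again the sources agree, and equality of the kernel components is the cocycle condition
  linking \<open>\<mu>\<close>, \<open>\<Omega>\<close> and \<open>\<Omega>'\<close>, with every
  occurrence of \<open>\<mu>\<close> negated.\<close>

lemma coherence_sides:
  assumes g: "g \<in> pts (Arr G)" "k \<in> pts (Arr G)" "gsrc G g = gtgt G k" and x: "x \<in> pts (tot (E1 R))" "proj (E1 R) x = gsrc G k"
  shows "lmult W (lmult W (alph A' ((g, k), f0 x)) (act1 A' (g, D (k, x)))) (D (g, act0 A (k, x))) =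
      P'.arr (vadd (E0 R') (vadd (E0 R') (Omg R' ((g, k), p1 x)) (lam0 R' (g, vneg (E0 R') (m (k, x))))) (vneg (E0 R') (m (g, lam1 R (k, x)))))
        (p1 (lam1 R (g, lam1 R (k, x))))"
    and "lmult W (D (gmult G g k, x)) (f1 (alph A ((g, k), x))) =
      P'.arr (vadd (E0 R') (vneg (E0 R') (m (gmult G g k, x))) (p0 (Omg R ((g, k), x)))) (p1 (lam1 R (g, lam1 R (k, x))))"
proof -
  note om = OmgD[OF P.G P.R g] and om' = OmgD[OF P.G P'.R g]
  have lx: "lam1 R (k, x) \<in> pts (tot (E1 R))" "proj (E1 R) (lam1 R (k, x)) = gsrc G g" using g x P.lam1s by auto
  have gk: "gmult G g k \<in> pts (Arr G)" "gsrc G (gmult G g k) = gsrc G k" "gtgt G (gmult G g k) = gtgt G g" using P.laws g by auto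
  \<comment> \<open>\<open>l1\<close>, \<open>l2\<close> and \<open>l3\<close> say that the source
    of each arrow is the target of the one before it, as \<open>lmult_arr\<close> demands.\<close>
  have l1: "lam1 R' (g, lam1 R' (k, p1 x)) = vadd (E1 R') (dl R' (lam0 R' (g, vneg (E0 R') (m (k, x))))) (lam1 R' (g, p1 (lam1 R (k, x))))"
    using lam[OF g(2) x] g x hm h1 P'.ops P'.diffD P.lam1s P'.lam1s dl_lam[OF P.G P'.R g(1), of "vneg (E0 R') (m (k, x))"] by simp
  note l2 = lam[OF g(1) lx]
  have "lam1 R (gmult G g k, x) = vadd (E1 R) (dl R (Omg R ((g, k), x))) (lam1 R (g, lam1 R (k, x)))"
    using g gk x lx P.ops P.diffD P.lam1s om lam_comp(2)[OF P.G P.R g x] 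
    by (intro coord_eqI[OF P.vbs(2)]) (simp_all add: P.coords)
  then have l3: "p1 (lam1 R (gmult G g k, x)) = vadd (E1 R') (dl R' (p0 (Omg R ((g, k), x)))) (p1 (lam1 R (g, lam1 R (k, x))))"
    using g x lx om h1 dl P.diffD P.lam1s by simp
  show "lmult W (lmult W (alph A' ((g, k), f0 x)) (act1 A' (g, D (k, x)))) (D (g, act0 A (k, x))) =
      P'.arr (vadd (E0 R') (vadd (E0 R') (Omg R' ((g, k), p1 x)) (lam0 R' (g, vneg (E0 R') (m (k, x))))) (vneg (E0 R') (m (g, lam1 R (k, x)))))
        (p1 (lam1 R (g, lam1 R (k, x))))"
    using g x lx l1 l2 hm h1 P'.ops P'.diffD P.lam1s P'.lam0s P'.lam1s om'
    by (simp add: ap P.act0 P'.alph P'.act1_arr P'.lmult_arr)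
  show "lmult W (D (gmult G g k, x)) (f1 (alph A ((g, k), x))) =
      P'.arr (vadd (E0 R') (vneg (E0 R') (m (gmult G g k, x))) (p0 (Omg R ((g, k), x)))) (p1 (lam1 R (g, lam1 R (k, x))))"
    using g gk x lx l3 hm h0 h1 P'.ops P'.diffD P.lam1s om
    by (simp add: ap P.alph P'.lmult_arr)
qed

end

context presented_pair
begin

text \<open>The degree 1 condition solved for \<open>\<lambda>'\<^sub>g\<phi>\<close>: the arrow
  with kernel component \<open>-\<mu>\<close> that starts at \<open>\<phi>\<lambda>\<^sub>g\<close>
  ends there.\<close>

lemma ruth_hom_lam1:
  assumes p: "(p0, p1, m) \<in> ruth2_hom G R R'" and g: "g \<in> pts (Arr G)" and x: "x \<in> pts (tot (E1 R))" "proj (E1 R) x = gsrc G g"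
  shows "lam1 R' (g, p1 x) = vadd (E1 R') (dl R' (vneg (E0 R') (m (g, x)))) (p1 (lam1 R (g, x)))"
  using g x hmD[OF P.G P.R P'.R p] hp1D[OF P.G P.R P'.R p] P'.ops P'.diffD P.lam1s P'.lam1s ruth_hom_lam(2)[OF P.G P.R P'.R p g x]
  by (intro coord_eqI[OF P'.vbs(2)]) (simp_all add: P'.coords)

text \<open>Sources hold by construction. The chain map condition makes \<open>(f0, f1)\<close> a
  functor, the degree 1 condition gives the target of \<open>D\<close>, the degree 0 condition its
  naturality, the cocycle condition its coherence, and the vanishing of \<open>m\<close> on units
  its value there.\<close>

lemma induced_mor_hom:
  assumes p: "(p0, p1, m) \<in> ruth2_hom G R R'"
  shows "induced_mor G R A \<rho> R' A' \<kappa>' (p0, p1, m) \<in> wrep_hom G A A'"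
proof -
  obtain f0 f1 D where T: "induced_mor G R A \<rho> R' A' \<kappa>' (p0, p1, m) = (f0, f1, D)" by (metis prod_cases3)
  note ap = induced_mor_apply[OF T]
  note vb = ruth_hom_vb[OF P.G P.R P'.R p]
  note h0 = hp0D[OF P.G P.R P'.R p] and h1 = hp1D[OF P.G P.R P'.R p] and hm = hmD[OF P.G P.R P'.R p]
  note pre1 = pull_prebundle(1)[OF P.G P.vbs(2)]
  have ext: "f0 \<in> extensional (pts (tot (E1 R)))" "f1 \<in> extensional (pts (tot (Varr V)))"
    "D \<in> extensional (pts (tot (pull1 G (E1 R))))"
    using T by (auto simp: induced_mor_def)
  have f0: "vb_map (E1 R) (E1 R') (\<lambda>x. x) f0"
    by (rule vb_map_cong[OF vb(2) P.pre(2) P'.vbs(2)]) (simp_all add: ap)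
  have "vb_map (Varr V) (Varr W) (\<lambda>x. x) (\<lambda>v. P'.arr (p0 (\<rho> v)) (p1 (lsrc V v)))"
    by (intro P'.arr_vb_map P.pre vb_map_comp[OF P.\<rho> vb(1) P.pre(3) P.vbs(1) P'.vbs(1)]
          vb_map_comp[OF P.lsrc_vb vb(2) P.pre(3) P.vbs(2) P'.vbs(2)])
  then have f1: "vb_map (Varr V) (Varr W) (\<lambda>x. x) f1"
    by (rule vb_map_cong[OF _ P.pre(3) P'.vbs(3)]) (use T in \<open>auto simp: induced_mor_def\<close>)
  have "vb_map (pull1 G (E1 R)) (Varr W) (gtgt G) (\<lambda>e. P'.arr (vneg (E0 R') (m e)) (p1 (lam1 R e)))"
    by (intro P'.arr_vb_map pre1 vb_map_vneg[OF vb(3) pre1 P'.vbs(1)]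
        vb_map_comp[OF ruth_vb_maps(2)[OF P.G P.R] vb(2) pre1 P.vbs(2) P'.vbs(2)])
  then have D: "vb_map (pull1 G (E1 R)) (Varr W) (gtgt G) D"
    by (rule vb_map_cong[OF _ pre1 P'.vbs(3)]) (use T in \<open>auto simp: induced_mor_def\<close>)
  have dl: "p1 (dl R a) = dl R' (p0 a)" if "a \<in> pts (tot (E0 R))" for a
    using ruth_hom_dl[OF P.G P.R P'.R p that] .
  interpret M: presented_mor G R A \<kappa> \<rho> R' A' \<kappa>' \<rho>' p0 p1 m f0 f1 D
    by unfold_locales (use vb dl ruth_hom_lam1[OF p] ap in auto)
  have p00: "p0 (vzero (E0 R) y) = vzero (E0 R') y" if "y \<in> pts (Obj G)" for y
    using vb_map_zero[OF vb(1) P.vbs(1) P'.vbs(1)] that P.bases by simp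
  have lgb: "lgb_map V W (\<lambda>x. x) f0 f1"
    unfolding lgb_map_iff P.Vob P'.Vob
  proof (intro conjI allI impI f0 f1)
    fix v assume "v \<in> pts (tot (Varr V))"
    then obtain a x where a: "a \<in> pts (tot (E0 R))" "x \<in> pts (tot (E1 R))" "proj (E0 R) a = proj (E1 R) x" 
      "proj (Varr V) v = proj (E1 R) x" "v = P.arr a x" by (rule P.arr_exhaust)
    show "lsrc W (f1 v) = f0 (lsrc V v)" "ltgt W (f1 v) = f0 (ltgt V v)"
      using a ap h0 h1 dl P.ops P.diffD by (simp_all add: P.arr_pts P'.arr_pts)
    fix w assume "w \<in> pts (tot (Varr V))" and vw: "lsrc V v = ltgt V w"
    then obtain b y where b: "b \<in> pts (tot (E0 R))" "y \<in> pts (tot (E1 R))" "proj (E0 R) b = proj (E1 R) y" 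
      "proj (Varr V) w = proj (E1 R) y" "w = P.arr b y" by (elim P.arr_exhaust)
    have x: "x = vadd (E1 R) (dl R b) y" using a b vw by (simp add: P.arr_pts)
    have xy: "proj (E1 R) x = proj (E1 R) y" using x b P.diffD P.ops by simp
    have x': "p1 x = vadd (E1 R') (dl R' (p0 b)) (p1 y)" using x b h1 dl P.diffD by simp
    show "f1 (lmult V v w) = lmult W (f1 v) (f1 w)"
      using a b xy P.lmult_arr[OF a(1-3) b(1-3) x] P'.lmult_arr[of "p0 a" "p1 x" "p0 b" "p1 y", OF _ _ _ _ _ _ x'] ap h0 h1 P.ops
      by simp
  next
    fix x assume x: "x \<in> pts (tot (E1 R))"
    then have y: "proj (E1 R) x \<in> pts (Obj G)" using P.in_base P.bases by simp
    then show "f1 (lunit V x) = lunit W (f0 x)"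
      using x h1 p00[OF y] P.ops P.bases by (simp add: P.lunit_arr P'.lunit_arr ap)
  qed
  have c: "lsrc W (D (g, x)) = f0 (act0 A (g, x))" "ltgt W (D (g, x)) = act0 A' (g, f0 x)"
    if g: "g \<in> pts (Arr G)" and x: "x \<in> pts (tot (E1 R))" "proj (E1 R) x = gsrc G g" for g x
  proof -
    show "lsrc W (D (g, x)) = f0 (act0 A (g, x))"
      using g x P'.ops hm h1 by (simp add: ap P'.arr_pts P.act0 P.lam1s)
    note ruth_hom_lam1[OF p g x]
    then show "ltgt W (D (g, x)) = act0 A' (g, f0 x)"
      using g x P'.ops hm h1 by (simp add: ap P'.arr_pts P'.act0 P.lam1s)
  qed
  have n: "lmult W (D (g, ltgt V v)) (f1 (act1 A (g, v))) = lmult W (act1 A' (g, f1 v)) (D (g, lsrc V v))"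
    if g: "g \<in> pts (Arr G)" and v: "v \<in> pts (tot (Varr V))" "proj (Varr V) v = gsrc G g" for g v
  proof -
    from v(1) obtain a x where a: "a \<in> pts (tot (E0 R))" "x \<in> pts (tot (E1 R))" "proj (E0 R) a = proj (E1 R) x" 
      "proj (Varr V) v = proj (E1 R) x" "v = P.arr a x" by (rule P.arr_exhaust)
    have gx: "proj (E1 R) x = gsrc G g" "proj (E0 R) a = gsrc G g" using a v by auto
    note sides = M.naturality_sides[OF g a(1) gx(2) a(2) gx(1)]
    have "lmult W (D (g, ltgt V v)) (f1 (act1 A (g, v))) =
      P'.arr (vadd (E0 R') (vneg (E0 R') (m (g, vadd (E1 R) (dl R a) x))) (p0 (lam0 R (g, a)))) (p1 (lam1 R (g, x)))"
      unfolding a(5) by (rule sides(1))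
    also have "\<dots> = P'.arr (vadd (E0 R') (lam0 R' (g, p0 a)) (vneg (E0 R') (m (g, x)))) (p1 (lam1 R (g, x)))"
    proof -
      have "m (g, vadd (E1 R) (dl R a) x) = vadd (E0 R') (m (g, dl R a)) (m (g, x))"
        using a g gx hm(3) P.diffD by simp
      then have "vadd (E0 R') (vneg (E0 R') (m (g, vadd (E1 R) (dl R a) x))) (p0 (lam0 R (g, a))) =
        vadd (E0 R') (lam0 R' (g, p0 a)) (vneg (E0 R') (m (g, x)))"
        using a g gx hm h0 P'.ops P.diffD P.lam0s P'.lam0s ruth_hom_lam(1)[OF P.G P.R P'.R p g a(1) gx(2)]
        by (intro coord_eqI[OF P'.vbs(1)]) (simp_all add: P'.coords)
      then show ?thesis by simp
    qed
    also have "\<dots> = lmult W (act1 A' (g, f1 v)) (D (g, lsrc V v))"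
      unfolding a(5) by (rule sides(2)[symmetric])
    finally show ?thesis .
  qed
  have k: "lmult W (lmult W (alph A' ((g, k), f0 x)) (act1 A' (g, D (k, x)))) (D (g, act0 A (k, x))) =
        lmult W (D (gmult G g k, x)) (f1 (alph A ((g, k), x)))"
    if g: "g \<in> pts (Arr G)" "k \<in> pts (Arr G)" "gsrc G g = gtgt G k" and x: "x \<in> pts (tot (E1 R))" "proj (E1 R) x = gsrc G k" for g k x
  proof -
    note om = OmgD[OF P.G P.R g] and om' = OmgD[OF P.G P'.R g]
    have lx: "lam1 R (k, x) \<in> pts (tot (E1 R))" "proj (E1 R) (lam1 R (k, x)) = gsrc G g" using g x P.lam1s by auto
    have gk: "gmult G g k \<in> pts (Arr G)" "gsrc G (gmult G g k) = gsrc G k" "gtgt G (gmult G g k) = gtgt G g" using P.laws g by auto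
    note sides = M.coherence_sides[OF g x]
    have "lmult W (lmult W (alph A' ((g, k), f0 x)) (act1 A' (g, D (k, x)))) (D (g, act0 A (k, x))) =
      P'.arr (vadd (E0 R') (vadd (E0 R') (Omg R' ((g, k), p1 x)) (lam0 R' (g, vneg (E0 R') (m (k, x))))) (vneg (E0 R') (m (g, lam1 R (k, x)))))
        (p1 (lam1 R (g, lam1 R (k, x))))"
      by (rule sides(1))
    also have "\<dots> = P'.arr (vadd (E0 R') (vneg (E0 R') (m (gmult G g k, x))) (p0 (Omg R ((g, k), x)))) (p1 (lam1 R (g, lam1 R (k, x))))"
    proof -
      have "vadd (E0 R') (vadd (E0 R') (Omg R' ((g, k), p1 x)) (lam0 R' (g, vneg (E0 R') (m (k, x))))) (vneg (E0 R') (m (g, lam1 R (k, x)))) =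
         vadd (E0 R') (vneg (E0 R') (m (gmult G g k, x))) (p0 (Omg R ((g, k), x)))"
        using g gk x lx hm h0 h1 P'.ops P.lam1s P'.lam0s om om'
      proof (intro coord_eqI[OF P'.vbs(1)], goal_cases)
        case (4 i)
        then show ?case using ruth_hom_cocycle[OF P.G P.R P'.R p g x, of i] by (simp add: P'.coords)
      qed simp_all
      then show ?thesis by simp
    qed
    also have "\<dots> = lmult W (D (gmult G g k, x)) (f1 (alph A ((g, k), x)))"
      by (rule sides(2)[symmetric])
    finally show ?thesis .
  qed
  have u: "D (gunit G (proj (E1 R) x), x) = lunit W (f0 x)" if x: "x \<in> pts (tot (E1 R))" for x
  proof -
    let ?y = "proj (E1 R) x"
    have y: "?y \<in> pts (Obj G)" using P.in_base x P.bases by simp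
    have "vneg (E0 R') (vzero (E0 R') ?y) = vzero (E0 R') ?y"
      using y P'.ops P'.bases by (intro coord_eqI[OF P'.vbs(1)]) (simp_all add: P'.coords)
    then show ?thesis
      using x y P.laws ruth_hom_unit[OF P.G P.R P'.R p x] ruth_unit(2)[OF P.G P.R x] h1
      by (simp add: ap P'.lunit_arr)
  qed
  show ?thesis
    unfolding T wrep_hom_iff P.Vob using ext lgb D c n k u by auto
qed

lemma induced_mor_inj:
  assumes p: "(p0, p1, m) \<in> ruth2_hom G R R'" and q: "(q0, q1, n) \<in> ruth2_hom G R R'"
    and eq: "induced_mor G R A \<rho> R' A' \<kappa>' (p0, p1, m) = induced_mor G R A \<rho> R' A' \<kappa>' (q0, q1, n)"
  shows "(p0, p1, m) = (q0, q1, n)"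
proof -
  obtain f0 f1 D where T: "induced_mor G R A \<rho> R' A' \<kappa>' (p0, p1, m) = (f0, f1, D)" by (metis prod_cases3)
  note ap = induced_mor_apply[OF T] and aq = induced_mor_apply[OF T[unfolded eq]]
  note h0 = hp0D[OF P.G P.R P'.R p] and h1 = hp1D[OF P.G P.R P'.R p] and hm = hmD[OF P.G P.R P'.R p]
  note k0 = hp0D[OF P.G P.R P'.R q] and k1 = hp1D[OF P.G P.R P'.R q] and km = hmD[OF P.G P.R P'.R q]
  have e1: "p1 x = q1 x" if "x \<in> pts (tot (E1 R))" for x using ap(1)[OF that] aq(1)[OF that] by simp
  have e0: "p0 a = q0 a" if a: "a \<in> pts (tot (E0 R))" for a
  proof -
    \<comment> \<open>Every \<open>a\<close> is the kernel component of some arrow, for instance of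
      the one starting at the zero object; there the two functors can be compared.\<close>
    let ?z = "vzero (E1 R) (proj (E0 R) a)"
    have y: "proj (E0 R) a \<in> pts (base (E1 R))" using P.in_base(1)[OF a] P.bases by simp
    have "P'.arr (p0 a) (p1 ?z) = P'.arr (q0 a) (q1 ?z)" using ap(2)[OF a, of ?z] aq(2)[OF a, of ?z] y P.ops by simp
    then have "\<rho>' (P'.arr (p0 a) (p1 ?z)) = \<rho>' (P'.arr (q0 a) (q1 ?z))" by simp
    then show ?thesis using a y P.ops h0 h1 k0 k1 by (simp add: P'.arr_pts)
  qed
  have em: "m z = n z" if z: "z \<in> pts (tot (pull1 G (E1 R)))" for z
  proof -
    obtain g x where gx: "z = (g, x)" "g \<in> pts (Arr G)" "x \<in> pts (tot (E1 R))" "proj (E1 R) x = gsrc G g" using z by auto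
    have "P'.arr (vneg (E0 R') (m (g, x))) (p1 (lam1 R (g, x))) = P'.arr (vneg (E0 R') (n (g, x))) (q1 (lam1 R (g, x)))"
      using ap(3)[OF gx(2-4)] aq(3)[OF gx(2-4)] by simp
    then have "\<rho>' (P'.arr (vneg (E0 R') (m (g, x))) (p1 (lam1 R (g, x)))) = \<rho>' (P'.arr (vneg (E0 R') (n (g, x))) (q1 (lam1 R (g, x))))" by simp
    then have v: "vneg (E0 R') (m (g, x)) = vneg (E0 R') (n (g, x))" using gx P'.ops P.lam1s hm h1 km k1 by (simp add: P'.arr_pts)
    have "coord (E0 R') (m (g, x)) i = coord (E0 R') (n (g, x)) i" for i
      using arg_cong[OF v, of "\<lambda>e. coord (E0 R') e i"] gx hm km by (simp add: P'.coords)
    then show ?thesis unfolding gx(1) using gx hm km by (intro coord_eqI[OF P'.vbs(1)]) auto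
  qed
  show ?thesis
    using p q e0 e1 em unfolding ruth2_hom_iff prod.inject
    by (intro conjI; elim conjE; intro extensionalityI[where A = "_ :: _ set"]) assumption+
qed

text \<open>\<open>p0\<close> is the effect of \<open>f1\<close> on kernel arrows and
  \<open>m\<close> is minus the kernel component of \<open>D\<close>. Applying
  \<open>\<rho>'\<close> to naturality and coherence of \<open>D\<close> returns the conditions on
  \<open>m\<close>.\<close>

lemma induced_mor_surj:
  assumes F: "(f0, f1, D) \<in> wrep_hom G A A'"
  obtains p0 p1 m where "(p0, p1, m) \<in> ruth2_hom G R R'" "induced_mor G R A \<rho> R' A' \<kappa>' (p0, p1, m) = (f0, f1, D)"
proof -
  note F' = F[unfolded wrep_hom_iff P.Vob]
  have lgb: "lgb_map V W (\<lambda>x. x) f0 f1" using F' by simp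
  note L = lgb[unfolded lgb_map_iff P.Vob P'.Vob]
  have fvb: "vb_map (E1 R) (E1 R') (\<lambda>x. x) f0" "vb_map (Varr V) (Varr W) (\<lambda>x. x) f1" using L by auto
  have Dvb: "vb_map (pull1 G (E1 R)) (Varr W) (gtgt G) D" using F' by simp
  note pre1 = pull_prebundle(1)[OF P.G P.vbs(2)]
  note hf0 = vb_mapD(3-8)[OF fvb(1) P.pre(2) P'.vbs(2)] and hf1 = vb_mapD(3-8)[OF fvb(2) P.pre(3) P'.vbs(3)]
    and hD = pull1_mapD[OF P.G P.vbs(2) P'.vbs(3) Dvb]
  define p0 where "p0 = restrict (\<lambda>a. \<rho>' (f1 (\<kappa> a))) (pts (tot (E0 R)))"
  define m where "m = restrict (\<lambda>z. vneg (E0 R') (\<rho>' (D z))) (pts (tot (pull1 G (E1 R))))"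
  have "vb_map (E0 R) (E0 R') (\<lambda>x. x) (\<lambda>a. \<rho>' (f1 (\<kappa> a)))"
    using vb_map_comp[OF vb_map_comp[OF P.\<kappa> fvb(2) P.pre(1) P.vbs(3) P'.vbs(3)] P'.\<rho> P.pre(1) P'.vbs(3,1)] by simp
  then have vp0: "vb_map (E0 R) (E0 R') (\<lambda>x. x) p0"
    by (rule vb_map_cong[OF _ P.pre(1) P'.vbs(1)]) (auto simp: p0_def)
  have "vb_map (pull1 G (E1 R)) (E0 R') (gtgt G) (\<lambda>z. vneg (E0 R') (\<rho>' (D z)))"
    using vb_map_comp[OF Dvb P'.\<rho> pre1 P'.vbs(3,1)] by (intro vb_map_vneg pre1 P'.vbs(1)) auto
  then have vm: "vb_map (pull1 G (E1 R)) (E0 R') (gtgt G) m"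
    by (rule vb_map_cong[OF _ pre1 P'.vbs(1)]) (auto simp: m_def)
  note h0 = vb_mapD(3-8)[OF vp0 P.pre(1) P'.vbs(1)] and hm = pull1_mapD[OF P.G P.vbs(2) P'.vbs(1) vm]
  have f1arr: "f1 (P.arr a x) = P'.arr (p0 a) (f0 x)"
    if a: "a \<in> pts (tot (E0 R))" "x \<in> pts (tot (E1 R))" "proj (E0 R) a = proj (E1 R) x" for a x
  proof -
    note ax = P.arr_pts[OF a]
    have 1: "f1 (P.arr a x) = vadd (Varr W) (f1 (\<kappa> a)) (lunit W (f0 x))"
      using a hf1 P.\<kappa>D P.maps L by (simp add: P.arr_def)
    have y: "proj (E1 R) x \<in> pts (base (E0 R'))" using P.in_base(2)[OF a(2)] P.bases P'.bases by simp
    have "\<rho>' (f1 (P.arr a x)) = vadd (E0 R') (p0 a) (vzero (E0 R') (proj (E1 R) x))"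
      unfolding 1 using a hf0 hf1 P.\<kappa>D P'.maps P'.\<rho>D P'.\<rho>_lunit by (simp add: p0_def)
    also have "\<dots> = p0 a"
      using a y h0 P'.ops by (intro coord_eqI[OF P'.vbs(1)]) (simp_all add: P'.coords)
    finally have "\<rho>' (f1 (P.arr a x)) = p0 a" .
    moreover have "lsrc W (f1 (P.arr a x)) = f0 x" using L ax by simp
    ultimately show ?thesis using P'.arr_surj[of "f1 (P.arr a x)"] hf1(1)[OF ax(1)] by simp
  qed
  have src: "lsrc W (D (g, x)) = f0 (lam1 R (g, x))" and tgt: "ltgt W (D (g, x)) = lam1 R' (g, f0 x)"
    if g: "g \<in> pts (Arr G)" and x: "x \<in> pts (tot (E1 R))" "proj (E1 R) x = gsrc G g" for g x
    using F' g x hf0 by (simp_all add: P.act0 P'.act0)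
  have Darr: "D (g, x) = P'.arr (vneg (E0 R') (m (g, x))) (f0 (lam1 R (g, x)))"
    if g: "g \<in> pts (Arr G)" and x: "x \<in> pts (tot (E1 R))" "proj (E1 R) x = gsrc G g" for g x
  proof -
    have "vneg (E0 R') (m (g, x)) = \<rho>' (D (g, x))"
      using g x hD P'.\<rho>D P'.ops by (intro coord_eqI[OF P'.vbs(1)]) (simp_all add: m_def P'.coords)
    then show ?thesis using P'.arr_surj[of "D (g, x)"] hD(1)[OF g x] src[OF g x] by simp
  qed
  have dl: "f0 (dl R a) = dl R' (p0 a)" if a: "a \<in> pts (tot (E0 R))" for a
  proof -
    let ?z = "vzero (E1 R) (proj (E0 R) a)"
    have y: "proj (E0 R) a \<in> pts (base (E1 R))" "proj (E0 R) a \<in> pts (base (E1 R'))" using P.in_base(1)[OF a] P.bases P'.bases by auto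
    have z: "?z \<in> pts (tot (E1 R))" "proj (E1 R) ?z = proj (E0 R) a" "f0 ?z = vzero (E1 R') (proj (E0 R) a)"
      using y P.ops vb_map_zero[OF fvb(1) P.vbs(2) P'.vbs(2)] by auto
    have "f0 (vadd (E1 R) (dl R a) ?z) = ltgt W (f1 (P.arr a ?z))"
      using L P.arr_pts[OF a z(1)] z by simp
    also have "\<dots> = vadd (E1 R') (dl R' (p0 a)) (vzero (E1 R') (proj (E0 R) a))"
      using f1arr[OF a z(1)] z a h0 hf0(1)[OF z(1)] hf0(2)[OF z(1)] by (simp add: P'.arr_pts)
    also have "\<dots> = dl R' (p0 a)"
      using a y h0 P'.ops P'.diffD by (intro coord_eqI[OF P'.vbs(2)]) (simp_all add: P'.coords)
    also have "vadd (E1 R) (dl R a) ?z = dl R a"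
      using a y P.ops P.diffD by (intro coord_eqI[OF P.vbs(2)]) (simp_all add: P.coords)
    finally show ?thesis .
  qed
  have lam: "lam1 R' (g, f0 x) = vadd (E1 R') (dl R' (vneg (E0 R') (m (g, x)))) (f0 (lam1 R (g, x)))"
    if g: "g \<in> pts (Arr G)" and x: "x \<in> pts (tot (E1 R))" "proj (E1 R) x = gsrc G g" for g x
    using tgt[OF g x] Darr[OF g x] g x hm hf0 P'.ops P.lam1s by (simp add: P'.arr_pts)
  interpret M: presented_mor G R A \<kappa> \<rho> R' A' \<kappa>' \<rho>' p0 f0 m f0 f1 D
    by unfold_locales (use vp0 fvb vm dl lam f1arr Darr in auto)
  note ns = M.naturality_sides and cs = M.coherence_sides
  have hom: "(p0, f0, m) \<in> ruth2_hom G R R'"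
    unfolding ruth2_hom_iff
  proof (intro conjI allI impI fvb(1) vp0 vm dl)
    show "p0 \<in> extensional (pts (tot (E0 R)))" "f0 \<in> extensional (pts (tot (E1 R)))"
      "m \<in> extensional (pts (tot (pull1 G (E1 R))))" using F' by (auto simp: p0_def m_def)
    fix g assume g: "g \<in> pts (Arr G)"
    show "vsub (E1 R') (f0 (lam1 R (g, x))) (lam1 R' (g, f0 x)) = dl R' (m (g, x))"
      if x: "x \<in> pts (tot (E1 R))" "proj (E1 R) x = gsrc G g" for x
    proof -
      let ?u = "f0 (lam1 R (g, x))" and ?d = "dl R' (m (g, x))"
      have u: "?u \<in> pts (tot (E1 R'))" "proj (E1 R') ?u = gtgt G g" using g x hf0(1,2) P.lam1s(1,2) by simp_all
      have d: "?d \<in> pts (tot (E1 R'))" "proj (E1 R') ?d = gtgt G g" "dl R' (vneg (E0 R') (m (g, x))) = vneg (E1 R') ?d"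
        using g x hm(1,2) P'.diffD(3,4,7) by simp_all
      show ?thesis
        unfolding lam[OF g x] d(3) using u d(1,2) P'.ops by (intro coord_eqI[OF P'.vbs(2)]) (simp_all add: P'.coords)
    qed
    show "vsub (E0 R') (p0 (lam0 R (g, a))) (lam0 R' (g, p0 a)) = m (g, dl R a)"
      if a: "a \<in> pts (tot (E0 R))" "proj (E0 R) a = gsrc G g" for a
    proof -
      \<comment> \<open>Naturality is used at the kernel arrow from 0 to \<open>\<delta>a\<close>:
        the term \<open>m (g, 0)\<close> vanishes and the degree 0 condition remains.\<close>
      let ?z = "vzero (E1 R) (gsrc G g)"
      have y: "gsrc G g \<in> pts (base (E1 R))" "gtgt G g \<in> pts (base (E0 R'))" "gtgt G g \<in> pts (base (E1 R'))"
        using g P.laws P.bases P'.bases by auto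
      have z: "?z \<in> pts (tot (E1 R))" "proj (E1 R) ?z = gsrc G g" using y P.ops by auto
      have v: "P.arr a ?z \<in> pts (tot (Varr V))" "proj (Varr V) (P.arr a ?z) = gsrc G g" using P.arr_pts a z by auto
      have dz: "vadd (E1 R) (dl R a) ?z = dl R a"
        using a y P.ops P.diffD by (intro coord_eqI[OF P.vbs(2)]) (simp_all add: P.coords)
      have "lmult W (D (g, ltgt V (P.arr a ?z))) (f1 (act1 A (g, P.arr a ?z))) =
          lmult W (act1 A' (g, f1 (P.arr a ?z))) (D (g, lsrc V (P.arr a ?z)))" using F' g v by blast
      then have "P'.arr (vadd (E0 R') (vneg (E0 R') (m (g, dl R a))) (p0 (lam0 R (g, a)))) (f0 (lam1 R (g, ?z))) =
         P'.arr (vadd (E0 R') (lam0 R' (g, p0 a)) (vneg (E0 R') (m (g, ?z)))) (f0 (lam1 R (g, ?z)))"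
        unfolding ns(1)[OF g a z] ns(2)[OF g a z] dz .
      then have "\<rho>' (P'.arr (vadd (E0 R') (vneg (E0 R') (m (g, dl R a))) (p0 (lam0 R (g, a)))) (f0 (lam1 R (g, ?z)))) =
         \<rho>' (P'.arr (vadd (E0 R') (lam0 R' (g, p0 a)) (vneg (E0 R') (m (g, ?z)))) (f0 (lam1 R (g, ?z))))" by simp
      then have e: "vadd (E0 R') (vneg (E0 R') (m (g, dl R a))) (p0 (lam0 R (g, a))) = vadd (E0 R') (lam0 R' (g, p0 a)) (vneg (E0 R') (m (g, ?z)))"
        using g a z hm h0 hf0 P'.ops P.diffD P.lam0s P.lam1s P'.lam0s by (simp add: P'.arr_pts)
      show ?thesis
      proof (rule coord_eqI[OF P'.vbs(1)])
        fix i show "coord (E0 R') (vsub (E0 R') (p0 (lam0 R (g, a))) (lam0 R' (g, p0 a))) i = coord (E0 R') (m (g, dl R a)) i"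
          using arg_cong[OF e, of "\<lambda>e. coord (E0 R') e i"] g a y z hm h0 P'.ops P.diffD P.lam0s P'.lam0s by (simp add: P'.coords)
      qed (use g a hm h0 P'.ops P.diffD P.lam0s P'.lam0s in simp_all)
    qed
    fix k x assume k: "k \<in> pts (Arr G)" "gsrc G g = gtgt G k" and x: "x \<in> pts (tot (E1 R))" "proj (E1 R) x = gsrc G k"
    note om = OmgD[OF P.G P.R g k] and om' = OmgD[OF P.G P'.R g k]
    have lx: "lam1 R (k, x) \<in> pts (tot (E1 R))" "proj (E1 R) (lam1 R (k, x)) = gsrc G g" using k x P.lam1s by auto
    have gk: "gmult G g k \<in> pts (Arr G)" "gsrc G (gmult G g k) = gsrc G k" "gtgt G (gmult G g k) = gtgt G g" using P.laws g k by auto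
    have "lmult W (lmult W (alph A' ((g, k), f0 x)) (act1 A' (g, D (k, x)))) (D (g, act0 A (k, x))) =
        lmult W (D (gmult G g k, x)) (f1 (alph A ((g, k), x)))" using F' g k x by blast
    from arg_cong[OF this[unfolded cs(1)[OF g k x] cs(2)[OF g k x]], of \<rho>']
    have e: "vadd (E0 R') (vadd (E0 R') (Omg R' ((g, k), f0 x)) (lam0 R' (g, vneg (E0 R') (m (k, x))))) (vneg (E0 R') (m (g, lam1 R (k, x)))) =
       vadd (E0 R') (vneg (E0 R') (m (gmult G g k, x))) (p0 (Omg R ((g, k), x)))"
      using g k gk x lx hm h0 hf0 P'.ops P.lam1s P'.lam0s om om' by (simp add: P'.arr_pts)
    show "vadd (E0 R') (vadd (E0 R') (p0 (Omg R ((g, k), x))) (m (g, lam1 R (k, x)))) (lam0 R' (g, m (k, x))) =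
        vadd (E0 R') (m (gmult G g k, x)) (Omg R' ((g, k), f0 x))"
    proof (rule coord_eqI[OF P'.vbs(1)])
      fix i show "coord (E0 R') (vadd (E0 R') (vadd (E0 R') (p0 (Omg R ((g, k), x))) (m (g, lam1 R (k, x)))) (lam0 R' (g, m (k, x)))) i =
        coord (E0 R') (vadd (E0 R') (m (gmult G g k, x)) (Omg R' ((g, k), f0 x))) i"
        using arg_cong[OF e, of "\<lambda>e. coord (E0 R') e i"] g k gk x lx hm h0 hf0 P'.ops P.lam1s P'.lam0s om om' by (simp add: P'.coords)
    qed (use g k gk x lx hm h0 hf0 P'.ops P.lam1s P'.lam0s om om' in simp_all)
  qed
  have "induced_mor G R A \<rho> R' A' \<kappa>' (p0, f0, m) = (f0, f1, D)"
  proof -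
    have ext: "f0 \<in> extensional (pts (tot (E1 R)))" "f1 \<in> extensional (pts (tot (Varr V)))"
      "D \<in> extensional (pts (tot (pull1 G (E1 R))))" using F' by blast+
    have "restrict f0 (pts (tot (E1 R))) = f0" using ext(1) by (rule extensional_restrict)
    moreover have "restrict (\<lambda>v. P'.arr (p0 (\<rho> v)) (f0 (lsrc V v))) (pts (tot (Varr V))) = f1"
    proof (rule extensionalityI[OF restrict_extensional ext(2)])
      fix v assume v: "v \<in> pts (tot (Varr V))"
      then obtain a x where a: "a \<in> pts (tot (E0 R))" "x \<in> pts (tot (E1 R))" "proj (E0 R) a = proj (E1 R) x" 
        "proj (Varr V) v = proj (E1 R) x" "v = P.arr a x" by (rule P.arr_exhaust)
      show "restrict (\<lambda>v. P'.arr (p0 (\<rho> v)) (f0 (lsrc V v))) (pts (tot (Varr V))) v = f1 v"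
        using v a f1arr P.arr_pts by simp
    qed
    moreover have "restrict (\<lambda>(g, x). P'.arr (vneg (E0 R') (m (g, x))) (f0 (lam1 R (g, x)))) (pts (tot (pull1 G (E1 R)))) = D"
    proof (rule extensionalityI[OF restrict_extensional ext(3)])
      fix z assume z: "z \<in> pts (tot (pull1 G (E1 R)))"
      then obtain g x where gx: "z = (g, x)" "g \<in> pts (Arr G)" "x \<in> pts (tot (E1 R))" "proj (E1 R) x = gsrc G g" by auto
      show "restrict (\<lambda>(g, x). P'.arr (vneg (E0 R') (m (g, x))) (f0 (lam1 R (g, x)))) (pts (tot (pull1 G (E1 R)))) z = D z"
        using Darr[OF gx(2-4)] z by (simp add: gx(1))
    qed
    ultimately show ?thesis by (simp add: induced_mor_def)
  qed
  with hom show thesis by (rule that)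
qed

end

lemma (in presented) induced_mor_ident:
  "induced_mor G R A \<rho> R A \<kappa> (Ident (RutH2 G) R) = Ident (WRep G) A"
proof -
  have "restrict (restrict (\<lambda>e. e) (pts (tot (E1 R)))) (pts (tot (E1 R))) = restrict (\<lambda>x. x) (pts (tot (E1 R)))"
    by simp
  moreover have "restrict (\<lambda>v. arr (restrict (\<lambda>e. e) (pts (tot (E0 R))) (\<rho> v)) (restrict (\<lambda>e. e) (pts (tot (E1 R))) (lsrc (wV A) v)))
      (pts (tot (Varr (wV A)))) = restrict (\<lambda>v. v) (pts (tot (Varr (wV A))))"
    by (rule restrict_ext) (simp add: \<rho>D(3) maps arr_surj)
  moreover have "restrict (\<lambda>(g, x). arr (vneg (E0 R) (restrict (\<lambda>(g, e). vzero (E0 R) (gtgt G g)) (pts (tot (pull1 G (E1 R)))) (g, x)))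
        (restrict (\<lambda>e. e) (pts (tot (E1 R))) (lam1 R (g, x)))) (pts (tot (pull1 G (E1 R)))) =
     restrict (\<lambda>(g, x). lunit (wV A) (act0 A (g, x))) (pts (tot (pull1 G (E1 R))))"
  proof (rule restrict_ext)
    fix z assume z: "z \<in> pts (tot (pull1 G (E1 R)))"
    then obtain g x where gx: "z = (g, x)" "g \<in> pts (Arr G)" "x \<in> pts (tot (E1 R))" "proj (E1 R) x = gsrc G g" by auto
    have y: "gtgt G g \<in> pts (base (E0 R))" using gx laws bases by simp
    have "vneg (E0 R) (vzero (E0 R) (gtgt G g)) = vzero (E0 R) (gtgt G g)"
      using y ops by (intro coord_eqI[OF vbs(1)]) (simp_all add: coords)
    then show "(\<lambda>(g, x). arr (vneg (E0 R) (restrict (\<lambda>(g, e). vzero (E0 R) (gtgt G g)) (pts (tot (pull1 G (E1 R)))) (g, x)))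
        (restrict (\<lambda>e. e) (pts (tot (E1 R))) (lam1 R (g, x)))) z = (\<lambda>(g, x). lunit (wV A) (act0 A (g, x))) z"
      using gx lam1s(1,2) by (simp add: act0 lunit_arr)
  qed
  ultimately show ?thesis by (simp only: induced_mor_def RutH2_def WRep_def category.simps prod.case Vob)
qed

text \<open>When \<open>g1 (D (g, x))\<close> is followed by \<open>D' (g, f0 x)\<close>, the kernel
  components add up to \<open>-n (g, p1 x) - q0 (m (g, x))\<close>. This is the negative of the
  third component of the composite in \<open>RutH2 G\<close>, so the sign convention is compatible
  with composition.\<close>

lemma induced_mor_comp:
  assumes 1: "presented_pair G R A \<kappa> \<rho> R' A' \<kappa>' \<rho>'" and 2: "presented_pair G R' A' \<kappa>' \<rho>' R'' A'' \<kappa>'' \<rho>''"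
    and p: "(p0, p1, m) \<in> ruth2_hom G R R'" and q: "(q0, q1, n) \<in> ruth2_hom G R' R''"
  shows "Comp (WRep G) A A' A'' (induced_mor G R' A' \<rho>' R'' A'' \<kappa>'' (q0, q1, n)) (induced_mor G R A \<rho> R' A' \<kappa>' (p0, p1, m)) =
    induced_mor G R A \<rho> R'' A'' \<kappa>'' (Comp (RutH2 G) R R' R'' (q0, q1, n) (p0, p1, m))"
proof -
  interpret A: presented_pair G R A \<kappa> \<rho> R' A' \<kappa>' \<rho>' by fact
  interpret B: presented_pair G R' A' \<kappa>' \<rho>' R'' A'' \<kappa>'' \<rho>'' by fact
  obtain f0 f1 D where T: "induced_mor G R A \<rho> R' A' \<kappa>' (p0, p1, m) = (f0, f1, D)" by (metis prod_cases3)
  obtain g0 g1 D' where T': "induced_mor G R' A' \<rho>' R'' A'' \<kappa>'' (q0, q1, n) = (g0, g1, D')" by (metis prod_cases3)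
  note ap = A.induced_mor_apply[OF T] and aq = B.induced_mor_apply[OF T']
  note h0 = hp0D(3-7)[OF A.P.G A.P.R A.P'.R p] and h1 = hp1D(3-7)[OF A.P.G A.P.R A.P'.R p] and hm = hmD[OF A.P.G A.P.R A.P'.R p]
  note k0 = hp0D(3-7)[OF A.P.G A.P'.R B.P'.R q] and k1 = hp1D(3-7)[OF A.P.G A.P'.R B.P'.R q] and km = hmD[OF A.P.G A.P'.R B.P'.R q]
  have e0: "compose (pts (tot (E1 R))) g0 f0 = restrict (compose (pts (tot (E1 R))) q1 p1) (pts (tot (E1 R)))"
    unfolding compose_def by (rule restrict_ext) (simp add: ap aq h1)
  have e1: "compose (pts (tot (Varr (wV A)))) g1 f1 =
     restrict (\<lambda>v. B.P'.arr (compose (pts (tot (E0 R))) q0 p0 (\<rho> v)) (compose (pts (tot (E1 R))) q1 p1 (lsrc (wV A) v))) (pts (tot (Varr (wV A))))"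
    unfolding compose_def
  proof (rule restrict_ext)
    fix v assume v: "v \<in> pts (tot (Varr (wV A)))"
    then obtain a x where a: "a \<in> pts (tot (E0 R))" "x \<in> pts (tot (E1 R))" "proj (E0 R) a = proj (E1 R) x" 
        "proj (Varr (wV A)) v = proj (E1 R) x" "v = A.P.arr a x" by (rule A.P.arr_exhaust)
    show "g1 (f1 v) = B.P'.arr ((\<lambda>x\<in>pts (tot (E0 R)). q0 (p0 x)) (\<rho> v)) ((\<lambda>x\<in>pts (tot (E1 R)). q1 (p1 x)) (lsrc (wV A) v))"
      using a by (simp add: ap aq h0 h1 A.P.arr_pts)
  qed
  have e2: "restrict (\<lambda>(g, x). lmult (wV A'') (D' (g, f0 x)) (g1 (D (g, x)))) (pts (tot (pull1 G (E1 R)))) =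
     restrict (\<lambda>(g, x). B.P'.arr (vneg (E0 R'') (restrict (\<lambda>(g, e). vadd (E0 R'') (q0 (m (g, e))) (n (g, p1 e))) (pts (tot (pull1 G (E1 R)))) (g, x)))
        (compose (pts (tot (E1 R))) q1 p1 (lam1 R (g, x)))) (pts (tot (pull1 G (E1 R))))"
  proof (rule restrict_ext)
    fix z assume z: "z \<in> pts (tot (pull1 G (E1 R)))"
    then obtain g x where gx: "z = (g, x)" and g: "g \<in> pts (Arr G)" and x: "x \<in> pts (tot (E1 R))" "proj (E1 R) x = gsrc G g" by auto
    \<comment> \<open>Composability: \<open>q1\<close> carries the target of \<open>D (g, x)\<close>
      to the source of \<open>D' (g, f0 x)\<close>.\<close>
    have l: "q1 (lam1 R' (g, p1 x)) = vadd (E1 R'') (dl R'' (q0 (vneg (E0 R') (m (g, x))))) (q1 (p1 (lam1 R (g, x))))"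
      unfolding A.ruth_hom_lam1[OF p g x]
      using g x h1 hm k1 A.P'.ops(7,8) A.P'.diffD(3,4) A.P.lam1s(1,2) ruth_hom_dl[OF A.P.G A.P'.R B.P'.R q] by simp
    have "lmult (wV A'') (D' (g, f0 x)) (g1 (D (g, x))) =
      B.P'.arr (vadd (E0 R'') (vneg (E0 R'') (n (g, p1 x))) (q0 (vneg (E0 R') (m (g, x))))) (q1 (p1 (lam1 R (g, x))))"
      using g x l h1 hm k0 k1 km A.P'.ops(7,8) B.P'.ops(7,8,13,14) B.P'.diffD(3,4) A.P.lam1s(1,2) A.P'.lam1s(1,2)
      by (simp add: ap aq B.P'.lmult_arr)
    also have "vadd (E0 R'') (vneg (E0 R'') (n (g, p1 x))) (q0 (vneg (E0 R') (m (g, x)))) =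
       vneg (E0 R'') (vadd (E0 R'') (q0 (m (g, x))) (n (g, p1 x)))"
      using g x h1 hm k0 km B.P'.ops(3,4,7,8) by (intro coord_eqI[OF B.P'.vbs(1)]) (simp_all add: B.P'.coords)
    finally show "(\<lambda>(g, x). lmult (wV A'') (D' (g, f0 x)) (g1 (D (g, x)))) z =
       (\<lambda>(g, x). B.P'.arr (vneg (E0 R'') (restrict (\<lambda>(g, e). vadd (E0 R'') (q0 (m (g, e))) (n (g, p1 e))) (pts (tot (pull1 G (E1 R)))) (g, x)))
        (compose (pts (tot (E1 R))) q1 p1 (lam1 R (g, x)))) z"
      using gx g x A.P.lam1s(1,2) by (simp add: compose_def)
  qed
  show ?thesis
    unfolding T T' by (simp only: induced_mor_def RutH2_def WRep_def category.simps prod.case A.P.Vob e0 e1 e2)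
qed

section \<open>Equivalences from presentations\<close>

text \<open>\<open>P a b k\<close> reads: \<open>k\<close> presents \<open>b\<close> by
  \<open>a\<close>. Since the bijections \<open>T\<close> respect identities and composition, the
  hom sets of \<open>D\<close> are copies of hom sets of \<open>C\<close>. The laws of
  \<open>D\<close> follow from those of \<open>C\<close>, and a choice of presentations for the
  objects of \<open>D\<close> defines an inverse functor. Presentations of the same object, or by
  the same object, are compared through identities.\<close>

lemma equivalence_from_presentations:
  fixes C :: "('o, 'm) category" and D :: "('p, 'n) category" and P :: "'o \<Rightarrow> 'p \<Rightarrow> 'k \<Rightarrow> bool"
  assumes C: "is_category C"
    and P_ob: "\<And>a b k. P a b k \<Longrightarrow> a \<in> Ob C" 
    and ex: "\<And>b. b \<in> Ob D \<Longrightarrow> \<exists>a k. P a b k"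
    and can: "\<And>a. a \<in> Ob C \<Longrightarrow> P a (Fo a) (can a)" and Fo: "\<And>a. a \<in> Ob C \<Longrightarrow> Fo a \<in> Ob D"
    and bij: "\<And>a b k a' b' k'. P a b k \<Longrightarrow> P a' b' k' \<Longrightarrow> bij_betw (T a b k a' b' k') (Hom C a a') (Hom D b b')"
    and T_id: "\<And>a b k. P a b k \<Longrightarrow> T a b k a b k (Ident C a) = Ident D b"
    and T_comp: "\<And>a b k a' b' k' a'' b'' k'' f g. P a b k \<Longrightarrow> P a' b' k' \<Longrightarrow> P a'' b'' k'' \<Longrightarrow> f \<in> Hom C a a' \<Longrightarrow> g \<in> Hom C a' a'' \<Longrightarrow>
      Comp D b b' b'' (T a' b' k' a'' b'' k'' g) (T a b k a' b' k' f) = T a b k a'' b'' k'' (Comp C a a' a'' g f)"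
    and Fm: "\<And>a a' f. a \<in> Ob C \<Longrightarrow> a' \<in> Ob C \<Longrightarrow> f \<in> Hom C a a' \<Longrightarrow> Fm a a' f = T a (Fo a) (can a) a' (Fo a') (can a') f"
  shows "equivalence_of_categories C D Fo Fm"
proof -
  have cid: "Ident C a \<in> Hom C a a" if "a \<in> Ob C" for a using C that by (simp add: is_category_def)
  have ccomp: "Comp C a b c g f \<in> Hom C a c" if "a \<in> Ob C" "b \<in> Ob C" "c \<in> Ob C" "f \<in> Hom C a b" "g \<in> Hom C b c" for a b c f g
    using C that by (simp add: is_category_def)
  have cunit: "Comp C a a b f (Ident C a) = f" "Comp C a b b (Ident C b) f = f" if "a \<in> Ob C" "b \<in> Ob C" "f \<in> Hom C a b" for a b f
    using C that by (simp_all add: is_category_def)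
  have cassoc: "Comp C a b d (Comp C b c d h g) f = Comp C a c d h (Comp C a b c g f)"
    if "a \<in> Ob C" "b \<in> Ob C" "c \<in> Ob C" "d \<in> Ob C" "f \<in> Hom C a b" "g \<in> Hom C b c" "h \<in> Hom C c d" for a b c d f g h
    using C that by (simp add: is_category_def)
  obtain Go K where K: "\<And>b. b \<in> Ob D \<Longrightarrow> P (Go b) b (K b)" using ex by metis
  have TH: "T a b k a' b' k' f \<in> Hom D b b'" if "P a b k" "P a' b' k'" "f \<in> Hom C a a'" for a b k a' b' k' f
    using bij[OF that(1,2)] that(3) by (rule bij_betwE[rule_format])
  have inj: "f = g" if "P a b k" "P a' b' k'" "f \<in> Hom C a a'" "g \<in> Hom C a a'" "T a b k a' b' k' f = T a b k a' b' k' g" for a b k a' b' k' f g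
    using bij_betw_imp_inj_on[OF bij[OF that(1,2)]] that(3-5) by (auto simp: inj_on_def)
  have sur: "\<exists>g\<in>Hom C a a'. T a b k a' b' k' g = f" if "P a b k" "P a' b' k'" "f \<in> Hom D b b'" for a b k a' b' k' f
  proof -
    have "f \<in> T a b k a' b' k' ` Hom C a a'" using bij_betw_imp_surj_on[OF bij[OF that(1,2)]] that(3) by simp
    then show ?thesis by auto
  qed
  define S where "S a b k a' b' k' f = (SOME g. g \<in> Hom C a a' \<and> T a b k a' b' k' g = f)" for a b k a' b' k' f
  have S: "S a b k a' b' k' f \<in> Hom C a a'" "T a b k a' b' k' (S a b k a' b' k' f) = f"
    if "P a b k" "P a' b' k'" "f \<in> Hom D b b'" for a b k a' b' k' f
  proof -
    have "S a b k a' b' k' f \<in> Hom C a a' \<and> T a b k a' b' k' (S a b k a' b' k' f) = f"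
      unfolding S_def by (rule someI_ex) (use sur[OF that] in blast)
    then show "S a b k a' b' k' f \<in> Hom C a a'" "T a b k a' b' k' (S a b k a' b' k' f) = f" by auto
  qed
  have did: "Ident D b \<in> Hom D b b" if b: "b \<in> Ob D" for b
    using TH[OF K[OF b] K[OF b] cid[OF P_ob[OF K[OF b]]]] T_id[OF K[OF b]] by simp
  \<comment> \<open>Each law is lifted to \<open>C\<close> by \<open>S\<close>, applied there and
    pushed down by \<open>T\<close>.\<close>
  have dcat: "is_category D"
    unfolding is_category_def
  proof (intro conjI ballI)
    show "Ident D a \<in> Hom D a a" if "a \<in> Ob D" for a by (rule did[OF that])
  next
    fix a b c f g assume o: "a \<in> Ob D" "b \<in> Ob D" "c \<in> Ob D" and f: "f \<in> Hom D a b" and g: "g \<in> Hom D b c"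
    note k = K[OF o(1)] K[OF o(2)] K[OF o(3)]
    note sf = S[OF k(1,2) f] and sg = S[OF k(2,3) g]
    show "Comp D a b c g f \<in> Hom D a c"
      using T_comp[OF k sf(1) sg(1)] TH[OF k(1,3) ccomp[OF P_ob[OF k(1)] P_ob[OF k(2)] P_ob[OF k(3)] sf(1) sg(1)]] sf(2) sg(2) by simp
  next
    fix a b f assume o: "a \<in> Ob D" "b \<in> Ob D" and f: "f \<in> Hom D a b"
    note k = K[OF o(1)] K[OF o(2)]
    note sf = S[OF k f]
    show "Comp D a a b f (Ident D a) = f"
      using T_comp[OF k(1,1,2) cid[OF P_ob[OF k(1)]] sf(1)] sf cunit(1)[OF P_ob[OF k(1)] P_ob[OF k(2)] sf(1)] T_id[OF k(1)] by simp
    show "Comp D a b b (Ident D b) f = f"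
      using T_comp[OF k(1,2,2) sf(1) cid[OF P_ob[OF k(2)]]] sf cunit(2)[OF P_ob[OF k(1)] P_ob[OF k(2)] sf(1)] T_id[OF k(2)] by simp
  next
    fix a b c d f g h assume o: "a \<in> Ob D" "b \<in> Ob D" "c \<in> Ob D" "d \<in> Ob D" and f: "f \<in> Hom D a b" and g: "g \<in> Hom D b c" and h: "h \<in> Hom D c d"
    note k = K[OF o(1)] K[OF o(2)] K[OF o(3)] K[OF o(4)]
    note p = P_ob[OF k(1)] P_ob[OF k(2)] P_ob[OF k(3)] P_ob[OF k(4)]
    note sf = S[OF k(1,2) f] and sg = S[OF k(2,3) g] and sh = S[OF k(3,4) h]
    have "Comp D a b d (Comp D b c d h g) f = T (Go a) a (K a) (Go d) d (K d) (Comp C (Go a) (Go b) (Go d)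
        (Comp C (Go b) (Go c) (Go d) (S (Go c) c (K c) (Go d) d (K d) h) (S (Go b) b (K b) (Go c) c (K c) g)) (S (Go a) a (K a) (Go b) b (K b) f))"
      using T_comp[OF k(2,3,4) sg(1) sh(1)] T_comp[OF k(1,2,4) sf(1) ccomp[OF p(2,3,4) sg(1) sh(1)]] sf(2) sg(2) sh(2) by simp
    moreover have "Comp D a c d h (Comp D a b c g f) = T (Go a) a (K a) (Go d) d (K d) (Comp C (Go a) (Go c) (Go d)
        (S (Go c) c (K c) (Go d) d (K d) h) (Comp C (Go a) (Go b) (Go c) (S (Go b) b (K b) (Go c) c (K c) g) (S (Go a) a (K a) (Go b) b (K b) f)))"
      using T_comp[OF k(1,2,3) sf(1) sg(1)] T_comp[OF k(1,3,4) ccomp[OF p(1,2,3) sf(1) sg(1)] sh(1)] sf(2) sg(2) sh(2) by simp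
    ultimately show "Comp D a b d (Comp D b c d h g) f = Comp D a c d h (Comp D a b c g f)"
      using cassoc[OF p sf(1) sg(1) sh(1)] by simp
  qed
  have dunit: "Comp D a a b f (Ident D a) = f" "Comp D a b b (Ident D b) f = f" if "a \<in> Ob D" "b \<in> Ob D" "f \<in> Hom D a b" for a b f
    using dcat that by (simp_all add: is_category_def)
  have F: "is_functor C D Fo Fm"
    unfolding is_functor_def
    using Fo Fm can TH T_id T_comp cid ccomp by simp
  define Gm where "Gm b b' f = S (Go b) b (K b) (Go b') b' (K b') f" for b b' f
  have Gob: "Go b \<in> Ob C" if "b \<in> Ob D" for b using P_ob[OF K[OF that]] .
  have GmH: "Gm b b' f \<in> Hom C (Go b) (Go b')" "T (Go b) b (K b) (Go b') b' (K b') (Gm b b' f) = f"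
    if "b \<in> Ob D" "b' \<in> Ob D" "f \<in> Hom D b b'" for b b' f
    using S[OF K[OF that(1)] K[OF that(2)] that(3)] by (simp_all add: Gm_def)
  have G: "is_functor D C Go Gm"
    unfolding is_functor_def
  proof (intro conjI ballI Gob GmH(1))
    fix a assume a: "a \<in> Ob D"
    show "Gm a a (Ident D a) = Ident C (Go a)"
      by (rule inj[OF K[OF a] K[OF a] GmH(1)[OF a a did[OF a]] cid[OF Gob[OF a]]]) (simp add: GmH(2) a did T_id[OF K[OF a]])
  next
    fix a b c f g assume o: "a \<in> Ob D" "b \<in> Ob D" "c \<in> Ob D" and f: "f \<in> Hom D a b" and g: "g \<in> Hom D b c"
    note k = K[OF o(1)] K[OF o(2)] K[OF o(3)]
    have gf: "Comp D a b c g f \<in> Hom D a c" using dcat o f g by (simp add: is_category_def)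
    note mf = GmH[OF o(1,2) f] and mg = GmH[OF o(2,3) g] and mgf = GmH[OF o(1,3) gf]
    show "Gm a c (Comp D a b c g f) = Comp C (Go a) (Go b) (Go c) (Gm b c g) (Gm a b f)"
      by (rule inj[OF k(1,3) mgf(1) ccomp[OF Gob[OF o(1)] Gob[OF o(2)] Gob[OF o(3)] mf(1) mg(1)]])
         (use T_comp[OF k mf(1) mg(1)] mf(2) mg(2) mgf(2) in simp)
  qed
  \<comment> \<open>Both \<open>a\<close> and \<open>Go (Fo a)\<close> present \<open>Fo a\<close>,
    so the identity of \<open>Fo a\<close> lifts to mutually inverse morphisms between them.\<close>
  define \<eta> where "\<eta> a = S a (Fo a) (can a) (Go (Fo a)) (Fo a) (K (Fo a)) (Ident D (Fo a))" for a
  define \<eta>' where "\<eta>' a = S (Go (Fo a)) (Fo a) (K (Fo a)) a (Fo a) (can a) (Ident D (Fo a))" for a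
  have \<eta>: "\<eta> a \<in> Hom C a (Go (Fo a))" "T a (Fo a) (can a) (Go (Fo a)) (Fo a) (K (Fo a)) (\<eta> a) = Ident D (Fo a)"
    and \<eta>': "\<eta>' a \<in> Hom C (Go (Fo a)) a" "T (Go (Fo a)) (Fo a) (K (Fo a)) a (Fo a) (can a) (\<eta>' a) = Ident D (Fo a)" if a: "a \<in> Ob C" for a
    using S[OF can[OF a] K[OF Fo[OF a]] did[OF Fo[OF a]]] S[OF K[OF Fo[OF a]] can[OF a] did[OF Fo[OF a]]]
    by (simp_all add: \<eta>_def \<eta>'_def)
  have "natural_iso C C (\<lambda>a. a) (\<lambda>a b f. f) (\<lambda>a. Go (Fo a)) (\<lambda>a b f. Gm (Fo a) (Fo b) (Fm a b f)) \<eta>"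
    unfolding natural_iso_def
  proof (intro conjI ballI)
    fix a assume a: "a \<in> Ob C"
    note k = can[OF a] K[OF Fo[OF a]] and fa = Fo[OF a] and ga = Gob[OF Fo[OF a]]
    have dd: "Comp D (Fo a) (Fo a) (Fo a) (Ident D (Fo a)) (Ident D (Fo a)) = Ident D (Fo a)" by (rule dunit(1)[OF fa fa did[OF fa]])
    have "Comp C a (Go (Fo a)) a (\<eta>' a) (\<eta> a) = Ident C a"
      by (rule inj[OF k(1,1) ccomp[OF a ga a \<eta>(1)[OF a] \<eta>'(1)[OF a]] cid[OF a]])
         (use T_comp[OF k(1,2,1) \<eta>(1)[OF a] \<eta>'(1)[OF a]] \<eta>(2)[OF a] \<eta>'(2)[OF a] T_id[OF k(1)] dd in simp)
    moreover have "Comp C (Go (Fo a)) a (Go (Fo a)) (\<eta> a) (\<eta>' a) = Ident C (Go (Fo a))"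
      by (rule inj[OF k(2,2) ccomp[OF ga a ga \<eta>'(1)[OF a] \<eta>(1)[OF a]] cid[OF ga]])
         (use T_comp[OF k(2,1,2) \<eta>'(1)[OF a] \<eta>(1)[OF a]] \<eta>(2)[OF a] \<eta>'(2)[OF a] T_id[OF k(2)] dd in simp)
    ultimately show "is_iso C a (Go (Fo a)) (\<eta> a)"
      unfolding is_iso_def using \<eta>(1)[OF a] \<eta>'(1)[OF a] by blast
  next
    fix a b f assume a: "a \<in> Ob C" and b: "b \<in> Ob C" and f: "f \<in> Hom C a b"
    note k = can[OF a] can[OF b] K[OF Fo[OF a]] K[OF Fo[OF b]]
    have ff: "Fm a b f \<in> Hom D (Fo a) (Fo b)" using Fm[OF a b f] TH[OF k(1,2) f] by simp
    note gm = GmH[OF Fo[OF a] Fo[OF b] ff]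
    show "Comp C a b (Go (Fo b)) (\<eta> b) f = Comp C a (Go (Fo a)) (Go (Fo b)) (Gm (Fo a) (Fo b) (Fm a b f)) (\<eta> a)"
      by (rule inj[OF k(1,4) ccomp[OF a b Gob[OF Fo[OF b]] f \<eta>(1)[OF b]] ccomp[OF a Gob[OF Fo[OF a]] Gob[OF Fo[OF b]] \<eta>(1)[OF a] gm(1)]])
         (use T_comp[OF k(1,2,4) f \<eta>(1)[OF b]] T_comp[OF k(1,3,4) \<eta>(1)[OF a] gm(1)] gm(2) \<eta>(2)[OF a] \<eta>(2)[OF b] Fm[OF a b f]
            dunit[OF Fo[OF a] Fo[OF b] ff] in simp)
  qed
  \<comment> \<open>\<open>Go b\<close> presents \<open>b\<close> as well as its own image
    \<open>Fo (Go b)\<close>; its identity is transported to a comparison of the two.\<close>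
  moreover define \<epsilon> where "\<epsilon> b = T (Go b) (Fo (Go b)) (can (Go b)) (Go b) b (K b) (Ident C (Go b))" for b
  have "natural_iso D D (\<lambda>p. Fo (Go p)) (\<lambda>p q f. Fm (Go p) (Go q) (Gm p q f)) (\<lambda>p. p) (\<lambda>p q f. f) \<epsilon>"
    unfolding natural_iso_def
  proof (intro conjI ballI)
    fix b assume b: "b \<in> Ob D"
    note g = Gob[OF b] and k = K[OF b] can[OF Gob[OF b]]
    let ?e = "T (Go b) b (K b) (Go b) (Fo (Go b)) (can (Go b)) (Ident C (Go b))"
    note cc = cunit(1)[OF g g cid[OF g]]
    have "Comp D (Fo (Go b)) b (Fo (Go b)) ?e (\<epsilon> b) = Ident D (Fo (Go b))"
      using T_comp[OF k(2,1,2) cid[OF g] cid[OF g]] cc T_id[OF k(2)] by (simp add: \<epsilon>_def)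
    moreover have "Comp D b (Fo (Go b)) b (\<epsilon> b) ?e = Ident D b"
      using T_comp[OF k(1,2,1) cid[OF g] cid[OF g]] cc T_id[OF k(1)] by (simp add: \<epsilon>_def)
    ultimately show "is_iso D (Fo (Go b)) b (\<epsilon> b)"
      unfolding is_iso_def using TH[OF k(2,1) cid[OF g]] TH[OF k(1,2) cid[OF g]] by (auto simp: \<epsilon>_def)
  next
    fix a b f assume a: "a \<in> Ob D" and b: "b \<in> Ob D" and f: "f \<in> Hom D a b"
    note ga = Gob[OF a] and gb = Gob[OF b] and k = K[OF a] K[OF b] can[OF Gob[OF a]] can[OF Gob[OF b]]
    note gm = GmH[OF a b f]
    have "Comp D (Fo (Go a)) (Fo (Go b)) b (\<epsilon> b) (Fm (Go a) (Go b) (Gm a b f)) = T (Go a) (Fo (Go a)) (can (Go a)) (Go b) b (K b) (Gm a b f)"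
      using T_comp[OF k(3,4,2) gm(1) cid[OF gb]] cunit(2)[OF ga gb gm(1)] Fm[OF ga gb gm(1)] by (simp add: \<epsilon>_def)
    also have "\<dots> = Comp D (Fo (Go a)) a b f (\<epsilon> a)"
      using T_comp[OF k(3,1,2) cid[OF ga] gm(1)] cunit(1)[OF ga gb gm(1)] gm(2) by (simp add: \<epsilon>_def)
    finally show "Comp D (Fo (Go a)) (Fo (Go b)) b (\<epsilon> b) (Fm (Go a) (Go b) (Gm a b f)) = Comp D (Fo (Go a)) a b f (\<epsilon> a)" .
  qed
  ultimately show ?thesis
    unfolding equivalence_of_categories_def using C dcat F G by blast
qed

section \<open>The category of representations up to homotopy\<close>

lemma ruth2_ident_hom:
  assumes G: "lie_groupoid G" and R: "is_ruth2 G R"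
  shows "Ident (RutH2 G) R \<in> ruth2_hom G R R"
proof -
  note B = ruth_bundles[OF G R]
  note pre = prebundle_vector_bundle[OF B(1)] prebundle_vector_bundle[OF B(2)] pull_prebundle(1)[OF G B(2)]
  note O = vector_bundle_fibre_ops[OF B(1)] vector_bundle_fibre_ops[OF B(2)]
  note l = lam0D(1,2)[OF G R] lam1D(1,2)[OF G R] dlD(3,4)[OF G R]
  have t: "psmooth (Arr G) (base (E0 R)) (gtgt G)" using lie_groupoidD(6)[OF G] B(3) by simp
  have m: "vb_map (pull1 G (E1 R)) (E0 R) (gtgt G) (restrict (\<lambda>(g, e). vzero (E0 R) (gtgt G g)) (pts (tot (pull1 G (E1 R)))))"
    by (rule vb_map_cong[OF vb_map_const_zero[OF _ pre(3) B(1)] pre(3) B(1)]) (use t in auto)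
  have b: "gtgt G g \<in> pts (base (E0 R))" "gtgt G g \<in> pts (base (E1 R))" if "g \<in> pts (Arr G)" for g
    using groupoid_laws(2)[OF G that] B by auto
  have dz: "dl R (vzero (E0 R) y) = vzero (E1 R) y" if "y \<in> pts (base (E0 R))" for y
    using dl_zero[OF G R] that B by simp
  have "(restrict (\<lambda>e. e) (pts (tot (E0 R))), restrict (\<lambda>e. e) (pts (tot (E1 R))),
      restrict (\<lambda>(g, e). vzero (E0 R) (gtgt G g)) (pts (tot (pull1 G (E1 R))))) \<in> ruth2_hom G R R"
    unfolding ruth2_hom_iff
  proof (intro conjI allI impI m restrict_extensional)
    show "vb_map (E0 R) (E0 R) (\<lambda>x. x) (restrict (\<lambda>e. e) (pts (tot (E0 R))))"
      by (rule vb_map_cong[OF vb_map_ident[OF pre(1)] pre(1) B(1)]) auto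
    show "vb_map (E1 R) (E1 R) (\<lambda>x. x) (restrict (\<lambda>e. e) (pts (tot (E1 R))))"
      by (rule vb_map_cong[OF vb_map_ident[OF pre(2)] pre(2) B(2)]) auto
  next
    fix g e assume g: "g \<in> pts (Arr G)" and e: "e \<in> pts (tot (E0 R))" "proj (E0 R) e = gsrc G g"
    have "vsub (E0 R) (lam0 R (g, e)) (lam0 R (g, e)) = vzero (E0 R) (gtgt G g)"
      using g e l O b by (intro coord_eqI[OF B(1)]) (simp_all add: coord_ops[OF B(1)])
    then show "vsub (E0 R) (restrict (\<lambda>e. e) (pts (tot (E0 R))) (lam0 R (g, e))) (lam0 R (g, restrict (\<lambda>e. e) (pts (tot (E0 R))) e)) =
      restrict (\<lambda>(g, e). vzero (E0 R) (gtgt G g)) (pts (tot (pull1 G (E1 R)))) (g, dl R e)"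
      using g e l by simp
  next
    fix g e assume g: "g \<in> pts (Arr G)" and e: "e \<in> pts (tot (E1 R))" "proj (E1 R) e = gsrc G g"
    have "vsub (E1 R) (lam1 R (g, e)) (lam1 R (g, e)) = vzero (E1 R) (gtgt G g)"
      using g e l O b by (intro coord_eqI[OF B(2)]) (simp_all add: coord_ops[OF B(2)])
    then show "vsub (E1 R) (restrict (\<lambda>e. e) (pts (tot (E1 R))) (lam1 R (g, e))) (lam1 R (g, restrict (\<lambda>e. e) (pts (tot (E1 R))) e)) =
      dl R (restrict (\<lambda>(g, e). vzero (E0 R) (gtgt G g)) (pts (tot (pull1 G (E1 R)))) (g, e))"
      using g e l b dz by simp
  next
    fix g h e assume g: "g \<in> pts (Arr G)" "h \<in> pts (Arr G)" "gsrc G g = gtgt G h" and e: "e \<in> pts (tot (E1 R))" "proj (E1 R) e = gsrc G h"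
    note om = OmgD(1,2)[OF G R g] and gl = groupoid_laws[OF G]
    have z: "lam0 R (g, vzero (E0 R) (gtgt G h)) = vzero (E0 R) (gtgt G g)"
      using lam0D(5)[OF G R g(1)] g b by simp
    have "vadd (E0 R) (vadd (E0 R) (Omg R ((g, h), e)) (vzero (E0 R) (gtgt G g))) (vzero (E0 R) (gtgt G g)) =
      vadd (E0 R) (vzero (E0 R) (gtgt G g)) (Omg R ((g, h), e))"
      using g e om O b by (intro coord_eqI[OF B(1)]) (simp_all add: coord_ops[OF B(1)])
    then show "vadd (E0 R) (vadd (E0 R) (restrict (\<lambda>e. e) (pts (tot (E0 R))) (Omg R ((g, h), e)))
         (restrict (\<lambda>(g, e). vzero (E0 R) (gtgt G g)) (pts (tot (pull1 G (E1 R)))) (g, lam1 R (h, e))))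
        (lam0 R (g, restrict (\<lambda>(g, e). vzero (E0 R) (gtgt G g)) (pts (tot (pull1 G (E1 R)))) (h, e))) =
      vadd (E0 R) (restrict (\<lambda>(g, e). vzero (E0 R) (gtgt G g)) (pts (tot (pull1 G (E1 R)))) (gmult G g h, e))
        (Omg R ((g, h), restrict (\<lambda>e. e) (pts (tot (E1 R))) e))"
      using g e l om gl z by simp
  qed (use l in auto)
  then show ?thesis by (simp add: RutH2_def)
qed

lemma ruth2_comp_hom:
  assumes G: "lie_groupoid G" and R: "is_ruth2 G R" and R': "is_ruth2 G R'" and R'': "is_ruth2 G R''"
    and p: "(p0, p1, m) \<in> ruth2_hom G R R'" and q: "(q0, q1, n) \<in> ruth2_hom G R' R''"
  shows "Comp (RutH2 G) R R' R'' (q0, q1, n) (p0, p1, m) \<in> ruth2_hom G R R''"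
proof -
  note B = ruth_bundles[OF G R] and B' = ruth_bundles[OF G R'] and B'' = ruth_bundles[OF G R'']
  note pre = prebundle_vector_bundle[OF B(1)] prebundle_vector_bundle[OF B(2)] pull_prebundle(1)[OF G B(2)]
  note O = vector_bundle_fibre_ops(3,4,9,10)[OF B''(1)] vector_bundle_fibre_ops(3,4,9,10)[OF B''(2)]
  note O' = vector_bundle_fibre_ops(3,4,9,10)[OF B'(1)] vector_bundle_fibre_ops(3,4,9,10)[OF B'(2)]
  note C = coord_ops[OF B''(1)] coord_ops[OF B''(2)]
  note l = lam0D(1,2)[OF G R] lam1D(1,2)[OF G R] dlD(3,4)[OF G R]
    lam0D(1-3)[OF G R'] lam1D(1-3)[OF G R'] dlD(3-5)[OF G R']
    lam0D(1-3)[OF G R''] lam1D(1-3)[OF G R''] dlD(3-5)[OF G R'']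
  note hv = ruth_hom_vb[OF G R R' p] and kv = ruth_hom_vb[OF G R' R'' q]
  note h = hp0D(3-5)[OF G R R' p] hp1D(3-5)[OF G R R' p] hmD(1-3)[OF G R R' p]
  note k = hp0D(3-5)[OF G R' R'' q] hp1D(3-5)[OF G R' R'' q] hmD(1-3)[OF G R' R'' q]
  note gl = groupoid_laws[OF G]
  note pd = ruth_hom_dl[OF G R R' p] and qd = ruth_hom_dl[OF G R' R'' q]
  let ?p0 = "compose (pts (tot (E0 R))) q0 p0" and ?p1 = "compose (pts (tot (E1 R))) q1 p1"
  let ?m = "restrict (\<lambda>(g, e). vadd (E0 R'') (q0 (m (g, e))) (n (g, p1 e))) (pts (tot (pull1 G (E1 R))))"
  have a: "?p0 e = q0 (p0 e)" if "e \<in> pts (tot (E0 R))" for e using that by (simp add: compose_def)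
  have b: "?p1 e = q1 (p1 e)" if "e \<in> pts (tot (E1 R))" for e using that by (simp add: compose_def)
  have c: "?m (g, e) = vadd (E0 R'') (q0 (m (g, e))) (n (g, p1 e))"
    if "g \<in> pts (Arr G)" "e \<in> pts (tot (E1 R))" "proj (E1 R) e = gsrc G g" for g e using that by simp
  have v0: "vb_map (E0 R) (E0 R'') (\<lambda>x. x) ?p0"
    by (rule vb_map_cong[OF vb_map_comp[OF hv(1) kv(1) pre(1) B'(1) B''(1)] pre(1) B''(1)]) (simp_all add: a)
  have v1: "vb_map (E1 R) (E1 R'') (\<lambda>x. x) ?p1"
    by (rule vb_map_cong[OF vb_map_comp[OF hv(2) kv(2) pre(2) B'(2) B''(2)] pre(2) B''(2)]) (simp_all add: b)
  have s: "psmooth (Arr G) (base (E1 R)) (gsrc G)" "psmooth (Arr G) (base (E1 R')) (gsrc G)" 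
    using lie_groupoidD(5)[OF G] B(4) B'(4) by simp_all
  \<comment> \<open>The family \<open>n (g, p1 e)\<close> is obtained in two steps:
    \<open>p1\<close> first maps into \<open>E1 R'\<close>, and then \<open>n\<close> is applied
    over the same arrow \<open>g\<close> of the pullback.\<close>
  have x: "vb_map (pull1 G (E1 R)) (E1 R') (gsrc G) (\<lambda>z. p1 (snd z))"
    using vb_map_comp[OF vb_map_pullback_snd[OF B(2) s(1)] hv(2) pre(3) B(2) B'(2)] by simp
  have "vb_map (pull1 G (E1 R)) (E0 R'') (\<lambda>g. gtgt G g) (\<lambda>z. n (proj (pull1 G (E1 R)) z, p1 (snd z)))"
    by (rule vb_map_comp_pullback[OF x pre(3) B'(2) _ s(2) _ kv(3) B''(1)]) (use lie_groupoidD(3)[OF G] in \<open>auto intro: psmooth_id\<close>)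
  then have "vb_map (pull1 G (E1 R)) (E0 R'') (gtgt G) (\<lambda>z. vadd (E0 R'') (q0 (m z)) (n (proj (pull1 G (E1 R)) z, p1 (snd z))))"
    using vb_map_comp[OF hv(3) kv(1) pre(3) B'(1) B''(1)] by (intro vb_map_vadd pre(3) B''(1)) auto
  then have vm: "vb_map (pull1 G (E1 R)) (E0 R'') (gtgt G) ?m"
    by (rule vb_map_cong[OF _ pre(3) B''(1)]) auto
  have "(?p0, ?p1, ?m) \<in> ruth2_hom G R R''"
    unfolding ruth2_hom_iff
  proof (intro conjI allI impI v0 v1 vm restrict_extensional compose_extensional)
    show "?p1 (dl R e) = dl R'' (?p0 e)" if "e \<in> pts (tot (E0 R))" for e
      using that l h k pd qd by (simp add: a b)
  next
    fix g e assume g: "g \<in> pts (Arr G)" and e: "e \<in> pts (tot (E0 R))" "proj (E0 R) e = gsrc G g"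
    have pe: "p0 e \<in> pts (tot (E0 R'))" "proj (E0 R') (p0 e) = gsrc G g" using e h by auto
    have "p0 (lam0 R (g, e)) = vadd (E0 R') (lam0 R' (g, p0 e)) (m (g, dl R e))"
      using g e pe l h O' ruth_hom_lam(1)[OF G R R' p g e] by (intro coord_eqI[OF B'(1)]) (simp_all add: coord_ops[OF B'(1)])
    then have 1: "q0 (p0 (lam0 R (g, e))) = vadd (E0 R'') (q0 (lam0 R' (g, p0 e))) (q0 (m (g, dl R e)))"
      using g e pe l h k by simp
    have "vsub (E0 R'') (q0 (p0 (lam0 R (g, e)))) (lam0 R'' (g, q0 (p0 e))) = vadd (E0 R'') (q0 (m (g, dl R e))) (n (g, p1 (dl R e)))"
      unfolding 1 using g e pe l h k O pd ruth_hom_lam(1)[OF G R' R'' q g pe]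
      by (intro coord_eqI[OF B''(1)]) (simp_all add: C)
    then show "vsub (E0 R'') (?p0 (lam0 R (g, e))) (lam0 R'' (g, ?p0 e)) = ?m (g, dl R e)"
      using g e l c by (simp add: a)
  next
    fix g e assume g: "g \<in> pts (Arr G)" and e: "e \<in> pts (tot (E1 R))" "proj (E1 R) e = gsrc G g"
    have pe: "p1 e \<in> pts (tot (E1 R'))" "proj (E1 R') (p1 e) = gsrc G g" using e h by auto
    have "p1 (lam1 R (g, e)) = vadd (E1 R') (lam1 R' (g, p1 e)) (dl R' (m (g, e)))"
      using g e pe l h O' ruth_hom_lam(2)[OF G R R' p g e] by (intro coord_eqI[OF B'(2)]) (simp_all add: coord_ops[OF B'(2)])
    then have 1: "q1 (p1 (lam1 R (g, e))) = vadd (E1 R'') (q1 (lam1 R' (g, p1 e))) (dl R'' (q0 (m (g, e))))"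
      using g e pe l h k qd by simp
    have "vsub (E1 R'') (q1 (p1 (lam1 R (g, e)))) (lam1 R'' (g, q1 (p1 e))) = dl R'' (vadd (E0 R'') (q0 (m (g, e))) (n (g, p1 e)))"
      unfolding 1 using g e pe l h k O ruth_hom_lam(2)[OF G R' R'' q g pe]
      by (intro coord_eqI[OF B''(2)]) (simp_all add: C)
    then show "vsub (E1 R'') (?p1 (lam1 R (g, e))) (lam1 R'' (g, ?p1 e)) = dl R'' (?m (g, e))"
      using g e l c by (simp add: b)
  next
    fix g h' e assume g: "g \<in> pts (Arr G)" "h' \<in> pts (Arr G)" "gsrc G g = gtgt G h'" and e: "e \<in> pts (tot (E1 R))" "proj (E1 R) e = gsrc G h'"
    note om = OmgD(1,2)[OF G R g] OmgD(1,2)[OF G R' g] OmgD(1,2)[OF G R'' g]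
    have le: "lam1 R (h', e) \<in> pts (tot (E1 R))" "proj (E1 R) (lam1 R (h', e)) = gsrc G g" using g e l by auto
    have pe: "p1 e \<in> pts (tot (E1 R'))" "proj (E1 R') (p1 e) = gsrc G h'" using e h by auto
    have me: "m (h', e) \<in> pts (tot (E0 R'))" "proj (E0 R') (m (h', e)) = gsrc G g" using g e h by auto
    have gh: "gmult G g h' \<in> pts (Arr G)" "gsrc G (gmult G g h') = gsrc G h'" "gtgt G (gmult G g h') = gtgt G g" using gl g by auto
    have "vadd (E0 R') (vadd (E0 R') (p0 (Omg R ((g, h'), e))) (m (g, lam1 R (h', e)))) (lam0 R' (g, m (h', e))) =
        vadd (E0 R') (m (gmult G g h', e)) (Omg R' ((g, h'), p1 e))" using p g e by (simp add: ruth2_hom_iff)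
    from arg_cong[OF this, of q0]
    have 1: "vadd (E0 R'') (vadd (E0 R'') (q0 (p0 (Omg R ((g, h'), e)))) (q0 (m (g, lam1 R (h', e))))) (q0 (lam0 R' (g, m (h', e)))) =
        vadd (E0 R'') (q0 (m (gmult G g h', e))) (q0 (Omg R' ((g, h'), p1 e)))"
      using g gh e le pe me l h k om O' by simp
    have "p1 (lam1 R (h', e)) = vadd (E1 R') (lam1 R' (h', p1 e)) (dl R' (m (h', e)))"
      using g e pe me l h O' ruth_hom_lam(2)[OF G R R' p g(2) e] by (intro coord_eqI[OF B'(2)]) (simp_all add: coord_ops[OF B'(2)])
    \<comment> \<open>The term \<open>n (g, dl R' (m (h', e)))\<close> that appears here is the
      defect of \<open>q0\<close> from commuting with the action of \<open>g\<close> on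
      \<open>m (h', e)\<close>. The degree 0 condition for \<open>q\<close> cancels it against the
      other terms.\<close>
    then have 2: "n (g, p1 (lam1 R (h', e))) = vadd (E0 R'') (n (g, lam1 R' (h', p1 e))) (n (g, dl R' (m (h', e))))"
      using g e pe me l k by simp
    have 3: "lam0 R'' (g, vadd (E0 R'') (q0 (m (h', e))) (n (h', p1 e))) =
        vadd (E0 R'') (lam0 R'' (g, q0 (m (h', e)))) (lam0 R'' (g, n (h', p1 e)))"
      using g pe me l k by simp
    have "vadd (E0 R'') (vadd (E0 R'') (q0 (p0 (Omg R ((g, h'), e)))) (vadd (E0 R'') (q0 (m (g, lam1 R (h', e)))) (n (g, p1 (lam1 R (h', e))))))
        (lam0 R'' (g, vadd (E0 R'') (q0 (m (h', e))) (n (h', p1 e)))) =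
      vadd (E0 R'') (vadd (E0 R'') (q0 (m (gmult G g h', e))) (n (gmult G g h', p1 e))) (Omg R'' ((g, h'), q1 (p1 e)))"
      unfolding 2 3
    proof (rule coord_eqI[OF B''(1)])
      fix i
      have c1: "coord (E0 R'') (q0 (p0 (Omg R ((g, h'), e)))) i + coord (E0 R'') (q0 (m (g, lam1 R (h', e)))) i + coord (E0 R'') (q0 (lam0 R' (g, m (h', e)))) i =
        coord (E0 R'') (q0 (m (gmult G g h', e))) i + coord (E0 R'') (q0 (Omg R' ((g, h'), p1 e))) i"
        using arg_cong[OF 1, of "\<lambda>e. coord (E0 R'') e i"] g gh e le pe me l h k om O by (simp add: C)
      note c2 = ruth_hom_cocycle[OF G R' R'' q g pe, of i] and c3 = ruth_hom_lam(1)[OF G R' R'' q g(1) me, of i]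
      show "coord (E0 R'') (vadd (E0 R'') (vadd (E0 R'') (q0 (p0 (Omg R ((g, h'), e)))) (vadd (E0 R'') (q0 (m (g, lam1 R (h', e)))) (vadd (E0 R'') (n (g, lam1 R' (h', p1 e))) (n (g, dl R' (m (h', e)))))))
        (vadd (E0 R'') (lam0 R'' (g, q0 (m (h', e)))) (lam0 R'' (g, n (h', p1 e))))) i =
        coord (E0 R'') (vadd (E0 R'') (vadd (E0 R'') (q0 (m (gmult G g h', e))) (n (gmult G g h', p1 e))) (Omg R'' ((g, h'), q1 (p1 e)))) i"
        using c1 c2 c3 g gh e le pe me l h k om O by (simp add: C)
    qed (use g gh e le pe me l h k om O in simp_all)
    then show "vadd (E0 R'') (vadd (E0 R'') (?p0 (Omg R ((g, h'), e))) (?m (g, lam1 R (h', e)))) (lam0 R'' (g, ?m (h', e))) =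
       vadd (E0 R'') (?m (gmult G g h', e)) (Omg R'' ((g, h'), ?p1 e))"
      unfolding c[OF g(1) le] c[OF g(2) e] c[OF gh(1) e(1) e(2)[folded gh(2)]] b[OF e(1)] a[OF om(1)[OF e]] .
  qed
  then show ?thesis by (simp add: RutH2_def)
qed

lemma category_RutH2:
  assumes G: "lie_groupoid G"
  shows "is_category (RutH2 G)"
  unfolding is_category_def
proof (intro conjI ballI)
  have ob: "Ob (RutH2 G) = {R. is_ruth2 G R}" "Hom (RutH2 G) = ruth2_hom G" by (simp_all add: RutH2_def)
  show "Ident (RutH2 G) R \<in> Hom (RutH2 G) R R" if "R \<in> Ob (RutH2 G)" for R
    using ruth2_ident_hom[OF G, of R] that by (simp add: ob)
  show "Comp (RutH2 G) R R' R'' g f \<in> Hom (RutH2 G) R R''"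
    if "R \<in> Ob (RutH2 G)" "R' \<in> Ob (RutH2 G)" "R'' \<in> Ob (RutH2 G)" "f \<in> Hom (RutH2 G) R R'" "g \<in> Hom (RutH2 G) R' R''" for R R' R'' f g
    using ruth2_comp_hom[OF G, of R R' R''] that by (cases f, cases g) (simp add: ob)
  fix R R' f assume "R \<in> Ob (RutH2 G)" "R' \<in> Ob (RutH2 G)" "f \<in> Hom (RutH2 G) R R'"
  then have R: "is_ruth2 G R" "is_ruth2 G R'" and f': "f \<in> ruth2_hom G R R'" by (simp_all add: ob)
  obtain p0 p1 m where f: "f = (p0, p1, m)" by (cases f)
  note p = f'[unfolded f]
  note B = ruth_bundles[OF G R(1)] and B' = ruth_bundles[OF G R(2)]
  have ext: "p0 \<in> extensional (pts (tot (E0 R)))" "p1 \<in> extensional (pts (tot (E1 R)))" "m \<in> extensional (pts (tot (pull1 G (E1 R))))"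
    using p unfolding ruth2_hom_iff by blast+
  note h = hp0D(3,4)[OF G R p] hp1D(3,4)[OF G R p] hmD(1,2)[OF G R p]
  have z: "vadd (E0 R') (m (g, e)) (vzero (E0 R') (gtgt G g)) = m (g, e)" "vadd (E0 R') (vzero (E0 R') (gtgt G g)) (m (g, e)) = m (g, e)"
    "p0 (vzero (E0 R) (gtgt G g)) = vzero (E0 R') (gtgt G g)"
    if g: "g \<in> pts (Arr G)" "e \<in> pts (tot (E1 R))" "proj (E1 R) e = gsrc G g" for g e
  proof -
    have y: "gtgt G g \<in> pts (base (E0 R'))" "gtgt G g \<in> pts (base (E0 R))" using groupoid_laws(2)[OF G g(1)] B B' by auto
    show "vadd (E0 R') (m (g, e)) (vzero (E0 R') (gtgt G g)) = m (g, e)" "vadd (E0 R') (vzero (E0 R') (gtgt G g)) (m (g, e)) = m (g, e)"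
      using g h y vector_bundle_fibre_ops(1-4)[OF B'(1)] 
      by (auto intro!: coord_eqI[OF B'(1)] simp: coord_ops[OF B'(1)])
    show "p0 (vzero (E0 R) (gtgt G g)) = vzero (E0 R') (gtgt G g)"
      using vb_map_zero[OF ruth_hom_vb(1)[OF G R p] B(1) B'(1) y(2)] .
  qed
  have e1: "restrict p0 (pts (tot (E0 R))) = p0" "restrict p1 (pts (tot (E1 R))) = p1" "restrict m (pts (tot (pull1 G (E1 R)))) = m"
    using ext by (simp_all only: extensional_restrict)
  show "Comp (RutH2 G) R R R' f (Ident (RutH2 G) R) = f"
  proof -
    have "compose (pts (tot (E0 R))) p0 (restrict (\<lambda>e. e) (pts (tot (E0 R)))) = restrict p0 (pts (tot (E0 R)))"
      "compose (pts (tot (E1 R))) p1 (restrict (\<lambda>e. e) (pts (tot (E1 R)))) = restrict p1 (pts (tot (E1 R)))"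
      unfolding compose_def by (rule restrict_ext, simp)+
    moreover have "restrict (\<lambda>(g, e). vadd (E0 R') (p0 (restrict (\<lambda>(g, e). vzero (E0 R) (gtgt G g)) (pts (tot (pull1 G (E1 R)))) (g, e)))
        (m (g, restrict (\<lambda>e. e) (pts (tot (E1 R))) e))) (pts (tot (pull1 G (E1 R)))) = restrict m (pts (tot (pull1 G (E1 R))))"
      by (rule restrict_ext) (use z in auto)
    ultimately show ?thesis unfolding f e1 by (simp only: RutH2_def category.simps prod.case)
  qed
  show "Comp (RutH2 G) R R' R' (Ident (RutH2 G) R') f = f"
  proof -
    have "compose (pts (tot (E0 R))) (restrict (\<lambda>e. e) (pts (tot (E0 R')))) p0 = restrict p0 (pts (tot (E0 R)))"
      "compose (pts (tot (E1 R))) (restrict (\<lambda>e. e) (pts (tot (E1 R')))) p1 = restrict p1 (pts (tot (E1 R)))"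
      unfolding compose_def by (rule restrict_ext, simp add: h)+
    moreover have "restrict (\<lambda>(g, e). vadd (E0 R') (restrict (\<lambda>e. e) (pts (tot (E0 R'))) (m (g, e)))
        (restrict (\<lambda>(g, e). vzero (E0 R') (gtgt G g)) (pts (tot (pull1 G (E1 R')))) (g, p1 e))) (pts (tot (pull1 G (E1 R)))) = restrict m (pts (tot (pull1 G (E1 R))))"
      by (rule restrict_ext) (use z h in auto)
    ultimately show ?thesis unfolding f e1 by (simp only: RutH2_def category.simps prod.case)
  qed
next
  have ob: "Ob (RutH2 G) = {R. is_ruth2 G R}" "Hom (RutH2 G) = ruth2_hom G" by (simp_all add: RutH2_def)
  fix R R' R'' R''' f g h
  assume "R \<in> Ob (RutH2 G)" "R' \<in> Ob (RutH2 G)" "R'' \<in> Ob (RutH2 G)" "R''' \<in> Ob (RutH2 G)" 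
    "f \<in> Hom (RutH2 G) R R'" "g \<in> Hom (RutH2 G) R' R''" "h \<in> Hom (RutH2 G) R'' R'''"
  then have R: "is_ruth2 G R" "is_ruth2 G R'" "is_ruth2 G R''" "is_ruth2 G R'''" 
    and fgh: "f \<in> ruth2_hom G R R'" "g \<in> ruth2_hom G R' R''" "h \<in> ruth2_hom G R'' R'''" by (simp_all add: ob)
  obtain p0 p1 m q0 q1 n r0 r1 o' where f: "f = (p0, p1, m)" and g: "g = (q0, q1, n)" and h: "h = (r0, r1, o')" by (cases f, cases g, cases h)
  note p = fgh(1)[unfolded f] and q = fgh(2)[unfolded g] and r = fgh(3)[unfolded h]
  note B''' = ruth_bundles(1)[OF G R(4)]
  note hs = hp0D(3,4)[OF G R(1,2) p] hp1D(3,4)[OF G R(1,2) p] hmD(1,2)[OF G R(1,2) p] hp0D(3-5)[OF G R(2,3) q] hp1D(3,4)[OF G R(2,3) q] hmD(1,2)[OF G R(2,3) q]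
    hp0D(3-5)[OF G R(3,4) r] hp1D(3,4)[OF G R(3,4) r] hmD(1,2)[OF G R(3,4) r]
  show "Comp (RutH2 G) R R' R''' (Comp (RutH2 G) R' R'' R''' h g) f = Comp (RutH2 G) R R'' R''' h (Comp (RutH2 G) R R' R'' g f)"
  proof -
    have "compose (pts (tot (E0 R))) (compose (pts (tot (E0 R'))) r0 q0) p0 = compose (pts (tot (E0 R))) r0 (compose (pts (tot (E0 R))) q0 p0)"
      "compose (pts (tot (E1 R))) (compose (pts (tot (E1 R'))) r1 q1) p1 = compose (pts (tot (E1 R))) r1 (compose (pts (tot (E1 R))) q1 p1)"
      unfolding compose_def by (rule restrict_ext, simp add: hs)+
    moreover have "restrict (\<lambda>(g, e). vadd (E0 R''') (compose (pts (tot (E0 R'))) r0 q0 (m (g, e)))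
         (restrict (\<lambda>(g, e). vadd (E0 R''') (r0 (n (g, e))) (o' (g, q1 e))) (pts (tot (pull1 G (E1 R')))) (g, p1 e))) (pts (tot (pull1 G (E1 R)))) =
       restrict (\<lambda>(g, e). vadd (E0 R''') (r0 (restrict (\<lambda>(g, e). vadd (E0 R'') (q0 (m (g, e))) (n (g, p1 e))) (pts (tot (pull1 G (E1 R)))) (g, e)))
         (o' (g, compose (pts (tot (E1 R))) q1 p1 e))) (pts (tot (pull1 G (E1 R))))"
    proof (rule restrict_ext)
      fix z assume "z \<in> pts (tot (pull1 G (E1 R)))"
      then obtain g e where z: "z = (g, e)" "g \<in> pts (Arr G)" "e \<in> pts (tot (E1 R))" "proj (E1 R) e = gsrc G g" by auto
      have "vadd (E0 R''') (r0 (q0 (m (g, e)))) (vadd (E0 R''') (r0 (n (g, p1 e))) (o' (g, q1 (p1 e)))) =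
        vadd (E0 R''') (vadd (E0 R''') (r0 (q0 (m (g, e)))) (r0 (n (g, p1 e)))) (o' (g, q1 (p1 e)))"
        using z hs vector_bundle_fibre_ops(3,4)[OF B'''] by (intro coord_eqI[OF B''']) (simp_all add: coord_ops[OF B'''])
      then show "(\<lambda>(g, e). vadd (E0 R''') (compose (pts (tot (E0 R'))) r0 q0 (m (g, e)))
         (restrict (\<lambda>(g, e). vadd (E0 R''') (r0 (n (g, e))) (o' (g, q1 e))) (pts (tot (pull1 G (E1 R')))) (g, p1 e))) z =
         (\<lambda>(g, e). vadd (E0 R''') (r0 (restrict (\<lambda>(g, e). vadd (E0 R'') (q0 (m (g, e))) (n (g, p1 e))) (pts (tot (pull1 G (E1 R)))) (g, e)))
         (o' (g, compose (pts (tot (E1 R))) q1 p1 e))) z"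
        using z hs by (simp add: compose_def)
    qed
    ultimately show ?thesis unfolding f g h by (simp only: RutH2_def category.simps prod.case)
  qed
qed

section \<open>The bundle \<open>\<Phi>(C)\<close>\<close>

text \<open>A smooth local section through \<open>p\<close> makes the differential onto:
  \<open>f\<close> after \<open>\<sigma>\<close> is the identity, so by the chain rule the Jacobian
  of \<open>\<sigma>\<close> is a right inverse of the Jacobian of \<open>f\<close>.\<close>

lemma submersionI:
  assumes f: "psmooth X Y f"
    and sec: "\<And>p. p \<in> pts X \<Longrightarrow> \<exists>N \<sigma>. openin (mtop Y) N \<and> f p \<in> N \<and> psmooth (submfd Y N) X \<sigma> \<and> \<sigma> (f p) = p \<and> (\<forall>y\<in>N. f (\<sigma> y) = y)"
  shows "submersion X Y f"
  unfolding submersion_def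
proof (intro conjI)
  show "smooth_map X Y f" by (rule psmoothD(5)[OF f])
  have "\<exists>v. \<forall>j<m. (\<Sum>i<n. partial_deriv i (\<lambda>x. \<psi> (f (inv_into U \<phi> x)) j) (\<phi> p) * v i) = w j"
    if c: "(n, U, \<phi>) \<in> atlas X" and d: "(m, V, \<psi>) \<in> atlas Y" and p: "p \<in> U" "f p \<in> V" for n U \<phi> m V \<psi> p w
  proof -
    note X = psmoothD(1)[OF f] and Y = psmoothD(2)[OF f]
    note cc = premanifold_chart[OF X c] and cd = premanifold_chart[OF Y d]
    note C = is_chartD[OF cc] and D = is_chartD[OF cd]
    obtain N \<sigma> where N: "openin (mtop Y) N" "f p \<in> N" "psmooth (submfd Y N) X \<sigma>" "\<sigma> (f p) = p" "\<forall>y\<in>N. f (\<sigma> y) = y"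
      using sec[of p] p C(5) by blast
    have dN: "(m, V \<inter> N, \<psi>) \<in> atlas (submfd Y N)" by (rule submfd_open_atlas[OF atlas_maximal[OF Y d] N(1) Y])
    have cN: "is_chart (mtop (submfd Y N)) (m, V \<inter> N, \<psi>)" by (rule premanifold_chart[OF premanifold_submfd[OF Y] dN])
    define A where "A = \<phi> ` (U \<inter> f -` V)"
    define B where "B = \<psi> ` (V \<inter> N \<inter> \<sigma> -` (U \<inter> f -` V))"
    have oUV: "openin (mtop X) (U \<inter> f -` V)" by (rule continuous_preimage_open[OF psmoothD(3)[OF f] C(1) D(1)])
    have oA: "openin (Euclidean_space n) A" unfolding A_def by (rule chart_image_open[OF cc oUV]) auto
    have oB: "openin (Euclidean_space m) B"
      unfolding B_def
      by (rule chart_image_open[OF cN continuous_preimage_open[OF psmoothD(3)[OF N(3)] is_chartD(1)[OF cN] oUV]]) auto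
    define F where "F x = \<psi> (f (inv_into U \<phi> x))" for x
    define S where "S y = \<phi> (\<sigma> (inv_into V \<psi> y))" for y
    have sF: "smooth_euclid n m A F"
      using psmoothD(5)[OF f] c d unfolding smooth_map_def A_def F_def[abs_def] comp_def by fastforce
    have "smooth_euclid m n (\<psi> ` (V \<inter> N \<inter> \<sigma> -` U)) (\<phi> \<circ> \<sigma> \<circ> inv_into (V \<inter> N) \<psi>)"
      using psmoothD(5)[OF N(3)] dN c unfolding smooth_map_def by fastforce
    then have "smooth_euclid m n B (\<phi> \<circ> \<sigma> \<circ> inv_into (V \<inter> N) \<psi>)"
      by (rule smooth_euclid_subset) (auto simp: B_def)
    then have sS: "smooth_euclid m n B S"
    proof (rule smooth_euclid_cong[OF oB, rotated])
      fix y assume "y \<in> B"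
      then have "y \<in> \<psi> ` (V \<inter> N)" by (auto simp: B_def)
      then show "(\<phi> \<circ> \<sigma> \<circ> inv_into (V \<inter> N) \<psi>) y = S y"
        using inv_into_restrict[OF D(3), of "V \<inter> N" y] by (auto simp: S_def)
    qed
    have yB: "\<psi> (f p) \<in> B" using p N by (auto simp: B_def)
    have Sy: "S (\<psi> (f p)) = \<phi> p" using p D(3) N(4) by (simp add: S_def inv_into_f_f)
    have SA: "S ` B \<subseteq> A" using D(3) by (auto simp: S_def B_def A_def inv_into_f_f)
    have FS: "F (S y) = y" if "y \<in> B" for y
      using that C(3) D(3) N(5) by (auto simp: F_def S_def B_def inv_into_f_f)
    have jac: "(\<Sum>l<n. partial_deriv l (\<lambda>x. F x j) (\<phi> p) * partial_deriv i (\<lambda>y. S y l) (\<psi> (f p))) = (if i = j then 1 else 0)"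
      if i: "i < m" and j: "j < m" for i j
    proof -
      have "((\<lambda>r. F (S ((\<psi> (f p))(i := r))) j) has_real_derivative
        (\<Sum>l<n. partial_deriv l (\<lambda>x. F x j) (S (\<psi> (f p))) * partial_deriv i (\<lambda>y. S y l) (\<psi> (f p)))) (at (\<psi> (f p) i))"
        by (rule partial_deriv_compose[OF oA smooth_euclidD[OF sF j] oB smooth_euclidD[OF sS] SA yB i])
      then have "partial_deriv i (\<lambda>y. F (S y) j) (\<psi> (f p)) =
        (\<Sum>l<n. partial_deriv l (\<lambda>x. F x j) (S (\<psi> (f p))) * partial_deriv i (\<lambda>y. S y l) (\<psi> (f p)))"
        unfolding partial_deriv_def[of i "\<lambda>y. F (S y) j"] by (rule DERIV_imp_deriv)
      moreover have "partial_deriv i (\<lambda>y. F (S y) j) (\<psi> (f p)) = partial_deriv i (\<lambda>y. y j) (\<psi> (f p))"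
        by (rule partial_deriv_cong(1)[OF oB _ yB i]) (simp add: FS)
      ultimately show ?thesis by (simp add: partial_deriv_coordinate Sy)
    qed
    \<comment> \<open>The preimage of \<open>w\<close> is the Jacobian of the section applied to
      \<open>w\<close>.\<close>
    define v where "v l = (\<Sum>i<m. partial_deriv i (\<lambda>y. S y l) (\<psi> (f p)) * w i)" for l
    have "(\<Sum>l<n. partial_deriv l (\<lambda>x. F x j) (\<phi> p) * v l) = w j" if j: "j < m" for j
    proof -
      have "(\<Sum>l<n. partial_deriv l (\<lambda>x. F x j) (\<phi> p) * v l) =
        (\<Sum>l<n. \<Sum>i<m. partial_deriv l (\<lambda>x. F x j) (\<phi> p) * partial_deriv i (\<lambda>y. S y l) (\<psi> (f p)) * w i)"
        by (simp add: v_def sum_distrib_left mult.assoc)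
      also have "\<dots> = (\<Sum>i<m. (\<Sum>l<n. partial_deriv l (\<lambda>x. F x j) (\<phi> p) * partial_deriv i (\<lambda>y. S y l) (\<psi> (f p))) * w i)"
        by (subst sum.swap) (simp add: sum_distrib_right)
      also have "\<dots> = (\<Sum>i<m. (if i = j then 1 else 0) * w i)"
        by (rule sum.cong) (simp_all add: jac j)
      also have "\<dots> = w j" using j by (simp add: if_distrib[of "\<lambda>x. x * _"] cong: if_cong)
      finally show ?thesis .
    qed
    then show ?thesis unfolding F_def by blast
  qed
  then show "\<forall>(n, U, \<phi>)\<in>atlas X. \<forall>(m, V, \<psi>)\<in>atlas Y. \<forall>p\<in>U. f p \<in> V \<longrightarrow>
        (\<forall>w. \<exists>v. \<forall>j<m. (\<Sum>i<n. partial_deriv i (\<lambda>x. \<psi> (f (inv_into U \<phi> x)) j) (\<phi> p) * v i) = w j)"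
    by blast
qed

text \<open>The section is constant in a trivialization around the base point of the given
  vector.\<close>

lemma local_section_through:
  assumes E: "vector_bundle E" and e: "e \<in> pts (tot E)"
  obtains N \<sigma> where "openin (mtop (base E)) N" "proj E e \<in> N" "psmooth (submfd (base E) N) (tot E) \<sigma>" "\<sigma> (proj E e) = e"
    "\<And>y. y \<in> N \<Longrightarrow> proj E (\<sigma> y) = y"
proof -
  note EB = vector_bundleD[OF E]
  obtain U k \<tau> \<sigma> where t: "proj E e \<in> U" "local_triv E U k \<tau> \<sigma>" using vector_bundle_triv[OF E EB(9)[OF e]] .
  note T = local_trivD[OF t(2)]
  have te: "\<tau> e \<in> EU k" by (rule T(7)[OF e t(1)])
  have "psmooth (submfd (base E) U) (Rn k) (\<lambda>y. \<tau> e)"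
    using te EB(4) by (intro psmooth_RnI) (auto intro: premanifold_submfd psmooth_real_const)
  then have "psmooth (submfd (base E) U) (tot E) (\<lambda>y. \<sigma> y (\<tau> e))"
    by (intro psmooth_triv_inv[OF E t(2) psmooth_incl[OF EB(4)]]) auto
  then show thesis using that[of U "\<lambda>y. \<sigma> y (\<tau> e)"] T(1) t(1) T(8)[OF e t(1)] T(5)[OF _ te] by blast
qed

section \<open>Structure maps and groupoid laws of \<open>\<Phi>(C)\<close>\<close>

lemma Phi_obj_simps [simp]:
  "Vob (Phi_obj C) = C1 C" "Varr (Phi_obj C) = whitney_sum (C0 C) (C1 C)" "lsrc (Phi_obj C) = snd"
  "ltgt (Phi_obj C) (a, x) = vadd (C1 C) (diff C a) x" "lunit (Phi_obj C) x = (vzero (C0 C) (proj (C1 C) x), x)"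
  "linv (Phi_obj C) (a, x) = (vneg (C0 C) a, vadd (C1 C) (diff C a) x)" "lmult (Phi_obj C) (a, x) (b, y) = (vadd (C0 C) a b, y)"
  by (simp_all add: Phi_obj_def)

context
  fixes C :: "('b, 'e, 'f) complex2"
  assumes C: "cochain_complex C"
begin

lemma complex_bundles: "vector_bundle (C0 C)" "vector_bundle (C1 C)" "base (C1 C) = base (C0 C)"
  "vb_map (C0 C) (C1 C) (\<lambda>x. x) (diff C)" "vector_bundle (whitney_sum (C0 C) (C1 C))"
  using C vector_bundle_whitney_sum by (auto simp: cochain_complex_def)

lemmas cpre = prebundle_vector_bundle[OF complex_bundles(1)] prebundle_vector_bundle[OF complex_bundles(2)]
  prebundle_vector_bundle[OF complex_bundles(5)]
lemmas cdiff = vb_mapD[OF complex_bundles(4) cpre(1) complex_bundles(2)]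
lemmas cops = vector_bundle_fibre_ops[OF complex_bundles(1)] vector_bundle_fibre_ops[OF complex_bundles(2)]
lemmas ccoords = coord_ops[OF complex_bundles(1)] coord_ops[OF complex_bundles(2)]

lemma wfst: "vb_map (whitney_sum (C0 C) (C1 C)) (C0 C) (\<lambda>x. x) fst"
  and wsnd: "vb_map (whitney_sum (C0 C) (C1 C)) (C1 C) (\<lambda>x. x) snd"
  using vb_map_whitney_fst vb_map_whitney_snd complex_bundles by auto

lemma c_in_base: "a \<in> pts (tot (C0 C)) \<Longrightarrow> proj (C0 C) a \<in> pts (base (C0 C))"
  "x \<in> pts (tot (C1 C)) \<Longrightarrow> proj (C1 C) x \<in> pts (base (C0 C))"
  using vector_bundleD(9)[OF complex_bundles(1)] vector_bundleD(9)[OF complex_bundles(2)] complex_bundles(3) by auto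

lemma c_laws:
  "x \<in> pts (tot (C1 C)) \<Longrightarrow> vadd (C1 C) (vzero (C1 C) (proj (C1 C) x)) x = x"
  "a \<in> pts (tot (C0 C)) \<Longrightarrow> proj (C0 C) a = u \<Longrightarrow> vadd (C0 C) (vzero (C0 C) u) a = a"
  "a \<in> pts (tot (C0 C)) \<Longrightarrow> proj (C0 C) a = u \<Longrightarrow> vadd (C0 C) a (vzero (C0 C) u) = a"
  "a \<in> pts (tot (C0 C)) \<Longrightarrow> b \<in> pts (tot (C0 C)) \<Longrightarrow> c \<in> pts (tot (C0 C)) \<Longrightarrow> proj (C0 C) a = proj (C0 C) b \<Longrightarrow> proj (C0 C) b = proj (C0 C) c \<Longrightarrow>
    vadd (C0 C) (vadd (C0 C) a b) c = vadd (C0 C) a (vadd (C0 C) b c)"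
  "x \<in> pts (tot (C1 C)) \<Longrightarrow> y \<in> pts (tot (C1 C)) \<Longrightarrow> z \<in> pts (tot (C1 C)) \<Longrightarrow> proj (C1 C) x = proj (C1 C) y \<Longrightarrow> proj (C1 C) y = proj (C1 C) z \<Longrightarrow>
    vadd (C1 C) (vadd (C1 C) x y) z = vadd (C1 C) x (vadd (C1 C) y z)"
  "a \<in> pts (tot (C0 C)) \<Longrightarrow> vadd (C0 C) (vneg (C0 C) a) a = vzero (C0 C) (proj (C0 C) a)"
  "a \<in> pts (tot (C0 C)) \<Longrightarrow> vadd (C0 C) a (vneg (C0 C) a) = vzero (C0 C) (proj (C0 C) a)"
  "a \<in> pts (tot (C0 C)) \<Longrightarrow> x \<in> pts (tot (C1 C)) \<Longrightarrow> proj (C0 C) a = proj (C1 C) x \<Longrightarrow>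
    vadd (C1 C) (diff C (vneg (C0 C) a)) (vadd (C1 C) (diff C a) x) = x"
  using cops cdiff c_in_base complex_bundles(3)
  by (auto intro!: coord_eqI[OF complex_bundles(1)] coord_eqI[OF complex_bundles(2)] simp: ccoords)

lemma diff_zero: "y \<in> pts (base (C0 C)) \<Longrightarrow> diff C (vzero (C0 C) y) = vzero (C1 C) y"
  using vb_map_zero[OF complex_bundles(4,1,2)] .

lemma Phi_tgt_vb: "vb_map (whitney_sum (C0 C) (C1 C)) (C1 C) (\<lambda>x. x) (ltgt (Phi_obj C))"
proof -
  have "vb_map (whitney_sum (C0 C) (C1 C)) (C1 C) (\<lambda>x. x) (\<lambda>v. vadd (C1 C) (diff C (fst v)) (snd v))"
    using vb_map_comp[OF wfst complex_bundles(4) cpre(3) complex_bundles(1,2)] by (intro vb_map_vadd wsnd cpre(3) complex_bundles(2))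
  then show ?thesis by (rule vb_map_cong[OF _ cpre(3) complex_bundles(2)]) auto
qed

lemma Phi_unit_vb: "vb_map (C1 C) (whitney_sum (C0 C) (C1 C)) (\<lambda>x. x) (lunit (Phi_obj C))"
proof -
  have i: "psmooth (base (C1 C)) (base (C0 C)) (\<lambda>x. x)" using psmooth_id vector_bundleD(4)[OF complex_bundles(1)] complex_bundles(3) by simp
  show ?thesis
    using vb_map_whitney_pair[OF vb_map_const_zero[OF i cpre(2) complex_bundles(1)] vb_map_ident[OF cpre(2)] cpre(2) complex_bundles(1,2,3)]
    by (rule vb_map_cong[OF _ cpre(2) complex_bundles(5)]) auto
qed

lemma Phi_inv_vb: "vb_map (whitney_sum (C0 C) (C1 C)) (whitney_sum (C0 C) (C1 C)) (\<lambda>x. x) (linv (Phi_obj C))"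
  using vb_map_whitney_pair[OF vb_map_vneg[OF wfst cpre(3) complex_bundles(1)] Phi_tgt_vb cpre(3) complex_bundles(1,2,3)]
  by (rule vb_map_cong[OF _ cpre(3) complex_bundles(5)]) auto

abbreviation (input) "Wtot \<equiv> tot (whitney_sum (C0 C) (C1 C))"

lemma pts_comp_Phi: "pts (comp_pairs (grpd (Phi_obj C))) =
    {(v, w). v \<in> pts Wtot \<and> w \<in> pts Wtot \<and> snd v = ltgt (Phi_obj C) w}"
  by simp

text \<open>Fibrewise sums and multiples of composable pairs are composable because source and
  target are linear.\<close>

lemma comp_vb_prebundle: "prebundle (comp_vb (Phi_obj C))"
proof -
  note B = vector_bundleD[OF complex_bundles(5)]
  have "psmooth (comp_pairs (grpd (Phi_obj C))) Wtot fst"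
    unfolding comp_pairs_def using psmooth_fibre_prod_fst[OF B(5,5)] by simp
  from psmooth_comp[OF this B(3)] have "psmooth (tot (comp_vb (Phi_obj C))) (base (comp_vb (Phi_obj C))) (proj (comp_vb (Phi_obj C)))"
    by (simp add: comp_vb_def whitney_sum_def case_prod_unfold)
  moreover have "premanifold (base (comp_vb (Phi_obj C)))" using B(4) by (simp add: comp_vb_def)
  ultimately show ?thesis
    unfolding prebundle_def comp_vb_def using cops cdiff c_in_base
    by (auto intro!: coord_eqI[OF complex_bundles(2)] simp: ccoords distrib_left)
qed

lemma comp_vb_fst: "vb_map (comp_vb (Phi_obj C)) (whitney_sum (C0 C) (C1 C)) (\<lambda>x. x) fst"
  and comp_vb_snd: "vb_map (comp_vb (Phi_obj C)) (whitney_sum (C0 C) (C1 C)) (\<lambda>x. x) snd"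
proof -
  note B = vector_bundleD[OF complex_bundles(5)]
  have s: "psmooth (comp_pairs (grpd (Phi_obj C))) Wtot fst" "psmooth (comp_pairs (grpd (Phi_obj C))) Wtot snd"
    unfolding comp_pairs_def using psmooth_fibre_prod_fst[OF B(5,5)] psmooth_fibre_prod_snd[OF B(5,5)] by simp_all
  have i: "psmooth (base (comp_vb (Phi_obj C))) (base (whitney_sum (C0 C) (C1 C))) (\<lambda>x. x)"
    using psmooth_id[OF B(4)] by (simp add: comp_vb_def)
  show "vb_map (comp_vb (Phi_obj C)) (whitney_sum (C0 C) (C1 C)) (\<lambda>x. x) fst"
    by (rule vb_mapI[OF comp_vb_prebundle i]) (use s(1) in \<open>auto simp: comp_vb_def\<close>)
  show "vb_map (comp_vb (Phi_obj C)) (whitney_sum (C0 C) (C1 C)) (\<lambda>x. x) snd"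
    by (rule vb_mapI[OF comp_vb_prebundle i]) (use s(2) cdiff cops in \<open>auto simp: comp_vb_def\<close>)
qed

lemma Phi_mult_vb: "vb_map (comp_vb (Phi_obj C)) (whitney_sum (C0 C) (C1 C)) (\<lambda>x. x) (\<lambda>(v, w). lmult (Phi_obj C) v w)"
proof -
  note p = comp_vb_prebundle and W = complex_bundles(5)
  have "vb_map (comp_vb (Phi_obj C)) (whitney_sum (C0 C) (C1 C)) (\<lambda>x. x) (\<lambda>z. (vadd (C0 C) (fst (fst z)) (fst (snd z)), snd (snd z)))"
    by (intro vb_map_whitney_pair vb_map_vadd p complex_bundles
       vb_map_comp[OF comp_vb_fst wfst p W complex_bundles(1)] vb_map_comp[OF comp_vb_snd wfst p W complex_bundles(1)]
       vb_map_comp[OF comp_vb_snd wsnd p W complex_bundles(2)])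
  then show ?thesis by (rule vb_map_cong[OF _ p W]) (auto simp: comp_vb_def)
qed

lemma Phi_src_submersion: "submersion Wtot (tot (C1 C)) snd"
proof (rule submersionI)
  note D = vb_mapD[OF wsnd cpre(3) complex_bundles(2)]
  show "psmooth Wtot (tot (C1 C)) snd" by (rule D(2))
  note B1 = vector_bundleD[OF complex_bundles(2)]
  fix p assume p: "p \<in> pts Wtot"
  then obtain a x where ax: "p = (a, x)" "a \<in> pts (tot (C0 C))" "x \<in> pts (tot (C1 C))" "proj (C0 C) a = proj (C1 C) x" by auto
  obtain N \<sigma> where N: "openin (mtop (base (C0 C))) N" "proj (C0 C) a \<in> N" "psmooth (submfd (base (C0 C)) N) (tot (C0 C)) \<sigma>"
    "\<sigma> (proj (C0 C) a) = a" "\<And>y. y \<in> N \<Longrightarrow> proj (C0 C) (\<sigma> y) = y" using local_section_through[OF complex_bundles(1) ax(2)] by blast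
  let ?N = "{x \<in> pts (tot (C1 C)). proj (C1 C) x \<in> N}"
  have oN: "openin (mtop (tot (C1 C))) ?N" using proj_preimage_open[OF B1(3)] N(1) complex_bundles(3) by simp
  have pr: "psmooth (submfd (tot (C1 C)) ?N) (base (C0 C)) (proj (C1 C))" using psmooth_submfd[OF B1(3)] complex_bundles(3) by simp
  have s: "psmooth (submfd (tot (C1 C)) ?N) (tot (C0 C)) (\<lambda>x. \<sigma> (proj (C1 C) x))"
    by (rule psmooth_comp[OF psmooth_into_open[OF pr N(1)] N(3)]) auto
  have p0: "psmooth (tot (C0 C)) (base (C1 C)) (proj (C0 C))" using vector_bundleD(3)[OF complex_bundles(1)] complex_bundles(3) by simp
  have "psmooth (submfd (tot (C1 C)) ?N) Wtot (\<lambda>x. (\<sigma> (proj (C1 C) x), x))"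
    unfolding whitney_sum_simps(2)
    by (rule psmooth_fibre_prod_pair[OF complex_bundles(2) p0 s psmooth_incl[OF B1(5)]]) (use N(5) in auto)
  then show "\<exists>N \<sigma>. openin (mtop (tot (C1 C))) N \<and> snd p \<in> N \<and> psmooth (submfd (tot (C1 C)) N) Wtot \<sigma> \<and> \<sigma> (snd p) = p \<and> (\<forall>y\<in>N. snd (\<sigma> y) = y)"
    using oN N(2,4) ax by (intro exI[of _ ?N] exI[of _ "\<lambda>x. (\<sigma> (proj (C1 C) x), x)"]) auto
qed

lemma Phi_tgt_submersion: "submersion Wtot (tot (C1 C)) (ltgt (Phi_obj C))"
proof (rule submersionI)
  note D = vb_mapD[OF Phi_tgt_vb cpre(3) complex_bundles(2)]
  show "psmooth Wtot (tot (C1 C)) (ltgt (Phi_obj C))" by (rule D(2))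
  note B1 = vector_bundleD[OF complex_bundles(2)]
  fix p assume p: "p \<in> pts Wtot"
  then obtain a x where ax: "p = (a, x)" "a \<in> pts (tot (C0 C))" "x \<in> pts (tot (C1 C))" "proj (C0 C) a = proj (C1 C) x" by auto
  obtain N \<sigma> where N: "openin (mtop (base (C0 C))) N" "proj (C0 C) a \<in> N" "psmooth (submfd (base (C0 C)) N) (tot (C0 C)) \<sigma>"
    "\<sigma> (proj (C0 C) a) = a" "\<And>y. y \<in> N \<Longrightarrow> proj (C0 C) (\<sigma> y) = y" using local_section_through[OF complex_bundles(1) ax(2)] by blast
  let ?N = "{x \<in> pts (tot (C1 C)). proj (C1 C) x \<in> N}"
  have oN: "openin (mtop (tot (C1 C))) ?N" using proj_preimage_open[OF B1(3)] N(1) complex_bundles(3) by simp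
  have pr: "psmooth (submfd (tot (C1 C)) ?N) (base (C0 C)) (proj (C1 C))" using psmooth_submfd[OF B1(3)] complex_bundles(3) by simp
  have s: "psmooth (submfd (tot (C1 C)) ?N) (tot (C0 C)) (\<lambda>x. \<sigma> (proj (C1 C) x))"
    by (rule psmooth_comp[OF psmooth_into_open[OF pr N(1)] N(3)]) auto
  have sN: "\<sigma> y \<in> pts (tot (C0 C))" if "y \<in> N" for y
    using psmoothD(6)[OF N(3), of y] that openin_subset[OF N(1)] by auto
  have p0: "psmooth (tot (C0 C)) (base (C1 C)) (proj (C0 C))" using vector_bundleD(3)[OF complex_bundles(1)] complex_bundles(3) by simp
  \<comment> \<open>For a section of the target map the equation \<open>\<delta>a + x = y\<close> is
    solved for \<open>x\<close>, with \<open>a\<close> taken from a local section of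
    \<open>C0 C\<close>.\<close>
  let ?s = "\<lambda>x. (\<sigma> (proj (C1 C) x), vadd (C1 C) (vneg (C1 C) (diff C (\<sigma> (proj (C1 C) x)))) x)"
  have n: "psmooth (submfd (tot (C1 C)) ?N) (tot (C1 C)) (\<lambda>x. vneg (C1 C) (diff C (\<sigma> (proj (C1 C) x))))"
    unfolding vneg_def by (rule psmooth_vscale[OF complex_bundles(2) psmooth_comp[OF s cdiff(2)]])
  have "psmooth (submfd (tot (C1 C)) ?N) Wtot ?s"
    unfolding whitney_sum_simps(2)
    by (intro psmooth_fibre_prod_pair[OF complex_bundles(2) p0 s] psmooth_vadd[OF complex_bundles(2) n] psmooth_incl[OF B1(5)])
       (use N(5) sN cdiff cops in auto)
  moreover have "vadd (C1 C) (vneg (C1 C) (diff C a)) (vadd (C1 C) (diff C a) x) = x"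
    "\<And>y. y \<in> ?N \<Longrightarrow> vadd (C1 C) (diff C (\<sigma> (proj (C1 C) y))) (vadd (C1 C) (vneg (C1 C) (diff C (\<sigma> (proj (C1 C) y)))) y) = y"
    using ax N(5) sN cdiff cops by (auto intro!: coord_eqI[OF complex_bundles(2)] simp: ccoords)
  ultimately show "\<exists>N \<sigma>. openin (mtop (tot (C1 C))) N \<and> ltgt (Phi_obj C) p \<in> N \<and> psmooth (submfd (tot (C1 C)) N) Wtot \<sigma> \<and>
      \<sigma> (ltgt (Phi_obj C) p) = p \<and> (\<forall>y\<in>N. ltgt (Phi_obj C) (\<sigma> y) = y)"
    using oN N(2,4) ax cdiff cops by (intro exI[of _ ?N] exI[of _ ?s]) auto
qed

lemma lgb_Phi_obj: "linear_lie_groupoid_bundle (Phi_obj C)"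
proof -
  note B1 = vector_bundleD[OF complex_bundles(2)] and BW = vector_bundleD[OF complex_bundles(5)]
  have u: "smooth_map (tot (C1 C)) Wtot (lunit (Phi_obj C))"
    and i: "smooth_map Wtot Wtot (linv (Phi_obj C))"
    and mu: "smooth_map (comp_pairs (grpd (Phi_obj C))) Wtot (\<lambda>(v, w). lmult (Phi_obj C) v w)"
    using Phi_unit_vb Phi_inv_vb Phi_mult_vb unfolding vb_map_def by (simp_all add: comp_vb_def)
  have grp: "lie_groupoid (grpd (Phi_obj C))"
    unfolding lie_groupoid_def grpd_simps Phi_obj_simps(1-3)
  proof (intro conjI B1(2) BW(2) Phi_src_submersion Phi_tgt_submersion u i mu ballI; (unfold comp_triples_def pts_comp_Phi grpd_simps Phi_obj_simps(1-3))?)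
    fix z assume "z \<in> {(v, w). v \<in> pts Wtot \<and> w \<in> pts Wtot \<and> snd v = ltgt (Phi_obj C) w}"
    then show "case z of (g, h) \<Rightarrow> snd (lmult (Phi_obj C) g h) = snd h \<and> ltgt (Phi_obj C) (lmult (Phi_obj C) g h) = ltgt (Phi_obj C) g"
      using cdiff cops by (auto simp: c_laws)
  next
    fix z assume "z \<in> {(g, h, k). g \<in> pts Wtot \<and> h \<in> pts Wtot \<and> k \<in> pts Wtot \<and> snd g = ltgt (Phi_obj C) h \<and> snd h = ltgt (Phi_obj C) k}"
    then show "case z of (g, h, k) \<Rightarrow> lmult (Phi_obj C) (lmult (Phi_obj C) g h) k = lmult (Phi_obj C) g (lmult (Phi_obj C) h k)"
      using cdiff cops by (auto simp: c_laws)
  qed (use cops cdiff c_in_base c_laws diff_zero in \<open>auto\<close>)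
  moreover have "lie_groupoid_map (grpd (Phi_obj C)) (trivial_groupoid (base (C1 C))) (proj (C1 C)) (proj (whitney_sum (C0 C) (C1 C)))"
    unfolding lie_groupoid_map_def trivial_groupoid_def grpd_simps Phi_obj_simps(1-3) pts_comp_Phi groupoid.simps
    using psmoothD(5)[OF B1(3)] psmoothD(5)[OF BW(3)] complex_bundles(3) cdiff cops c_in_base by auto
  ultimately show ?thesis
    unfolding linear_lie_groupoid_bundle_def Phi_obj_simps(1-3)
    using complex_bundles wsnd Phi_tgt_vb Phi_unit_vb Phi_inv_vb Phi_mult_vb by simp
qed

lemma split_Phi_obj: "split_lgb (Phi_obj C) C (\<lambda>a. (a, vzero (C1 C) (proj (C0 C) a))) fst"
proof
  show "linear_lie_groupoid_bundle (Phi_obj C)" "cochain_complex C" by (fact lgb_Phi_obj C)+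
  have i: "psmooth (base (C0 C)) (base (C1 C)) (\<lambda>x. x)" using psmooth_id vector_bundleD(4)[OF complex_bundles(1)] complex_bundles(3) by simp
  show "vb_map (C0 C) (Varr (Phi_obj C)) (\<lambda>x. x) (\<lambda>a. (a, vzero (C1 C) (proj (C0 C) a)))"
    unfolding Phi_obj_simps
    by (rule vb_map_whitney_pair[OF vb_map_ident[OF cpre(1)] vb_map_const_zero[OF i cpre(1) complex_bundles(2)] cpre(1) complex_bundles(1,2,3)])
  show "vb_map (Varr (Phi_obj C)) (C0 C) (\<lambda>x. x) fst" using wfst by simp
  show "ltgt (Phi_obj C) (a, vzero (C1 C) (proj (C0 C) a)) = diff C a" if "a \<in> pts (tot (C0 C))" for a
    using that c_in_base(1)[OF that] complex_bundles(3) cdiff cops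
    by (auto intro!: coord_eqI[OF complex_bundles(2)] simp: ccoords)
  show "(fst v, vzero (C1 C) (proj (C0 C) (fst v))) = vsub (Varr (Phi_obj C)) v (lunit (Phi_obj C) (lsrc (Phi_obj C) v))"
    if v: "v \<in> pts (tot (Varr (Phi_obj C)))" for v
  proof -
    obtain a x where ax: "v = (a, x)" "a \<in> pts (tot (C0 C))" "x \<in> pts (tot (C1 C))" "proj (C0 C) a = proj (C1 C) x" using v by auto
    have "vsub (C0 C) a (vzero (C0 C) (proj (C1 C) x)) = a" "vsub (C1 C) x x = vzero (C1 C) (proj (C1 C) x)"
      using ax c_in_base complex_bundles(3) cops by (auto intro!: coord_eqI[OF complex_bundles(1)] coord_eqI[OF complex_bundles(2)] simp: ccoords)
    then show ?thesis using ax by simp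
  qed
qed simp_all

lemma arr_Phi_obj:
  assumes "a \<in> pts (tot (C0 C))" "x \<in> pts (tot (C1 C))" "proj (C0 C) a = proj (C1 C) x"
  shows "split_lgb.arr (Phi_obj C) (\<lambda>a. (a, vzero (C1 C) (proj (C0 C) a))) a x = (a, x)"
  using assms c_laws(1)[OF assms(2)] c_laws(3)[OF assms(1,3)] by (simp add: split_lgb.arr_def[OF split_Phi_obj])

end

lemma psmooth_base:
  assumes "lie_groupoid G" "base E = Obj G"
  shows "psmooth (Arr G) (base E) (gsrc G)" "psmooth (Arr G) (base E) (gtgt G)" "psmooth (comp_pairs G) (base E) (src2 G)"
  using lie_groupoidD(5,6,11)[OF assms(1)] assms(2) by simp_all

lemma vb_map_pull_fst:
  assumes G: "lie_groupoid G" and E: "vector_bundle E" and F: "vector_bundle F" and b: "base E = Obj G" "base F = Obj G"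
    and f: "vb_map E F (\<lambda>x. x) f" and H: "vector_bundle H" and g: "vb_map (pull1 G F) H c g"
  shows "vb_map (pull1 G E) H c (\<lambda>z. g (fst z, f (snd z)))"
proof -
  note p = psmooth_base[OF G b(1)] psmooth_base[OF G b(2)] and pre = pull_prebundle(1)[OF G E]
  have 1: "vb_map (pull1 G E) F (gsrc G) (\<lambda>z. f (snd z))"
    using vb_map_comp[OF vb_map_pullback_snd[OF E p(1)] f pre E F] by simp
  have "vb_map (pull1 G E) H (\<lambda>x. c x) (\<lambda>z. g (proj (pull1 G E) z, f (snd z)))"
    by (rule vb_map_comp_pullback[OF 1 pre F _ p(4) _ g H]) (use lie_groupoidD(3)[OF G] in \<open>auto intro: psmooth_id\<close>)
  then show ?thesis by simp
qed

section \<open>Every weak representation is presented\<close>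

text \<open>The representation is read off in kernel components. Compatibility of the action with
  targets makes it commute with the differential, the target of \<open>\<alpha>\<close> gives the
  defect of \<open>\<lambda>\<^sup>1\<close>, naturality of \<open>\<alpha>\<close> on kernel arrows
  the defect of \<open>\<lambda>\<^sup>0\<close>, and coherence of \<open>\<alpha>\<close> the
  cocycle identity.\<close>

lemma (in split_lgb) presented_weak_rep:
  fixes G :: "('b, 'a) groupoid" and A :: "('b, 'a, 'f, 'y) wrep"
  assumes G: "lie_groupoid G" and A: "is_weak_rep G A" and VA: "wV A = V"
  shows "presented G \<lparr>cpx = C, lam0 = (\<lambda>z. \<rho> (act1 A (fst z, \<kappa> (snd z)))), lam1 = act0 A, Omg = (\<lambda>z. \<rho> (alph A z))\<rparr> A \<kappa> \<rho>"
proof -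
  note W = A[unfolded weak_rep_iff VA Vob]
  note Wr = W[THEN conjunct2, THEN conjunct2, THEN conjunct2, THEN conjunct1, rule_format] W[THEN conjunct2, THEN conjunct2, THEN conjunct2, THEN conjunct2, THEN conjunct1, rule_format]
  note Wc = W[THEN conjunct2, THEN conjunct2, THEN conjunct2, THEN conjunct2, THEN conjunct2, THEN conjunct2, THEN conjunct1, rule_format] W[THEN conjunct2, THEN conjunct2, THEN conjunct2, THEN conjunct2, THEN conjunct2, THEN conjunct2, THEN conjunct2, THEN conjunct1, rule_format] W[THEN conjunct2, THEN conjunct2, THEN conjunct2, THEN conjunct2, THEN conjunct2, THEN conjunct2, THEN conjunct2, THEN conjunct2, THEN conjunct1, rule_format] W[THEN conjunct2, THEN conjunct2, THEN conjunct2, THEN conjunct2, THEN conjunct2, THEN conjunct2, THEN conjunct2, THEN conjunct2, THEN conjunct2, rule_format]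
  have b1: "base (C1 C) = Obj G" and b0: "base (C0 C) = Obj G" and bV: "base (Varr V) = Obj G" using W vbs by auto
  have lgbm: "lgb_map (lpull1 G V) V (gtgt G) (act0 A) (act1 A)" using W by simp
  note L = lgbm[unfolded lgb_map_iff pullback_lgb_simps(1,2) Vob]
  have v0: "vb_map (pull1 G (C1 C)) (C1 C) (gtgt G) (act0 A)" and v1: "vb_map (pull1 G (Varr V)) (Varr V) (gtgt G) (act1 A)"
    using L by auto
  have va: "vb_map (pull2 G (C1 C)) (Varr V) (tgt2 G) (alph A)" using W by simp
  note a0 = pull1_mapD[OF G vbs(2,2) v0] and a1 = pull1_mapD[OF G vbs(3,3) v1] and al = pull2_mapD[OF G vbs(2,3) va]
  note gl = groupoid_laws[OF G]
  have a1s: "lsrc V (act1 A (g, v)) = act0 A (g, lsrc V v)" "ltgt V (act1 A (g, v)) = act0 A (g, ltgt V v)"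
    if "g \<in> pts (Arr G)" "v \<in> pts (tot (Varr V))" "proj (Varr V) v = gsrc G g" for g v
  proof -
    have "(g, v) \<in> pts (tot (pull1 G (Varr V)))" using that by simp
    with L have "lsrc V (act1 A (g, v)) = act0 A (lsrc (lpull1 G V) (g, v)) \<and> ltgt V (act1 A (g, v)) = act0 A (ltgt (lpull1 G V) (g, v))" by blast
    then show "lsrc V (act1 A (g, v)) = act0 A (g, lsrc V v)" "ltgt V (act1 A (g, v)) = act0 A (g, ltgt V v)" by auto
  qed
  have a1u: "act1 A (g, lunit V x) = lunit V (act0 A (g, x))"
    if "g \<in> pts (Arr G)" "x \<in> pts (tot (C1 C))" "proj (C1 C) x = gsrc G g" for g x
  proof -
    have "(g, x) \<in> pts (tot (pull1 G (C1 C)))" using that by simp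
    with L have "act1 A (lunit (lpull1 G V) (g, x)) = lunit V (act0 A (g, x))" by blast
    then show ?thesis by simp
  qed
  define l where "l g a = \<rho> (act1 A (g, \<kappa> a))" for g a
  define om where "om g h x = \<rho> (alph A ((g, h), x))" for g h x
  have z1: "vzero (C1 C) y \<in> pts (tot (C1 C))" "proj (C1 C) (vzero (C1 C) y) = y" if "y \<in> pts (Obj G)" for y using that b1 ops by auto
  have a0z: "act0 A (g, vzero (C1 C) (gsrc G g)) = vzero (C1 C) (gtgt G g)" if "g \<in> pts (Arr G)" for g using a0(5) that gl b1 by simp
  \<comment> \<open>The arrow \<open>\<kappa> a\<close> starts at 0, and the action on objects is
    linear; so its image starts at 0 as well and is again in the image of
    \<open>\<kappa>\<close>.\<close>
  have lD: "l g a \<in> pts (tot (C0 C))" "proj (C0 C) (l g a) = gtgt G g" "act1 A (g, \<kappa> a) = \<kappa> (l g a)"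
    "diff C (l g a) = act0 A (g, diff C a)"
    if g: "g \<in> pts (Arr G)" and a: "a \<in> pts (tot (C0 C))" "proj (C0 C) a = gsrc G g" for g a
  proof -
    have k: "\<kappa> a \<in> pts (tot (Varr V))" "proj (Varr V) (\<kappa> a) = gsrc G g" using a \<kappa>D by auto
    note ak = a1(1,2)[OF g k]
    show l: "l g a \<in> pts (tot (C0 C))" "proj (C0 C) (l g a) = gtgt G g" using ak \<rho>D by (auto simp: l_def)
    have "lsrc V (act1 A (g, \<kappa> a)) = vzero (C1 C) (gtgt G g)" using a1s(1)[OF g k] src_\<kappa>[OF a(1)] a(2) a0z[OF g] by simp
    then have "act1 A (g, \<kappa> a) = arr (l g a) (vzero (C1 C) (gtgt G g))" using arr_surj[OF ak(1)] by (simp add: l_def)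
    also have "\<dots> = \<kappa> (l g a)" using \<kappa>_arr[OF l(1)] l(2) by simp
    finally show e: "act1 A (g, \<kappa> a) = \<kappa> (l g a)" .
    show "diff C (l g a) = act0 A (g, diff C a)"
      using a1s(2)[OF g k] tgt_\<kappa>[OF a(1)] tgt_\<kappa>[OF l(1)] e by simp
  qed
  have act: "act1 A (g, arr a x) = arr (l g a) (act0 A (g, x))"
    if g: "g \<in> pts (Arr G)" and a: "a \<in> pts (tot (C0 C))" "proj (C0 C) a = gsrc G g" and x: "x \<in> pts (tot (C1 C))" "proj (C1 C) x = gsrc G g" for g a x
    unfolding arr_def using a1(3)[OF g, of "\<kappa> a" "lunit V x"] g a x \<kappa>D maps lD(3)[OF g a] a1u[OF g x] by simp
  have omD: "om g h x \<in> pts (tot (C0 C))" "proj (C0 C) (om g h x) = gtgt G g" "alph A ((g, h), x) = arr (om g h x) (act0 A (g, act0 A (h, x)))"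
    "act0 A (gmult G g h, x) = vadd (C1 C) (diff C (om g h x)) (act0 A (g, act0 A (h, x)))"
    if g: "g \<in> pts (Arr G)" "h \<in> pts (Arr G)" "gsrc G g = gtgt G h" and x: "x \<in> pts (tot (C1 C))" "proj (C1 C) x = gsrc G h" for g h x
  proof -
    note ax = al(1,2)[OF g x]
    have st: "lsrc V (alph A ((g, h), x)) = act0 A (g, act0 A (h, x))" "ltgt V (alph A ((g, h), x)) = act0 A (gmult G g h, x)"
      using Wc(1)[OF g x] by simp_all
    have hx: "act0 A (h, x) \<in> pts (tot (C1 C))" "proj (C1 C) (act0 A (h, x)) = gsrc G g" using a0(1,2)[OF g(2) x] g by auto
    note ghx = a0(1,2)[OF g(1) hx]
    show o: "om g h x \<in> pts (tot (C0 C))" "proj (C0 C) (om g h x) = gtgt G g" using ax \<rho>D by (auto simp: om_def)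
    show e: "alph A ((g, h), x) = arr (om g h x) (act0 A (g, act0 A (h, x)))" using arr_surj[OF ax(1)] st by (simp add: om_def)
    show "act0 A (gmult G g h, x) = vadd (C1 C) (diff C (om g h x)) (act0 A (g, act0 A (h, x)))"
      using st(2) arr_pts(4)[OF o(1) ghx(1)] o(2) ghx(2) e by simp
  qed
  let ?R = "\<lparr>cpx = C, lam0 = (\<lambda>z. \<rho> (act1 A (fst z, \<kappa> (snd z)))), lam1 = act0 A, Omg = (\<lambda>z. \<rho> (alph A z))\<rparr>"
  have vl: "vb_map (pull1 G (C0 C)) (C0 C) (gtgt G) (\<lambda>z. \<rho> (act1 A (fst z, \<kappa> (snd z))))"
    using vb_map_comp[OF vb_map_pull_fst[OF G vbs(1,3) b0 bV \<kappa> vbs(3) v1] \<rho> pull_prebundle(1)[OF G vbs(1)] vbs(3,1)] by simp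
  have vo: "vb_map (pull2 G (C1 C)) (C0 C) (tgt2 G) (\<lambda>z. \<rho> (alph A z))"
    using vb_map_comp[OF va \<rho> pull_prebundle(2)[OF G vbs(2)] vbs(3,1)] by simp
  have R: "is_ruth2 G ?R"
    unfolding is_ruth2_def ruth.simps unital_quasi_action_def
  proof (intro conjI ballI C b0 vl v0 vo)
    show "\<rho> (act1 A (fst (gunit G (proj (C0 C) e), e), \<kappa> (snd (gunit G (proj (C0 C) e), e)))) = e" if e: "e \<in> pts (tot (C0 C))" for e
    proof -
      have "act1 A (gunit G (proj (Varr V) (\<kappa> e)), \<kappa> e) = \<kappa> e" by (rule Wr(2)[OF \<kappa>D(3)[OF e]])
      then show ?thesis using e \<kappa>D \<rho>\<kappa> by simp
    qed
    show "act0 A (gunit G (proj (C1 C) e), e) = e" if "e \<in> pts (tot (C1 C))" for e by (rule Wr(1)[OF that])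
    fix g assume g: "g \<in> pts (Arr G)"
    show "\<rho> (alph A ((g, gunit G (gsrc G g)), e)) = vzero (C0 C) (gtgt G g)" "\<rho> (alph A ((gunit G (gtgt G g), g), e)) = vzero (C0 C) (gtgt G g)"
      if "e \<in> fibre (C1 C) (gsrc G g)" for e
    proof -
      have e: "e \<in> pts (tot (C1 C))" "proj (C1 C) e = gsrc G g" using that by (auto simp: fibre_def)
      have "alph A ((g, gunit G (gsrc G g)), e) = lunit V (act0 A (g, e))" "alph A ((gunit G (gtgt G g), g), e) = lunit V (act0 A (g, e))"
        using Wc(4)[OF g e] by simp_all
      then show "\<rho> (alph A ((g, gunit G (gsrc G g)), e)) = vzero (C0 C) (gtgt G g)" "\<rho> (alph A ((gunit G (gtgt G g), g), e)) = vzero (C0 C) (gtgt G g)"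
        using \<rho>_lunit a0(1,2)[OF g e] by simp_all
    qed
    show "diff C (\<rho> (act1 A (fst (g, e), \<kappa> (snd (g, e))))) = act0 A (g, diff C e)" if "e \<in> fibre (C0 C) (gsrc G g)" for e
      using lD(4)[OF g, of e] that by (simp add: fibre_def l_def)
  next
    fix z assume "z \<in> pts (comp_pairs G)"
    then obtain g h where z: "z = (g, h)" and g: "g \<in> pts (Arr G)" "h \<in> pts (Arr G)" "gsrc G g = gtgt G h" by auto
    have gh: "gmult G g h \<in> pts (Arr G)" "gsrc G (gmult G g h) = gsrc G h" "gtgt G (gmult G g h) = gtgt G g" using gl g by auto
    have "vsub (C0 C) (l (gmult G g h) a) (l g (l h a)) = om g h (diff C a)" if "a \<in> fibre (C0 C) (gsrc G h)" for a
    proof -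
      have a: "a \<in> pts (tot (C0 C))" "proj (C0 C) a = gsrc G h" "proj (C0 C) a = gsrc G (gmult G g h)" using that gh by (auto simp: fibre_def)
      let ?z = "vzero (C1 C) (gsrc G h)" and ?z' = "vzero (C1 C) (gtgt G g)"
      have zz: "?z \<in> pts (tot (C1 C))" "proj (C1 C) ?z = gsrc G h" "?z' \<in> pts (tot (C1 C))" "proj (C1 C) ?z' = gtgt G g" using z1 gl g by auto
      have da: "diff C a \<in> pts (tot (C1 C))" "proj (C1 C) (diff C a) = gsrc G h" using a diffD by auto
      note lh = lD[OF g(2) a(1,2)]
      have lh': "proj (C0 C) (l h a) = gsrc G g" using lh g by simp
      note lgh = lD[OF g(1) lh(1) lh'] and lm = lD[OF gh(1) a(1,3)]
      note od = omD[OF g da] and oz = omD[OF g zz(1,2)]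
      \<comment> \<open>The kernel component of \<open>\<alpha>\<close> is linear and hence zero at
        the zero vector. This removes the contribution of \<open>\<alpha>\<close> at the source of
        \<open>\<kappa> a\<close> from the naturality square.\<close>
      have omz: "om g h ?z = vzero (C0 C) (gtgt G g)"
      proof -
        have "\<rho> (alph A ((g, h), ?z)) = vzero (C0 C) (gtgt G g)"
        proof -
          have "vb_map (pull2 G (C1 C)) (C0 C) (tgt2 G) (\<lambda>z. \<rho> (alph A z))" by (rule vo)
          note D = vb_mapD(3-8)[OF this pull_prebundle(2)[OF G vbs(2)] vbs(1)]
          have m: "((g, h), ?z) \<in> pts (tot (pull2 G (C1 C)))" using g zz by simp
          have "\<rho> (alph A ((g, h), ?z)) = \<rho> (alph A (vscale (pull2 G (C1 C)) 0 ((g, h), ?z)))"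
            using vzero_eq_scale[OF vbs(2) zz(1)] zz by simp
          also have "\<dots> = vscale (C0 C) 0 (\<rho> (alph A ((g, h), ?z)))" by (rule D(4)[OF m])
          also have "\<dots> = vzero (C0 C) (gtgt G g)" using vzero_eq_scale[OF vbs(1) D(1)[OF m]] D(2)[OF m] by simp
          finally show ?thesis .
        qed
        then show ?thesis by (simp add: om_def)
      qed
      have zl: "act0 A (g, act0 A (h, ?z)) = ?z'" using a0z[OF g(1)] a0z[OF g(2)] g by simp
      have \<kappa>a: "\<kappa> a = arr a ?z" "\<kappa> (l g (l h a)) = arr (l g (l h a)) ?z'" "\<kappa> (l (gmult G g h) a) = arr (l (gmult G g h) a) ?z'"
        using \<kappa>_arr[OF a(1)] a \<kappa>_arr[OF lgh(1)] lgh(2) \<kappa>_arr[OF lm(1)] lm(2) gh by simp_all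
      have "lmult V (alph A ((g, h), ltgt V (\<kappa> a))) (act1 A (g, act1 A (h, \<kappa> a))) = lmult V (act1 A (gmult G g h, \<kappa> a)) (alph A ((g, h), lsrc V (\<kappa> a)))"
        using Wc(2)[OF g \<kappa>D(3)[OF a(1)]] \<kappa>D(4)[OF a(1)] a(2) by simp
      then have e: "lmult V (arr (om g h (diff C a)) (act0 A (g, act0 A (h, diff C a)))) (arr (l g (l h a)) ?z') =
          lmult V (arr (l (gmult G g h) a) ?z') (arr (vzero (C0 C) (gtgt G g)) ?z')"
        unfolding tgt_\<kappa>[OF a(1)] src_\<kappa>[OF a(1)] a(2) lh(3) lgh(3) lm(3) \<kappa>a(2,3) od(3) oz(3) omz zl .
      have dl: "act0 A (g, act0 A (h, diff C a)) = vadd (C1 C) (diff C (l g (l h a))) ?z'"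
      proof -
        have dd: "diff C (l g (l h a)) \<in> pts (tot (C1 C))" "proj (C1 C) (diff C (l g (l h a))) = gtgt G g" using diffD(3,4)[OF lgh(1)] lgh(2) by simp_all
        have y: "gtgt G g \<in> pts (base (C1 C))" using gl g b1 by auto
        show ?thesis
          unfolding lh(4)[symmetric] lgh(4)[symmetric] using dd zz(3,4) y ops by (intro coord_eqI[OF vbs(2)]) (simp_all add: coords)
      qed
      have y: "gtgt G g \<in> pts (base (C0 C))" "gtgt G g \<in> pts (base (C1 C))" using gl g b0 b1 by auto
      have dz: "?z' = vadd (C1 C) (diff C (vzero (C0 C) (gtgt G g))) ?z'"
        using y zz ops vb_map_zero[OF vbs(6,1,2) y(1)] by (intro coord_eqI[OF vbs(2)]) (simp_all add: coords)
      have ghd: "act0 A (g, act0 A (h, diff C a)) \<in> pts (tot (C1 C))" "proj (C1 C) (act0 A (g, act0 A (h, diff C a))) = gtgt G g"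
        unfolding dl using diffD(3,4)[OF lgh(1)] lgh(2) zz(3,4) ops(11-14) by simp_all
      have "arr (vadd (C0 C) (om g h (diff C a)) (l g (l h a))) ?z' = arr (vadd (C0 C) (l (gmult G g h) a) (vzero (C0 C) (gtgt G g))) ?z'"
        using e lmult_arr[OF od(1) ghd(1) _ lgh(1) zz(3) _ dl] lmult_arr[OF lm(1) zz(3) _ ops(1)[OF y(1)] zz(3) _ dz]
          od(2) ghd(2) lgh(2) zz(4) lm(2) gh ops(2)[OF y(1)] by simp
      then have "\<rho> (arr (vadd (C0 C) (om g h (diff C a)) (l g (l h a))) ?z') = \<rho> (arr (vadd (C0 C) (l (gmult G g h) a) (vzero (C0 C) (gtgt G g))) ?z')" by simp
      then have f: "vadd (C0 C) (om g h (diff C a)) (l g (l h a)) = vadd (C0 C) (l (gmult G g h) a) (vzero (C0 C) (gtgt G g))"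
        using od lgh lm gh zz y ops by (simp add: arr_pts)
      show ?thesis
      proof (rule coord_eqI[OF vbs(1)])
        fix i show "coord (C0 C) (vsub (C0 C) (l (gmult G g h) a) (l g (l h a))) i = coord (C0 C) (om g h (diff C a)) i"
          using arg_cong[OF f, of "\<lambda>e. coord (C0 C) e i"] od lgh lm gh y ops by (simp add: coords)
      qed (use od lgh lm gh ops in simp_all)
    qed
    moreover have "vsub (C1 C) (act0 A (gmult G g h, x)) (act0 A (g, act0 A (h, x))) = diff C (om g h x)" if "x \<in> fibre (C1 C) (gsrc G h)" for x
    proof -
      have x: "x \<in> pts (tot (C1 C))" "proj (C1 C) x = gsrc G h" using that by (auto simp: fibre_def)
      have hx: "act0 A (h, x) \<in> pts (tot (C1 C))" "proj (C1 C) (act0 A (h, x)) = gsrc G g" using a0(1,2)[OF g(2) x] g by auto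
      note ghx = a0(1,2)[OF g(1) hx] and o = omD[OF g x]
      show ?thesis
        unfolding o(4) using o ghx diffD ops by (intro coord_eqI[OF vbs(2)]) (simp_all add: coords)
    qed
    ultimately show "case z of (g, h) \<Rightarrow>
        (\<forall>e\<in>fibre (C0 C) (gsrc G h). vsub (C0 C) (\<rho> (act1 A (fst (gmult G g h, e), \<kappa> (snd (gmult G g h, e)))))
            (\<rho> (act1 A (fst (g, \<rho> (act1 A (fst (h, e), \<kappa> (snd (h, e))))), \<kappa> (snd (g, \<rho> (act1 A (fst (h, e), \<kappa> (snd (h, e))))))))) =
           \<rho> (alph A ((g, h), diff C e))) \<and>
        (\<forall>e\<in>fibre (C1 C) (gsrc G h). vsub (C1 C) (act0 A (gmult G g h, e)) (act0 A (g, act0 A (h, e))) = diff C (\<rho> (alph A ((g, h), e))))"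
      by (simp add: z l_def om_def)
  next
    fix z assume "z \<in> comp_triples G"
    then obtain g h k where z: "z = (g, h, k)" and g: "g \<in> pts (Arr G)" "h \<in> pts (Arr G)" "k \<in> pts (Arr G)" "gsrc G g = gtgt G h" "gsrc G h = gtgt G k"
      by (auto simp: comp_triples_def)
    have hk: "gmult G h k \<in> pts (Arr G)" "gsrc G g = gtgt G (gmult G h k)" "gsrc G (gmult G h k) = gsrc G k"
      "gmult G g h \<in> pts (Arr G)" "gsrc G (gmult G g h) = gtgt G k" "gtgt G (gmult G g h) = gtgt G g" using g gl by auto
    have "vsub (C0 C) (vadd (C0 C) (vsub (C0 C) (l g (om h k x)) (om (gmult G g h) k x)) (om g (gmult G h k) x)) (om g h (act0 A (k, x))) = vzero (C0 C) (gtgt G g)"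
      if "x \<in> fibre (C1 C) (gsrc G k)" for x
    proof -
      have x: "x \<in> pts (tot (C1 C))" "proj (C1 C) x = gsrc G k" "proj (C1 C) x = gsrc G (gmult G h k)" using that hk by (auto simp: fibre_def)
      note kx = a0(1,2)[OF g(3) x(1,2)]
      have kx': "proj (C1 C) (act0 A (k, x)) = gsrc G h" using kx g by simp
      note hkx = a0(1,2)[OF g(2) kx(1) kx']
      have hkx': "proj (C1 C) (act0 A (h, act0 A (k, x))) = gsrc G g" using hkx g by simp
      note ghkx = a0(1,2)[OF g(1) hkx(1) hkx']
      note o1 = omD[OF g(2,3,5) x(1,2)] and o2 = omD[OF hk(4) g(3) hk(5) x(1,2)] and o3 = omD[OF g(1) hk(1,2) x(1,3)] and o4 = omD[OF g(1,2,4) kx(1) kx']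
      have o1': "proj (C0 C) (om h k x) = gsrc G g" using o1(2) g by simp
      note lo = lD[OF g(1) o1(1) o1']
      have c1: "act0 A (g, act0 A (gmult G h k, x)) = vadd (C1 C) (diff C (l g (om h k x))) (act0 A (g, act0 A (h, act0 A (k, x))))"
        unfolding o1(4) lo(4) using a0(3)[OF g(1)] diffD(3,4)[OF o1(1)] o1' hkx(1) hkx' by simp
      have p1: "act0 A (g, act0 A (gmult G h k, x)) \<in> pts (tot (C1 C))" "proj (C1 C) (act0 A (g, act0 A (gmult G h k, x))) = gtgt G g"
        unfolding c1 using diffD(3,4)[OF lo(1)] lo(2) ghkx ops(11-14) by simp_all
      have p2: "act0 A (gmult G g h, act0 A (k, x)) \<in> pts (tot (C1 C))" "proj (C1 C) (act0 A (gmult G g h, act0 A (k, x))) = gtgt G g"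
        unfolding o4(4) using diffD(3,4)[OF o4(1)] o4(2) ghkx hk ops(11-14) by simp_all
      have "lmult V (alph A ((g, gmult G h k), x)) (act1 A (g, alph A ((h, k), x))) = lmult V (alph A ((gmult G g h, k), x)) (alph A ((g, h), act0 A (k, x)))"
        by (rule Wc(3)[OF g x(1,2)])
      moreover have "lmult V (alph A ((g, gmult G h k), x)) (act1 A (g, alph A ((h, k), x))) =
         arr (vadd (C0 C) (om g (gmult G h k) x) (l g (om h k x))) (act0 A (g, act0 A (h, act0 A (k, x))))"
        unfolding o3(3) o1(3) act[OF g(1) o1(1) o1' hkx(1) hkx']
        using lmult_arr[OF o3(1) p1(1) _ lo(1) ghkx(1) _ c1] o3(2) p1(2) lo(2) ghkx(2) by simp
      moreover have "lmult V (alph A ((gmult G g h, k), x)) (alph A ((g, h), act0 A (k, x))) =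
         arr (vadd (C0 C) (om (gmult G g h) k x) (om g h (act0 A (k, x)))) (act0 A (g, act0 A (h, act0 A (k, x))))"
        unfolding o2(3) o4(3)
        using lmult_arr[OF o2(1) p2(1) _ o4(1) ghkx(1) _ o4(4)] o2(2) p2(2) o4(2) ghkx(2) hk(6) by simp
      ultimately have "\<rho> (arr (vadd (C0 C) (om g (gmult G h k) x) (l g (om h k x))) (act0 A (g, act0 A (h, act0 A (k, x))))) =
        \<rho> (arr (vadd (C0 C) (om (gmult G g h) k x) (om g h (act0 A (k, x)))) (act0 A (g, act0 A (h, act0 A (k, x)))))" by simp
      then have f: "vadd (C0 C) (om g (gmult G h k) x) (l g (om h k x)) = vadd (C0 C) (om (gmult G g h) k x) (om g h (act0 A (k, x)))"
        using o2(1,2) o3(1,2) o4(1,2) lo(1,2) ghkx hk(6) ops by (simp add: arr_pts)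
      have y: "gtgt G g \<in> pts (base (C0 C))" using gl g b0 by auto
      show ?thesis
      proof (rule coord_eqI[OF vbs(1)])
        fix i show "coord (C0 C) (vsub (C0 C) (vadd (C0 C) (vsub (C0 C) (l g (om h k x)) (om (gmult G g h) k x)) (om g (gmult G h k) x)) (om g h (act0 A (k, x)))) i =
           coord (C0 C) (vzero (C0 C) (gtgt G g)) i"
          using arg_cong[OF f, of "\<lambda>e. coord (C0 C) e i"] o2(1,2) o3(1,2) o4(1,2) lo(1,2) hk(6) y ops by (simp add: coords)
      qed (use o2(1,2) o3(1,2) o4(1,2) lo(1,2) hk(6) y ops in simp_all)
    qed
    then show "case z of (g, h, k) \<Rightarrow> \<forall>e\<in>fibre (C1 C) (gsrc G k).
        vsub (C0 C) (vadd (C0 C) (vsub (C0 C) (\<rho> (act1 A (fst (g, \<rho> (alph A ((h, k), e))), \<kappa> (snd (g, \<rho> (alph A ((h, k), e)))))))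
            (\<rho> (alph A ((gmult G g h, k), e)))) (\<rho> (alph A ((g, gmult G h k), e)))) (\<rho> (alph A ((g, h), act0 A (k, e)))) = vzero (C0 C) (gtgt G g)"
      by (simp add: z l_def om_def)
  qed
  have sp: "split_lgb (wV A) (cpx ?R) \<kappa> \<rho>" using split_lgb_axioms VA by simp
  show ?thesis
    unfolding presented_def presented_axioms_def
    using sp G R A lD(3) omD(3) by (simp add: VA l_def om_def)
qed

text \<open>Units are preimages under the source map, so it is onto in each fibre and its kernel is
  a vector bundle. Subtracting the unit projects onto that kernel along the image of the
  units.\<close>

lemma kernel_splitting:
  fixes V :: "('b, 'x, 'y) lgb" and j :: "'e \<Rightarrow> 'y"
  assumes V: "linear_lie_groupoid_bundle V" and j: "bij j"
  shows "split_lgb V \<lparr>C0 = transport_vb j (ker_bundle (Varr V) (Vob V) (lsrc V)), C1 = Vob V, diff = (\<lambda>a. ltgt V (j a))\<rparr>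
     j (\<lambda>v. inv j (vsub (Varr V) v (lunit V (lsrc V v))))"
proof -
  note D = lgb_basicD[OF V] and M = lgb_maps[OF V]
  note pre = prebundle_vector_bundle[OF D(2)] prebundle_vector_bundle[OF D(3)]
  note s = vb_mapD[OF D(5) pre(2) D(2)]
  note O = vector_bundle_fibre_ops[OF D(3)] and O' = vector_bundle_fibre_ops[OF D(2)]
  have b: "base (Vob V) = base (Varr V)" using D(4) by simp
  have surj: "\<exists>v\<in>pts (tot (Varr V)). proj (Varr V) v = proj (Vob V) w \<and> lsrc V v = w" if "w \<in> pts (tot (Vob V))" for w
    using M(5-7)[OF that] by blast
  let ?K = "ker_bundle (Varr V) (Vob V) (lsrc V)"
  let ?S = "ker_set (Varr V) (Vob V) (lsrc V)"
  note K = vector_bundle_ker[OF D(3,2) b D(5) surj] and cov = ker_covered[OF D(3,2) b D(5) surj]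
  note T = vector_bundle_transport[OF j K] and ij = j_inv[OF j]
  have pK: "pts (tot ?K) = ?S" using pts_ker by (metis ker_bundle_simps(2))
  have pT: "a \<in> pts (tot (transport_vb j ?K)) \<longleftrightarrow> j a \<in> ?S" for a using pts_transport[OF j, of "tot ?K"] pK by simp (metis Int_iff)
  have preT: "prebundle (transport_vb j ?K)" by (rule prebundle_vector_bundle[OF T])
  have idb: "psmooth (base (transport_vb j ?K)) (base (Varr V)) (\<lambda>x. x)" "psmooth (base (Varr V)) (base (transport_vb j ?K)) (\<lambda>x. x)"
    using psmooth_id[OF vector_bundleD(4)[OF D(3)]] by simp_all
  have jS: "j a \<in> pts (tot (Varr V))" "lsrc V (j a) = vzero (Vob V) (proj (Varr V) (j a))" if "a \<in> pts (tot (transport_vb j ?K))" for a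
    using that pT by (auto simp: ker_set_def)
  have ps: "psmooth (tot (transport_vb j ?K)) (tot (Varr V)) j"
    using psmooth_comp[OF psmooth_j[OF j vector_bundleD(5)[OF K]] psmooth_incl[OF vector_bundleD(5)[OF D(3)], of ?S, folded ker_bundle_simps(2)]] by simp
  have \<kappa>: "vb_map (transport_vb j ?K) (Varr V) (\<lambda>x. x) j"
    by (rule vb_mapI[OF preT idb(1) ps]) (simp_all add: ij)
  let ?r = "\<lambda>v. vsub (Varr V) v (lunit V (lsrc V v))"
  have rv: "vb_map (Varr V) (Varr V) (\<lambda>x. x) ?r"
    using vb_map_comp[OF D(5,7) pre(2) D(2,3)] by (intro vb_map_vsub vb_map_ident pre(2) D(3)) auto
  note r = vb_mapD[OF rv pre(2) D(3)]
  have rS: "?r v \<in> ?S" if v: "v \<in> pts (tot (Varr V))" for v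
  proof -
    have y: "proj (Varr V) v \<in> pts (base (Vob V))" using vector_bundleD(9)[OF D(3) v] b by simp
    have "lsrc V (?r v) = vsub (Vob V) (lsrc V v) (lsrc V v)" using s(8)[OF v] v M by simp
    also have "\<dots> = vzero (Vob V) (proj (Varr V) v)"
      using v y M O' by (intro coord_eqI[OF D(2)]) (simp_all add: coord_ops[OF D(2)])
    finally show ?thesis using r(3,4)[OF v] by (simp add: ker_set_def)
  qed
  have "psmooth (tot (Varr V)) (tot ?K) ?r"
    unfolding ker_bundle_simps(2)
  proof (rule psmooth_into_submfd[OF r(2) rS])
    show "?r v \<in> covered (submfd (tot (Varr V)) ?S)" if "v \<in> covered (tot (Varr V))" for v
      using rS that vector_bundleD(7)[OF D(3)] cov by simp
  qed
  then have "psmooth (tot (Varr V)) (tot (transport_vb j ?K)) (\<lambda>v. inv j (?r v))" using psmooth_inv_j[OF j] by simp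
  then have \<rho>: "vb_map (Varr V) (transport_vb j ?K) (\<lambda>x. x) (\<lambda>v. inv j (?r v))"
    by (rule vb_mapI[OF pre(2) idb(2)]) (use r in \<open>auto simp: ij\<close>)
  show ?thesis
  proof (unfold_locales; (unfold complex2.simps)?)
    show "cochain_complex \<lparr>C0 = transport_vb j ?K, C1 = Vob V, diff = (\<lambda>a. ltgt V (j a))\<rparr>"
      unfolding cochain_complex_def complex2.simps
      using T D(2,4) vb_map_comp[OF \<kappa> D(6) preT D(3,2)] by simp
    show "inv j (?r (j a)) = a" if a: "a \<in> pts (tot (transport_vb j ?K))" for a
    proof -
      have y: "proj (Varr V) (j a) \<in> pts (base (Vob V))" "proj (Varr V) (j a) \<in> pts (base (Varr V))"
        using vector_bundleD(9)[OF D(3) jS(1)[OF a]] b by simp_all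
      have "?r (j a) = j a"
        using jS[OF a] y O vb_map_zero[OF D(7,2,3) y(1)] by (intro coord_eqI[OF D(3)]) (simp_all add: coord_ops[OF D(3)])
      then show ?thesis by (simp add: ij)
    qed
    show "lsrc V (j a) = vzero (Vob V) (proj (transport_vb j ?K) a)" if "a \<in> pts (tot (transport_vb j ?K))" for a
      using jS(2)[OF that] by simp
  qed (use V \<kappa> \<rho> in \<open>simp_all add: ij\<close>)
qed

section \<open>The functor on objects and morphisms\<close>

text \<open>The action lives on the pullback to \<open>G\<^sub>1\<close>; it is entered twice, once
  for each arrow of a composable pair, with the base map being a projection of the pair.\<close>

lemma vb_map_act_twice:
  assumes G: "lie_groupoid G" and E: "vector_bundle E" and b: "base E = Obj G" and l: "vb_map (pull1 G E) E (gtgt G) l"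
  shows "vb_map (pull2 G E) E (tgt2 G) (\<lambda>z. l (fst (fst z), l (snd (fst z), snd z)))"
proof -
  note p = psmooth_base[OF G b] and D = lie_groupoidD[OF G] and pre = pull_prebundle(2)[OF G E]
  have 1: "vb_map (pull2 G E) E (\<lambda>x. gtgt G (snd x)) (\<lambda>z. l (snd (proj (pull2 G E) z), snd z))"
    by (rule vb_map_comp_pullback[OF vb_map_pullback_snd[OF E p(3)] pre E _ p(1) _ l E]) (use D(10) in auto)
  have "vb_map (pull2 G E) E (\<lambda>x. gtgt G (fst x)) (\<lambda>z. l (fst (proj (pull2 G E) z), l (snd (proj (pull2 G E) z), snd z)))"
    by (rule vb_map_comp_pullback[OF 1 pre E _ p(1) _ l E]) (use D(9) in auto)
  then show ?thesis by (simp add: case_prod_unfold)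
qed

lemma Phi_G_obj_simps [simp]:
  "wV (Phi_G_obj R) = Phi_obj (cpx R)" "act0 (Phi_G_obj R) = lam1 R" "act1 (Phi_G_obj R) (g, (a, x)) = (lam0 R (g, a), lam1 R (g, x))"
  "alph (Phi_G_obj R) ((g, h), x) = (Omg R ((g, h), x), lam1 R (g, lam1 R (h, x)))"
  by (simp_all add: Phi_G_obj_def Phi_map_def Phi_htpy_def pull_iso_def)

text \<open>The source of \<open>\<alpha>\<close> is built in. The defect of
  \<open>\<lambda>\<^sup>1\<close> yields its target, the defect of \<open>\<lambda>\<^sup>0\<close>
  together with additivity of \<open>\<Omega>\<close> its naturality, and the cocycle identity its
  coherence.\<close>

lemma weak_rep_Phi_G_obj:
  assumes G: "lie_groupoid G" and R: "is_ruth2 G R"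
  shows "is_weak_rep G (Phi_G_obj R)"
proof -
  note B = ruth_bundles[OF G R] and C = ruth_bundles(6)[OF G R]
  note cb = complex_bundles[OF C]
  note l0 = lam0D[OF G R] and l1 = lam1D[OF G R] and om = OmgD[OF G R] and d = dlD[OF G R]
  note O = cops[OF C] and co = ccoords[OF C] and gl = groupoid_laws[OF G]
  note v = ruth_vb_maps[OF G R]
  let ?W = "whitney_sum (E0 R) (E1 R)"
  have bW: "base ?W = Obj G" using B by simp
  have a1: "vb_map (pull1 G ?W) ?W (gtgt G) (act1 (Phi_G_obj R))"
  proof -
    have "vb_map (pull1 G ?W) ?W (gtgt G) (\<lambda>z. (lam0 R (fst z, fst (snd z)), lam1 R (fst z, snd (snd z))))"
      by (intro vb_map_whitney_pair pull_prebundle(1)[OF G cb(5)] cb(1,2,3) 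
          vb_map_pull_fst[OF G cb(5,1) bW B(3) wfst[OF C] cb(1) v(1)] vb_map_pull_fst[OF G cb(5,2) bW B(4) wsnd[OF C] cb(2) v(2)])
    then show ?thesis by (rule vb_map_cong[OF _ pull_prebundle(1)[OF G cb(5)] cb(5)]) auto
  qed
  have al: "vb_map (pull2 G (E1 R)) ?W (tgt2 G) (alph (Phi_G_obj R))"
    by (rule vb_map_cong[OF vb_map_whitney_pair[OF v(3) vb_map_act_twice[OF G B(2,4) v(2)] pull_prebundle(2)[OF G B(2)] cb(1,2,3)] 
          pull_prebundle(2)[OF G B(2)] cb(5)]) auto
  have lb: "g \<in> pts (Arr G) \<Longrightarrow> lam0 R (g, vzero (E0 R) (gsrc G g)) = vzero (E0 R) (gtgt G g)" for g
    using l0(5) gl(1) B(3) by simp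
  have lc: "lam1 R (gmult G g h, x) = vadd (E1 R) (dl R (Omg R ((g, h), x))) (lam1 R (g, lam1 R (h, x)))"
    if g: "g \<in> pts (Arr G)" "h \<in> pts (Arr G)" "gsrc G g = gtgt G h" and x: "x \<in> pts (tot (E1 R))" "proj (E1 R) x = gsrc G h" for g h x
    using g x gl l1 om[OF g] d O lam_comp(2)[OF G R g x] by (intro coord_eqI[OF B(2)]) (simp_all add: co)
  have lgb: "lgb_map (lpull1 G (Phi_obj (cpx R))) (Phi_obj (cpx R)) (gtgt G) (lam1 R) (act1 (Phi_G_obj R))"
    unfolding lgb_map_iff pullback_lgb_simps Phi_obj_simps(1-3)
  proof (intro conjI allI impI v(2) a1)
    fix z assume "z \<in> pts (tot (pull1 G ?W))"
    then obtain g a x where z: "z = (g, (a, x))" "g \<in> pts (Arr G)" "a \<in> pts (tot (E0 R))" "x \<in> pts (tot (E1 R))"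
      "proj (E0 R) a = gsrc G g" "proj (E1 R) x = gsrc G g" by auto
    show "snd (act1 (Phi_G_obj R) z) = lam1 R (lsrc (lpull1 G (Phi_obj (cpx R))) z)" by (simp add: z(1))
    show "ltgt (Phi_obj (cpx R)) (act1 (Phi_G_obj R) z) = lam1 R (ltgt (lpull1 G (Phi_obj (cpx R))) z)"
      using z l0 l1 d dl_lam[OF G R] by simp
    fix w assume "w \<in> pts (tot (pull1 G ?W))" "lsrc (lpull1 G (Phi_obj (cpx R))) z = ltgt (lpull1 G (Phi_obj (cpx R))) w"
    then show "act1 (Phi_G_obj R) (lmult (lpull1 G (Phi_obj (cpx R))) z w) = lmult (Phi_obj (cpx R)) (act1 (Phi_G_obj R) z) (act1 (Phi_G_obj R) w)"
      using z l0 by auto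
  next
    fix z assume "z \<in> pts (tot (pull1 G (E1 R)))"
    then obtain g x where "z = (g, x)" "g \<in> pts (Arr G)" "x \<in> pts (tot (E1 R))" "proj (E1 R) x = gsrc G g" by auto
    then show "act1 (Phi_G_obj R) (lunit (lpull1 G (Phi_obj (cpx R))) z) = lunit (Phi_obj (cpx R)) (lam1 R z)"
      using l1(1,2) lb by simp
  qed
  show ?thesis
    unfolding weak_rep_iff Phi_G_obj_simps(1,2) Phi_obj_simps(1-3)
  proof (intro conjI allI impI lgb_Phi_obj[OF C] B(4) lgb al ruth_unit(2)[OF G R])
    show "act1 (Phi_G_obj R) (gunit G (proj ?W v), v) = v" if "v \<in> pts (tot ?W)" for v
      using that ruth_unit(1,2)[OF G R] by auto metis
  next
    fix g h x assume g: "g \<in> pts (Arr G)" "h \<in> pts (Arr G)" "gsrc G g = gtgt G h" and x: "x \<in> pts (tot (E1 R))" "proj (E1 R) x = gsrc G h"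
    show "snd (alph (Phi_G_obj R) ((g, h), x)) = lam1 R (g, lam1 R (h, x))" by simp
    show "ltgt (Phi_obj (cpx R)) (alph (Phi_G_obj R) ((g, h), x)) = lam1 R (gmult G g h, x)" using lc[OF g x] by simp
  next
    fix g h w assume g: "g \<in> pts (Arr G)" "h \<in> pts (Arr G)" "gsrc G g = gtgt G h" and w: "w \<in> pts (tot ?W)" "proj ?W w = gsrc G h"
    obtain a x where ax: "w = (a, x)" "a \<in> pts (tot (E0 R))" "x \<in> pts (tot (E1 R))" "proj (E0 R) a = gsrc G h" "proj (E1 R) x = gsrc G h" using w by auto
    have "vadd (E0 R) (Omg R ((g, h), vadd (E1 R) (dl R a) x)) (lam0 R (g, lam0 R (h, a))) = vadd (E0 R) (lam0 R (gmult G g h, a)) (Omg R ((g, h), x))"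
    proof -
      have 1: "Omg R ((g, h), vadd (E1 R) (dl R a) x) = vadd (E0 R) (Omg R ((g, h), dl R a)) (Omg R ((g, h), x))"
        using ax om(3)[OF g] d by simp
      show ?thesis
        unfolding 1 using g ax gl l0 om[OF g] d O lam_comp(1)[OF G R g ax(2,4)] by (intro coord_eqI[OF B(1)]) (simp_all add: co)
    qed
    then show "lmult (Phi_obj (cpx R)) (alph (Phi_G_obj R) ((g, h), ltgt (Phi_obj (cpx R)) w)) (act1 (Phi_G_obj R) (g, act1 (Phi_G_obj R) (h, w))) =
       lmult (Phi_obj (cpx R)) (act1 (Phi_G_obj R) (gmult G g h, w)) (alph (Phi_G_obj R) ((g, h), snd w))"
      by (simp add: ax(1))
  next
    fix g h k x assume g: "g \<in> pts (Arr G)" "h \<in> pts (Arr G)" "k \<in> pts (Arr G)" "gsrc G g = gtgt G h" "gsrc G h = gtgt G k"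
      and x: "x \<in> pts (tot (E1 R))" "proj (E1 R) x = gsrc G k"
    have hk: "h \<in> pts (Arr G)" "k \<in> pts (Arr G)" "gsrc G h = gtgt G k" "g \<in> pts (Arr G)" "gmult G h k \<in> pts (Arr G)" "gsrc G g = gtgt G (gmult G h k)"
      "gmult G g h \<in> pts (Arr G)" "gsrc G (gmult G g h) = gtgt G k" "gsrc G (gmult G h k) = gsrc G k" "gtgt G (gmult G g h) = gtgt G g"
      using g gl by auto
    note omega = om[OF hk(1-3)] om[OF hk(4-6)] om[OF hk(7,2,8)] om[OF g(1,2,4)]
    have "vadd (E0 R) (Omg R ((g, gmult G h k), x)) (lam0 R (g, Omg R ((h, k), x))) = vadd (E0 R) (Omg R ((gmult G g h, k), x)) (Omg R ((g, h), lam1 R (k, x)))"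
      using g hk x l0 l1 omega O Omg_cocycle[OF G R g x] by (intro coord_eqI[OF B(1)]) (simp_all add: co add.commute)
    then show "lmult (Phi_obj (cpx R)) (alph (Phi_G_obj R) ((g, gmult G h k), x)) (act1 (Phi_G_obj R) (g, alph (Phi_G_obj R) ((h, k), x))) =
       lmult (Phi_obj (cpx R)) (alph (Phi_G_obj R) ((gmult G g h, k), x)) (alph (Phi_G_obj R) ((g, h), lam1 R (k, x)))"
      by simp
  next
    fix g x assume g: "g \<in> pts (Arr G)" and x: "x \<in> pts (tot (E1 R))" "proj (E1 R) x = gsrc G g"
    note u = ruth_unit(3,4)[OF G R g x] ruth_unit(2)[OF G R x(1)] ruth_unit(2)[OF G R l1(1)[OF g x]]
    show "alph (Phi_G_obj R) ((g, gunit G (gsrc G g)), x) = lunit (Phi_obj (cpx R)) (lam1 R (g, x))"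
      "alph (Phi_G_obj R) ((gunit G (gtgt G g), g), x) = lunit (Phi_obj (cpx R)) (lam1 R (g, x))"
      using u g x l1 by simp_all
  qed
qed

definition canonical_kappa :: "('o, 'a, 'e, 'f) ruth \<Rightarrow> 'e \<Rightarrow> 'e \<times> 'f" where
  "canonical_kappa R = (\<lambda>a. (a, vzero (E1 R) (proj (E0 R) a)))"

text \<open>Images under the functor carry a canonical presentation, in which
  \<open>\<kappa>\<close> pairs a vector with zero and \<open>\<rho>\<close> is the first
  projection.\<close>

lemma presented_Phi_G_obj:
  assumes G: "lie_groupoid G" and R: "is_ruth2 G R"
  shows "presented G R (Phi_G_obj R) (canonical_kappa R) fst"
proof -
  note C = ruth_bundles(6)[OF G R] and B = ruth_bundles[OF G R]
  interpret split_lgb "wV (Phi_G_obj R)" "cpx R" "canonical_kappa R" fst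
    using split_Phi_obj[OF C] by (simp add: canonical_kappa_def)
  show ?thesis
  proof (unfold_locales, goal_cases)
    case 1 then show ?case by (rule G)
  next
    case 2 then show ?case by (rule R)
  next
    case 3 then show ?case by (rule weak_rep_Phi_G_obj[OF G R])
  next
    case (4 g x) then show ?case by simp
  next
    case (5 g a) then show ?case
      using lam0D(2)[OF G R 5] lam1D(5)[OF G R 5(1)] groupoid_laws(1)[OF G 5(1)] B(4) by (simp add: canonical_kappa_def)
  next
    case (6 g h x)
    have "lam1 R (h, x) \<in> pts (tot (E1 R))" "proj (E1 R) (lam1 R (h, x)) = gsrc G g" using 6 lam1D(1,2)[OF G R] by auto
    then show ?case
      using arr_Phi_obj[OF C, of "Omg R ((g, h), x)" "lam1 R (g, lam1 R (h, x))"] OmgD(1,2)[OF G R 6(1-3) 6(4,5)] lam1D(1,2)[OF G R 6(1)]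
      by (simp add: canonical_kappa_def)
  qed
qed

text \<open>For canonical presentations \<open>arr a x\<close> is just the pair
  \<open>(a, x)\<close>, so the functor given by explicit formulas is an instance of
  \<open>induced_mor\<close> and inherits its properties.\<close>

lemma Phi_G_mor_eq:
  assumes G: "lie_groupoid G" and R: "is_ruth2 G R" and R': "is_ruth2 G R'" and p: "(p0, p1, m) \<in> ruth2_hom G R R'"
  shows "Phi_G_mor G R R' (p0, p1, m) = induced_mor G R (Phi_G_obj R) fst R' (Phi_G_obj R') (canonical_kappa R') (p0, p1, m)"
proof -
  note arr = arr_Phi_obj[OF ruth_bundles(6)[OF G R'], folded canonical_kappa_def]
  note h = hp0D(3,4)[OF G R R' p] hp1D(3,4)[OF G R R' p] hmD(1,2)[OF G R R' p] lam1D(1,2)[OF G R]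
    vector_bundle_fibre_ops(7,8)[OF ruth_bundles(1)[OF G R']]
  have "restrict (\<lambda>(a, x). (p0 a, p1 x)) (pts (tot (whitney_sum (E0 R) (E1 R)))) =
    restrict (\<lambda>v. split_lgb.arr (Phi_obj (cpx R')) (canonical_kappa R') (p0 (fst v)) (p1 (snd v))) (pts (tot (whitney_sum (E0 R) (E1 R))))"
    by (rule restrict_ext) (use h in \<open>auto simp: arr\<close>)
  moreover have "restrict (\<lambda>c. (vneg (E0 R') (m c), (\<lambda>(g, e). p1 (lam1 R (g, e))) c)) (pts (tot (pull1 G (E1 R)))) =
    restrict (\<lambda>(g, x). split_lgb.arr (Phi_obj (cpx R')) (canonical_kappa R') (vneg (E0 R') (m (g, x))) (p1 (lam1 R (g, x)))) (pts (tot (pull1 G (E1 R))))"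
    by (rule restrict_ext) (use h in \<open>auto simp: arr\<close>)
  ultimately show ?thesis
    by (simp add: Phi_G_mor_def induced_mor_def Phi_map_def Phi_htpy_def)
qed

theorem theorem4p7:
  fixes G :: "('o, 'a) groupoid"
  assumes "lie_groupoid G"
    and "infinite (UNIV :: 'u set)"
  shows "equivalence_of_categories
           (RutH2 G :: (('o, 'a, 'u, 'u) ruth, ('a, 'u, 'u, 'u, 'u) ruth_mor) category)
           (WRep G :: (('o, 'a, 'u, 'u \<times> 'u) wrep,
                       ('a, 'u, 'u \<times> 'u, 'u, 'u \<times> 'u) wrep_mor) category)
           Phi_G_obj (Phi_G_mor G)"
\<comment> \<open>A presentation consists of \<open>R\<close> and the pair
  \<open>(\<kappa>, \<rho>)\<close>. To carry over a morphism one extracts kernel components with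
  \<open>\<rho>\<close> at its source and rebuilds arrows with \<open>\<kappa>\<close> at its
  target.\<close>
proof (rule equivalence_from_presentations[where P = "\<lambda>R A k. presented G R A (fst k) (snd k)"
      and can = "\<lambda>R. (canonical_kappa R, fst)"
      and T = "\<lambda>R A k R' A' k'. induced_mor G R A (snd k) R' A' (fst k')"])
  note G = assms(1)
  have ob: "Ob (RutH2 G) = {R. is_ruth2 G R}" "Hom (RutH2 G) = ruth2_hom G"
    "Ob (WRep G) = {A. is_weak_rep G A}" "Hom (WRep G) = wrep_hom G"
    by (simp_all add: RutH2_def WRep_def)
  show "is_category (RutH2 G :: (('o, 'a, 'u, 'u) ruth, ('a, 'u, 'u, 'u, 'u) ruth_mor) category)"
    by (rule category_RutH2[OF G])
  fix R :: "('o, 'a, 'u, 'u) ruth" and A :: "('o, 'a, 'u, 'u \<times> 'u) wrep" and k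
  show "R \<in> Ob (RutH2 G)" if "presented G R A (fst k) (snd k)"
    using presented.R[OF that] by (simp add: ob)
  show "presented G R (Phi_G_obj R) (fst (canonical_kappa R, fst)) (snd (canonical_kappa R, fst))" if "R \<in> Ob (RutH2 G)"
    using presented_Phi_G_obj[OF G] that by (simp add: ob)
  show "Phi_G_obj R \<in> Ob (WRep G)" if "R \<in> Ob (RutH2 G)"
    using weak_rep_Phi_G_obj[OF G] that by (simp add: ob)
  show "\<exists>(R :: ('o, 'a, 'u, 'u) ruth) k. presented G R A (fst k) (snd k)" if "A \<in> Ob (WRep G)"
  proof -
    have A: "is_weak_rep G A" using that by (simp add: ob)
    obtain f :: "'u \<times> 'u \<Rightarrow> 'u" where "bij f"
      using iffD2[OF card_of_ordIso card_of_Times_same_infinite[OF assms(2)]] by auto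
    then obtain j :: "'u \<Rightarrow> 'u \<times> 'u" where "bij j"
      using bij_imp_bij_inv by blast
    then have "split_lgb (wV A) \<lparr>C0 = transport_vb j (ker_bundle (Varr (wV A)) (Vob (wV A)) (lsrc (wV A))), C1 = Vob (wV A),
        diff = (\<lambda>a. ltgt (wV A) (j a))\<rparr> j (\<lambda>v. inv j (vsub (Varr (wV A)) v (lunit (wV A) (lsrc (wV A) v))))"
      by (intro kernel_splitting[OF A[unfolded weak_rep_iff, THEN conjunct1]])
    from split_lgb.presented_weak_rep[OF this G A refl] show ?thesis
      by - (rule exI, rule exI[of _ "(j, \<lambda>v. inv j (vsub (Varr (wV A)) v (lunit (wV A) (lsrc (wV A) v))))"], simp)
  qed
  show "induced_mor G R A (snd k) R A (fst k) (Ident (RutH2 G) R) = Ident (WRep G) A" if "presented G R A (fst k) (snd k)"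
    by (rule presented.induced_mor_ident[OF that])
  fix R' :: "('o, 'a, 'u, 'u) ruth" and A' :: "('o, 'a, 'u, 'u \<times> 'u) wrep" and k'
  show "bij_betw (induced_mor G R A (snd k) R' A' (fst k')) (Hom (RutH2 G) R R') (Hom (WRep G) A A')"
    if "presented G R A (fst k) (snd k)" "presented G R' A' (fst k') (snd k')"
  proof -
    interpret presented_pair G R A "fst k" "snd k" R' A' "fst k'" "snd k'"
      by (rule presented_pair.intro[OF that])
    show ?thesis
      unfolding bij_betw_def ob
    proof (intro conjI inj_onI subset_antisym subsetI)
      fix p q assume "p \<in> ruth2_hom G R R'" "q \<in> ruth2_hom G R R'"
        "induced_mor G R A (snd k) R' A' (fst k') p = induced_mor G R A (snd k) R' A' (fst k') q"
      then show "p = q" using induced_mor_inj by (cases p, cases q) blast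
    next
      fix f assume "f \<in> induced_mor G R A (snd k) R' A' (fst k') ` ruth2_hom G R R'"
      then show "f \<in> wrep_hom G A A'" using induced_mor_hom by auto
    next
      fix f assume f: "f \<in> wrep_hom G A A'"
      obtain f0 f1 D where f': "f = (f0, f1, D)" by (cases f)
      obtain p0 p1 m where "(p0, p1, m) \<in> ruth2_hom G R R'" "induced_mor G R A (snd k) R' A' (fst k') (p0, p1, m) = f"
        using induced_mor_surj[OF f[unfolded f']] f' by blast
      then show "f \<in> induced_mor G R A (snd k) R' A' (fst k') ` ruth2_hom G R R'" by (metis imageI)
    qed
  qed
  show "Phi_G_mor G R R' f = induced_mor G R (Phi_G_obj R) (snd (canonical_kappa R, fst)) R' (Phi_G_obj R') (fst (canonical_kappa R', fst)) f"
    if "R \<in> Ob (RutH2 G)" "R' \<in> Ob (RutH2 G)" "f \<in> Hom (RutH2 G) R R'" for f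
    using Phi_G_mor_eq[OF G] that by (cases f) (simp add: ob)
  fix R'' :: "('o, 'a, 'u, 'u) ruth" and A'' :: "('o, 'a, 'u, 'u \<times> 'u) wrep" and k'' f g
  show "Comp (WRep G) A A' A'' (induced_mor G R' A' (snd k') R'' A'' (fst k'') g) (induced_mor G R A (snd k) R' A' (fst k') f) =
      induced_mor G R A (snd k) R'' A'' (fst k'') (Comp (RutH2 G) R R' R'' g f)"
    if "presented G R A (fst k) (snd k)" "presented G R' A' (fst k') (snd k')" "presented G R'' A'' (fst k'') (snd k'')"
      "f \<in> Hom (RutH2 G) R R'" "g \<in> Hom (RutH2 G) R' R''"
    using induced_mor_comp[OF presented_pair.intro[OF that(1,2)] presented_pair.intro[OF that(2,3)]] that(4,5)
    by (cases f, cases g) (simp add: ob)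
qed

end
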